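(* Bryant spheres with smooth ends are 2-soliton spheres.
   Context: Conventions. Quaternionic vector spaces are right $\mathbb{H}$-vector spaces; the dual $V^*$ is a right vector space via $(\alpha\lambda)(x)=\bar\lambda\,\alpha(x)$. For a 1-form $\omega$ on a Riemann surface $M$, $*\omega=\omega\circ J_{TM}$, where $J_{TM}$ is the complex structure of $TM$. Quaternionic holomorphic line bundles. A complex quaternionic line bundle is a quaternionic line bundle $L$ over a Riemann surface $M$ with a field $J\in\Gamma(\mathrm{End}(L))$ of quaternionic linear endomorphisms, $J^2=-\mathrm{Id}$. $\bar KL$ denotes the bundle of $L$-valued 1-forms $\omega$ with $*\omega=-J\omega$. A quaternionic holomorphic structure is an operator $D\colon\Gamma(L)\to\Gamma(\bar KL)$ with $D(\psi\lambda)=(D\psi)\lambda+(\psi\,d\lambda)''$ for $\psi\in\Gamma(L)$, $\lambda\colon M\to\mathbb{H}$, where $\omega''=\frac12(\omega+J{*}\omega)$. $H^0(L)=\ker D$; its elements are called holomorphic sections, and a linear system is a finite-dimensional quaternionic subspace $H\subset H^0(L)$. Write $\hat L=\{\psi\in L\mid J\psi=\psi\mathbf{i}\}$, $\deg L:=\deg\hat L$ for compact $M$, and $D=\bar\partial+Q$ with $\bar\partial$ commuting and the Hopf field $Q$ anticommuting with $J$; the Willmore energy of $L$ is $W(L)=\frac12\int_M\mathrm{tr}_{\mathbb{R}}(Q\wedge *Q)$. Equality in the Plücker estimate. A holomorphic section $\psi\not\equiv0$ vanishes to order $k=\mathrm{ord}_p\psi$ at $p$ if $\psi=z^k\varphi+O(k+1)$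 for a centered holomorphic coordinate $z$ and a local section $\varphi$ not vanishing at $p$ (complex functions act on $L$ via $J$). For an $(n+1)$-dimensional linear system $H$ let $n_0(p)<\dots<n_n(p)$ be the possible vanishing orders at $p$ of nonzero elements of $H$, $\mathrm{ord}_p(H)=\sum_{k=0}^n(n_k(p)-k)$, $|\mathrm{ord}\,H|=\sum_p\mathrm{ord}_p(H)$. Over a compact Riemann surface of genus $g$, with $d=\deg L$, $H$ has equality in the Plücker estimate if $W(L)=4\pi[(n+1)(n(1-g)-d)+|\mathrm{ord}\,H|]$. Soliton spheres. Maps $M\to\mathbb{HP}^1$ are identified with line subbundles $L\subset\mathbb{H}^2$ of the trivial bundle; $\nabla$ is the trivial connection, $\delta=\pi\nabla_{|L}$ with $\pi\colon\mathbb{H}^2\to\mathbb{H}^2/L$ the projection. The affine chart $[\lambda,1]\mapsto\lambda$ identifies $\mathbb{HP}^1$ with the conformal 4-sphere $\mathbb{H}\cup\{\infty\}$; orientation preserving Möbius transformations are the projective transformations. For a conformal immersion $L\subset\mathbb{H}^2$ there are unique complex structures $J$ on $L$ and on $\mathbb{H}^2/L$ with $*\delta=\delta J=J\delta$. The Möbius invariant holomorphic line bundles are $L^{-1}=(\mathbb{H}^2)^*/L^\perp$ ($L^\perp$ the annihilator of $L$, complex structure dual to that of $L$) and $\mathbb{H}^2/L$, each with the unique quaternionic holomorphic structure for which projections of constant sections of $(\mathbb{H}^2)^*$, respectively $\mathbb{H}^2$, are holomorphic; these projections form the canonical linear systems. A conformal immersion $\mathbb{CP}^1\to\mathbb{HP}^1$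 is a soliton sphere if one of its two Möbius invariant holomorphic line bundles admits a linear system with equality in the Plücker estimate that contains the canonical linear system. The soliton number of a soliton sphere that is not the round sphere is the minimal $n$ for which one of the two canonical linear systems is contained in an $(n+1)$-dimensional linear system with equality in the Plücker estimate; the soliton number of the round sphere is defined to be $0$. An $n$-soliton sphere is a soliton sphere with soliton number $n$. Bryant spheres with smooth ends. These are surfaces of mean curvature one in hyperbolic 3-space that compactify to immersed spheres by adding points on the ideal boundary of hyperbolic space. Equivalently, an immersion $L\subset\mathbb{H}^2$ of $\mathbb{CP}^1$ into $\mathbb{HP}^1$ is a Bryant sphere with smooth ends if and only if, up to Möbius transformation, $L=\psi\mathbb{H}$ (away from the poles of $F$) with $\psi=F\begin{pmatrix}\mathbf{k}\\1\end{pmatrix}$ for a rational null immersion $F$ into $\mathrm{SL}(2,\mathbb{C})$ such that all poles of $dF\,F^{-1}$ have order $2$; here null immersion means that $\det(dF)=0$ and $dF$ has no zeros.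
   Formalization: The round sphere is excluded: the horosphere given by F = (1 z; 0 1) is a Bryant sphere with smooth ends that is a round sphere, whose soliton number is 0 by definition, so the claim is proved for all Bryant spheres with smooth ends other than the round sphere. *)

theory Defs
  imports "HOL-Complex_Analysis.Complex_Analysis"
begin

no_notation fps_nth (infixl \<open>$\<close> 75)

section \<open>Quaternions\<close>

datatype quat = Quat (qre: real) (qi: real) (qj: real) (qk: real)

lemma quat_eq_iff: "x = y \<longleftrightarrow> qre x = qre y \<and> qi x = qi y \<and> qj x = qj y \<and> qk x = qk y"
  by (cases x; cases y) auto

instantiation quat :: ring_1
begin

definition "0 = Quat 0 0 0 0"
definition "1 = Quat 1 0 0 0"
definition "x + y = Quat (qre x + qre y) (qi x + qi y) (qj x + qj y) (qk x + qk y)"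
definition "x - y = Quat (qre x - qre y) (qi x - qi y) (qj x - qj y) (qk x - qk y)"
definition "- x = Quat (- qre x) (- qi x) (- qj x) (- qk x)"
definition "x * y = Quat
  (qre x * qre y - qi x * qi y - qj x * qj y - qk x * qk y)
  (qre x * qi y + qi x * qre y + qj x * qk y - qk x * qj y)
  (qre x * qj y - qi x * qk y + qj x * qre y + qk x * qi y)
  (qre x * qk y + qi x * qj y - qj x * qi y + qk x * qre y)"

instance
  by standard
    (simp_all add: quat_eq_iff zero_quat_def one_quat_def plus_quat_def minus_quat_def
      uminus_quat_def times_quat_def algebra_simps)

end

lemma quat_sel_simps [simp]:
  "qre 0 = 0" "qi 0 = 0" "qj 0 = 0" "qk 0 = 0"
  "qre 1 = 1" "qi 1 = 0" "qj 1 = 0" "qk 1 = 0"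
  "qre (x + y) = qre x + qre y" "qi (x + y) = qi x + qi y"
  "qj (x + y) = qj x + qj y" "qk (x + y) = qk x + qk y"
  "qre (x - y) = qre x - qre y" "qi (x - y) = qi x - qi y"
  "qj (x - y) = qj x - qj y" "qk (x - y) = qk x - qk y"
  "qre (- x) = - qre x" "qi (- x) = - qi x" "qj (- x) = - qj x" "qk (- x) = - qk x"
  by (simp_all add: zero_quat_def one_quat_def plus_quat_def minus_quat_def uminus_quat_def)

lemma quat_mult_sel [simp]:
  "qre (x * y) = qre x * qre y - qi x * qi y - qj x * qj y - qk x * qk y"
  "qi (x * y) = qre x * qi y + qi x * qre y + qj x * qk y - qk x * qj y"
  "qj (x * y) = qre x * qj y - qi x * qk y + qj x * qre y + qk x * qi y"
  "qk (x * y) = qre x * qk y + qi x * qj y - qj x * qi y + qk x * qre y"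
  by (simp_all add: times_quat_def)

instantiation quat :: real_algebra_1
begin

definition "scaleR r x = Quat (r * qre x) (r * qi x) (r * qj x) (r * qk x)"

instance
  by standard (simp_all add: quat_eq_iff scaleR_quat_def algebra_simps)

end

lemma quat_scaleR_sel [simp]:
  "qre (r *\<^sub>R x) = r * qre x" "qi (r *\<^sub>R x) = r * qi x"
  "qj (r *\<^sub>R x) = r * qj x" "qk (r *\<^sub>R x) = r * qk x"
  by (simp_all add: scaleR_quat_def)

instantiation quat :: real_inner
begin

definition "inner x y = qre x * qre y + qi x * qi y + qj x * qj y + qk x * qk y"

definition "norm (x :: quat) = sqrt (inner x x)"

definition "sgn (x :: quat) = x /\<^sub>R norm x"

definition "dist (x :: quat) y = norm (x - y)"

definition uniformity_quat_def [code del]: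
  "(uniformity :: (quat \<times> quat) filter) = (INF e\<in>{0 <..}. principal {(x, y). dist x y < e})"

definition open_quat_def [code del]:
  "open (U :: quat set) \<longleftrightarrow> (\<forall>x\<in>U. eventually (\<lambda>(x', y). x' = x \<longrightarrow> y \<in> U) uniformity)"

instance
proof
  fix x y z :: quat and r :: real
  show "inner x y = inner y x" by (simp add: inner_quat_def mult.commute)
  show "inner (x + y) z = inner x z + inner y z" by (simp add: inner_quat_def algebra_simps)
  show "inner (r *\<^sub>R x) y = r * inner x y" by (simp add: inner_quat_def algebra_simps)
  show "0 \<le> inner x x" by (simp add: inner_quat_def)
  show "inner x x = 0 \<longleftrightarrow> x = 0"
    by (auto simp: inner_quat_def quat_eq_iff add_nonneg_eq_0_iff)
qed (rule norm_quat_def sgn_quat_def dist_quat_def open_quat_def uniformity_quat_def)+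

end

instantiation quat :: real_normed_div_algebra
begin

definition "inverse x = (1 / inner x x) *\<^sub>R Quat (qre x) (- qi x) (- qj x) (- qk x)"

definition "(x :: quat) div y = x * inverse y"

instance
proof
  fix x y :: quat
  let ?n = "qre x * qre x + qi x * qi x + qj x * qj x + qk x * qk x"
  have n: "?n \<noteq> 0" if "x \<noteq> 0"
    using that inner_eq_zero_iff[of x] unfolding inner_quat_def by simp
  have l: "inverse x * x = (?n / ?n) *\<^sub>R 1"
    unfolding inverse_quat_def quat_eq_iff inner_quat_def by (simp add: algebra_simps add_divide_distrib)
  have r: "x * inverse x = (?n / ?n) *\<^sub>R 1"
    unfolding inverse_quat_def quat_eq_iff inner_quat_def by (simp add: algebra_simps add_divide_distrib)
  show "inverse x * x = 1" if "x \<noteq> 0"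
    unfolding l using n[OF that] by simp
  show "x * inverse x = 1" if "x \<noteq> 0"
    unfolding r using n[OF that] by simp
  show "x div y = x * inverse y" by (rule divide_quat_def)
  show "inverse (0 :: quat) = 0" by (simp add: inverse_quat_def inner_quat_def quat_eq_iff)
  show "norm (x * y) = norm x * norm y"
    unfolding norm_quat_def real_sqrt_mult[symmetric]
    by (rule arg_cong[where f = sqrt]) (simp add: inner_quat_def algebra_simps)
qed

end

instantiation quat :: euclidean_space
begin

definition "Basis = {Quat 1 0 0 0, Quat 0 1 0 0, Quat 0 0 1 0, Quat 0 0 0 1}"

instance
proof
  fix u v x :: quat
  show "(Basis :: quat set) \<noteq> {}" "finite (Basis :: quat set)" by (simp_all add: Basis_quat_def)
  show "inner u v = (if u = v then 1 else 0)" if "u \<in> Basis" "v \<in> Basis"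
    using that unfolding Basis_quat_def by (elim insertE emptyE) (simp_all add: inner_quat_def)
  show "(\<forall>u\<in>Basis. inner x u = 0) \<longleftrightarrow> x = 0"
    by (cases x) (simp add: Basis_quat_def inner_quat_def zero_quat_def)
qed

end

definition qcnj :: "quat \<Rightarrow> quat"
  where "qcnj x = Quat (qre x) (- qi x) (- qj x) (- qk x)"

definition quat_k :: quat
  where "quat_k = Quat 0 0 0 1"

definition quat_of_complex :: "complex \<Rightarrow> quat"
  where "quat_of_complex z = Quat (Re z) (Im z) 0 0"


section \<open>The right vector space H^2 and its dual\<close>

type_synonym H2 = "quat \<times> quat"

definition rscale :: "H2 \<Rightarrow> quat \<Rightarrow> H2"  (infixl \<open>\<odot>\<close> 75)
  where "x \<odot> l = (fst x * l, snd x * l)"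

definition hline :: "H2 \<Rightarrow> H2 set"
  where "hline x = range (\<lambda>l. x \<odot> l)"

text \<open>
  The dual of H^2 is identified with H^2: the pair a stands for the functional
  \<open>pairing a\<close>, and \<open>pairing (a \<odot> l) x = qcnj l * pairing a x\<close>, so that \<open>\<odot>\<close> is also the
  right multiplication of the dual space.
\<close>

definition pairing :: "H2 \<Rightarrow> H2 \<Rightarrow> quat"
  where "pairing a x = qcnj (fst a) * fst x + qcnj (snd a) * snd x"

lemma pairing_rscale_left: "pairing (a \<odot> l) x = qcnj l * pairing a x"
  by (simp add: pairing_def rscale_def qcnj_def quat_eq_iff algebra_simps)

lemma pairing_rscale_right: "pairing a (x \<odot> l) = pairing a x * l"
  by (simp add: pairing_def rscale_def algebra_simps)

definition rlinear :: "(H2 \<Rightarrow> H2) \<Rightarrow> bool"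
  where "rlinear A \<longleftrightarrow> (\<forall>x y. A (x + y) = A x + A y) \<and> (\<forall>x l. A (x \<odot> l) = A x \<odot> l)"


section \<open>The Riemann surface CP^1 and smooth maps\<close>

datatype cp1 = Finite complex | Infinity

datatype chart = Zchart | Wchart

text \<open>
  The inverses of the two standard holomorphic coordinates \<open>z\<close> and \<open>w = 1/z\<close>; the complex
  structure of the tangent bundle is multiplication by \<open>\<i>\<close> in either coordinate.
\<close>

fun par :: "chart \<Rightarrow> complex \<Rightarrow> cp1" where
  "par Zchart z = Finite z"
| "par Wchart w = (if w = 0 then Infinity else Finite (1 / w))"

text \<open>C^k and smooth functions, for open sets.\<close>

primrec Ck_on :: "nat \<Rightarrow> complex set \<Rightarrow> (complex \<Rightarrow> 'a::real_normed_vector) \<Rightarrow> bool" where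
  "Ck_on 0 S f \<longleftrightarrow> continuous_on S f"
| "Ck_on (Suc k) S f \<longleftrightarrow>
     f differentiable_on S \<and> (\<forall>v. Ck_on k S (\<lambda>z. frechet_derivative f (at z) v))"

definition smooth_on :: "complex set \<Rightarrow> (complex \<Rightarrow> 'a::real_normed_vector) \<Rightarrow> bool"
  where "smooth_on S f \<longleftrightarrow> (\<forall>k. Ck_on k S f)"

definition smooth_cp1 :: "(cp1 \<Rightarrow> 'a::real_normed_vector) \<Rightarrow> bool"
  where "smooth_cp1 f \<longleftrightarrow> (\<forall>c. smooth_on UNIV (f \<circ> par c))"

text \<open>
  A 1-form is given by its values \<open>\<omega> c z v\<close> on the tangent vector \<open>v\<close> at the point with
  coordinate \<open>z\<close> in the chart \<open>c\<close>; \<open>d w = - d z / z^2\<close> relates the two charts.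
\<close>

type_synonym H2_form = "chart \<Rightarrow> complex \<Rightarrow> complex \<Rightarrow> H2"

definition smooth_form :: "H2_form \<Rightarrow> bool"
  where "smooth_form \<omega> \<longleftrightarrow>
    (\<forall>c z. linear (\<omega> c z)) \<and>
    (\<forall>c v. smooth_on UNIV (\<lambda>z. \<omega> c z v)) \<and>
    (\<forall>z v. z \<noteq> 0 \<longrightarrow> \<omega> Wchart (1 / z) (- v / z ^ 2) = \<omega> Zchart z v)"

definition diff_at :: "(cp1 \<Rightarrow> 'a::real_normed_vector) \<Rightarrow> chart \<Rightarrow> complex \<Rightarrow> complex \<Rightarrow> 'a"
  where "diff_at f c z v = frechet_derivative (f \<circ> par c) (at z) v"


section \<open>Line subbundles of the trivial H^2 bundle and complex structures\<close>

definition local_section :: "(cp1 \<Rightarrow> H2 set) \<Rightarrow> chart \<Rightarrow> complex set \<Rightarrow> (complex \<Rightarrow> H2) \<Rightarrow> bool"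
  where "local_section E c U \<psi> \<longleftrightarrow>
    open U \<and> smooth_on U \<psi> \<and> (\<forall>u\<in>U. \<psi> u \<in> E (par c u))"

definition line_subbundle :: "(cp1 \<Rightarrow> H2 set) \<Rightarrow> bool"
  where "line_subbundle E \<longleftrightarrow>
    (\<forall>c z. \<exists>U \<psi>. z \<in> U \<and> open U \<and> smooth_on U \<psi> \<and>
       (\<forall>u\<in>U. \<psi> u \<noteq> 0 \<and> E (par c u) = hline (\<psi> u)))"

definition annihilator :: "(cp1 \<Rightarrow> H2 set) \<Rightarrow> cp1 \<Rightarrow> H2 set"
  where "annihilator E p = {a. \<forall>x\<in>E p. pairing a x = 0}"

text \<open>
  All line bundles below are of the form \<open>V/E\<close> with \<open>V\<close> the trivial H^2 bundle over CP^1 and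
  \<open>E\<close> a line subbundle. Sections of \<open>V/E\<close> and \<open>V/E\<close>-valued forms are represented by smooth
  \<open>V\<close>-valued lifts (which always exist), and equality in \<open>V/E\<close> is congruence modulo \<open>E\<close>.
  Likewise endomorphism fields of \<open>E\<close> and of \<open>V/E\<close> are represented by endomorphism fields
  of \<open>V\<close> that preserve \<open>E\<close>.
\<close>

definition smooth_End :: "(cp1 \<Rightarrow> H2 \<Rightarrow> H2) \<Rightarrow> bool"
  where "smooth_End A \<longleftrightarrow> (\<forall>p. rlinear (A p)) \<and> (\<forall>x. smooth_cp1 (\<lambda>p. A p x))"

definition complex_structure_sub :: "(cp1 \<Rightarrow> H2 set) \<Rightarrow> (cp1 \<Rightarrow> H2 \<Rightarrow> H2) \<Rightarrow> bool"
  where "complex_structure_sub E J \<longleftrightarrow> smooth_End J \<and>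
    (\<forall>p. \<forall>x\<in>E p. J p x \<in> E p \<and> J p (J p x) = - x)"

definition complex_structure_quot :: "(cp1 \<Rightarrow> H2 set) \<Rightarrow> (cp1 \<Rightarrow> H2 \<Rightarrow> H2) \<Rightarrow> bool"
  where "complex_structure_quot E J \<longleftrightarrow> smooth_End J \<and>
    (\<forall>p. (\<forall>x\<in>E p. J p x \<in> E p) \<and> (\<forall>x. J p (J p x) + x \<in> E p))"


section \<open>Quaternionic holomorphic structures\<close>

text \<open>
  \<open>hol_structure E J D\<close>: the operator \<open>D\<close> from sections of \<open>V/E\<close> to \<open>V/E\<close>-valued forms
  (well defined modulo \<open>E\<close> and additive) takes values in the forms with
  \<open>*\<omega> = - J \<omega>\<close> and satisfies the Leibniz rule
  \<open>D (\<psi> h) = (D \<psi>) h + (\<psi> dh)''\<close>, where \<open>\<omega>'' = (\<omega> + J *\<omega>) / 2\<close>.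
\<close>

definition hol_structure ::
    "(cp1 \<Rightarrow> H2 set) \<Rightarrow> (cp1 \<Rightarrow> H2 \<Rightarrow> H2) \<Rightarrow> ((cp1 \<Rightarrow> H2) \<Rightarrow> H2_form) \<Rightarrow> bool"
  where "hol_structure E J D \<longleftrightarrow>
    (\<forall>\<psi>. smooth_cp1 \<psi> \<longrightarrow> smooth_form (D \<psi>)) \<and>
    (\<forall>\<psi> \<phi>. smooth_cp1 \<psi> \<and> smooth_cp1 \<phi> \<and> (\<forall>p. \<psi> p - \<phi> p \<in> E p) \<longrightarrow>
       (\<forall>c z v. D \<psi> c z v - D \<phi> c z v \<in> E (par c z))) \<and>
    (\<forall>\<psi>. smooth_cp1 \<psi> \<longrightarrow>
       (\<forall>c z v. D \<psi> c z (\<i> * v) + J (par c z) (D \<psi> c z v) \<in> E (par c z))) \<and>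
    (\<forall>\<psi> \<phi>. smooth_cp1 \<psi> \<and> smooth_cp1 \<phi> \<longrightarrow>
       (\<forall>c z v. D (\<lambda>p. \<psi> p + \<phi> p) c z v - (D \<psi> c z v + D \<phi> c z v) \<in> E (par c z))) \<and>
    (\<forall>\<psi> h. smooth_cp1 \<psi> \<and> smooth_cp1 h \<longrightarrow>
       (\<forall>c z v.
          D (\<lambda>p. \<psi> p \<odot> h p) c z v -
            (D \<psi> c z v \<odot> h (par c z) +
             (1/2) *\<^sub>R (\<psi> (par c z) \<odot> diff_at h c z v +
                     J (par c z) (\<psi> (par c z) \<odot> diff_at h c z (\<i> * v))))
          \<in> E (par c z)))"

definition hol_sections ::
    "(cp1 \<Rightarrow> H2 set) \<Rightarrow> ((cp1 \<Rightarrow> H2) \<Rightarrow> H2_form) \<Rightarrow> (cp1 \<Rightarrow> H2) set"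
  where "hol_sections E D = {\<psi>. smooth_cp1 \<psi> \<and> (\<forall>c z v. D \<psi> c z v \<in> E (par c z))}"

text \<open>
  A linear system is a set of lifts closed under congruence modulo \<open>E\<close>; \<open>m\<close> is the
  quaternionic dimension of the corresponding space of sections of \<open>V/E\<close>.
\<close>

definition linear_system ::
    "(cp1 \<Rightarrow> H2 set) \<Rightarrow> ((cp1 \<Rightarrow> H2) \<Rightarrow> H2_form) \<Rightarrow> nat \<Rightarrow> (cp1 \<Rightarrow> H2) set \<Rightarrow> bool"
  where "linear_system E D m H \<longleftrightarrow>
    H \<subseteq> hol_sections E D \<and>
    (\<lambda>_. 0) \<in> H \<and>
    (\<forall>\<psi>\<in>H. \<forall>\<phi>\<in>H. (\<lambda>p. \<psi> p + \<phi> p) \<in> H) \<and>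
    (\<forall>\<psi>\<in>H. \<forall>l. (\<lambda>p. \<psi> p \<odot> l) \<in> H) \<and>
    (\<forall>\<psi>\<in>H. \<forall>\<phi>. smooth_cp1 \<phi> \<and> (\<forall>p. \<phi> p - \<psi> p \<in> E p) \<longrightarrow> \<phi> \<in> H) \<and>
    (\<exists>b. (\<forall>k<m. b k \<in> H) \<and>
       (\<forall>l. (\<forall>p. (\<Sum>k<m. b k p \<odot> l k) \<in> E p) \<longrightarrow> (\<forall>k<m. l k = 0)) \<and>
       (\<forall>\<psi>\<in>H. \<exists>l. \<forall>p. \<psi> p - (\<Sum>k<m. b k p \<odot> l k) \<in> E p))"

text \<open>
  Complex numbers act on \<open>V/E\<close> through \<open>J\<close>. The norm of the class of \<open>x\<close> in the quotient by
  \<open>E p\<close> is \<open>infdist x (E p)\<close>.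
\<close>

definition complex_act :: "(cp1 \<Rightarrow> H2 \<Rightarrow> H2) \<Rightarrow> cp1 \<Rightarrow> complex \<Rightarrow> H2 \<Rightarrow> H2"
  where "complex_act J p a x = Re a *\<^sub>R x + Im a *\<^sub>R J p x"

definition vanishes_to_order ::
    "(cp1 \<Rightarrow> H2 set) \<Rightarrow> (cp1 \<Rightarrow> H2 \<Rightarrow> H2) \<Rightarrow> (cp1 \<Rightarrow> H2) \<Rightarrow> cp1 \<Rightarrow> nat \<Rightarrow> bool"
  where "vanishes_to_order E J \<psi> p k \<longleftrightarrow>
    (\<exists>c z r \<phi> C. par c z = p \<and> r > 0 \<and> smooth_on (ball z r) \<phi> \<and> \<phi> z \<notin> E p \<and>
       (\<forall>u\<in>ball z r.
          infdist (\<psi> (par c u) - complex_act J (par c u) ((u - z) ^ k) (\<phi> u)) (E (par c u))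
            \<le> C * norm (u - z) ^ (k + 1)))"

definition vanishing_orders ::
    "(cp1 \<Rightarrow> H2 set) \<Rightarrow> (cp1 \<Rightarrow> H2 \<Rightarrow> H2) \<Rightarrow> (cp1 \<Rightarrow> H2) set \<Rightarrow> cp1 \<Rightarrow> nat set"
  where "vanishing_orders E J H p =
    {k. \<exists>\<psi>\<in>H. (\<exists>q. \<psi> q \<notin> E q) \<and> vanishes_to_order E J \<psi> p k}"

definition ord_at ::
    "(cp1 \<Rightarrow> H2 set) \<Rightarrow> (cp1 \<Rightarrow> H2 \<Rightarrow> H2) \<Rightarrow> nat \<Rightarrow> (cp1 \<Rightarrow> H2) set \<Rightarrow> cp1 \<Rightarrow> int"
  where "ord_at E J n H p =
    (\<Sum>k\<le>n. int (sorted_list_of_set (vanishing_orders E J H p) ! k) - int k)"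

text \<open>The sum ranges over a finite set, because the orders jump at isolated points only.\<close>

definition total_ord ::
    "(cp1 \<Rightarrow> H2 set) \<Rightarrow> (cp1 \<Rightarrow> H2 \<Rightarrow> H2) \<Rightarrow> nat \<Rightarrow> (cp1 \<Rightarrow> H2) set \<Rightarrow> int"
  where "total_ord E J n H = (\<Sum>p | ord_at E J n H p \<noteq> 0. ord_at E J n H p)"

text \<open>
  The degree of the complex line bundle \<open>{\<psi> \<in> V/E. J \<psi> = \<psi> \<i>}\<close>, by clutching: if \<open>\<phi>\<^sub>0\<close> and
  \<open>\<phi>\<^sub>1\<close> are nowhere vanishing sections over the \<open>z\<close>- and the \<open>w\<close>-chart and
  \<open>\<phi>\<^sub>1 = \<phi>\<^sub>0 g\<close> on the unit circle, the degree is the winding number of \<open>g\<close>. A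
  section \<open>\<phi>\<^sub>0 z^d\<close> which extends to \<open>\<phi>\<^sub>1\<close> has \<open>d\<close> zeros, counted with sign.
\<close>

definition hat_frame ::
    "(cp1 \<Rightarrow> H2 set) \<Rightarrow> (cp1 \<Rightarrow> H2 \<Rightarrow> H2) \<Rightarrow> chart \<Rightarrow> (complex \<Rightarrow> H2) \<Rightarrow> bool"
  where "hat_frame E J c \<phi> \<longleftrightarrow> smooth_on UNIV \<phi> \<and>
    (\<forall>z. \<phi> z \<notin> E (par c z) \<and>
         J (par c z) (\<phi> z) - \<phi> z \<odot> quat_of_complex \<i> \<in> E (par c z))"

definition bundle_degree :: "(cp1 \<Rightarrow> H2 set) \<Rightarrow> (cp1 \<Rightarrow> H2 \<Rightarrow> H2) \<Rightarrow> int"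
  where "bundle_degree E J = (THE d. \<exists>\<phi>\<^sub>0 \<phi>\<^sub>1 g.
    hat_frame E J Zchart \<phi>\<^sub>0 \<and> hat_frame E J Wchart \<phi>\<^sub>1 \<and>
    (\<forall>u. norm u = 1 \<longrightarrow> \<phi>\<^sub>1 (1 / u) - \<phi>\<^sub>0 u \<odot> quat_of_complex (g u) \<in> E (Finite u)) \<and>
    winding_number (g \<circ> circlepath 0 1) 0 = of_int d)"

text \<open>
  The part of \<open>D\<close> anticommuting with \<open>J\<close> is \<open>Q = (D + J D J) / 2\<close>. It is tensorial, hence
  its value on the vector \<open>x\<close> may be computed from the constant section \<open>x\<close>.
\<close>

definition hopf_field ::
    "(cp1 \<Rightarrow> H2 \<Rightarrow> H2) \<Rightarrow> ((cp1 \<Rightarrow> H2) \<Rightarrow> H2_form) \<Rightarrow> chart \<Rightarrow> complex \<Rightarrow> complex \<Rightarrow> H2 \<Rightarrow> H2"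
  where "hopf_field J D c z v x =
    (1/2) *\<^sub>R (D (\<lambda>_. x) c z v + J (par c z) (D (\<lambda>p. J p x) c z v))"

text \<open>
  Real trace of an endomorphism \<open>A\<close> of the fibre \<open>V/E\<close> at \<open>p\<close>: in the frame \<open>x\<close> with
  \<open>A x = x b\<close> it is the map \<open>\<lambda>l. b * l\<close> of the real vector space of quaternions.
\<close>

definition quot_trace :: "(cp1 \<Rightarrow> H2 set) \<Rightarrow> cp1 \<Rightarrow> (H2 \<Rightarrow> H2) \<Rightarrow> real"
  where "quot_trace E p A =
    (THE t. \<exists>x b. x \<notin> E p \<and> A x - x \<odot> b \<in> E p \<and> t = (\<Sum>e\<in>Basis. inner (b * e) e))"

text \<open>
  The integrand is \<open>tr (Q \<and> *Q)\<close> evaluated on the coordinate fields \<open>(1, \<i>)\<close> of the \<open>z\<close>-chart,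
  where \<open>(\<alpha> \<and> \<beta>) (X, Y) = \<alpha> X \<circ> \<beta> Y - \<alpha> Y \<circ> \<beta> X\<close> and \<open>*Q X = Q (\<i> X)\<close>; the chart omits
  one point only.
\<close>

definition willmore_energy ::
    "(cp1 \<Rightarrow> H2 set) \<Rightarrow> (cp1 \<Rightarrow> H2 \<Rightarrow> H2) \<Rightarrow> ((cp1 \<Rightarrow> H2) \<Rightarrow> H2_form) \<Rightarrow> real"
  where "willmore_energy E J D = (1/2) *
    (\<integral>z. quot_trace E (Finite z)
       (\<lambda>x. hopf_field J D Zchart z 1 (hopf_field J D Zchart z (\<i> * \<i>) x)
          - hopf_field J D Zchart z \<i> (hopf_field J D Zchart z (\<i> * 1) x)) \<partial>lborel)"

text \<open>The genus of CP^1 is 0, so \<open>n (1 - g) - d = n - d\<close>.\<close>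

definition plucker_equality ::
    "(cp1 \<Rightarrow> H2 set) \<Rightarrow> (cp1 \<Rightarrow> H2 \<Rightarrow> H2) \<Rightarrow> ((cp1 \<Rightarrow> H2) \<Rightarrow> H2_form) \<Rightarrow>
      nat \<Rightarrow> (cp1 \<Rightarrow> H2) set \<Rightarrow> bool"
  where "plucker_equality E J D n H \<longleftrightarrow>
    linear_system E D (n + 1) H \<and>
    willmore_energy E J D =
      4 * pi * real_of_int ((int n + 1) * (int n - bundle_degree E J) + total_ord E J n H)"


section \<open>Immersions into HP^1\<close>

text \<open>
  \<open>f\<close> represents \<open>L\<close> near \<open>par c z\<close> in one of the affine charts \<open>[\<lambda>, 1] \<mapsto> \<lambda>\<close> and
  \<open>[1, \<mu>] \<mapsto> \<mu>\<close> of HP^1; these differ by \<open>\<mu> = inverse \<lambda>\<close>, which is conformal.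
\<close>

definition affine_rep :: "(cp1 \<Rightarrow> H2 set) \<Rightarrow> chart \<Rightarrow> complex \<Rightarrow> (complex \<Rightarrow> quat) \<Rightarrow> bool"
  where "affine_rep L c z f \<longleftrightarrow>
    (\<forall>\<^sub>F u in nhds z. L (par c u) = hline (f u, 1)) \<or>
    (\<forall>\<^sub>F u in nhds z. L (par c u) = hline (1, f u))"

definition immersion :: "(cp1 \<Rightarrow> H2 set) \<Rightarrow> bool"
  where "immersion L \<longleftrightarrow> line_subbundle L \<and>
    (\<forall>c z. \<exists>f f'. affine_rep L c z f \<and> (f has_derivative f') (at z) \<and> inj f')"

definition conformal_immersion :: "(cp1 \<Rightarrow> H2 set) \<Rightarrow> bool"
  where "conformal_immersion L \<longleftrightarrow> line_subbundle L \<and>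
    (\<forall>c z. \<exists>f f' s. affine_rep L c z f \<and> (f has_derivative f') (at z) \<and>
       s > 0 \<and> (\<forall>v. norm (f' v) = s * norm v))"

definition projective_transformation :: "(H2 \<Rightarrow> H2) \<Rightarrow> bool"
  where "projective_transformation T \<longleftrightarrow> rlinear T \<and> bij T"

text \<open>Up to Moebius transformations there is only one round 2-sphere, the closure of the plane C.\<close>

definition round_sphere :: "(cp1 \<Rightarrow> H2 set) \<Rightarrow> bool"
  where "round_sphere L \<longleftrightarrow> conformal_immersion L \<and>
    (\<exists>T. projective_transformation T \<and>
       range (\<lambda>p. T ` L p) = insert (hline (1, 0)) (range (\<lambda>z. hline (quat_of_complex z, 1))))"

text \<open>
  For a section \<open>\<psi>\<close> of \<open>L\<close>, \<open>\<delta> \<psi>\<close> is the class of \<open>d\<psi>\<close> modulo \<open>L\<close>. The following two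
  conditions are \<open>*\<delta> = J \<delta>\<close> for \<open>J\<close> on \<open>V/L\<close>, and \<open>*\<delta> = \<delta> J\<close> for \<open>J\<close> on \<open>L\<close>.
\<close>

definition star_delta_quot :: "(cp1 \<Rightarrow> H2 set) \<Rightarrow> (cp1 \<Rightarrow> H2 \<Rightarrow> H2) \<Rightarrow> bool"
  where "star_delta_quot L J \<longleftrightarrow>
    (\<forall>c U \<psi>. local_section L c U \<psi> \<longrightarrow>
      (\<forall>z\<in>U. \<forall>v. frechet_derivative \<psi> (at z) (\<i> * v)
                 - J (par c z) (frechet_derivative \<psi> (at z) v) \<in> L (par c z)))"

definition star_delta_sub :: "(cp1 \<Rightarrow> H2 set) \<Rightarrow> (cp1 \<Rightarrow> H2 \<Rightarrow> H2) \<Rightarrow> bool"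
  where "star_delta_sub L J \<longleftrightarrow>
    (\<forall>c U \<psi>. local_section L c U \<psi> \<longrightarrow>
      (\<forall>z\<in>U. \<forall>v. frechet_derivative \<psi> (at z) (\<i> * v)
                 - frechet_derivative (\<lambda>u. J (par c u) (\<psi> u)) (at z) v \<in> L (par c z)))"


section \<open>Soliton spheres\<close>

text \<open>
  \<open>V/E\<close> with complex structure \<open>J\<close> is one of the two Moebius invariant bundles of \<open>L\<close>:
  either \<open>V/L\<close>, or the dual bundle of \<open>L\<close>, i.e. the quotient of the dual of \<open>V\<close> by the
  annihilator of \<open>L\<close>, with complex structure \<open>(J \<alpha>) x = \<alpha> (J x)\<close>.
\<close>

definition mobius_invariant_bundle ::
    "(cp1 \<Rightarrow> H2 set) \<Rightarrow> (cp1 \<Rightarrow> H2 set) \<Rightarrow> (cp1 \<Rightarrow> H2 \<Rightarrow> H2) \<Rightarrow> bool"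
  where "mobius_invariant_bundle L E J \<longleftrightarrow> complex_structure_quot E J \<and>
    (E = L \<and> star_delta_quot L J \<or>
     E = annihilator L \<and>
       (\<exists>J\<^sub>L. complex_structure_sub L J\<^sub>L \<and> star_delta_sub L J\<^sub>L \<and>
          (\<forall>p a. \<forall>x\<in>L p. pairing (J p a) x = pairing a (J\<^sub>L p x))))"

text \<open>
  One of the canonical linear systems (the classes of the constant sections) is contained in an
  \<open>(n + 1)\<close>-dimensional linear system with equality in the Pluecker estimate. \<open>J\<close> and \<open>D\<close> are
  uniquely determined (modulo \<open>E\<close>) by \<open>L\<close> and the choice of the bundle.
\<close>

definition has_soliton_system :: "(cp1 \<Rightarrow> H2 set) \<Rightarrow> nat \<Rightarrow> bool"
  where "has_soliton_system L n \<longleftrightarrow>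
    (\<exists>E J D H. mobius_invariant_bundle L E J \<and>
       hol_structure E J D \<and> (\<forall>x. (\<lambda>_. x) \<in> hol_sections E D) \<and>
       plucker_equality E J D n H \<and> (\<forall>x. (\<lambda>_. x) \<in> H))"

definition soliton_sphere :: "(cp1 \<Rightarrow> H2 set) \<Rightarrow> bool"
  where "soliton_sphere L \<longleftrightarrow> conformal_immersion L \<and> (\<exists>n. has_soliton_system L n)"

definition soliton_number :: "(cp1 \<Rightarrow> H2 set) \<Rightarrow> nat"
  where "soliton_number L = (if round_sphere L then 0 else (LEAST n. has_soliton_system L n))"

definition n_soliton_sphere :: "nat \<Rightarrow> (cp1 \<Rightarrow> H2 set) \<Rightarrow> bool"
  where "n_soliton_sphere n L \<longleftrightarrow> soliton_sphere L \<and> soliton_number L = n"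


section \<open>Bryant spheres with smooth ends\<close>

text \<open>
  Rational functions on CP^1; \<open>remove_sings\<close> supplies the value at removable singularities and
  at infinity, and the junk value 0 at poles.
\<close>

definition rational_fun :: "(cp1 \<Rightarrow> complex) \<Rightarrow> bool"
  where "rational_fun f \<longleftrightarrow> (\<exists>p q. q \<noteq> 0 \<and>
    (\<forall>z. f (Finite z) = remove_sings (\<lambda>u. poly p u / poly q u) z) \<and>
    f Infinity = remove_sings (\<lambda>w. poly p (1 / w) / poly q (1 / w)) 0)"

definition pole_of_order :: "(complex \<Rightarrow> complex^2^2) \<Rightarrow> complex \<Rightarrow> nat \<Rightarrow> bool"
  where "pole_of_order M z m \<longleftrightarrow> m > 0 \<and>
    (\<exists>B. B \<noteq> 0 \<and> ((\<lambda>u. \<chi> i j. (u - z) ^ m * M u $ i $ j) \<longlongrightarrow> B) (at z))"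

definition matrix_deriv :: "(complex \<Rightarrow> complex^2^2) \<Rightarrow> complex \<Rightarrow> complex^2^2"
  where "matrix_deriv M z = (\<chi> i j. deriv (\<lambda>u. M u $ i $ j) z)"

text \<open>At a pole of \<open>F\<close> the form \<open>dF\<close> has a pole as well, so it has no zero there.\<close>

definition rational_null_immersion :: "(cp1 \<Rightarrow> complex^2^2) \<Rightarrow> bool"
  where "rational_null_immersion F \<longleftrightarrow>
    (\<forall>i j. rational_fun (\<lambda>p. F p $ i $ j)) \<and>
    (\<forall>c z. (\<nexists>m. pole_of_order (F \<circ> par c) z m) \<longrightarrow>
       det (F (par c z)) = 1 \<and>
       det (matrix_deriv (F \<circ> par c) z) = 0 \<and> matrix_deriv (F \<circ> par c) z \<noteq> 0)"

text \<open>The product of the complex matrix \<open>A\<close> with the column \<open>(k, 1)\<close>.\<close>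

definition bryant_vector :: "complex^2^2 \<Rightarrow> H2"
  where "bryant_vector A =
    (quat_of_complex (A $ 1 $ 1) * quat_k + quat_of_complex (A $ 1 $ 2),
     quat_of_complex (A $ 2 $ 1) * quat_k + quat_of_complex (A $ 2 $ 2))"

definition bryant_sphere_smooth_ends :: "(cp1 \<Rightarrow> H2 set) \<Rightarrow> bool"
  where "bryant_sphere_smooth_ends L \<longleftrightarrow> immersion L \<and>
    (\<exists>T F. projective_transformation T \<and> rational_null_immersion F \<and>
       (\<forall>c z m. pole_of_order
          (\<lambda>u. matrix_deriv (F \<circ> par c) u ** matrix_inv (F (par c u))) z m \<longrightarrow> m = 2) \<and>
       (\<forall>c z. (\<nexists>m. pole_of_order (F \<circ> par c) z m) \<longrightarrow>
          T ` L (par c z) = hline (bryant_vector (F (par c z)))))"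

end

theory Submission
  imports Defs "HOL-Computational_Algebra.Fundamental_Theorem_Algebra"
begin

text \<open>
  For a null immersion \<open>F\<close>, the rank one forms \<open>dF F\<^sup>-\<^sup>1\<close> and \<open>F\<^sup>-\<^sup>1 dF\<close> are squares of meromorphic
  spinors. If \<open>(p, q)\<close> is the spinor of \<open>F\<^sup>-\<^sup>1 dF\<close>, the row \<open>(p - k q)\<^sup>-\<^sup>1 (1, - k) F\<^sup>-\<^sup>1\<close> has kernel
  \<open>L = F (k, 1) H\<close> and represents \<open>V/L\<close> in a frame in which \<open>J\<close> is left multiplication by \<open>\<i>\<close>. In this
  frame the constants and the function \<open>\<tau> = (p - k q)\<^sup>-\<^sup>1\<close> satisfy the same equation, whose Hopf field
  is \<open>k h dz\<close> with \<open>h = (q p' - p q') / (|p|\<^sup>2 + |q|\<^sup>2)\<close>; poles of order two of \<open>dF F\<^sup>-\<^sup>1\<close> are exactly what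
  makes everything smooth at the ends. So \<open>V/L\<close> has a third holomorphic section. Its Willmore energy is four
  times the area of the rational curve \<open>(p : q)\<close>, i.e. \<open>4 \<pi> N\<close> with \<open>N\<close> the degree of the curve,
  and the three-dimensional linear system has vanishing orders \<open>0, 1, 2 + ord k\<^sub>0\<close> where the zeros of
  \<open>k\<^sub>0\<close> are \<open>N - 3\<close> in number. As \<open>deg (V/L) = 1\<close>, this is equality in the Pluecker estimate.

  Conversely, equality for the constants alone forces \<open>N = 0\<close>. Then \<open>(p : q)\<close> is constant, \<open>F\<close> is affine
  in a coordinate of degree one, and \<open>L\<close> is a round sphere. The dual bundle behaves in the same way, because
  \<open>L\<close> lies in the 3-sphere of null lines of a Hermitian form.
\<close>

section \<open>Quaternions as pairs of complex numbers\<close>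

text \<open>The obstacle is that \<open>F\<close> is known only away from its poles, whereas the
  vanishing orders, the degree and the energy concern the whole sphere. Hence everything is
  expressed through polynomials in both charts: an identity is proved off the zeros of the
  denominator \<open>dl\<close> of \<open>F\<close> and extended over the ends by continuity. The
  count N - 3 is a degree count. The spinor (P, Q) / dl lives in a square root of the canonical
  bundle, of degree -1, so \<open>dl\<close> has N + 1 zeros on the sphere. The Wronskian K = P Q' -
  Q P' has 2 N - 2 zeros, and K = dl k0, where the divisibility by \<open>dl\<close> is the effect
  of the smooth ends. With degree 1 the right side of the equality is 4 \<pi> (3 (2 - 1) + N - 3)
  for n = 2, and 0 for n = 1 and the constants. The lower bound concerns arbitrary J, D and H. In a
  spinor frame, star \<delta> = J \<delta> forces J to be left multiplication by \<i>, and
  holomorphic constants determine D modulo E by the Leibniz rule, so the numbers computed for one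
  choice hold for all.\<close>

abbreviation qc :: "complex \<Rightarrow> quat"
  where "qc \<equiv> quat_of_complex"

lemma qc_sel [simp]:
  "qre (qc z) = Re z" "qi (qc z) = Im z" "qj (qc z) = 0" "qk (qc z) = 0"
  by (simp_all add: quat_of_complex_def)

lemma quat_k_sel [simp]:
  "qre quat_k = 0" "qi quat_k = 0" "qj quat_k = 0" "qk quat_k = 1"
  by (simp_all add: quat_k_def)

lemma qcnj_sel [simp]:
  "qre (qcnj x) = qre x" "qi (qcnj x) = - qi x" "qj (qcnj x) = - qj x" "qk (qcnj x) = - qk x"
  by (simp_all add: qcnj_def)

lemma qc_0 [simp]: "qc 0 = 0" and qc_1 [simp]: "qc 1 = 1"
  and qc_add: "qc (a + b) = qc a + qc b"
  and qc_diff: "qc (a - b) = qc a - qc b"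
  and qc_minus: "qc (- a) = - qc a"
  and qc_mult: "qc (a * b) = qc a * qc b"
  and qc_scaleR: "qc (r *\<^sub>R a) = r *\<^sub>R qc a"
  by (simp_all add: quat_eq_iff algebra_simps)

lemma qc_inverse: "qc (inverse a) = inverse (qc a)"
proof (cases "a = 0")
  case False
  have "qc a * qc (inverse a) = 1"
    using False by (simp flip: qc_mult)
  then show ?thesis
    by (rule inverse_unique[symmetric])
qed simp

lemma norm_qc [simp]: "norm (qc z) = norm z"
  by (simp add: norm_quat_def inner_quat_def cmod_def power2_eq_square)

lemma qc_eq_0_iff [simp]: "qc z = 0 \<longleftrightarrow> z = 0"
  by (auto simp: quat_eq_iff complex_eq_iff)

lemma qc_eq_iff: "qc z = qc w \<longleftrightarrow> z = w"
  by (auto simp: quat_eq_iff complex_eq_iff)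

lemma qc_quat_k_eq_0_iff: "qc a + quat_k * qc b = 0 \<longleftrightarrow> a = 0 \<and> b = 0"
  by (auto simp: quat_eq_iff complex_eq_iff)

lemma qcnj_add: "qcnj (x + y) = qcnj x + qcnj y"
  and qcnj_mult: "qcnj (x * y) = qcnj y * qcnj x"
  and qcnj_qcnj [simp]: "qcnj (qcnj x) = x"
  and qcnj_0 [simp]: "qcnj 0 = 0"
  and qcnj_scaleR: "qcnj (r *\<^sub>R x) = r *\<^sub>R qcnj x"
  by (simp_all add: quat_eq_iff)

lemma qcnj_eq_0_iff [simp]: "qcnj x = 0 \<longleftrightarrow> x = 0"
  by (auto simp: quat_eq_iff)

lemma norm_qcnj [simp]: "norm (qcnj x) = norm x"
  by (simp add: norm_quat_def inner_quat_def)

lemma norm_quat_square: "(norm x)\<^sup>2 = qre x * qre x + qi x * qi x + qj x * qj x + qk x * qk x"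
  by (simp add: norm_quat_def inner_quat_def)

lemma mult_qcnj: "x * qcnj x = of_real ((norm x)\<^sup>2)"
  and qcnj_times: "qcnj x * x = of_real ((norm x)\<^sup>2)"
  by (simp_all add: quat_eq_iff norm_quat_square of_real_def)

lemma rscale_simps [simp]: "fst (x \<odot> l) = fst x * l" "snd (x \<odot> l) = snd x * l"
  by (simp_all add: rscale_def)

lemma rscale_one [simp]: "x \<odot> 1 = x" and rscale_zero [simp]: "x \<odot> 0 = 0" "0 \<odot> l = 0"
  and rscale_rscale: "x \<odot> l \<odot> m = x \<odot> (l * m)"
  and rscale_add: "(x + y) \<odot> l = x \<odot> l + y \<odot> l"
  and rscale_add_right: "x \<odot> (l + m) = x \<odot> l + x \<odot> m"
  by (simp_all add: prod_eq_iff mult.assoc algebra_simps)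

lemma rscale_eq_0_iff: "x \<odot> l = 0 \<longleftrightarrow> x = 0 \<or> l = 0"
  by (auto simp: prod_eq_iff)

lemma H2_basis: "x = (1, 0) \<odot> fst x + (0, 1) \<odot> snd x"
  by (simp add: prod_eq_iff)

lemma rscale_of_real: "x \<odot> of_real r = r *\<^sub>R x"
  by (simp add: prod_eq_iff of_real_def)

lemma rlinear_add: "rlinear A \<Longrightarrow> A (x + y) = A x + A y"
  and rlinear_rscale: "rlinear A \<Longrightarrow> A (x \<odot> l) = A x \<odot> l"
  unfolding rlinear_def by blast+

lemma rlinear_0: "rlinear A \<Longrightarrow> A 0 = 0"
  by (metis rlinear_rscale rscale_zero(1))

lemma rlinear_minus: "rlinear A \<Longrightarrow> A (- x) = - A x"
  by (metis add_eq_0_iff rlinear_0 rlinear_add)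

lemma rlinear_diff: "rlinear A \<Longrightarrow> A (x - y) = A x - A y"
  using rlinear_add[of A x "- y"] rlinear_minus[of A y] by simp

lemma rlinear_scaleR: "rlinear A \<Longrightarrow> A (r *\<^sub>R x) = r *\<^sub>R A x"
  by (metis rlinear_rscale rscale_of_real)

lemma bounded_linear_qc: "bounded_linear qc"
  by (rule bounded_linear_intro[where K = 1]) (simp_all add: qc_add qc_scaleR)

lemma bounded_linear_qcnj: "bounded_linear qcnj"
  by (rule bounded_linear_intro[where K = 1]) (simp_all add: qcnj_add qcnj_scaleR)

lemma bounded_bilinear_rscale: "bounded_bilinear (\<odot>)"
proof
  fix a a' :: H2 and b b' :: quat and r :: real
  show "(a + a') \<odot> b = a \<odot> b + a' \<odot> b" "a \<odot> (b + b') = a \<odot> b + a \<odot> b'"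
    by (rule rscale_add rscale_add_right)+
  show "(r *\<^sub>R a) \<odot> b = r *\<^sub>R (a \<odot> b)" "a \<odot> (r *\<^sub>R b) = r *\<^sub>R (a \<odot> b)"
    by (simp_all add: prod_eq_iff)
next
  have "norm (a \<odot> b) \<le> norm a * norm b * 1" for a b
    by (simp add: norm_prod_def norm_mult power_mult_distrib flip: distrib_right)
       (simp add: real_sqrt_mult)
  then show "\<exists>K. \<forall>a b. norm (a \<odot> b) \<le> norm a * norm b * K"
    by blast
qed

section \<open>Smooth functions\<close>

text \<open>The value of \<open>frechet_derivative\<close> at a point depends only on the germ, even
  where no derivative exists, because both functions admit the same derivatives there; so agreement
  on an open set passes through the recursion.\<close>

lemma Ck_on_cong:
  assumes "open S" "\<And>z. z \<in> S \<Longrightarrow> f z = g z"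
  shows "Ck_on k S f \<longleftrightarrow> Ck_on k S g"
  using assms(2)
proof (induction k arbitrary: f g)
  case 0
  then show ?case by (simp cong: continuous_on_cong)
next
  case (Suc k)
  have D: "f differentiable (at z) \<longleftrightarrow> g differentiable (at z)"
    "frechet_derivative f (at z) = frechet_derivative g (at z)" if "z \<in> S" for z
  proof -
    have "(f has_derivative D) (at z) \<longleftrightarrow> (g has_derivative D) (at z)" for D
      by (rule iffI; erule has_derivative_transform_within_open[OF _ assms(1) that])
         (simp_all add: Suc.prems)
    then show "f differentiable (at z) \<longleftrightarrow> g differentiable (at z)"
      "frechet_derivative f (at z) = frechet_derivative g (at z)"
      by (simp_all add: differentiable_def frechet_derivative_def)
  qed
  have "Ck_on k S (\<lambda>z. frechet_derivative f (at z) v) \<longleftrightarrow>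
    Ck_on k S (\<lambda>z. frechet_derivative g (at z) v)" for v
    by (rule Suc.IH) (simp add: D(2))
  then show ?case
    using D(1) assms(1) by (simp add: differentiable_on_eq_differentiable_at)
qed

lemma Ck_on_mono:
  assumes "open S" "open U" "U \<subseteq> S" "Ck_on k S f"
  shows "Ck_on k U f"
  using assms(4)
proof (induction k arbitrary: f)
  case 0
  then show ?case using assms(3) continuous_on_subset by auto
next
  case (Suc k)
  then show ?case
    using assms(1-3) by (auto intro: differentiable_on_subset)
qed

lemma Ck_on_pred:
  assumes "open S" "Ck_on (Suc k) S f"
  shows "Ck_on k S f"
  using assms(2)
proof (induction k arbitrary: f)
  case 0
  then show ?case by (simp add: differentiable_imp_continuous_on)
qed auto

lemma Ck_on_SucI:
  assumes "open S" "\<And>z. z \<in> S \<Longrightarrow> (f has_derivative f' z) (at z)"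
    "\<And>v. Ck_on k S (\<lambda>z. f' z v)"
  shows "Ck_on (Suc k) S f"
proof -
  have "frechet_derivative f (at z) = f' z" if "z \<in> S" for z
    using frechet_derivative_at[OF assms(2)[OF that]] by simp
  then have "Ck_on k S (\<lambda>z. frechet_derivative f (at z) v)" for v
    using Ck_on_cong[OF assms(1), of "\<lambda>z. f' z v" "\<lambda>z. frechet_derivative f (at z) v" k]
      assms(3) by simp
  then show ?thesis
    using assms(1,2) by (auto simp: differentiable_on_eq_differentiable_at differentiable_def)
qed

lemma Ck_on_SucD:
  assumes "open S" "Ck_on (Suc k) S f"
  shows "z \<in> S \<Longrightarrow> (f has_derivative frechet_derivative f (at z)) (at z)"
    and "Ck_on k S (\<lambda>z. frechet_derivative f (at z) v)"
  using assms by (auto simp: differentiable_on_eq_differentiable_at frechet_derivative_works)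

lemma Ck_on_const: "open S \<Longrightarrow> Ck_on k S (\<lambda>_. c)"
proof (induction k arbitrary: c)
  case (Suc k)
  then show ?case
    by (intro Ck_on_SucI[where f' = "\<lambda>_ _. 0"]) auto
qed simp

lemma Ck_on_linear:
  assumes "bounded_linear L" "open S" "Ck_on k S f"
  shows "Ck_on k S (\<lambda>z. L (f z))"
  using assms(3)
proof (induction k arbitrary: f)
  case 0
  then show ?case using assms(1) by (simp add: bounded_linear.continuous_on)
next
  case (Suc k)
  note D = Ck_on_SucD[OF assms(2) Suc.prems]
  show ?case
    by (rule Ck_on_SucI[OF assms(2) bounded_linear.has_derivative[OF assms(1) D(1)]])
       (auto intro: Suc.IH D(2))
qed

lemma Ck_on_add:
  assumes "open S" "Ck_on k S f" "Ck_on k S g"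
  shows "Ck_on k S (\<lambda>z. f z + g z)"
  using assms(2,3)
proof (induction k arbitrary: f g)
  case 0
  then show ?case by (simp add: continuous_on_add)
next
  case (Suc k)
  note D = Ck_on_SucD[OF assms(1) Suc.prems(1)] Ck_on_SucD[OF assms(1) Suc.prems(2)]
  show ?case
    by (rule Ck_on_SucI[OF assms(1) has_derivative_add[OF D(1) D(3)]])
       (auto intro: Suc.IH D)
qed

lemma Ck_on_bilinear:
  assumes "bounded_bilinear B" "open S" "Ck_on k S f" "Ck_on k S g"
  shows "Ck_on k S (\<lambda>z. B (f z) (g z))"
  using assms(3,4)
proof (induction k arbitrary: f g)
  case 0
  then show ?case by (simp add: bounded_bilinear.continuous_on[OF assms(1)])
next
  case (Suc k)
  note D = Ck_on_SucD[OF assms(2) Suc.prems(1)] Ck_on_SucD[OF assms(2) Suc.prems(2)]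
  have "Ck_on k S f" "Ck_on k S g"
    by (rule Ck_on_pred[OF assms(2)], rule Suc.prems)+
  then have "Ck_on k S (\<lambda>z. B (f z) (frechet_derivative g (at z) v)
      + B (frechet_derivative f (at z) v) (g z))" for v
    by (intro Ck_on_add[OF assms(2)] Suc.IH D)
  with Ck_on_SucI[OF assms(2) bounded_bilinear.FDERIV[OF assms(1) D(1) D(3)], of k]
  show ?case by blast
qed

text \<open>The derivative of the inverse contains the inverse again, so the step uses the
  conclusion one order lower for the same \<open>f\<close>. Real values suffice: a quaternion is
  inverted through its conjugate and the square of its norm.\<close>

lemma Ck_on_inverse:
  fixes f :: "complex \<Rightarrow> real"
  assumes "open S" "Ck_on k S f" "\<And>z. z \<in> S \<Longrightarrow> f z \<noteq> 0"
  shows "Ck_on k S (\<lambda>z. inverse (f z))"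
  using assms(2)
proof (induction k)
  case 0
  then show ?case using assms(3) by (simp add: continuous_on_inverse)
next
  case (Suc k)
  note D = Ck_on_SucD[OF assms(1) Suc.prems]
  have I: "Ck_on k S (\<lambda>z. inverse (f z))"
    by (rule Suc.IH) (rule Ck_on_pred[OF assms(1) Suc.prems])
  have "Ck_on k S (\<lambda>z. - (inverse (f z) * frechet_derivative f (at z) v * inverse (f z)))" for v
    by (intro Ck_on_linear[OF bounded_linear_minus[OF bounded_linear_ident]]
        Ck_on_bilinear[OF bounded_bilinear_mult] assms(1) I D)
  then show ?case
    by (intro Ck_on_SucI[OF assms(1) Deriv.has_derivative_inverse[OF assms(3) D(1)]]) auto
qed

lemma Ck_on_holomorphic:
  assumes "open S" "f holomorphic_on S"
  shows "Ck_on k S f"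
  using assms(2)
proof (induction k arbitrary: f)
  case 0
  then show ?case by (simp add: holomorphic_on_imp_continuous_on)
next
  case (Suc k)
  have "(f has_derivative (\<lambda>v. deriv f z * v)) (at z)" if "z \<in> S" for z
    using holomorphic_derivI[OF Suc.prems assms(1) that] by (simp add: has_field_derivative_def)
  then show ?case
    using holomorphic_deriv[OF Suc.prems assms(1)]
    by (intro Ck_on_SucI[where f' = "\<lambda>z v. deriv f z * v"] assms(1))
       (simp_all add: Suc.IH holomorphic_on_mult)
qed

lemma smooth_on_cong:
  "open S \<Longrightarrow> (\<And>z. z \<in> S \<Longrightarrow> f z = g z) \<Longrightarrow> smooth_on S f \<Longrightarrow> smooth_on S g"
  unfolding smooth_on_def by (metis Ck_on_cong)

lemma smooth_on_subset: "smooth_on S f \<Longrightarrow> open S \<Longrightarrow> open U \<Longrightarrow> U \<subseteq> S \<Longrightarrow> smooth_on U f"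
  unfolding smooth_on_def by (auto intro: Ck_on_mono[of S])

lemma smooth_on_const: "open S \<Longrightarrow> smooth_on S (\<lambda>_. c)"
  by (simp add: smooth_on_def Ck_on_const)

lemma smooth_on_linear: "bounded_linear L \<Longrightarrow> open S \<Longrightarrow> smooth_on S f \<Longrightarrow> smooth_on S (\<lambda>z. L (f z))"
  by (simp add: smooth_on_def Ck_on_linear)

lemma smooth_on_add: "open S \<Longrightarrow> smooth_on S f \<Longrightarrow> smooth_on S g \<Longrightarrow> smooth_on S (\<lambda>z. f z + g z)"
  by (simp add: smooth_on_def Ck_on_add)

lemma smooth_on_minus: "open S \<Longrightarrow> smooth_on S f \<Longrightarrow> smooth_on S (\<lambda>z. - f z)"
  by (rule smooth_on_linear[OF bounded_linear_minus[OF bounded_linear_ident]])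

lemma smooth_on_diff: "open S \<Longrightarrow> smooth_on S f \<Longrightarrow> smooth_on S g \<Longrightarrow> smooth_on S (\<lambda>z. f z - g z)"
  using smooth_on_add[of S f "\<lambda>z. - g z"] smooth_on_minus[of S g] by simp

lemma smooth_on_bilinear:
  "bounded_bilinear B \<Longrightarrow> open S \<Longrightarrow> smooth_on S f \<Longrightarrow> smooth_on S g \<Longrightarrow> smooth_on S (\<lambda>z. B (f z) (g z))"
  by (simp add: smooth_on_def Ck_on_bilinear)

lemmas smooth_on_mult = smooth_on_bilinear[OF bounded_bilinear_mult]
lemmas smooth_on_scaleR = smooth_on_bilinear[OF bounded_bilinear_scaleR]
lemmas smooth_on_rscale = smooth_on_bilinear[OF bounded_bilinear_rscale]
lemmas smooth_on_qc = smooth_on_linear[OF bounded_linear_qc]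
lemmas smooth_on_qcnj = smooth_on_linear[OF bounded_linear_qcnj]
lemmas smooth_on_cnj = smooth_on_linear[OF bounded_linear_cnj]
lemmas smooth_on_fst = smooth_on_linear[OF bounded_linear_fst]
lemmas smooth_on_snd = smooth_on_linear[OF bounded_linear_snd]

lemma smooth_on_Pair:
  assumes "open S" "smooth_on S f" "smooth_on S g"
  shows "smooth_on S (\<lambda>z. (f z, g z))"
proof -
  have "smooth_on S (\<lambda>z. (f z, 0) + (0, g z))"
    by (intro smooth_on_add assms smooth_on_linear[of "\<lambda>x. (x, 0)"] smooth_on_linear[of "\<lambda>x. (0, x)"])
       (auto intro!: bounded_linear_Pair bounded_linear_ident bounded_linear_zero)
  then show ?thesis by simp
qed

lemma smooth_on_inverse:
  "open S \<Longrightarrow> smooth_on S f \<Longrightarrow> (\<And>z. z \<in> S \<Longrightarrow> f z \<noteq> 0) \<Longrightarrow> smooth_on S (\<lambda>z. inverse (f z :: real))"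
  by (simp add: smooth_on_def Ck_on_inverse)

lemma smooth_on_inner:
  "open S \<Longrightarrow> smooth_on S f \<Longrightarrow> smooth_on S g \<Longrightarrow> smooth_on S (\<lambda>z. inner (f z) (g z))"
  by (rule smooth_on_bilinear[OF bounded_bilinear_inner])

lemma smooth_on_norm_square:
  "open S \<Longrightarrow> smooth_on S f \<Longrightarrow> smooth_on S (\<lambda>z. (norm (f z :: 'a :: real_inner))\<^sup>2)"
  using smooth_on_inner[of S f f] by (simp add: power2_norm_eq_inner)

lemma smooth_on_quat_inverse:
  assumes "open S" "smooth_on S f" "\<And>z. z \<in> S \<Longrightarrow> f z \<noteq> 0"
  shows "smooth_on S (\<lambda>z. inverse (f z :: quat))"
proof (rule smooth_on_cong[OF assms(1)])
  show "smooth_on S (\<lambda>z. inverse ((norm (f z))\<^sup>2) *\<^sub>R qcnj (f z))"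
    using assms by (intro smooth_on_scaleR smooth_on_inverse smooth_on_norm_square smooth_on_qcnj) auto
  show "inverse ((norm (f z))\<^sup>2) *\<^sub>R qcnj (f z) = inverse (f z)" for z
    unfolding inverse_quat_def qcnj_def power2_norm_eq_inner by (simp add: inverse_eq_divide)
qed

lemma smooth_on_holomorphic: "open S \<Longrightarrow> f holomorphic_on S \<Longrightarrow> smooth_on S f"
  by (simp add: smooth_on_def Ck_on_holomorphic)

lemma smooth_on_poly: "open S \<Longrightarrow> smooth_on S (poly p)"
  by (intro smooth_on_holomorphic) (auto intro!: holomorphic_intros)

lemma smooth_on_frechet:
  "open S \<Longrightarrow> smooth_on S f \<Longrightarrow> smooth_on S (\<lambda>z. frechet_derivative f (at z) v)"
  unfolding smooth_on_def by (blast intro: Ck_on_SucD(2))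

lemma smooth_on_has_derivative:
  "open S \<Longrightarrow> smooth_on S f \<Longrightarrow> z \<in> S \<Longrightarrow> (f has_derivative frechet_derivative f (at z)) (at z)"
  unfolding smooth_on_def by (blast intro: Ck_on_SucD(1))

lemma smooth_on_continuous: "smooth_on S f \<Longrightarrow> continuous_on S f"
  unfolding smooth_on_def using Ck_on.simps(1) by blast

lemmas smooth_on_intros = smooth_on_const smooth_on_add smooth_on_minus smooth_on_diff
  smooth_on_mult smooth_on_scaleR smooth_on_rscale smooth_on_qc smooth_on_qcnj smooth_on_cnj
  smooth_on_fst smooth_on_snd smooth_on_Pair smooth_on_poly smooth_on_norm_square

section \<open>Bundles with a spinor frame\<close>

definition glue :: "(chart \<Rightarrow> complex \<Rightarrow> 'a) \<Rightarrow> cp1 \<Rightarrow> 'a"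
  where "glue f p = (case p of Finite z \<Rightarrow> f Zchart z | Infinity \<Rightarrow> f Wchart 0)"

lemma glue_par:
  assumes "\<And>z. z \<noteq> 0 \<Longrightarrow> f Wchart (1 / z) = f Zchart z"
  shows "glue f (par c z) = f c z"
  using assms[of "1 / z"] by (cases c) (auto simp: glue_def)

lemma par_surj: obtains c z where "p = par c z"
proof (cases p)
  case (Finite z)
  then show ?thesis using that[of Zchart z] by simp
next
  case Infinity
  then show ?thesis using that[of Wchart 0] by simp
qed

lemma smooth_cp1_has_derivative:
  "smooth_cp1 f \<Longrightarrow> ((\<lambda>u. f (par c u)) has_derivative diff_at f c z) (at z)"
  unfolding smooth_cp1_def diff_at_def[abs_def]
  using smooth_on_has_derivative[OF open_UNIV, of "f \<circ> par c" z] by (simp add: o_def)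

lemma diff_at_smooth: "smooth_cp1 f \<Longrightarrow> smooth_on UNIV (\<lambda>z. diff_at f c z v)"
  unfolding smooth_cp1_def diff_at_def using smooth_on_frechet by blast

lemma diff_at_eqI: "((\<lambda>u. f (par c u)) has_derivative f') (at z) \<Longrightarrow> diff_at f c z = f'"
  unfolding diff_at_def[abs_def] using frechet_derivative_at[of "f \<circ> par c" f' z] by (auto simp: o_def)

lemma diff_at_transition:
  assumes "smooth_cp1 f" "z \<noteq> 0"
  shows "diff_at f Wchart (1 / z) (- v / z ^ 2) = diff_at f Zchart z v"
proof -
  have *: "((\<lambda>u. 1 / u) has_derivative (\<lambda>v. - v / z ^ 2)) (at z)"
    using assms(2) by (auto intro!: derivative_eq_intros simp: power2_eq_square field_simps)
  have "((\<lambda>u. f (par Wchart (1 / u))) has_derivative (\<lambda>v. diff_at f Wchart (1 / z) (- v / z ^ 2))) (at z)"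
    using has_derivative_compose[OF * smooth_cp1_has_derivative[OF assms(1)]] .
  then have "((\<lambda>u. f (par Zchart u)) has_derivative (\<lambda>v. diff_at f Wchart (1 / z) (- v / z ^ 2))) (at z)"
    by (rule has_derivative_transform_within_open[where s = "- {0}"]) (use assms(2) in auto)
  then show ?thesis
    using diff_at_eqI by metis
qed

lemma diff_at_linear: "smooth_cp1 f \<Longrightarrow> linear (diff_at f c z)"
  using smooth_cp1_has_derivative has_derivative_linear by blast

text \<open>
  In a fibre coordinate \<open>\<eta>\<close> of \<open>V/E\<close> in which \<open>J\<close> is the left multiplication by \<open>\<i>\<close>, this is the
  equation \<open>D \<eta> = 0\<close> for the holomorphic structure with Hopf field \<open>k h dz\<close>.
\<close>

definition hol_at :: "complex \<Rightarrow> (complex \<Rightarrow> quat) \<Rightarrow> complex \<Rightarrow> bool"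
  where "hol_at h f z \<longleftrightarrow> (\<exists>f'. (f has_derivative f') (at z) \<and>
    (\<forall>v. f' v + qc \<i> * f' (\<i> * v) = - (2 *\<^sub>R (quat_k * qc (h * v) * f z))))"

lemma hol_atD:
  assumes "hol_at h f z" "(f has_derivative f') (at z)"
  shows "f' v + qc \<i> * f' (\<i> * v) = - (2 *\<^sub>R (quat_k * qc (h * v) * f z))"
  using assms has_derivative_unique unfolding hol_at_def by blast

lemma hol_at_add: "hol_at h f z \<Longrightarrow> hol_at h g z \<Longrightarrow> hol_at h (\<lambda>u. f u + g u) z"
  unfolding hol_at_def
proof (elim exE conjE)
  fix f' g'
  assume "(f has_derivative f') (at z)" "(g has_derivative g') (at z)"
    and *: "\<forall>v. f' v + qc \<i> * f' (\<i> * v) = - (2 *\<^sub>R (quat_k * qc (h * v) * f z))"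
      "\<forall>v. g' v + qc \<i> * g' (\<i> * v) = - (2 *\<^sub>R (quat_k * qc (h * v) * g z))"
  then have "((\<lambda>u. f u + g u) has_derivative (\<lambda>v. f' v + g' v)) (at z)"
    by (intro has_derivative_add)
  moreover have "f' v + g' v + qc \<i> * (f' (\<i> * v) + g' (\<i> * v)) =
      - (2 *\<^sub>R (quat_k * qc (h * v) * (f z + g z)))" for v
    using arg_cong2[OF spec[OF *(1), of v] spec[OF *(2), of v], of "(+)"]
    by (simp add: algebra_simps)
  ultimately show "\<exists>d. ((\<lambda>u. f u + g u) has_derivative d) (at z) \<and>
      (\<forall>v. d v + qc \<i> * d (\<i> * v) = - (2 *\<^sub>R (quat_k * qc (h * v) * (f z + g z))))"
    by blast
qed

lemma hol_at_mult_right: "hol_at h f z \<Longrightarrow> hol_at h (\<lambda>u. f u * l) z"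
  unfolding hol_at_def
proof (elim exE conjE)
  fix f'
  assume "(f has_derivative f') (at z)"
    and *: "\<forall>v. f' v + qc \<i> * f' (\<i> * v) = - (2 *\<^sub>R (quat_k * qc (h * v) * f z))"
  then have "((\<lambda>u. f u * l) has_derivative (\<lambda>v. f' v * l)) (at z)"
    by (intro has_derivative_mult_left)
  moreover have "f' v * l + qc \<i> * (f' (\<i> * v) * l) = - (2 *\<^sub>R (quat_k * qc (h * v) * (f z * l)))" for v
    using arg_cong[OF spec[OF *, of v], of "\<lambda>x. x * l"] by (simp add: algebra_simps)
  ultimately show "\<exists>d. ((\<lambda>u. f u * l) has_derivative d) (at z) \<and>
      (\<forall>v. d v + qc \<i> * d (\<i> * v) = - (2 *\<^sub>R (quat_k * qc (h * v) * (f z * l))))"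
    by blast
qed

lemma qc_i_qc_i: "qc \<i> * (qc \<i> * x) = - x"
  by (simp flip: mult.assoc qc_mult) (simp add: qc_minus)

lemma linear_complex_left:
  assumes "linear f" "f \<i> = qc \<i> * f 1"
  shows "f v = qc v * f 1"
proof -
  have "f v = f (Re v *\<^sub>R 1 + Im v *\<^sub>R \<i>)"
    by (rule arg_cong[of _ _ f]) (simp add: complex_eq_iff)
  also have "\<dots> = Re v *\<^sub>R f 1 + Im v *\<^sub>R f \<i>"
    using assms(1) by (simp only: linear_add linear_scale)
  also have "\<dots> = qc v * f 1"
    unfolding assms(2) by (simp add: quat_eq_iff algebra_simps)
  finally show ?thesis .
qed

text \<open>
  \<open>R c z\<close> is the projection to the quotient by \<open>E\<close>, in coordinates in which the complex structure is
  left multiplication by \<open>\<i>\<close>. The transition factor \<open>1 / (\<i> z)\<close> is a square root of \<open>dw / dz\<close>.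
\<close>

locale spinor_frame =
  fixes E :: "cp1 \<Rightarrow> H2 set" and R :: "chart \<Rightarrow> complex \<Rightarrow> H2 \<Rightarrow> quat"
    and h :: "chart \<Rightarrow> complex \<Rightarrow> complex"
  assumes R_add: "R c z (x + y) = R c z x + R c z y"
    and R_rscale: "R c z (x \<odot> l) = R c z x * l"
    and R_smooth: "smooth_on UNIV (\<lambda>z. R c z x)"
    and mem_E_iff: "x \<in> E (par c z) \<longleftrightarrow> R c z x = 0"
    and R_nonzero: "\<exists>x. R c z x \<noteq> 0"
    and R_transition: "z \<noteq> 0 \<Longrightarrow> R Wchart (1 / z) x = qc (1 / (\<i> * z)) * R Zchart z x"
    and R_hol: "hol_at (h c z) (\<lambda>u. R c u x) z"
    and R_immersed: "x \<noteq> 0 \<Longrightarrow> R c z x = 0 \<Longrightarrow> frechet_derivative (\<lambda>u. R c u x) (at z) 1 \<noteq> 0"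
begin

lemma R_0 [simp]: "R c z 0 = 0"
  by (metis R_rscale mult_zero_right rscale_zero(1))

lemma R_minus: "R c z (- x) = - R c z x"
  by (metis R_0 R_add add_eq_0_iff)

lemma R_diff: "R c z (x - y) = R c z x - R c z y"
  using R_add[of c z x "- y"] by (simp add: R_minus)

lemma R_scaleR: "R c z (r *\<^sub>R x) = r *\<^sub>R R c z x"
  using R_rscale[of c z x "of_real r"] unfolding rscale_of_real by (simp add: of_real_def)

lemma R_basis: "R c z x = R c z (1, 0) * fst x + R c z (0, 1) * snd x"
  using arg_cong[OF H2_basis[of x], of "R c z"] by (simp only: R_add R_rscale)

definition DR :: "chart \<Rightarrow> complex \<Rightarrow> complex \<Rightarrow> H2 \<Rightarrow> quat"
  where "DR c z v x = frechet_derivative (\<lambda>u. R c u x) (at z) v"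

lemma R_has_derivative: "((\<lambda>u. R c u x) has_derivative (\<lambda>v. DR c z v x)) (at z)"
  unfolding DR_def using smooth_on_has_derivative[OF open_UNIV R_smooth] by simp

lemma DR_hol: "DR c z v x + qc \<i> * DR c z (\<i> * v) x = - (2 *\<^sub>R (quat_k * qc (h c z * v) * R c z x))"
  by (rule hol_atD[OF R_hol R_has_derivative])

lemma DR_linear: "linear (\<lambda>v. DR c z v x)"
  using R_has_derivative has_derivative_linear by blast

text \<open>On a vector of the fibre of \<open>E\<close> the Hopf term of \<open>DR_hol\<close>
  vanishes, so the derivative of the row is complex linear. This is the conformality of
  \<open>E\<close> seen in the frame: minus this derivative represents \<delta>.\<close>

lemma DR_kernel:
  assumes "R c z x = 0"
  shows "DR c z (\<i> * v) x = qc \<i> * DR c z v x" "DR c z v x = qc v * DR c z 1 x"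
proof -
  have *: "DR c z (\<i> * v) x = qc \<i> * DR c z v x" for v
  proof -
    have "DR c z v x + qc \<i> * DR c z (\<i> * v) x = 0"
      using DR_hol[of c z v x] assms by simp
    then have "qc \<i> * (DR c z v x + qc \<i> * DR c z (\<i> * v) x) = 0"
      by simp
    then show ?thesis
      by (simp add: distrib_left qc_i_qc_i)
  qed
  then show "DR c z (\<i> * v) x = qc \<i> * DR c z v x" .
  show "DR c z v x = qc v * DR c z 1 x"
    by (rule linear_complex_left[OF DR_linear]) (use *[of 1] in simp)
qed

lemma DR_kernel_nonzero: "R c z x = 0 \<Longrightarrow> x \<noteq> 0 \<Longrightarrow> DR c z 1 x \<noteq> 0"
  using R_immersed by (simp add: DR_def)

lemma DR_basis: "DR c z v x = DR c z v (1, 0) * fst x + DR c z v (0, 1) * snd x"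
proof -
  have "((\<lambda>u. R c u (1, 0) * fst x + R c u (0, 1) * snd x) has_derivative
      (\<lambda>v. DR c z v (1, 0) * fst x + DR c z v (0, 1) * snd x)) (at z)"
    by (intro has_derivative_add has_derivative_mult_left R_has_derivative)
  then have "((\<lambda>u. R c u x) has_derivative
      (\<lambda>v. DR c z v (1, 0) * fst x + DR c z v (0, 1) * snd x)) (at z)"
    by (simp only: R_basis[of c _ x, symmetric])
  then show ?thesis
    using has_derivative_unique[OF R_has_derivative] by metis
qed

lemma R_section_has_derivative:
  assumes "(\<psi> has_derivative \<psi>') (at z)"
  shows "((\<lambda>u. R c u (\<psi> u)) has_derivative (\<lambda>v. DR c z v (\<psi> z) + R c z (\<psi>' v))) (at z)"
proof -
  have "((\<lambda>u. R c u (1, 0) * fst (\<psi> u) + R c u (0, 1) * snd (\<psi> u)) has_derivative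
      (\<lambda>v. (R c z (1, 0) * fst (\<psi>' v) + DR c z v (1, 0) * fst (\<psi> z))
         + (R c z (0, 1) * snd (\<psi>' v) + DR c z v (0, 1) * snd (\<psi> z)))) (at z)"
    by (intro has_derivative_add has_derivative_mult R_has_derivative has_derivative_fst
        has_derivative_snd assms)
  moreover have "(\<lambda>u. R c u (1, 0) * fst (\<psi> u) + R c u (0, 1) * snd (\<psi> u)) = (\<lambda>u. R c u (\<psi> u))"
    by (intro ext) (rule R_basis[symmetric])
  moreover have "(R c z (1, 0) * fst (\<psi>' v) + DR c z v (1, 0) * fst (\<psi> z))
         + (R c z (0, 1) * snd (\<psi>' v) + DR c z v (0, 1) * snd (\<psi> z)) = DR c z v (\<psi> z) + R c z (\<psi>' v)" for v
    using R_basis[of c z "\<psi>' v"] DR_basis[of c z v "\<psi> z"] by simp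
  ultimately show ?thesis by simp
qed

lemma R_section_smooth:
  assumes "open S" "smooth_on S \<psi>"
  shows "smooth_on S (\<lambda>u. R c u (\<psi> u))"
proof (rule smooth_on_cong[OF assms(1)])
  show "smooth_on S (\<lambda>u. R c u (1, 0) * fst (\<psi> u) + R c u (0, 1) * snd (\<psi> u))"
    by (intro smooth_on_intros assms smooth_on_subset[OF R_smooth]) auto
  show "R c z (1, 0) * fst (\<psi> z) + R c z (0, 1) * snd (\<psi> z) = R c z (\<psi> z)" for z
    by (rule R_basis[symmetric])
qed

definition R_adj :: "chart \<Rightarrow> complex \<Rightarrow> H2"
  where "R_adj c z = (qcnj (R c z (1, 0)), qcnj (R c z (0, 1)))"

definition R_norm :: "chart \<Rightarrow> complex \<Rightarrow> real"
  where "R_norm c z = (norm (R c z (1, 0)))\<^sup>2 + (norm (R c z (0, 1)))\<^sup>2"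

text \<open>A right inverse of the row \<open>R c z\<close>, namely its adjoint divided by its
  squared norm; it supplies smooth representatives of classes with prescribed coordinate.\<close>

definition lift :: "chart \<Rightarrow> complex \<Rightarrow> quat \<Rightarrow> H2"
  where "lift c z l = inverse (R_norm c z) *\<^sub>R (R_adj c z \<odot> l)"

lemma R_norm_pos: "R_norm c z > 0"
proof -
  obtain x where "R c z x \<noteq> 0" using R_nonzero by blast
  then have "R c z (1, 0) \<noteq> 0 \<or> R c z (0, 1) \<noteq> 0"
    using R_basis[of c z x] by auto
  then show ?thesis
    unfolding R_norm_def by (auto simp: add_pos_nonneg add_nonneg_pos)
qed

lemma R_lift [simp]: "R c z (lift c z l) = l"
proof -
  have "R c z (R_adj c z) = of_real (R_norm c z)"
    using R_basis[of c z "R_adj c z"] by (simp add: R_adj_def mult_qcnj R_norm_def)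
  then show ?thesis
    using R_norm_pos[of c z] by (simp add: lift_def R_scaleR R_rscale of_real_def)
qed

lemma lift_smooth:
  assumes "open S" "smooth_on S l"
  shows "smooth_on S (\<lambda>u. lift c u (l u))"
proof -
  have "smooth_on S (\<lambda>z. R c z x)" for x
    by (rule smooth_on_subset[OF R_smooth]) (use assms in auto)
  moreover have "(norm (R c z (1, 0)))\<^sup>2 + (norm (R c z (0, 1)))\<^sup>2 \<noteq> 0" for z
    using R_norm_pos[of c z] unfolding R_norm_def by (metis less_irrefl)
  ultimately show ?thesis
    unfolding lift_def R_adj_def R_norm_def
    by (intro smooth_on_intros smooth_on_inverse assms)
qed

text \<open>The transition factor \<open>a\<close> multiplies the row from the left, so its
  conjugate stands at the right end of the adjoint and meets \<open>a\<close> in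
  \<open>qcnj a * a\<close>, the factor by which \<open>R_norm\<close> changes.\<close>

lemma lift_transition:
  assumes "z \<noteq> 0"
  shows "lift Wchart (1 / z) (qc (1 / (\<i> * z)) * l) = lift Zchart z l"
proof -
  define a where "a = qc (1 / (\<i> * z))"
  have a: "norm a \<noteq> 0" using assms by (simp add: a_def)
  have R: "R Wchart (1 / z) x = a * R Zchart z x" for x
    unfolding a_def by (rule R_transition[OF assms])
  have "R_norm Wchart (1 / z) = (norm a)\<^sup>2 * R_norm Zchart z"
    by (simp add: R_norm_def R norm_mult power_mult_distrib algebra_simps)
  moreover have "R_adj Wchart (1 / z) \<odot> (a * l) = (norm a)\<^sup>2 *\<^sub>R (R_adj Zchart z \<odot> l)"
  proof -
    have *: "qcnj (a * x) * (a * l) = (norm a)\<^sup>2 *\<^sub>R (qcnj x * l)" for x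
    proof -
      have "qcnj (a * x) * (a * l) = qcnj x * (qcnj a * a) * l"
        by (simp add: qcnj_mult mult.assoc)
      also have "\<dots> = (norm a)\<^sup>2 *\<^sub>R (qcnj x * l)"
        unfolding qcnj_times by (simp add: of_real_def)
      finally show ?thesis .
    qed
    then show ?thesis
      by (simp add: R_adj_def rscale_def R)
  qed
  ultimately show ?thesis
    using a by (simp add: lift_def a_def[symmetric] field_simps)
qed

lemma E_closed: "x \<in> E p \<Longrightarrow> y \<in> E p \<Longrightarrow> x + y \<in> E p" "x \<in> E p \<Longrightarrow> y \<in> E p \<Longrightarrow> x - y \<in> E p"
  "x \<in> E p \<Longrightarrow> x \<odot> l \<in> E p" "0 \<in> E p"
  by (cases rule: par_surj[of p]; simp add: mem_E_iff R_add R_diff R_rscale)+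

definition acts_as_i :: "(cp1 \<Rightarrow> H2 \<Rightarrow> H2) \<Rightarrow> bool"
  where "acts_as_i J \<longleftrightarrow> (\<forall>c z x. R c z (J (par c z) x) = qc \<i> * R c z x)"

lemma acts_as_iD: "acts_as_i J \<Longrightarrow> R c z (J (par c z) x) = qc \<i> * R c z x"
  unfolding acts_as_i_def by blast

text \<open>Differentiating R \<psi> = 0 for a section \<psi> of \<open>E\<close> gives R (d\<psi>)
  = - (dR) \<psi>, and on the fibre of \<open>E\<close> the derivative of the row is complex linear
  by \<open>DR_kernel\<close>.\<close>

lemma acts_as_i_star_delta:
  assumes "acts_as_i J"
  shows "star_delta_quot E J"
  unfolding star_delta_quot_def local_section_def
proof (intro allI impI ballI, elim conjE)
  fix c U \<psi> z v
  assume U: "open U" "smooth_on U \<psi>" "\<forall>u\<in>U. \<psi> u \<in> E (par c u)" "z \<in> U"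
  define \<psi>' where "\<psi>' = frechet_derivative \<psi> (at z)"
  have "((\<lambda>u. R c u (\<psi> u)) has_derivative (\<lambda>v. DR c z v (\<psi> z) + R c z (\<psi>' v))) (at z)"
    unfolding \<psi>'_def by (intro R_section_has_derivative smooth_on_has_derivative[OF U(1,2,4)])
  moreover have "((\<lambda>u. R c u (\<psi> u)) has_derivative (\<lambda>_. 0)) (at z)"
    by (rule has_derivative_transform_within_open[where f = "\<lambda>_. 0", OF _ U(1,4)])
       (use U(3) in \<open>auto simp: mem_E_iff\<close>)
  ultimately have *: "R c z (\<psi>' v) = - DR c z v (\<psi> z)" for v
    using has_derivative_unique[of "\<lambda>u. R c u (\<psi> u)"] by (metis add_eq_0_iff)
  have "R c z (\<psi> z) = 0" using U by (auto simp: mem_E_iff)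
  then show "frechet_derivative \<psi> (at z) (\<i> * v) - J (par c z) (frechet_derivative \<psi> (at z) v) \<in> E (par c z)"
    unfolding \<psi>'_def[symmetric]
    by (simp add: mem_E_iff R_diff acts_as_iD[OF assms] * DR_kernel(1))
qed

text \<open>As \<delta> is nowhere zero, the derivative of a single section of \<open>E\<close>
  spans \<open>V/E\<close> at the point, and star \<delta> = J \<delta> prescribes J on it. Hence J
  is unique modulo \<open>E\<close>.\<close>

lemma star_delta_acts_as_i:
  assumes J: "complex_structure_quot E J" and star: "star_delta_quot E J"
  shows "acts_as_i J"
  unfolding acts_as_i_def
proof (intro allI)
  fix c z x
  have lin: "rlinear (J (par c z))" and JE: "\<And>x. x \<in> E (par c z) \<Longrightarrow> J (par c z) x \<in> E (par c z)"
    using J by (auto simp: complex_structure_quot_def smooth_End_def)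
  obtain e where e: "e \<noteq> 0" "R c z e = 0"
  proof (cases "R c z (1, 0) = 0")
    case True
    then show ?thesis using that[of "(1, 0)"] by (simp add: zero_prod_def)
  next
    case False
    have "R c z ((1, 0) \<odot> (- inverse (R c z (1, 0)) * R c z (0, 1)) + (0, 1)) = 0"
      using False by (simp add: R_add R_rscale flip: mult.assoc)
    then show ?thesis
      by (rule that[rotated]) (simp add: prod_eq_iff)
  qed
  \<comment> \<open>A section of \<open>E\<close> through the vector \<open>e\<close> of the fibre:
    the constant \<open>e\<close> minus a lift of its class, which is zero at
    \<open>z\<close>.\<close>
  define \<psi> where "\<psi> u = e - lift c u (R c u e)" for u
  have \<psi>: "local_section E c UNIV \<psi>"
    unfolding local_section_def \<psi>_def
    by (auto simp: mem_E_iff R_diff intro!: smooth_on_diff smooth_on_const lift_smooth R_smooth)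
  have \<psi>z: "\<psi> z = e" by (simp add: \<psi>_def e lift_def)
  define \<psi>' where "\<psi>' = frechet_derivative \<psi> (at z)"
  have "((\<lambda>u. R c u (\<psi> u)) has_derivative (\<lambda>v. DR c z v (\<psi> z) + R c z (\<psi>' v))) (at z)"
    unfolding \<psi>'_def using \<psi>
    by (intro R_section_has_derivative smooth_on_has_derivative[of UNIV]) (auto simp: local_section_def)
  moreover have "((\<lambda>u. R c u (\<psi> u)) has_derivative (\<lambda>_. 0)) (at z)"
    using \<psi> by (simp add: local_section_def mem_E_iff)
  ultimately have *: "R c z (\<psi>' v) = - DR c z v e" for v
    using has_derivative_unique[of "\<lambda>u. R c u (\<psi> u)"] \<psi>z by (metis add_eq_0_iff)
  define m where "m = R c z (\<psi>' 1)"
  have m: "m \<noteq> 0"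
    using DR_kernel_nonzero[OF e(2,1)] by (simp add: m_def *)
  have "R c z (\<psi>' (\<i> * 1) - J (par c z) (\<psi>' 1)) = 0"
    using star \<psi> unfolding star_delta_quot_def \<psi>'_def mem_E_iff[symmetric] by blast
  then have Jm: "R c z (J (par c z) (\<psi>' 1)) = qc \<i> * m"
    using DR_kernel(1)[OF e(2), of 1] by (simp add: R_diff * m_def)
  have "x - \<psi>' 1 \<odot> (inverse m * R c z x) \<in> E (par c z)"
    using m by (simp add: mem_E_iff R_diff R_rscale m_def flip: mult.assoc)
  from JE[OF this] have "R c z (J (par c z) x - J (par c z) (\<psi>' 1) \<odot> (inverse m * R c z x)) = 0"
    by (simp add: mem_E_iff rlinear_diff[OF lin] rlinear_rscale[OF lin])
  then show "R c z (J (par c z) x) = qc \<i> * R c z x"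
    using m by (simp add: R_diff R_rscale Jm mult.assoc) (simp flip: mult.assoc)
qed

definition J_frame :: "cp1 \<Rightarrow> H2 \<Rightarrow> H2"
  where "J_frame p x = glue (\<lambda>c z. lift c z (qc \<i> * R c z x)) p"

lemma J_frame_par: "J_frame (par c z) x = lift c z (qc \<i> * R c z x)"
  unfolding J_frame_def
proof (rule glue_par)
  fix z :: complex
  assume "z \<noteq> 0"
  have "qc \<i> * qc (1 / (\<i> * z)) = qc (1 / (\<i> * z)) * qc \<i>"
    unfolding qc_mult[symmetric] by (subst mult.commute) (rule refl)
  then have "qc \<i> * R Wchart (1 / z) x = qc (1 / (\<i> * z)) * (qc \<i> * R Zchart z x)"
    unfolding R_transition[OF \<open>z \<noteq> 0\<close>] by (simp only: mult.assoc[symmetric])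
  then show "lift Wchart (1 / z) (qc \<i> * R Wchart (1 / z) x) = lift Zchart z (qc \<i> * R Zchart z x)"
    using lift_transition[OF \<open>z \<noteq> 0\<close>] by simp
qed

lemma acts_as_i_J_frame: "acts_as_i J_frame"
  by (simp add: acts_as_i_def J_frame_par)

lemma lift_add: "lift c z (l + m) = lift c z l + lift c z m"
  and lift_mult: "lift c z (l * m) = lift c z l \<odot> m"
  by (simp_all add: lift_def rscale_add_right scaleR_add_right prod_eq_iff mult.assoc)

lemma complex_structure_J_frame: "complex_structure_quot E J_frame"
proof -
  have "rlinear (J_frame p)" for p
    by (cases rule: par_surj[of p])
       (simp add: rlinear_def J_frame_par R_add R_rscale lift_add lift_mult distrib_left flip: mult.assoc)
  moreover have "smooth_cp1 (\<lambda>p. J_frame p x)" for x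
    unfolding smooth_cp1_def o_def J_frame_par
    by (intro allI lift_smooth smooth_on_mult smooth_on_const R_smooth) auto
  moreover have "J_frame p x \<in> E p" if "x \<in> E p" for p x
    using that by (cases rule: par_surj[of p]) (simp add: mem_E_iff J_frame_par)
  moreover have "J_frame p (J_frame p x) + x \<in> E p" for p x
    by (cases rule: par_surj[of p]) (simp add: mem_E_iff J_frame_par R_add qc_i_qc_i)
  ultimately show ?thesis
    by (simp add: complex_structure_quot_def smooth_End_def)
qed

end

section \<open>Conformality, the canonical holomorphic structure and its Hopf field\<close>

context spinor_frame
begin

lemma scaled_left_mult_derivative:
  assumes "linear f'" "a \<noteq> 0" "\<And>v. a * f' (\<i> * v) = qc \<i> * (a * f' v)" "f' 1 \<noteq> 0"
  shows "\<exists>s > 0. \<forall>v. norm (f' v) = s * norm v"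
proof -
  have "linear (\<lambda>v. a * f' v)"
    by (rule linear_compose[OF assms(1), unfolded o_def])
       (auto intro!: linearI simp: algebra_simps)
  then have *: "a * f' v = qc v * (a * f' 1)" for v
    by (rule linear_complex_left) (use assms(3)[of 1] in simp)
  have "norm (f' v) = norm (f' 1) * norm v" for v
    using arg_cong[OF *[of v], of norm] assms(2) by (simp add: norm_mult)
  moreover have "norm (f' 1) > 0"
    using assms(4) by simp
  ultimately show ?thesis by blast
qed

lemma conformal_derivative:
  assumes \<psi>: "(\<psi> has_derivative \<psi>') (at z)" and mem: "\<forall>\<^sub>F u in nhds z. R c u (\<psi> u) = 0"
  shows "R c z (\<psi>' (\<i> * v)) = qc \<i> * R c z (\<psi>' v)"
proof -
  have "((\<lambda>u. R c u (\<psi> u)) has_derivative (\<lambda>v. DR c z v (\<psi> z) + R c z (\<psi>' v))) (at z)"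
    by (rule R_section_has_derivative[OF \<psi>])
  moreover have "((\<lambda>u. R c u (\<psi> u)) has_derivative (\<lambda>_. 0)) (at z)"
  proof -
    obtain S where S: "open S" "z \<in> S" "\<forall>u\<in>S. R c u (\<psi> u) = 0"
      using mem by (auto simp: eventually_nhds)
    show ?thesis
      by (rule has_derivative_transform_within_open[where f = "\<lambda>_. 0", OF _ S(1,2)]) (use S in auto)
  qed
  ultimately have *: "R c z (\<psi>' v) = - DR c z v (\<psi> z)" for v
    using has_derivative_unique[of "\<lambda>u. R c u (\<psi> u)"] by (metis add_eq_0_iff)
  have "R c z (\<psi> z) = 0" using mem by (rule eventually_nhds_x_imp_x)
  then show ?thesis by (simp add: * DR_kernel(1))
qed

lemma hline_E: "E (par c u) = hline x \<Longrightarrow> R c u x = 0"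
  by (metis hline_def mem_E_iff rangeI rscale_one)

text \<open>In an affine chart the derivative of a section of \<open>E\<close> has only the entry
  \<open>f' v\<close>, and the corresponding entry of the row turns \<open>f'\<close> into a complex
  linear map by \<open>conformal_derivative\<close>. Multiplication by a quaternion scales all norms
  equally, so \<open>f'\<close> is conformal; injectivity makes the scale positive.\<close>

lemma conformal_immersionI:
  assumes "immersion E"
  shows "conformal_immersion E"
  unfolding conformal_immersion_def
proof (intro conjI allI)
  show "line_subbundle E" using assms by (simp add: immersion_def)
  fix c z
  obtain f f' where f: "affine_rep E c z f" "(f has_derivative f') (at z)" "inj f'"
    using assms unfolding immersion_def by blast
  have lin: "linear f'" using f(2) has_derivative_linear by blast
  have "f' 1 \<noteq> 0" using f(3) linear_0[OF lin] by (metis injD one_neq_zero)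
  from f(1) consider (1) "\<forall>\<^sub>F u in nhds z. E (par c u) = hline (f u, 1)"
    | (2) "\<forall>\<^sub>F u in nhds z. E (par c u) = hline (1, f u)"
    unfolding affine_rep_def by blast
  then have "\<exists>s > 0. \<forall>v. norm (f' v) = s * norm v"
  proof cases
    case 1
    define \<psi> where "\<psi> u = (f u, 1 :: quat)" for u
    have "(\<psi> has_derivative (\<lambda>v. (f' v, 0))) (at z)"
      unfolding \<psi>_def by (intro has_derivative_Pair f(2)) simp
    moreover have ev: "\<forall>\<^sub>F u in nhds z. R c u (\<psi> u) = 0"
      using 1 by eventually_elim (auto simp: \<psi>_def intro: hline_E)
    ultimately have "R c z (f' (\<i> * v), 0) = qc \<i> * R c z (f' v, 0)" for v
      by (rule conformal_derivative)
    moreover have "R c z (f' v, 0) = R c z (1, 0) * f' v" for v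
      using R_rscale[of c z "(1, 0)" "f' v"] by (simp add: rscale_def)
    \<comment> \<open>Otherwise the vector \<open>(f z, 1)\<close> of the kernel would force the
      other entry of the row to vanish as well.\<close>
    moreover have "R c z (1, 0) \<noteq> 0"
    proof
      assume *: "R c z (1, 0) = 0"
      have "R c z (\<psi> z) = 0" using ev by (rule eventually_nhds_x_imp_x)
      then have "R c z (0, 1) = 0"
        using R_basis[of c z "\<psi> z"] * by (simp add: \<psi>_def)
      then show False
        using * R_norm_pos[of c z] by (simp add: R_norm_def)
    qed
    ultimately show ?thesis
      using scaled_left_mult_derivative[OF lin _ _ \<open>f' 1 \<noteq> 0\<close>, of "R c z (1, 0)"] by simp
  next
    case 2
    define \<psi> where "\<psi> u = (1 :: quat, f u)" for u
    have "(\<psi> has_derivative (\<lambda>v. (0, f' v))) (at z)"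
      unfolding \<psi>_def by (intro has_derivative_Pair f(2)) simp
    moreover have ev: "\<forall>\<^sub>F u in nhds z. R c u (\<psi> u) = 0"
      using 2 by eventually_elim (auto simp: \<psi>_def intro: hline_E)
    ultimately have "R c z (0, f' (\<i> * v)) = qc \<i> * R c z (0, f' v)" for v
      by (rule conformal_derivative)
    moreover have "R c z (0, f' v) = R c z (0, 1) * f' v" for v
      using R_rscale[of c z "(0, 1)" "f' v"] by (simp add: rscale_def)
    moreover have "R c z (0, 1) \<noteq> 0"
    proof
      assume *: "R c z (0, 1) = 0"
      have "R c z (\<psi> z) = 0" using ev by (rule eventually_nhds_x_imp_x)
      then have "R c z (1, 0) = 0"
        using R_basis[of c z "\<psi> z"] * by (simp add: \<psi>_def)
      then show False
        using * R_norm_pos[of c z] by (simp add: R_norm_def)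
    qed
    ultimately show ?thesis
      using scaled_left_mult_derivative[OF lin _ _ \<open>f' 1 \<noteq> 0\<close>, of "R c z (0, 1)"] by simp
  qed
  with f(1,2) show "\<exists>f f' s. affine_rep E c z f \<and> (f has_derivative f') (at z) \<and> s > 0 \<and>
      (\<forall>v. norm (f' v) = s * norm v)"
    by blast
qed

text \<open>The (0,1)-part of the trivial connection with respect to \<open>J_frame\<close>;
  constants are parallel, hence holomorphic.\<close>

definition D_frame :: "(cp1 \<Rightarrow> H2) \<Rightarrow> H2_form"
  where "D_frame \<psi> c z v = (1/2) *\<^sub>R (diff_at \<psi> c z v + J_frame (par c z) (diff_at \<psi> c z (\<i> * v)))"

text \<open>A holomorphic structure matters only modulo \<open>E\<close>, so \<open>D\<close> is
  constrained through \<open>R\<close> alone. Both \<open>D_frame\<close> and every structure with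
  holomorphic constants satisfy this.\<close>

definition is_dbar :: "((cp1 \<Rightarrow> H2) \<Rightarrow> H2_form) \<Rightarrow> bool"
  where "is_dbar D \<longleftrightarrow> (\<forall>\<psi> c z v. smooth_cp1 \<psi> \<longrightarrow>
    R c z (D \<psi> c z v) = (1/2) *\<^sub>R (R c z (diff_at \<psi> c z v) + qc \<i> * R c z (diff_at \<psi> c z (\<i> * v))))"

lemma is_dbarD: "is_dbar D \<Longrightarrow> smooth_cp1 \<psi> \<Longrightarrow>
    R c z (D \<psi> c z v) = (1/2) *\<^sub>R (R c z (diff_at \<psi> c z v) + qc \<i> * R c z (diff_at \<psi> c z (\<i> * v)))"
  unfolding is_dbar_def by blast

lemma is_dbar_D_frame: "is_dbar D_frame"
  unfolding is_dbar_def D_frame_def by (simp add: R_scaleR R_add acts_as_iD[OF acts_as_i_J_frame])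

lemma smooth_cp1_const: "smooth_cp1 (\<lambda>_. x)"
  by (simp add: smooth_cp1_def o_def smooth_on_const)

lemma smooth_cp1_rscale: "smooth_cp1 \<psi> \<Longrightarrow> smooth_cp1 g \<Longrightarrow> smooth_cp1 (\<lambda>p. \<psi> p \<odot> g p)"
  by (simp add: smooth_cp1_def o_def smooth_on_rscale)

lemma smooth_cp1_add: "smooth_cp1 \<psi> \<Longrightarrow> smooth_cp1 g \<Longrightarrow> smooth_cp1 (\<lambda>p. \<psi> p + g p)"
  by (simp add: smooth_cp1_def o_def smooth_on_add)

lemma diff_at_rscale:
  "smooth_cp1 \<psi> \<Longrightarrow> smooth_cp1 g \<Longrightarrow>
    diff_at (\<lambda>p. \<psi> p \<odot> g p) c z v = \<psi> (par c z) \<odot> diff_at g c z v + diff_at \<psi> c z v \<odot> g (par c z)"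
  by (subst diff_at_eqI[OF bounded_bilinear.FDERIV[OF bounded_bilinear_rscale]])
     (auto intro: smooth_cp1_has_derivative)

lemma diff_at_add:
  "smooth_cp1 \<psi> \<Longrightarrow> smooth_cp1 g \<Longrightarrow> diff_at (\<lambda>p. \<psi> p + g p) c z v = diff_at \<psi> c z v + diff_at g c z v"
  by (subst diff_at_eqI[OF has_derivative_add]) (auto intro: smooth_cp1_has_derivative)

lemma diff_at_const: "diff_at (\<lambda>_. x) c z v = 0"
  by (subst diff_at_eqI[OF has_derivative_const]) simp

lemma R_diff_at:
  assumes "smooth_cp1 \<psi>" "\<And>u. R c u (\<psi> (par c u)) = f u" "(f has_derivative f') (at z)"
  shows "R c z (diff_at \<psi> c z v) = f' v - DR c z v (\<psi> (par c z))"
proof -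
  have "((\<lambda>u. R c u (\<psi> (par c u))) has_derivative
      (\<lambda>v. DR c z v (\<psi> (par c z)) + R c z (diff_at \<psi> c z v))) (at z)"
    by (intro R_section_has_derivative smooth_cp1_has_derivative assms)
  then have "(f has_derivative (\<lambda>v. DR c z v (\<psi> (par c z)) + R c z (diff_at \<psi> c z v))) (at z)"
    by (simp add: assms(2))
  from has_derivative_unique[OF this assms(3)] show ?thesis
    by (auto simp: fun_eq_iff algebra_simps)
qed

text \<open>The coordinate of \<psi> varies with \<psi> and with the frame. By \<open>DR_hol\<close>
  the frame contributes the term with \<open>h\<close>, which anticommutes with J: this is the Hopf
  field in the coordinate.\<close>

lemma dbar_section:
  assumes "is_dbar D" "smooth_cp1 \<psi>" "\<And>u. R c u (\<psi> (par c u)) = f u" "(f has_derivative f') (at z)"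
  shows "R c z (D \<psi> c z v) = (1/2) *\<^sub>R (f' v + qc \<i> * f' (\<i> * v)) + quat_k * qc (h c z * v) * f z"
proof -
  have "R c z (D \<psi> c z v) = (1/2) *\<^sub>R ((f' v + qc \<i> * f' (\<i> * v))
      - (DR c z v (\<psi> (par c z)) + qc \<i> * DR c z (\<i> * v) (\<psi> (par c z))))"
    unfolding is_dbarD[OF assms(1,2)] R_diff_at[OF assms(2-4)] by (simp add: algebra_simps)
  then show ?thesis
    unfolding DR_hol assms(3) by (simp add: scaleR_add_right)
qed

lemma dbar_eq_0:
  assumes "is_dbar D" "smooth_cp1 \<psi>" "\<And>c u. R c u (\<psi> (par c u)) = f c u"
    "\<And>c z. hol_at (h c z) (f c) z"
  shows "\<psi> \<in> hol_sections E D"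
proof -
  have "R c z (D \<psi> c z v) = 0" for c z v
  proof -
    obtain f' where f': "(f c has_derivative f') (at z)"
      "\<And>v. f' v + qc \<i> * f' (\<i> * v) = - (2 *\<^sub>R (quat_k * qc (h c z * v) * f c z))"
      using assms(4) unfolding hol_at_def by blast
    show ?thesis
      unfolding dbar_section[OF assms(1-3) f'(1)] f'(2) by simp
  qed
  then show ?thesis
    using assms(2) by (simp add: hol_sections_def mem_E_iff)
qed

lemma const_hol_sections: "is_dbar D \<Longrightarrow> (\<lambda>_. x) \<in> hol_sections E D"
  by (rule dbar_eq_0[where f = "\<lambda>c u. R c u x"]) (auto intro: smooth_cp1_const R_hol)

text \<open>Every section is a combination of two constant ones with functions as coefficients. D
  vanishes on the constants, so the Leibniz rule leaves only the (0,1)-parts of the differentials of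
  the coefficients.\<close>

lemma hol_structure_is_dbar:
  assumes D: "hol_structure E J D" and J: "acts_as_i J"
    and const: "\<And>x. (\<lambda>_. x) \<in> hol_sections E D"
  shows "is_dbar D"
  unfolding is_dbar_def
proof (intro allI impI)
  fix \<psi> c z v
  assume \<psi>: "smooth_cp1 (\<psi> :: cp1 \<Rightarrow> H2)"
  define \<psi>1 \<psi>2 where "\<psi>1 = (\<lambda>p. fst (\<psi> p))" and "\<psi>2 = (\<lambda>p. snd (\<psi> p))"
  have s: "smooth_cp1 \<psi>1" "smooth_cp1 \<psi>2"
    using \<psi> by (auto simp: smooth_cp1_def \<psi>1_def \<psi>2_def o_def intro!: smooth_on_fst smooth_on_snd)
  have add: "\<And>\<psi> \<phi> c z v. smooth_cp1 \<psi> \<Longrightarrow> smooth_cp1 \<phi> \<Longrightarrow>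
      D (\<lambda>p. \<psi> p + \<phi> p) c z v - (D \<psi> c z v + D \<phi> c z v) \<in> E (par c z)"
    and leibniz: "\<And>\<psi> h c z v. smooth_cp1 \<psi> \<Longrightarrow> smooth_cp1 h \<Longrightarrow>
          D (\<lambda>p. \<psi> p \<odot> h p) c z v -
            (D \<psi> c z v \<odot> h (par c z) +
             (1/2) *\<^sub>R (\<psi> (par c z) \<odot> diff_at h c z v +
                     J (par c z) (\<psi> (par c z) \<odot> diff_at h c z (\<i> * v))))
          \<in> E (par c z)"
    using D unfolding hol_structure_def by blast+
  have D0: "R c z (D (\<lambda>_. x) c z v) = 0" for x
    using const[of x] by (simp add: hol_sections_def mem_E_iff)
  have e: "R c z (D (\<lambda>p. x \<odot> g p) c z v) =
      (1/2) *\<^sub>R (R c z (x \<odot> diff_at g c z v) + qc \<i> * R c z (x \<odot> diff_at g c z (\<i> * v)))"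
    if "smooth_cp1 g" for x g
    using leibniz[OF smooth_cp1_const that, of x c z v]
    by (simp add: mem_E_iff R_diff R_add R_scaleR R_rscale[of _ _ _ "g _"] acts_as_iD[OF J] D0)
  have \<psi>_eq: "\<psi> = (\<lambda>p. (1, 0) \<odot> \<psi>1 p + (0, 1) \<odot> \<psi>2 p)"
    by (simp add: fun_eq_iff prod_eq_iff \<psi>1_def \<psi>2_def)
  have "R c z (D \<psi> c z v) = R c z (D (\<lambda>p. (1, 0) \<odot> \<psi>1 p) c z v) + R c z (D (\<lambda>p. (0, 1) \<odot> \<psi>2 p) c z v)"
    using add[of "\<lambda>p. (1, 0) \<odot> \<psi>1 p" "\<lambda>p. (0, 1) \<odot> \<psi>2 p" c z v] s
    by (simp add: mem_E_iff R_diff R_add smooth_cp1_rscale smooth_cp1_const flip: \<psi>_eq)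
  moreover have "diff_at \<psi> c z v = (1, 0) \<odot> diff_at \<psi>1 c z v + (0, 1) \<odot> diff_at \<psi>2 c z v" for v
    by (subst \<psi>_eq, subst diff_at_add)
       (simp_all add: s smooth_cp1_rscale smooth_cp1_const diff_at_rscale diff_at_const)
  ultimately show "R c z (D \<psi> c z v) =
      (1/2) *\<^sub>R (R c z (diff_at \<psi> c z v) + qc \<i> * R c z (diff_at \<psi> c z (\<i> * v)))"
    by (simp add: e s R_add distrib_left scaleR_add_right)
qed

lemma smooth_form_D_frame:
  assumes \<psi>: "smooth_cp1 \<psi>"
  shows "smooth_form (D_frame \<psi>)"
  unfolding smooth_form_def
proof (intro conjI allI impI)
  fix c z
  have "rlinear (J_frame p)" for p
    using complex_structure_J_frame by (simp add: complex_structure_quot_def smooth_End_def)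
  note J = rlinear_add[OF this] rlinear_scaleR[OF this]
  note d = diff_at_linear[OF \<psi>, of c z]
  show "linear (D_frame \<psi> c z)"
    by (rule linearI)
       (simp_all add: D_frame_def linear_add[OF d] linear_scale[OF d] distrib_left J scaleR_add_right)
next
  fix c v
  have "smooth_on UNIV (\<lambda>z. lift c z (qc \<i> * R c z (diff_at \<psi> c z (\<i> * v))))"
    by (intro lift_smooth smooth_on_mult smooth_on_const R_section_smooth diff_at_smooth \<psi> open_UNIV)
  then show "smooth_on UNIV (\<lambda>z. D_frame \<psi> c z v)"
    unfolding D_frame_def J_frame_par
    by (intro smooth_on_scaleR smooth_on_add smooth_on_const diff_at_smooth \<psi> open_UNIV)
next
  fix z v :: complex
  assume z: "z \<noteq> 0"
  have "diff_at \<psi> Wchart (1 / z) (\<i> * (- v / z\<^sup>2)) = diff_at \<psi> Zchart z (\<i> * v)"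
    using diff_at_transition[OF \<psi> z, of "\<i> * v"] by simp
  then show "D_frame \<psi> Wchart (1 / z) (- v / z\<^sup>2) = D_frame \<psi> Zchart z v"
    unfolding D_frame_def using diff_at_transition[OF \<psi> z, of v] z by simp
qed

lemma hol_structure_D_frame: "hol_structure E J_frame D_frame"
  unfolding hol_structure_def
proof (intro conjI allI impI; (elim conjE)?)
  show "smooth_form (D_frame \<psi>)" if "smooth_cp1 \<psi>" for \<psi>
    using that by (rule smooth_form_D_frame)
next
  fix \<psi> \<phi> :: "cp1 \<Rightarrow> H2" and c z v
  assume s: "smooth_cp1 \<psi>" "smooth_cp1 \<phi>" and eq: "\<forall>p. \<psi> p - \<phi> p \<in> E p"
  define f where "f = (\<lambda>u. R c u (\<psi> (par c u)))"
  have "smooth_on UNIV f"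
    unfolding f_def by (intro R_section_smooth open_UNIV) (use s(1) in \<open>simp add: smooth_cp1_def o_def\<close>)
  then obtain f' where f': "(f has_derivative f') (at z)"
    using smooth_on_has_derivative[OF open_UNIV] by blast
  have "R c u (\<phi> (par c u)) = f u" for u
    using eq[rule_format, of "par c u"] by (simp add: f_def mem_E_iff R_diff)
  then show "D_frame \<psi> c z v - D_frame \<phi> c z v \<in> E (par c z)"
    using dbar_section[OF is_dbar_D_frame s(1) _ f'] dbar_section[OF is_dbar_D_frame s(2) _ f']
    by (simp add: mem_E_iff R_diff f_def)
next
  fix \<psi> :: "cp1 \<Rightarrow> H2" and c z v
  assume s: "smooth_cp1 \<psi>"
  have "diff_at \<psi> c z (\<i> * (\<i> * v)) = - diff_at \<psi> c z v"
    using linear_neg[OF diff_at_linear[OF s]] by (simp flip: mult.assoc)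
  then show "D_frame \<psi> c z (\<i> * v) + J_frame (par c z) (D_frame \<psi> c z v) \<in> E (par c z)"
    by (simp add: mem_E_iff R_add acts_as_iD[OF acts_as_i_J_frame] is_dbarD[OF is_dbar_D_frame s]
        R_minus distrib_left qc_i_qc_i)
       (simp add: algebra_simps)
next
  fix \<psi> \<phi> :: "cp1 \<Rightarrow> H2" and c z v
  assume s: "smooth_cp1 \<psi>" "smooth_cp1 \<phi>"
  show "D_frame (\<lambda>p. \<psi> p + \<phi> p) c z v - (D_frame \<psi> c z v + D_frame \<phi> c z v) \<in> E (par c z)"
    using s by (simp add: mem_E_iff R_add R_diff is_dbarD[OF is_dbar_D_frame] smooth_cp1_add
        diff_at_add algebra_simps)
next
  fix \<psi> :: "cp1 \<Rightarrow> H2" and g and c z v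
  assume s: "smooth_cp1 \<psi>" "smooth_cp1 (g :: cp1 \<Rightarrow> quat)"
  show "D_frame (\<lambda>p. \<psi> p \<odot> g p) c z v - (D_frame \<psi> c z v \<odot> g (par c z) +
      (1 / 2) *\<^sub>R (\<psi> (par c z) \<odot> diff_at g c z v +
        J_frame (par c z) (\<psi> (par c z) \<odot> diff_at g c z (\<i> * v)))) \<in> E (par c z)"
    using s by (simp add: mem_E_iff R_add R_diff R_scaleR is_dbarD[OF is_dbar_D_frame] smooth_cp1_rscale
        diff_at_rscale R_rscale acts_as_iD[OF acts_as_i_J_frame] algebra_simps)
qed

text \<open>Constants are holomorphic, so only \<open>D\<close> of J x contributes. Its coordinate
  is \<i> R x, and since \<i> anticommutes with k the derivative of the frame and the Hopf term add
  up instead of cancelling.\<close>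

lemma R_hopf_field:
  assumes "is_dbar D" "acts_as_i J" "\<And>x. smooth_cp1 (\<lambda>p. J p x)"
  shows "R c z (hopf_field J D c z v x) = quat_k * qc (h c z * v) * R c z x"
proof -
  have "R c z (D (\<lambda>_. x) c z v) = 0"
    using const_hol_sections[OF assms(1), of x] by (simp add: hol_sections_def mem_E_iff)
  moreover have "R c z (D (\<lambda>p. J p x) c z v) = 2 *\<^sub>R (quat_k * qc (h c z * v) * (qc \<i> * R c z x))"
  proof -
    have 1: "((\<lambda>u. qc \<i> * R c u x) has_derivative (\<lambda>v. qc \<i> * DR c z v x)) (at z)"
      by (intro has_derivative_mult_right R_has_derivative)
    have "R c z (D (\<lambda>p. J p x) c z v) =
        (1/2) *\<^sub>R (qc \<i> * (DR c z v x + qc \<i> * DR c z (\<i> * v) x)) + quat_k * qc (h c z * v) * (qc \<i> * R c z x)"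
      using dbar_section[OF assms(1,3) acts_as_iD[OF assms(2)] 1] by (simp add: distrib_left)
    also have "qc \<i> * (DR c z v x + qc \<i> * DR c z (\<i> * v) x) =
        - (2 *\<^sub>R ((qc \<i> * quat_k) * qc (h c z * v) * R c z x))"
      unfolding DR_hol by (simp add: mult.assoc)
    also have "qc \<i> * quat_k = - (quat_k * qc \<i>)"
      by (simp add: quat_eq_iff)
    also have "- (2 *\<^sub>R (- (quat_k * qc \<i>) * qc (h c z * v) * R c z x)) =
        2 *\<^sub>R (quat_k * (qc \<i> * qc (h c z * v)) * R c z x)"
      by (simp add: mult.assoc)
    also have "qc \<i> * qc (h c z * v) = qc (h c z * v) * qc \<i>"
      by (simp only: qc_mult[symmetric] mult.commute)
    finally show ?thesis
      by (simp add: mult.assoc scaleR_2)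
  qed
  ultimately have "R c z (hopf_field J D c z v x) =
      qc \<i> * (quat_k * (qc (h c z * v) * (qc \<i> * R c z x)))"
    by (simp add: hopf_field_def R_scaleR R_add acts_as_iD[OF assms(2)] mult.assoc)
  also have "\<dots> = qc \<i> * quat_k * qc (h c z * v * \<i>) * R c z x"
    by (simp only: qc_mult mult.assoc)
  also have "\<dots> = quat_k * qc (h c z * v) * R c z x"
    by (rule arg_cong[of _ _ "\<lambda>a. a * R c z x"]) (simp add: quat_eq_iff)
  finally show ?thesis .
qed

text \<open>Another choice of the frame vector conjugates the coefficient \<open>b\<close>, and the
  real part is invariant under conjugation, so the description in \<open>quot_trace\<close> singles
  out one number. Left multiplication by \<open>b\<close> on a real space of dimension four has
  trace four times the real part of \<open>b\<close>.\<close>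

lemma quot_trace_eqI:
  assumes "\<And>x. R c z (A x) = b * R c z x"
  shows "quot_trace E (par c z) A = 4 * qre b"
proof -
  have trace: "(\<Sum>e\<in>Basis. inner (a * e) e) = 4 * qre a" for a :: quat
    by (simp add: Basis_quat_def inner_quat_def)
  have re: "qre (inverse y * b * y) = qre b" if "y \<noteq> 0" for y
  proof -
    have "qre (x * y) = qre (y * x)" for x y :: quat by simp
    then have "qre ((inverse y * b) * y) = qre (y * (inverse y * b))" .
    also have "y * (inverse y * b) = b" using that by (simp flip: mult.assoc)
    finally show ?thesis .
  qed
  obtain x0 where x0: "R c z x0 \<noteq> 0" using R_nonzero by blast
  show ?thesis
    unfolding quot_trace_def
  proof (rule the_equality)
    let ?b = "inverse (R c z x0) * b * R c z x0"
    have "A x0 - x0 \<odot> ?b \<in> E (par c z)"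
      using x0 by (simp add: mem_E_iff R_diff R_rscale assms mult.assoc) (simp flip: mult.assoc)
    then show "\<exists>x ba. x \<notin> E (par c z) \<and> A x - x \<odot> ba \<in> E (par c z) \<and> 4 * qre b = (\<Sum>e\<in>Basis. inner (ba * e) e)"
      using x0 re[OF x0] trace[of ?b] mem_E_iff by metis
  next
    fix t
    assume "\<exists>x ba. x \<notin> E (par c z) \<and> A x - x \<odot> ba \<in> E (par c z) \<and> t = (\<Sum>e\<in>Basis. inner (ba * e) e)"
    then obtain x a where x: "R c z x \<noteq> 0" "b * R c z x = R c z x * a" "t = 4 * qre a"
      unfolding trace by (auto simp: mem_E_iff R_diff R_rscale assms)
    have "a = inverse (R c z x) * b * R c z x"
      using x(1,2) by (simp add: mult.assoc) (simp flip: mult.assoc)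
    then show "t = 4 * qre b"
      unfolding x(3) by (simp only: re[OF x(1)])
  qed
qed

text \<open>Moving k past a complex number conjugates it, so the two compositions of Hopf fields are
  |h|^2 and - |h|^2. The integrand is thus the trace of the scalar 2 |h|^2, that is 8 |h|^2, and the
  factor 1/2 leaves 4.\<close>

lemma willmore_energy_eq:
  assumes "is_dbar D" "acts_as_i J" "\<And>x. smooth_cp1 (\<lambda>p. J p x)"
  shows "willmore_energy E J D = 4 * (\<integral>z. (norm (h Zchart z))\<^sup>2 \<partial>lborel)"
proof -
  have "quot_trace E (par Zchart z)
       (\<lambda>x. hopf_field J D Zchart z 1 (hopf_field J D Zchart z (\<i> * \<i>) x)
          - hopf_field J D Zchart z \<i> (hopf_field J D Zchart z (\<i> * 1) x)) =
      8 * (norm (h Zchart z))\<^sup>2" for z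
  proof (subst quot_trace_eqI[where b = "of_real (2 * (norm (h Zchart z))\<^sup>2)"])
    let ?b = "of_real (2 * (norm (h Zchart z))\<^sup>2) :: quat"
    fix x
    let ?h = "h Zchart z"
    have "quat_k * qc ?h * (quat_k * qc (?h * - 1)) - quat_k * qc (?h * \<i>) * (quat_k * qc (?h * \<i>)) = ?b"
      by (simp add: quat_eq_iff cmod_power2 of_real_def) (simp add: power2_eq_square)
    then have "(quat_k * qc ?h * (quat_k * qc (?h * - 1)) - quat_k * qc (?h * \<i>) * (quat_k * qc (?h * \<i>)))
        * R Zchart z x = ?b * R Zchart z x"
      by simp
    then show "R Zchart z (hopf_field J D Zchart z 1 (hopf_field J D Zchart z (\<i> * \<i>) x)
          - hopf_field J D Zchart z \<i> (hopf_field J D Zchart z (\<i> * 1) x)) = ?b * R Zchart z x"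
      by (simp add: R_diff R_hopf_field[OF assms] left_diff_distrib mult.assoc)
  qed (simp add: of_real_def)
  then show ?thesis
    by (simp add: willmore_energy_def)
qed

end

section \<open>Orders of vanishing\<close>

definition bigO_at :: "(complex \<Rightarrow> 'a::real_normed_vector) \<Rightarrow> complex \<Rightarrow> nat \<Rightarrow> bool"
  where "bigO_at f z k \<longleftrightarrow> (\<exists>C r. r > 0 \<and> (\<forall>u\<in>ball z r. norm (f u) \<le> C * norm (u - z) ^ k))"

text \<open>Vanishing to order \<open>k\<close> in a fibre coordinate. The power stands on the left
  because complex numbers act through J, that is, by left multiplication; the leading coefficient is
  an arbitrary nonzero quaternion.\<close>

definition leads :: "(complex \<Rightarrow> quat) \<Rightarrow> complex \<Rightarrow> nat \<Rightarrow> bool"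
  where "leads f z k \<longleftrightarrow> (\<exists>m. m \<noteq> 0 \<and> bigO_at (\<lambda>u. f u - qc ((u - z) ^ k) * m) z (Suc k))"

lemma bigO_atI:
  "r > 0 \<Longrightarrow> (\<And>u. u \<in> ball z r \<Longrightarrow> norm (f u) \<le> C * norm (u - z) ^ k) \<Longrightarrow> bigO_at f z k"
  unfolding bigO_at_def by blast

lemma bigO_atE:
  assumes "bigO_at f z k"
  obtains C r where "C \<ge> 0" "r > 0" "\<And>u. u \<in> ball z r \<Longrightarrow> norm (f u) \<le> C * norm (u - z) ^ k"
proof -
  obtain C r where C: "r > 0" "\<And>u. u \<in> ball z r \<Longrightarrow> norm (f u) \<le> C * norm (u - z) ^ k"
    using assms unfolding bigO_at_def by blast
  have "norm (f u) \<le> \<bar>C\<bar> * norm (u - z) ^ k" if "u \<in> ball z r" for u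
    by (rule order_trans[OF C(2)[OF that]]) (simp add: mult_right_mono)
  then show ?thesis using C(1) that[of "\<bar>C\<bar>" r] by simp
qed

lemma bigO_at_add:
  assumes "bigO_at f z k" "bigO_at g z k"
  shows "bigO_at (\<lambda>u. f u + g u) z k"
proof -
  obtain C r where C: "r > 0" "\<And>u. u \<in> ball z r \<Longrightarrow> norm (f u) \<le> C * norm (u - z) ^ k"
    using assms(1) unfolding bigO_at_def by blast
  obtain C' r' where C': "r' > 0" "\<And>u. u \<in> ball z r' \<Longrightarrow> norm (g u) \<le> C' * norm (u - z) ^ k"
    using assms(2) unfolding bigO_at_def by blast
  have "norm (f u + g u) \<le> (C + C') * norm (u - z) ^ k" if "u \<in> ball z (min r r')" for u
    using C(2)[of u] C'(2)[of u] that norm_triangle_ineq[of "f u" "g u"] by (simp add: distrib_right)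
  then show ?thesis
    using C(1) C'(1) by (intro bigO_atI[of "min r r'"]) simp_all
qed

lemma bigO_at_mult:
  fixes f g :: "complex \<Rightarrow> 'a::real_normed_algebra"
  assumes "bigO_at f z k" "bigO_at g z l"
  shows "bigO_at (\<lambda>u. f u * g u) z (k + l)"
proof -
  obtain C r where C: "C \<ge> 0" "r > 0" "\<And>u. u \<in> ball z r \<Longrightarrow> norm (f u) \<le> C * norm (u - z) ^ k"
    using assms(1) by (elim bigO_atE) blast
  obtain C' r' where C': "C' \<ge> 0" "r' > 0" "\<And>u. u \<in> ball z r' \<Longrightarrow> norm (g u) \<le> C' * norm (u - z) ^ l"
    using assms(2) by (elim bigO_atE) blast
  have "norm (f u * g u) \<le> C * C' * norm (u - z) ^ (k + l)" if "u \<in> ball z (min r r')" for u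
  proof -
    have "norm (f u * g u) \<le> norm (f u) * norm (g u)" by (rule norm_mult_ineq)
    also have "\<dots> \<le> (C * norm (u - z) ^ k) * (C' * norm (u - z) ^ l)"
      using that C C' by (intro mult_mono) auto
    finally show ?thesis by (simp add: power_add algebra_simps)
  qed
  then show ?thesis
    using C(2) C'(2) by (intro bigO_atI[of "min r r'"]) simp_all
qed

lemma bigO_at_bounded: "isCont f z \<Longrightarrow> bigO_at f z 0"
proof -
  assume "isCont f z"
  then obtain d where "d > 0" "\<And>u. dist u z < d \<Longrightarrow> dist (f u) (f z) < 1"
    unfolding continuous_at_eps_delta using zero_less_one by blast
  then have "norm (f u) \<le> (norm (f z) + 1) * norm (u - z) ^ 0" if "u \<in> ball z d" for u
    using that norm_triangle_ineq2[of "f u" "f z"] by (fastforce simp: dist_norm norm_minus_commute)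
  then show ?thesis
    unfolding bigO_at_def using \<open>d > 0\<close> by blast
qed

lemma bigO_at_mono:
  assumes "bigO_at f z k" "l \<le> k"
  shows "bigO_at f z l"
proof -
  obtain C r where C: "C \<ge> 0" "r > 0" "\<And>u. u \<in> ball z r \<Longrightarrow> norm (f u) \<le> C * norm (u - z) ^ k"
    using assms(1) by (elim bigO_atE) blast
  have "norm (f u) \<le> C * norm (u - z) ^ l" if "u \<in> ball z (min r 1)" for u
  proof -
    have "norm (f u) \<le> C * norm (u - z) ^ k" using C that by simp
    also have "\<dots> \<le> C * norm (u - z) ^ l"
      using that assms(2) C(1) by (intro mult_left_mono power_decreasing) (auto simp: dist_norm norm_minus_commute)
    finally show ?thesis .
  qed
  then show ?thesis
    using C(2) by (intro bigO_atI[of "min r 1"]) simp_all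
qed

lemma bigO_at_cong:
  assumes "bigO_at f z k" "\<forall>\<^sub>F u in nhds z. g u = f u"
  shows "bigO_at g z k"
proof -
  obtain C r where C: "r > 0" "\<And>u. u \<in> ball z r \<Longrightarrow> norm (f u) \<le> C * norm (u - z) ^ k"
    using assms(1) unfolding bigO_at_def by blast
  obtain s where s: "s > 0" "\<And>u. dist u z < s \<Longrightarrow> g u = f u"
    using assms(2) unfolding eventually_nhds_metric by blast
  show ?thesis
  proof (rule bigO_atI[of "min r s"])
    fix u assume "u \<in> ball z (min r s)"
    then show "norm (g u) \<le> C * norm (u - z) ^ k"
      using C(2)[of u] s(2)[of u] by (simp add: dist_commute)
  qed (use C s in simp)
qed

lemma bigO_at_power: "bigO_at (\<lambda>u. qc ((u - z) ^ k)) z k"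
  by (rule bigO_atI[of 1 _ _ 1]) (auto simp: norm_power)

lemma bigO_at_mult_right: "bigO_at f z k \<Longrightarrow> bigO_at (\<lambda>u. f u * (l :: quat)) z k"
  using bigO_at_mult[of f z k "\<lambda>_. l" 0] bigO_at_bounded[where f = "\<lambda>_. l"] by simp

lemma bigO_at_zero: "bigO_at (\<lambda>_. 0) z k"
  by (rule bigO_atI[of 1 _ _ 0]) simp_all

lemma bigO_at_sum:
  "(\<And>i. i \<in> I \<Longrightarrow> bigO_at (f i) z k) \<Longrightarrow> bigO_at (\<lambda>u. \<Sum>i\<in>I. f i u) z k"
  by (induction I rule: infinite_finite_induct) (simp_all add: bigO_at_zero bigO_at_add)

lemma bigO_at_differentiable:
  assumes "(f has_derivative f') (at z)"
  shows "bigO_at (\<lambda>u. f u - f z) z 1"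
proof -
  obtain d where d: "d > 0" "\<And>u. norm (u - z) < d \<Longrightarrow> norm (f u - f z - f' (u - z)) \<le> 1 * norm (u - z)"
    using assms unfolding has_derivative_at_alt by (metis zero_less_one)
  obtain K where K: "\<And>v. norm (f' v) \<le> norm v * K"
    using bounded_linear.bounded[OF has_derivative_bounded_linear[OF assms]] by blast
  have "norm (f u - f z) \<le> (1 + K) * norm (u - z) ^ 1" if "u \<in> ball z d" for u
    using d(2)[of u] K[of "u - z"] that norm_triangle_ineq[of "f u - f z - f' (u - z)" "f' (u - z)"]
    by (simp add: dist_norm norm_minus_commute algebra_simps)
  then show ?thesis
    unfolding bigO_at_def using d(1) by blast
qed

text \<open>The mean value inequality is applied to \<open>f\<close> minus its linear part at z,
  whose derivative at distance s from z is O(s).\<close>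

lemma bigO_at_taylor1:
  fixes f :: "complex \<Rightarrow> quat"
  assumes "smooth_on UNIV f"
  shows "bigO_at (\<lambda>u. f u - f z - frechet_derivative f (at z) (u - z)) z 2"
proof -
  define D where "D u = frechet_derivative f (at u)" for u
  have D: "(f has_derivative D u) (at u)" for u
    unfolding D_def using smooth_on_has_derivative[OF open_UNIV assms] by simp
  have lin: "linear (D u)" for u using D has_derivative_linear by blast
  have DD: "bigO_at (\<lambda>u. D u v - D z v) z 1" for v
    unfolding D_def
    by (rule bigO_at_differentiable) (rule smooth_on_has_derivative[OF open_UNIV smooth_on_frechet[OF open_UNIV assms] UNIV_I])
  obtain C1 r1 where C1: "C1 \<ge> 0" "r1 > 0" "\<And>u. u \<in> ball z r1 \<Longrightarrow> norm (D u 1 - D z 1) \<le> C1 * norm (u - z) ^ 1"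
    using DD[of 1] by (elim bigO_atE) blast
  obtain C2 r2 where C2: "C2 \<ge> 0" "r2 > 0" "\<And>u. u \<in> ball z r2 \<Longrightarrow> norm (D u \<i> - D z \<i>) \<le> C2 * norm (u - z) ^ 1"
    using DD[of \<i>] by (elim bigO_atE) blast
  define r where "r = min r1 r2"
  have r: "r > 0" using C1 C2 by (simp add: r_def)
  have Dv: "norm (D u v - D z v) \<le> ((C1 + C2) * norm (u - z)) * norm v" if "u \<in> ball z r" for u v
  proof -
    have "D w v = Re v *\<^sub>R D w 1 + Im v *\<^sub>R D w \<i>" for w
    proof -
      have "D w v = D w (Re v *\<^sub>R 1 + Im v *\<^sub>R \<i>)"
        by (rule arg_cong[of _ _ "D w"]) (simp add: complex_eq_iff)
      then show ?thesis using lin by (simp only: linear_add linear_scale)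
    qed
    then have "D u v - D z v = Re v *\<^sub>R (D u 1 - D z 1) + Im v *\<^sub>R (D u \<i> - D z \<i>)"
      by (simp add: algebra_simps)
    then have "norm (D u v - D z v) \<le> \<bar>Re v\<bar> * norm (D u 1 - D z 1) + \<bar>Im v\<bar> * norm (D u \<i> - D z \<i>)"
      by (metis norm_scaleR norm_triangle_ineq)
    also have "\<dots> \<le> norm v * (C1 * norm (u - z)) + norm v * (C2 * norm (u - z))"
      using C1(3)[of u] C2(3)[of u] that
      by (intro add_mono mult_mono abs_Re_le_cmod abs_Im_le_cmod) (auto simp: r_def)
    finally show ?thesis by (simp add: algebra_simps)
  qed
  have "norm (f u - f z - D z (u - z)) \<le> (C1 + C2) * norm (u - z) ^ 2" if u: "u \<in> ball z r" for u
  proof -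
    define s where "s = norm (u - z)"
    have sub: "cball z s \<subseteq> ball z r" using u by (auto simp: s_def dist_norm norm_minus_commute)
    have 1: "norm ((f u - D z u) - (f z - D z z)) \<le> ((C1 + C2) * s) * norm (u - z)"
    proof (rule differentiable_bound[where S = "cball z s"])
      show "((\<lambda>w. f w - D z w) has_derivative (\<lambda>v. D w v - D z v)) (at w within cball z s)" for w
        by (intro has_derivative_diff has_derivative_at_withinI[OF D] bounded_linear_imp_has_derivative
            has_derivative_bounded_linear[OF D])
      show "onorm (\<lambda>v. D w v - D z v) \<le> (C1 + C2) * s" if w: "w \<in> cball z s" for w
      proof (rule onorm_bound)
        fix v
        have "norm (D w v - D z v) \<le> ((C1 + C2) * norm (w - z)) * norm v"
          using w sub by (intro Dv) auto
        also have "\<dots> \<le> ((C1 + C2) * s) * norm v"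
          using w C1 C2 by (intro mult_right_mono mult_left_mono) (auto simp: dist_norm norm_minus_commute)
        finally show "norm (D w v - D z v) \<le> ((C1 + C2) * s) * norm v" .
      qed (use C1 C2 in \<open>simp add: s_def\<close>)
    qed (auto simp: s_def dist_norm norm_minus_commute)
    have 2: "f u - f z - D z (u - z) = (f u - D z u) - (f z - D z z)"
      by (simp add: linear_diff[OF lin])
    show ?thesis unfolding 2 using 1 by (simp add: s_def power2_eq_square mult.assoc)
  qed
  then show ?thesis
    unfolding bigO_at_def D_def using r by blast
qed

lemma leads_cong:
  "leads f z k \<Longrightarrow> \<forall>\<^sub>F u in nhds z. g u = f u \<Longrightarrow> leads g z k"
  unfolding leads_def
  by (elim exE conjE, intro exI conjI, assumption, erule bigO_at_cong) (auto elim: eventually_mono)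

lemma leads_bigO: "leads f z k \<Longrightarrow> bigO_at f z k"
proof -
  assume "leads f z k"
  then obtain m where m: "bigO_at (\<lambda>u. f u - qc ((u - z) ^ k) * m) z (Suc k)"
    unfolding leads_def by blast
  have "bigO_at (\<lambda>u. (f u - qc ((u - z) ^ k) * m) + qc ((u - z) ^ k) * m) z k"
    by (intro bigO_at_add bigO_at_mult_right bigO_at_power bigO_at_mono[OF m]) simp
  then show ?thesis by simp
qed

lemma leads_add:
  assumes "leads f z k" "bigO_at g z (Suc k)"
  shows "leads (\<lambda>u. f u + g u) z k"
proof -
  obtain m where m: "m \<noteq> 0" "bigO_at (\<lambda>u. f u - qc ((u - z) ^ k) * m) z (Suc k)"
    using assms(1) unfolding leads_def by blast
  have "bigO_at (\<lambda>u. (f u - qc ((u - z) ^ k) * m) + g u) z (Suc k)"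
    by (intro bigO_at_add m assms(2))
  then show ?thesis
    unfolding leads_def using m(1) by (intro exI[of _ m]) (simp add: algebra_simps)
qed

lemma leads_mult_right:
  assumes "leads f z k" "l \<noteq> 0"
  shows "leads (\<lambda>u. f u * l) z k"
proof -
  obtain m where m: "m \<noteq> 0" "bigO_at (\<lambda>u. f u - qc ((u - z) ^ k) * m) z (Suc k)"
    using assms(1) unfolding leads_def by blast
  have "bigO_at (\<lambda>u. (f u - qc ((u - z) ^ k) * m) * l) z (Suc k)"
    by (intro bigO_at_mult_right m)
  then show ?thesis
    unfolding leads_def using m(1) assms(2)
    by (intro exI[of _ "m * l"]) (simp add: algebra_simps)
qed

text \<open>The limit of |f| / |u - z|^k retains the order but not the quaternionic coefficient, and
  so survives a change of chart; orders are compared through it.\<close>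

lemma leads_limit:
  assumes "leads f z k"
  shows "\<exists>L > 0. ((\<lambda>u. norm (f u) / norm (u - z) ^ k) \<longlongrightarrow> L) (at z)"
proof -
  obtain m where m: "m \<noteq> 0" "bigO_at (\<lambda>u. f u - qc ((u - z) ^ k) * m) z (Suc k)"
    using assms unfolding leads_def by blast
  obtain C r where C: "C \<ge> 0" "r > 0"
    "\<And>u. u \<in> ball z r \<Longrightarrow> norm (f u - qc ((u - z) ^ k) * m) \<le> C * norm (u - z) ^ Suc k"
    using m(2) by (elim bigO_atE) blast
  have "\<forall>\<^sub>F u in at z. norm (norm (f u) / norm (u - z) ^ k - norm m) \<le> C * norm (u - z)"
    unfolding eventually_at
  proof (intro exI[of _ r] conjI ballI impI C(2))
    fix u assume u: "u \<noteq> z \<and> dist u z < r"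
    then have pos: "norm (u - z) ^ k > 0" by simp
    have "\<bar>norm (f u) - norm (u - z) ^ k * norm m\<bar> \<le> C * norm (u - z) ^ Suc k"
      using norm_triangle_ineq3[of "f u" "qc ((u - z) ^ k) * m"] C(3)[of u] u
      by (simp add: norm_mult norm_power dist_commute)
    then have "\<bar>norm (f u) - norm (u - z) ^ k * norm m\<bar> \<le> (C * norm (u - z)) * norm (u - z) ^ k"
      by (simp add: mult.assoc)
    moreover define b where "b = norm (u - z) ^ k"
    ultimately have "\<bar>norm (f u) - b * norm m\<bar> / b \<le> C * norm (u - z)" "b > 0"
      using pos by (simp_all add: divide_le_eq)
    moreover from this have "norm (f u) / b - norm m = (norm (f u) - b * norm m) / b"
      by (simp add: diff_divide_distrib)
    ultimately show "norm (norm (f u) / norm (u - z) ^ k - norm m) \<le> C * norm (u - z)"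
      unfolding b_def by simp
  qed
  moreover have "((\<lambda>u. C * norm (u - z)) \<longlongrightarrow> 0) (at z)"
    by (auto intro!: tendsto_eq_intros)
  ultimately have "((\<lambda>u. norm (f u) / norm (u - z) ^ k - norm m) \<longlongrightarrow> 0) (at z)"
    by (rule Lim_null_comparison)
  then show ?thesis
    using m(1) LIM_zero_cancel by (intro exI[of _ "norm m"]) auto
qed

text \<open>The quotient for the smaller exponent is the other quotient times a positive power of |u
  - z|, hence tends to zero.\<close>

lemma limit_order_unique:
  fixes f :: "complex \<Rightarrow> real"
  assumes "((\<lambda>u. f u / norm (u - z) ^ k) \<longlongrightarrow> L) (at z)" "L > 0"
    and "((\<lambda>u. f u / norm (u - z) ^ k') \<longlongrightarrow> L') (at z)" "L' > 0"
  shows "k = k'"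
proof -
  have *: False if "k < k'" "((\<lambda>u. f u / norm (u - z) ^ k) \<longlongrightarrow> L) (at z)" "L > 0"
    "((\<lambda>u. f u / norm (u - z) ^ k') \<longlongrightarrow> L') (at z)" for k k' L L'
  proof -
    have "((\<lambda>u. f u / norm (u - z) ^ k' * norm (u - z) ^ (k' - k)) \<longlongrightarrow> L' * 0 ^ (k' - k)) (at z)"
      using that(4) by (intro tendsto_mult tendsto_power) (auto intro!: tendsto_eq_intros)
    then have "((\<lambda>u. f u / norm (u - z) ^ k) \<longlongrightarrow> L' * 0 ^ (k' - k)) (at z)"
    proof (rule Lim_transform_eventually)
      show "\<forall>\<^sub>F u in at z. f u / norm (u - z) ^ k' * norm (u - z) ^ (k' - k) = f u / norm (u - z) ^ k"
        unfolding eventually_at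
      proof (intro exI[of _ 1] conjI ballI impI)
        fix u assume "u \<noteq> z \<and> dist u z < 1"
        moreover have "norm (u - z) ^ k' = norm (u - z) ^ (k' - k) * norm (u - z) ^ k"
          using that(1) by (simp flip: power_add)
        ultimately show "f u / norm (u - z) ^ k' * norm (u - z) ^ (k' - k) = f u / norm (u - z) ^ k"
          by simp
      qed simp
    qed
    then have "L = L' * 0 ^ (k' - k)"
      using that(2) tendsto_unique[OF trivial_limit_at] by blast
    then show False using that(1,3) by (simp add: zero_power)
  qed
  show ?thesis
    by (cases k k' rule: linorder_cases) (use *[OF _ assms(1-3)] *[OF _ assms(3,4,1)] in blast)+
qed

lemma leads_unique: "leads f z k \<Longrightarrow> leads f z k' \<Longrightarrow> k = k'"
proof -
  assume a: "leads f z k" "leads f z k'"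
  obtain L where "((\<lambda>u. norm (f u) / norm (u - z) ^ k) \<longlongrightarrow> L) (at z)" "L > 0"
    using leads_limit[OF a(1)] by blast
  moreover obtain L' where "((\<lambda>u. norm (f u) / norm (u - z) ^ k') \<longlongrightarrow> L') (at z)" "L' > 0"
    using leads_limit[OF a(2)] by blast
  ultimately show ?thesis by (rule limit_order_unique)
qed

lemma not_leads_zero: "\<not> leads (\<lambda>_. 0) z k"
proof
  assume "leads (\<lambda>_. 0 :: quat) z k"
  from leads_limit[OF this] obtain L :: real
    where "L > 0" "((\<lambda>u. norm (0 :: quat) / norm (u - z) ^ k) \<longlongrightarrow> L) (at z)"
    by blast
  then show False
    using tendsto_const_iff[of "at z" "0 :: real" L] by simp
qed

section \<open>Vanishing orders of sections in a spinor frame\<close>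

context spinor_frame
begin

lemma norm_R_le: "norm (R c z x) \<le> (norm (R c z (1, 0)) + norm (R c z (0, 1))) * norm x"
proof -
  have "norm (R c z x) \<le> norm (R c z (1, 0) * fst x) + norm (R c z (0, 1) * snd x)"
    using norm_triangle_ineq[of "R c z (1, 0) * fst x"] by (subst R_basis) simp
  also have "\<dots> \<le> norm (R c z (1, 0)) * norm x + norm (R c z (0, 1)) * norm x"
    unfolding norm_mult using norm_fst_le[of "fst x" "snd x"] norm_snd_le[of "snd x" "fst x"]
    by (intro add_mono mult_left_mono) auto
  finally show ?thesis by (simp add: distrib_right)
qed

lemma infdist_le_lift: "infdist x (E (par c z)) \<le> norm (lift c z (R c z x))"
proof -
  have "x - lift c z (R c z x) \<in> E (par c z)"
    by (simp add: mem_E_iff R_diff)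
  from infdist_le[OF this, of x] show ?thesis by (simp add: dist_norm)
qed

text \<open>Together with \<open>infdist_le_lift\<close> this makes the quotient norm and |R x|
  equivalent with locally bounded factors, so that the estimates in \<open>vanishes_to_order\<close>
  become estimates of the fibre coordinate.\<close>

lemma norm_R_le_infdist:
  "norm (R c z x) \<le> (norm (R c z (1, 0)) + norm (R c z (0, 1))) * infdist x (E (par c z))"
proof -
  let ?K = "norm (R c z (1, 0)) + norm (R c z (0, 1))"
  have K: "?K > 0" using R_norm_pos[of c z]
    by (smt (verit) R_norm_def norm_ge_zero power2_eq_square mult_eq_0_iff)
  have ne: "E (par c z) \<noteq> {}" using E_closed(4) by blast
  have "norm (R c z x) / ?K \<le> dist x a" if "a \<in> E (par c z)" for a
  proof -
    have "R c z x = R c z (x - a)" using that by (simp add: mem_E_iff R_diff)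
    then have "norm (R c z x) \<le> ?K * dist x a"
      using norm_R_le[of c z "x - a"] by (simp add: dist_norm)
    then show ?thesis using K by (simp add: divide_le_eq mult.commute)
  qed
  then have "norm (R c z x) / ?K \<le> infdist x (E (par c z))"
    using ne by (simp add: infdist_notempty cINF_greatest)
  then show ?thesis using K by (simp add: divide_le_eq mult.commute)
qed

lemma R_complex_act: "acts_as_i J \<Longrightarrow> R c z (complex_act J (par c z) a x) = qc a * R c z x"
  by (simp add: complex_act_def R_add R_scaleR acts_as_iD quat_eq_iff algebra_simps)

lemma norm_lift: "norm (lift c z l) = norm (lift c z 1) * norm l"
proof -
  have "norm (x \<odot> l) = norm x * norm l" for x :: H2
    by (simp add: norm_prod_def norm_mult power_mult_distrib real_sqrt_mult flip: distrib_right)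
  then show ?thesis
    by (simp add: lift_def)
qed

lemma vanishes_to_orderI:
  assumes J: "acts_as_i J" and lead: "leads (\<lambda>u. R c u (\<psi> (par c u))) z k"
  shows "vanishes_to_order E J \<psi> (par c z) k"
proof -
  obtain m where m: "m \<noteq> 0" "bigO_at (\<lambda>u. R c u (\<psi> (par c u)) - qc ((u - z) ^ k) * m) z (Suc k)"
    using lead unfolding leads_def by blast
  \<comment> \<open>A constant vector serves as the local section: its coordinate is
    \<open>m\<close> at z and differs from \<open>m\<close> by O(u - z) nearby, which the error term
    of order k + 1 absorbs.\<close>
  define x where "x = lift c z m"
  have Rx: "R c z x = m" by (simp add: x_def)
  have "bigO_at (\<lambda>u. R c u x - R c z x) z 1"
    by (rule bigO_at_differentiable[OF R_has_derivative])
  then have "bigO_at (\<lambda>u. qc ((u - z) ^ k) * (R c u x - m)) z (k + 1)"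
    unfolding Rx by (rule bigO_at_mult[OF bigO_at_power])
  then have "bigO_at (\<lambda>u. (qc ((u - z) ^ k) * (R c u x - m)) * (-1)) z (Suc k)"
    by (intro bigO_at_mult_right) simp
  from bigO_at_add[OF m(2) this]
  have O: "bigO_at (\<lambda>u. R c u (\<psi> (par c u)) - qc ((u - z) ^ k) * R c u x) z (Suc k)"
    by (simp add: algebra_simps)
  have "smooth_on UNIV (\<lambda>u. lift c u 1)"
    by (intro lift_smooth smooth_on_const) auto
  then have "isCont (\<lambda>u. lift c u 1) z"
    using smooth_on_continuous continuous_on_eq_continuous_at by blast
  then have "bigO_at (\<lambda>u. lift c u 1) z 0"
    by (rule bigO_at_bounded)
  then obtain B r' where B: "B \<ge> 0" "r' > 0" "\<And>u. u \<in> ball z r' \<Longrightarrow> norm (lift c u 1) \<le> B * norm (u - z) ^ 0"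
    by (elim bigO_atE) blast
  obtain C r where C: "C \<ge> 0" "r > 0"
    "\<And>u. u \<in> ball z r \<Longrightarrow> norm (R c u (\<psi> (par c u)) - qc ((u - z) ^ k) * R c u x) \<le> C * norm (u - z) ^ Suc k"
    using O by (elim bigO_atE) blast
  show ?thesis
    unfolding vanishes_to_order_def
  proof (intro exI conjI ballI)
    show "par c z = par c z" ..
    show "min r r' > 0" using B C by simp
    show "smooth_on (ball z (min r r')) (\<lambda>_. x)" by (intro smooth_on_const open_ball)
    show "x \<notin> E (par c z)" using Rx m(1) by (simp add: mem_E_iff)
    fix u assume u: "u \<in> ball z (min r r')"
    have "infdist (\<psi> (par c u) - complex_act J (par c u) ((u - z) ^ k) x) (E (par c u))
      \<le> norm (lift c u 1) * norm (R c u (\<psi> (par c u)) - qc ((u - z) ^ k) * R c u x)"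
      using infdist_le_lift[of "\<psi> (par c u) - complex_act J (par c u) ((u - z) ^ k) x" c u]
      by (subst (asm) norm_lift) (simp add: R_diff R_complex_act[OF J])
    also have "\<dots> \<le> B * (C * norm (u - z) ^ Suc k)"
      using B(3)[of u] C(3)[of u] B(1) u by (intro mult_mono) auto
    finally show "infdist (\<psi> (par c u) - complex_act J (par c u) ((u - z) ^ k) x) (E (par c u))
      \<le> (B * C) * norm (u - z) ^ (k + 1)"
      by (simp add: mult.assoc)
  qed
qed

lemma norm_R_transition:
  assumes "u \<noteq> 0" "c \<noteq> c'"
  shows "norm (R c' (1 / u) x) = norm (R c u x) / norm u" "par c' (1 / u) = par c u"
proof -
  have W: "norm (R Wchart (1 / v) x) = norm (R Zchart v x) / norm v" if "v \<noteq> 0" for v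
    using that by (simp add: R_transition norm_mult norm_divide)
  show "norm (R c' (1 / u) x) = norm (R c u x) / norm u" "par c' (1 / u) = par c u"
    using assms W[of u] W[of "1 / u"]
    by (cases c; cases c'; simp add: norm_divide)+
qed

text \<open>The chart in \<open>vanishes_to_order\<close> is not prescribed. Where the charts meet,
  |1/u - 1/z| = |u - z| / (|u| |z|), and the norm of the coordinate is divided by |u|, so the limit
  only acquires a positive factor.\<close>

lemma order_limit_transition:
  assumes lim: "((\<lambda>u. norm (R c' u (\<psi> (par c' u))) / norm (u - z') ^ k) \<longlongrightarrow> L) (at z')" and L: "L > 0"
    and eq: "par c' z' = par c z"
  shows "\<exists>L > 0. ((\<lambda>u. norm (R c u (\<psi> (par c u))) / norm (u - z) ^ k) \<longlongrightarrow> L) (at z)"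
proof (cases "c = c'")
  case True
  then have "z = z'" using eq by (cases c) (auto split: if_splits)
  then show ?thesis using lim L True by blast
next
  case False
  then have z: "z \<noteq> 0" "z' = 1 / z" using eq by (cases c; cases c'; auto split: if_splits)+
  have f: "filterlim (\<lambda>u. 1 / u) (at (1 / z)) (at z)"
    unfolding filterlim_at
  proof
    show "\<forall>\<^sub>F u in at z. 1 / u \<in> UNIV \<and> 1 / u \<noteq> 1 / z"
      by (auto simp: eventually_at intro!: exI[of _ 1])
    show "((\<lambda>u. 1 / u) \<longlongrightarrow> 1 / z) (at z)"
      using z by (auto intro!: tendsto_eq_intros)
  qed
  have "((\<lambda>u. norm (R c' (1 / u) (\<psi> (par c' (1 / u)))) / norm (1 / u - 1 / z) ^ k
      * (norm u / (norm u * norm z) ^ k)) \<longlongrightarrow> L * (norm z / (norm z * norm z) ^ k)) (at z)"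
    using z by (intro tendsto_mult filterlim_compose[OF lim[unfolded z(2)] f]) (auto intro!: tendsto_eq_intros)
  then have "((\<lambda>u. norm (R c u (\<psi> (par c u))) / norm (u - z) ^ k) \<longlongrightarrow>
      L * (norm z / (norm z * norm z) ^ k)) (at z)"
  proof (rule Lim_transform_eventually)
    show "\<forall>\<^sub>F u in at z. norm (R c' (1 / u) (\<psi> (par c' (1 / u)))) / norm (1 / u - 1 / z) ^ k
      * (norm u / (norm u * norm z) ^ k) = norm (R c u (\<psi> (par c u))) / norm (u - z) ^ k"
      unfolding eventually_at
    proof (intro exI[of _ "norm z"] conjI ballI impI)
      fix u assume u: "u \<noteq> z \<and> dist u z < norm z"
      then have u0: "u \<noteq> 0" by (auto simp: dist_norm)
      have "norm (1 / u - 1 / z) = norm (u - z) / (norm u * norm z)"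
        using u0 z by (simp add: field_simps norm_divide norm_mult norm_minus_commute flip: norm_divide norm_mult)
          (simp add: divide_simps norm_divide norm_mult norm_minus_commute)
      then show "norm (R c' (1 / u) (\<psi> (par c' (1 / u)))) / norm (1 / u - 1 / z) ^ k
          * (norm u / (norm u * norm z) ^ k) = norm (R c u (\<psi> (par c u))) / norm (u - z) ^ k"
        using u u0 z by (simp add: norm_R_transition[OF u0 False] power_divide)
    qed (use z in simp)
  qed
  moreover have "L * (norm z / (norm z * norm z) ^ k) > 0" using L z by simp
  ultimately show ?thesis by blast
qed

text \<open>Only the limit is recovered, and not \<open>leads\<close>, because the witness may live
  in the other chart.\<close>

lemma vanishes_to_orderD:
  assumes J: "acts_as_i J" and v: "vanishes_to_order E J \<psi> (par c z) k"
  shows "\<exists>L > 0. ((\<lambda>u. norm (R c u (\<psi> (par c u))) / norm (u - z) ^ k) \<longlongrightarrow> L) (at z)"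
proof -
  obtain c' z' r \<phi> C where w: "par c' z' = par c z" "r > 0" "smooth_on (ball z' r) \<phi>" "\<phi> z' \<notin> E (par c z)"
    "\<And>u. u \<in> ball z' r \<Longrightarrow> infdist (\<psi> (par c' u) - complex_act J (par c' u) ((u - z') ^ k) (\<phi> u)) (E (par c' u))
            \<le> C * norm (u - z') ^ (k + 1)"
    using v unfolding vanishes_to_order_def by metis
  define m where "m = R c' z' (\<phi> z')"
  have m: "m \<noteq> 0" using w(4) unfolding m_def w(1)[symmetric] mem_E_iff .
  have z': "z' \<in> ball z' r" using w(2) by simp
  have "((\<lambda>u. R c' u (\<phi> u)) has_derivative
      (\<lambda>v. DR c' z' v (\<phi> z') + R c' z' (frechet_derivative \<phi> (at z') v))) (at z')"
    by (intro R_section_has_derivative smooth_on_has_derivative[OF open_ball w(3) z'])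
  then have "bigO_at (\<lambda>u. R c' u (\<phi> u) - R c' z' (\<phi> z')) z' 1"
    by (rule bigO_at_differentiable)
  then have 1: "bigO_at (\<lambda>u. qc ((u - z') ^ k) * (R c' u (\<phi> u) - m)) z' (k + 1)"
    unfolding m_def by (rule bigO_at_mult[OF bigO_at_power])
  have "isCont (\<lambda>u. R c' u x) z'" for x
    using smooth_on_continuous[OF R_smooth] continuous_on_eq_continuous_at[OF open_UNIV] by blast
  then have "isCont (\<lambda>u. norm (R c' u (1, 0)) + norm (R c' u (0, 1))) z'"
    by (intro continuous_intros)
  then have "bigO_at (\<lambda>u. norm (R c' u (1, 0)) + norm (R c' u (0, 1))) z' 0"
    by (rule bigO_at_bounded)
  then obtain B r' where B: "B \<ge> 0" "r' > 0" "\<And>u. u \<in> ball z' r' \<Longrightarrow>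
      norm (norm (R c' u (1, 0)) + norm (R c' u (0, 1))) \<le> B * norm (u - z') ^ 0"
    by (elim bigO_atE) blast
  have "bigO_at (\<lambda>u. R c' u (\<psi> (par c' u)) - qc ((u - z') ^ k) * R c' u (\<phi> u)) z' (k + 1)"
  proof (rule bigO_atI)
    show "min r r' > 0" using B w by simp
    fix u assume u: "u \<in> ball z' (min r r')"
    let ?x = "\<psi> (par c' u) - complex_act J (par c' u) ((u - z') ^ k) (\<phi> u)"
    have "norm (R c' u (\<psi> (par c' u)) - qc ((u - z') ^ k) * R c' u (\<phi> u)) = norm (R c' u ?x)"
      by (simp add: R_diff R_complex_act[OF J])
    also have "\<dots> \<le> (norm (R c' u (1, 0)) + norm (R c' u (0, 1))) * infdist ?x (E (par c' u))"
      by (rule norm_R_le_infdist)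
    also have "\<dots> \<le> B * (C * norm (u - z') ^ (k + 1))"
      using B(3)[of u] w(5)[of u] u B(1) by (intro mult_mono) (auto simp: infdist_nonneg)
    finally show "norm (R c' u (\<psi> (par c' u)) - qc ((u - z') ^ k) * R c' u (\<phi> u)) \<le> (B * C) * norm (u - z') ^ (k + 1)"
      by (simp add: mult.assoc)
  qed
  from bigO_at_add[OF this 1] have "leads (\<lambda>u. R c' u (\<psi> (par c' u))) z' k"
    unfolding leads_def using m by (intro exI[of _ m]) (simp add: algebra_simps)
  from leads_limit[OF this] show ?thesis
    by (elim exE conjE) (rule order_limit_transition[OF _ _ w(1)])
qed

text \<open>A nonzero combination of sections with strictly increasing orders has the order of its
  first nonzero coefficient, since the later terms are of higher order. Hence the orders of the
  basis are all the possible vanishing orders.\<close>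

lemma ord_at_adapted:
  assumes J: "acts_as_i J" and k: "\<And>i j. i < j \<Longrightarrow> j \<le> n \<Longrightarrow> k i < k j"
    and b: "\<And>j. j \<le> n \<Longrightarrow> b j \<in> H" "\<And>j. j \<le> n \<Longrightarrow> leads (\<lambda>u. R c u (b j (par c u))) z (k j)"
    and span: "\<And>\<psi>. \<psi> \<in> H \<Longrightarrow> \<exists>l. \<forall>p. \<psi> p - (\<Sum>j\<le>n. b j p \<odot> l j) \<in> E p"
  shows "ord_at E J n H (par c z) = (\<Sum>j\<le>n. int (k j) - int j)"
proof -
  have R_sum: "R c u (\<Sum>j\<in>I. f j) = (\<Sum>j\<in>I. R c u (f j))" for u I and f :: "nat \<Rightarrow> H2"
    by (induction I rule: infinite_finite_induct) (simp_all add: R_add)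
  have "vanishing_orders E J H (par c z) = k ` {..n}"
  proof (intro equalityI subsetI)
    fix a assume "a \<in> k ` {..n}"
    then obtain j where j: "j \<le> n" "a = k j" by blast
    have "\<exists>q. b j q \<notin> E q"
    proof (rule ccontr)
      assume "\<not> ?thesis"
      then have "(\<lambda>u. R c u (b j (par c u))) = (\<lambda>_. 0)" by (auto simp: mem_E_iff[symmetric])
      then show False using b(2)[OF j(1)] not_leads_zero by simp
    qed
    then show "a \<in> vanishing_orders E J H (par c z)"
      unfolding vanishing_orders_def using j b vanishes_to_orderI[OF J b(2)] by auto
  next
    fix a assume "a \<in> vanishing_orders E J H (par c z)"
    then obtain \<psi> q where \<psi>: "\<psi> \<in> H" "\<psi> q \<notin> E q" "vanishes_to_order E J \<psi> (par c z) a"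
      unfolding vanishing_orders_def by blast
    obtain l where l: "\<And>p. \<psi> p - (\<Sum>j\<le>n. b j p \<odot> l j) \<in> E p" using span[OF \<psi>(1)] by blast
    have "\<exists>j\<le>n. l j \<noteq> 0"
    proof (rule ccontr)
      assume "\<not> ?thesis"
      then show False using l[of q] \<psi>(2) by simp
    qed
    define j where "j = (LEAST j. j \<le> n \<and> l j \<noteq> 0)"
    have j: "j \<le> n" "l j \<noteq> 0"
      using LeastI_ex[OF \<open>\<exists>j\<le>n. l j \<noteq> 0\<close>] unfolding j_def by blast+
    have min: "l i = 0" if "i < j" for i
    proof -
      have "\<not> (i \<le> n \<and> l i \<noteq> 0)"
        using that unfolding j_def by (rule not_less_Least)
      moreover have "i \<le> n" using that j(1) by simp
      ultimately show ?thesis by blast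
    qed
    have "leads (\<lambda>u. R c u (b j (par c u)) * l j + (\<Sum>i\<in>{..n} - {j}. R c u (b i (par c u)) * l i)) z (k j)"
    proof (intro leads_add leads_mult_right b(2) j bigO_at_sum)
      fix i assume i: "i \<in> {..n} - {j}"
      show "bigO_at (\<lambda>u. R c u (b i (par c u)) * l i) z (Suc (k j))"
      proof (cases "i < j")
        case True
        then show ?thesis by (simp add: min bigO_at_zero)
      next
        case False
        then have "k j < k i" using i by (intro k) auto
        then show ?thesis
          using i by (intro bigO_at_mult_right bigO_at_mono[OF leads_bigO[OF b(2)]]) auto
      qed
    qed
    moreover have "R c u (b j (par c u)) * l j + (\<Sum>i\<in>{..n} - {j}. R c u (b i (par c u)) * l i) =
        R c u (\<psi> (par c u))" for u
    proof -
      have "R c u (\<psi> (par c u)) = (\<Sum>i\<le>n. R c u (b i (par c u)) * l i)"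
        using l[of "par c u"] by (simp add: mem_E_iff R_diff R_sum R_rscale)
      then show ?thesis using j by (simp add: sum.remove[of "{..n}" j])
    qed
    ultimately have "leads (\<lambda>u. R c u (\<psi> (par c u))) z (k j)" by simp
    from leads_limit[OF this] vanishes_to_orderD[OF J \<psi>(3)] have "a = k j"
      by (elim exE conjE) (rule limit_order_unique)
    then show "a \<in> k ` {..n}" using j by blast
  qed
  moreover have "sorted_list_of_set (k ` {..n}) = map k [0..<Suc n]"
  proof -
    have "sorted (map k [0..<Suc n])" "distinct (map k [0..<Suc n])"
      using k by (auto simp: sorted_iff_nth_mono_less distinct_conv_nth less_Suc_eq_le nth_append
          simp del: upt_Suc intro: less_imp_le) (metis linorder_neqE_nat nat_less_le)
    moreover have "set (map k [0..<Suc n]) = k ` {..n}" by (auto simp del: upt_Suc)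
    ultimately show ?thesis
      using sorted_list_of_set.idem_if_sorted_distinct by metis
  qed
  ultimately show ?thesis
    unfolding ord_at_def by (intro sum.cong) (auto simp del: upt_Suc)
qed

text \<open>Where a constant section lies in \<open>E\<close>, its first derivative represents
  \<delta> up to sign, which is injective by \<open>R_immersed\<close>; so the zero is
  simple.\<close>

lemma leads_const:
  assumes "x \<noteq> 0"
  shows "leads (\<lambda>u. R c u x) z (if R c z x = 0 then 1 else 0)"
proof (cases "R c z x = 0")
  case True
  have "bigO_at (\<lambda>u. R c u x - R c z x - DR c z (u - z) x) z 2"
    unfolding DR_def by (rule bigO_at_taylor1[OF R_smooth])
  then have "bigO_at (\<lambda>u. R c u x - qc ((u - z) ^ 1) * DR c z 1 x) z (Suc 1)"
    by (subst (asm) DR_kernel(2)[OF True]) (simp add: True numeral_2_eq_2)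
  then show ?thesis
    using DR_kernel_nonzero[OF True assms] True by (auto simp: leads_def)
next
  case False
  have "bigO_at (\<lambda>u. R c u x - qc ((u - z) ^ 0) * R c z x) z (Suc 0)"
    using bigO_at_differentiable[OF R_has_derivative[of c x z]] by simp
  then show ?thesis
    using False by (auto simp: leads_def)
qed

lemma fibre_basis:
  obtains a e where "R c z a \<noteq> 0" "e \<noteq> 0" "R c z e = 0" "\<And>x. \<exists>l m. x = a \<odot> l + e \<odot> m"
proof -
  consider (1) "R c z (1, 0) \<noteq> 0" | (2) "R c z (1, 0) = 0" "R c z (0, 1) \<noteq> 0"
    using R_norm_pos[of c z] by (force simp: R_norm_def)
  then show ?thesis
  proof cases
    case 1
    let ?e = "(- inverse (R c z (1, 0)) * R c z (0, 1), 1)"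
    show ?thesis
    proof (rule that[of "(1, 0)" ?e])
      show "R c z ?e = 0"
        using 1 R_basis[of c z ?e] by (simp flip: mult.assoc)
      show "\<exists>l m. x = (1, 0) \<odot> l + ?e \<odot> m" for x
        by (intro exI[of _ "fst x + inverse (R c z (1, 0)) * R c z (0, 1) * snd x"] exI[of _ "snd x"])
           (simp add: prod_eq_iff)
    qed (use 1 in \<open>simp_all add: prod_eq_iff\<close>)
  next
    case 2
    show ?thesis
      by (rule that[of "(0, 1)" "(1, 0)"]) (use 2 in \<open>auto simp: prod_eq_iff rscale_def\<close>)
  qed
qed

end

section \<open>The degree\<close>

definition complex_part :: "quat \<Rightarrow> complex"
  where "complex_part x = Complex (qre x) (qi x)"

lemma bounded_linear_complex_part: "bounded_linear complex_part"
proof (rule bounded_linear_intro[where K = 1])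
  fix x :: quat
  have "(norm (complex_part x))\<^sup>2 \<le> (norm x)\<^sup>2"
    unfolding norm_quat_square complex_part_def cmod_power2 by (simp add: power2_eq_square)
  then show "norm (complex_part x) \<le> norm x * 1"
    by (simp add: power2_le_iff_abs_le)
qed (simp_all add: complex_part_def complex_eq_iff)

lemma commutes_with_i_iff: "qc \<i> * x = x * qc \<i> \<longleftrightarrow> x = qc (complex_part x)"
  unfolding quat_eq_iff by (auto simp: complex_part_def)

text \<open>Nowhere vanishing functions on the plane have continuous logarithms, which return to
  their initial values along the circle; so \<open>e0\<close> and \<open>e1\<close> do not
  contribute. Only the factor \<open>u\<close> winds around zero, and it does so once.\<close>

lemma winding_number_clutching:
  assumes e: "continuous_on UNIV e0" "continuous_on UNIV e1" "\<And>z. e0 z \<noteq> 0" "\<And>z. e1 z \<noteq> 0"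
    and g: "\<And>u. norm u = 1 \<Longrightarrow> g u = \<i> * u * e1 (1 / u) / e0 u"
  shows "winding_number (g \<circ> circlepath 0 1) 0 = 1"
proof -
  obtain l0 where l0: "continuous_on UNIV l0" "\<And>z. e0 z = exp (l0 z)"
    using continuous_logarithm_on_contractible[OF e(1) contractible_UNIV] e(3) UNIV_I by metis
  obtain l1 where l1: "continuous_on UNIV l1" "\<And>z. e1 z = exp (l1 z)"
    using continuous_logarithm_on_contractible[OF e(2) contractible_UNIV] e(4) UNIV_I by metis
  \<comment> \<open>A continuous logarithm of \<open>g\<close> along the unit circle; \<i> \<pi> / 2
    is a logarithm of the constant factor \<i>.\<close>
  define p where "p t = \<i> * (pi / 2) + 2 * pi * \<i> * of_real t + l1 (exp (- (2 * pi * \<i> * of_real t)))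
      - l0 (exp (2 * pi * \<i> * of_real t))" for t :: real
  have "g (circlepath 0 1 t) = exp (p t)" for t
  proof -
    let ?u = "exp (2 * pi * \<i> * of_real t)"
    have u: "circlepath 0 1 t = ?u" by (simp add: circlepath)
    have "norm ?u = 1" by (simp add: norm_exp_eq_Re)
    moreover have "1 / ?u = exp (- (2 * pi * \<i> * of_real t))"
      by (simp add: exp_minus inverse_eq_divide)
    moreover have "\<i> = exp (\<i> * (pi / 2))"
      by (simp add: exp_Euler cos_of_real sin_of_real flip: of_real_divide)
    ultimately show ?thesis
      unfolding u p_def using g[of ?u] l0(2) l1(2)
      by (simp add: exp_add exp_diff)
  qed
  then have "g \<circ> circlepath 0 1 = exp \<circ> p" by auto
  moreover have "path p"
    unfolding path_def p_def
    by (intro continuous_intros continuous_on_compose2[OF l0(1)] continuous_on_compose2[OF l1(1)]) auto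
  moreover have "pathfinish p - pathstart p = 2 * of_real pi * \<i>"
    by (simp add: pathfinish_def pathstart_def p_def exp_minus)
  ultimately show ?thesis
    using winding_number_compose_exp[of p] by simp
qed

context spinor_frame
begin

text \<open>The clutching function of the frames \<open>lift c z 1\<close> is \<i> u. In any other
  pair of frames the coordinates commute with \<i>, hence are complex and nowhere zero on the whole
  chart, and \<open>winding_number_clutching\<close> shows that the winding number stays the
  same.\<close>

lemma bundle_degree_eq_1:
  assumes J: "acts_as_i J"
  shows "bundle_degree E J = 1"
  unfolding bundle_degree_def
proof (rule the_equality)
  let ?\<phi> = "\<lambda>c z. lift c z 1"
  have "hat_frame E J c (?\<phi> c)" for c
    unfolding hat_frame_def
    by (auto intro!: lift_smooth smooth_on_const simp: mem_E_iff R_diff R_rscale acts_as_iD[OF J])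
  moreover have "?\<phi> Wchart (1 / u) - ?\<phi> Zchart u \<odot> qc (\<i> * u) \<in> E (Finite u)" if "norm u = 1" for u
  proof -
    have u: "u \<noteq> 0" using that by auto
    have "qc (1 / (\<i> * u)) * qc (\<i> * u) = 1"
      using u unfolding qc_mult[symmetric] by simp
    then have "?\<phi> Wchart (1 / u) = lift Zchart u (qc (\<i> * u))"
      using lift_transition[OF u, of "qc (\<i> * u)"] by simp
    then show ?thesis
      using mem_E_iff[of _ Zchart u] by (simp add: R_diff R_rscale)
  qed
  moreover have "winding_number ((\<lambda>u. \<i> * u) \<circ> circlepath 0 1) 0 = 1"
    by (rule winding_number_clutching[of "\<lambda>_. 1" "\<lambda>_. 1"]) auto
  ultimately show "\<exists>\<phi>\<^sub>0 \<phi>\<^sub>1 g. hat_frame E J Zchart \<phi>\<^sub>0 \<and> hat_frame E J Wchart \<phi>\<^sub>1 \<and>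
      (\<forall>u. norm u = 1 \<longrightarrow> \<phi>\<^sub>1 (1 / u) - \<phi>\<^sub>0 u \<odot> qc (g u) \<in> E (Finite u)) \<and>
      winding_number (g \<circ> circlepath 0 1) 0 = of_int 1"
    by (intro exI[of _ "?\<phi> Zchart"] exI[of _ "?\<phi> Wchart"] exI[of _ "\<lambda>u. \<i> * u"]) simp
next
  fix d
  assume "\<exists>\<phi>\<^sub>0 \<phi>\<^sub>1 g. hat_frame E J Zchart \<phi>\<^sub>0 \<and> hat_frame E J Wchart \<phi>\<^sub>1 \<and>
      (\<forall>u. norm u = 1 \<longrightarrow> \<phi>\<^sub>1 (1 / u) - \<phi>\<^sub>0 u \<odot> qc (g u) \<in> E (Finite u)) \<and>
      winding_number (g \<circ> circlepath 0 1) 0 = of_int d"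
  then obtain \<phi>0 \<phi>1 g where \<phi>: "hat_frame E J Zchart \<phi>0" "hat_frame E J Wchart \<phi>1"
    and g: "\<And>u. norm u = 1 \<Longrightarrow> \<phi>1 (1 / u) - \<phi>0 u \<odot> qc (g u) \<in> E (Finite u)"
    and w: "winding_number (g \<circ> circlepath 0 1) 0 = of_int d"
    by blast
  have frame: "R c z (\<phi> z) = qc (complex_part (R c z (\<phi> z)))" "complex_part (R c z (\<phi> z)) \<noteq> 0"
    "continuous_on UNIV (\<lambda>z. complex_part (R c z (\<phi> z)))"
    if "hat_frame E J c \<phi>" for c \<phi> z
  proof -
    have 1: "R c z (\<phi> z) \<noteq> 0" "qc \<i> * R c z (\<phi> z) = R c z (\<phi> z) * qc \<i>"
      using that by (auto simp: hat_frame_def mem_E_iff R_diff R_rscale acts_as_iD[OF J])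
    then show 2: "R c z (\<phi> z) = qc (complex_part (R c z (\<phi> z)))"
      using commutes_with_i_iff by blast
    show "complex_part (R c z (\<phi> z)) \<noteq> 0"
      using 1(1) 2 by (metis qc_0)
    show "continuous_on UNIV (\<lambda>z. complex_part (R c z (\<phi> z)))"
      using that unfolding hat_frame_def
      by (intro bounded_linear.continuous_on[OF bounded_linear_complex_part] smooth_on_continuous
          R_section_smooth open_UNIV) blast
  qed
  define e0 e1 where "e0 = (\<lambda>z. complex_part (R Zchart z (\<phi>0 z)))"
    and "e1 = (\<lambda>z. complex_part (R Wchart z (\<phi>1 z)))"
  have "g u = \<i> * u * e1 (1 / u) / e0 u" if u: "norm u = 1" for u
  proof -
    have u0: "u \<noteq> 0" using u by auto
    have "R Zchart u (\<phi>1 (1 / u)) = qc (e0 u * g u)"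
      using g[OF u] mem_E_iff[of _ Zchart u] frame(1)[OF \<phi>(1), of u]
      by (simp add: R_diff R_rscale qc_mult e0_def)
    moreover have "qc (e1 (1 / u)) = qc (1 / (\<i> * u)) * R Zchart u (\<phi>1 (1 / u))"
      using frame(1)[OF \<phi>(2), of "1 / u"] R_transition[OF u0] by (simp add: e1_def)
    ultimately have "e1 (1 / u) = 1 / (\<i> * u) * (e0 u * g u)"
      by (simp only: qc_mult[symmetric] qc_eq_iff)
    then show ?thesis
      using u0 frame(2)[OF \<phi>(1), of u] by (simp add: e0_def field_simps)
  qed
  then have "winding_number (g \<circ> circlepath 0 1) 0 = 1"
    by (intro winding_number_clutching[of e0 e1]) (use frame(2,3)[OF \<phi>(1)] frame(2,3)[OF \<phi>(2)] in \<open>auto simp: e0_def e1_def\<close>)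
  with w show "d = 1" by simp
qed

end

lemma sum_order_eq_degree:
  fixes p :: "complex poly"
  assumes "p \<noteq> 0" "finite S" "{z. poly p z = 0} \<subseteq> S"
  shows "(\<Sum>z\<in>S. order z p) = degree p"
  using assms(1,3)
proof (induction "degree p" arbitrary: p)
  case 0
  obtain c where "p = [:c:]"
    using "0"(1) by (metis degree_eq_zeroE)
  then have "poly p z \<noteq> 0" for z
    using "0"(2) by simp
  then show ?case using 0 by (simp add: order_0I)
next
  case (Suc n)
  obtain a where "poly p a = 0"
    using alg_closed_imp_poly_has_root[of p] Suc.hyps(2) by auto
  then obtain q where q: "p = [:- a, 1:] * q"
    by (metis dvdE poly_eq_0_iff_dvd)
  have q0: "q \<noteq> 0" using q Suc.prems by auto
  have a: "a \<in> S" using \<open>poly p a = 0\<close> Suc.prems by auto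
  have lin: "order z [:- a, 1:] = (if z = a then 1 else 0)" for z
    using order_power_n_n[of a 1] by (auto intro: order_0I)
  have "(\<Sum>z\<in>S. order z p) = (\<Sum>z\<in>S. order z [:- a, 1:]) + (\<Sum>z\<in>S. order z q)"
    using Suc.prems(1) unfolding q
    by (subst order_mult) (simp_all add: sum.distrib del: mult_pCons_left)
  also have "(\<Sum>z\<in>S. order z [:- a, 1:]) = 1"
    unfolding lin using a assms(2) by simp
  also have "(\<Sum>z\<in>S. order z q) = degree q"
  proof (rule Suc.hyps(1))
    show "n = degree q" using Suc.hyps(2) q q0 by (simp add: degree_mult_eq del: mult_pCons_left)
    show "{z. poly q z = 0} \<subseteq> S" using Suc.prems q by auto
  qed (rule q0)
  finally show ?case using q q0 by (simp add: degree_mult_eq del: mult_pCons_left)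
qed

section \<open>Frames with a third holomorphic section\<close>

text \<open>
  \<open>\<tau>\<close> is a further holomorphic section of \<open>V/E\<close> in the fibre coordinates; \<open>k0 c\<close> is a polynomial whose
  order at each point is the defect of the vanishing orders of the span of \<open>\<tau>\<close> and the constants.
\<close>

locale soliton_frame = spinor_frame +
  fixes \<tau> :: "chart \<Rightarrow> complex \<Rightarrow> quat" and k0 :: "chart \<Rightarrow> complex poly" and N :: nat
  assumes \<tau>_smooth: "smooth_on UNIV (\<tau> c)"
    and \<tau>_transition: "z \<noteq> 0 \<Longrightarrow> \<tau> Wchart (1 / z) = qc (1 / (\<i> * z)) * \<tau> Zchart z"
    and \<tau>_hol: "hol_at (h c z) (\<tau> c) z"
    and third_section: "\<exists>x l. leads (\<lambda>u. R c u x + \<tau> c u * l) z (order z (k0 c) + 2)"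
    and k0_nonzero: "k0 c \<noteq> 0"
    and total_order: "int (degree (k0 Zchart)) + int (order 0 (k0 Wchart)) = int N - 3"
    and energy: "(\<integral>z. (norm (h Zchart z))\<^sup>2 \<partial>lborel) = pi * real N"
begin

definition \<xi> :: "cp1 \<Rightarrow> H2"
  where "\<xi> = glue (\<lambda>c z. lift c z (\<tau> c z))"

lemma \<xi>_par: "\<xi> (par c z) = lift c z (\<tau> c z)"
  unfolding \<xi>_def by (rule glue_par) (simp add: \<tau>_transition lift_transition)

lemma R_\<xi>: "R c z (\<xi> (par c z)) = \<tau> c z"
  by (simp add: \<xi>_par)

lemma \<xi>_smooth: "smooth_cp1 \<xi>"
  unfolding smooth_cp1_def o_def \<xi>_par by (intro allI lift_smooth \<tau>_smooth open_UNIV)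

text \<open>If \<tau> were the coordinate of a constant section, the element of
  \<open>third_section\<close> would be constant as well; but it vanishes to order at least two, and
  nonzero constants to order at most one.\<close>

lemma not_identically_zero:
  assumes "\<And>c u. R c u x + \<tau> c u * l = 0"
  shows "x = 0 \<and> l = 0"
proof (cases "l = 0")
  case True
  then have "R Zchart u x = 0" for u using assms[of Zchart u] by simp
  then have "leads (\<lambda>_. 0) 0 (if R Zchart 0 x = 0 then 1 else 0)" if "x \<noteq> 0"
    using leads_const[OF that, of Zchart 0] by simp
  then show ?thesis using True not_leads_zero by blast
next
  case False
  then have \<tau>: "\<tau> c u = R c u (- x \<odot> inverse l)" for c u
    using arg_cong[OF assms[of c u], of "\<lambda>y. y * inverse l"]
    by (simp add: R_rscale R_minus distrib_right mult.assoc add_eq_0_iff)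
  obtain y m where "leads (\<lambda>u. R Zchart u y + \<tau> Zchart u * m) 0 (order 0 (k0 Zchart) + 2)"
    using third_section by blast
  then have *: "leads (\<lambda>u. R Zchart u (y + - x \<odot> inverse l \<odot> m)) 0 (order 0 (k0 Zchart) + 2)"
    by (simp only: \<tau> R_add R_rscale)
  moreover have "y + - x \<odot> inverse l \<odot> m \<noteq> 0"
    using * not_leads_zero by (metis (no_types, lifting) ext R_0)
  ultimately show ?thesis
    using leads_unique[OF * leads_const] by (simp split: if_splits)
qed

definition H3 :: "(cp1 \<Rightarrow> H2) set"
  where "H3 = {\<psi>. smooth_cp1 \<psi> \<and> (\<exists>x l. \<forall>p. \<psi> p - (x + \<xi> p \<odot> l) \<in> E p)}"

lemma H3I: "smooth_cp1 \<psi> \<Longrightarrow> (\<And>p. \<psi> p - (x + \<xi> p \<odot> l) \<in> E p) \<Longrightarrow> \<psi> \<in> H3"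
  unfolding H3_def by blast

lemma const_H3: "(\<lambda>_. x) \<in> H3"
  by (rule H3I[of _ x 0]) (simp_all add: smooth_cp1_const E_closed)

lemma comb_H3: "(\<lambda>p. x + \<xi> p \<odot> l) \<in> H3"
  by (rule H3I[of _ x l])
     (simp_all add: smooth_cp1_add smooth_cp1_rscale smooth_cp1_const \<xi>_smooth E_closed)

lemma H3_hol_sections:
  assumes "is_dbar D"
  shows "H3 \<subseteq> hol_sections E D"
proof
  fix \<psi> assume "\<psi> \<in> H3"
  then obtain x l where \<psi>: "smooth_cp1 \<psi>" "\<And>p. \<psi> p - (x + \<xi> p \<odot> l) \<in> E p"
    unfolding H3_def by blast
  show "\<psi> \<in> hol_sections E D"
  proof (rule dbar_eq_0[OF assms \<psi>(1)])
    show "R c u (\<psi> (par c u)) = R c u x + \<tau> c u * l" for c u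
      using \<psi>(2)[of "par c u"] by (simp add: mem_E_iff R_diff R_add R_rscale R_\<xi>)
    show "hol_at (h c z) (\<lambda>u. R c u x + \<tau> c u * l) z" for c z
      by (intro hol_at_add hol_at_mult_right R_hol \<tau>_hol)
  qed
qed

lemma linear_system_H3:
  assumes "is_dbar D"
  shows "linear_system E D (2 + 1) H3"
  unfolding linear_system_def
proof (intro conjI ballI allI impI)
  show "H3 \<subseteq> hol_sections E D" by (rule H3_hol_sections[OF assms])
  show "(\<lambda>_. 0) \<in> H3" by (rule const_H3)
next
  fix \<psi> \<phi> assume "\<psi> \<in> H3" "\<phi> \<in> H3"
  then obtain x l y m where \<psi>: "smooth_cp1 \<psi>" "\<And>p. \<psi> p - (x + \<xi> p \<odot> l) \<in> E p"
    and \<phi>: "smooth_cp1 \<phi>" "\<And>p. \<phi> p - (y + \<xi> p \<odot> m) \<in> E p"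
    unfolding H3_def by blast
  show "(\<lambda>p. \<psi> p + \<phi> p) \<in> H3"
  proof (rule H3I[of _ "x + y" "l + m"])
    show "\<psi> p + \<phi> p - (x + y + \<xi> p \<odot> (l + m)) \<in> E p" for p
      using E_closed(1)[OF \<psi>(2) \<phi>(2), of p] by (simp add: rscale_add_right algebra_simps)
  qed (intro smooth_cp1_add \<psi> \<phi>)
next
  fix \<psi> a assume "\<psi> \<in> H3"
  then obtain x l where \<psi>: "smooth_cp1 \<psi>" "\<And>p. \<psi> p - (x + \<xi> p \<odot> l) \<in> E p"
    unfolding H3_def by blast
  show "(\<lambda>p. \<psi> p \<odot> a) \<in> H3"
  proof (rule H3I[of _ "x \<odot> a" "l * a"])
    show "\<psi> p \<odot> a - (x \<odot> a + \<xi> p \<odot> (l * a)) \<in> E p" for p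
      using E_closed(3)[OF \<psi>(2), of p a] by (simp add: rscale_def minus_prod_def algebra_simps)
  qed (intro smooth_cp1_rscale smooth_cp1_const \<psi>)
next
  fix \<psi> \<phi> assume "\<psi> \<in> H3" "smooth_cp1 \<phi> \<and> (\<forall>p. \<phi> p - \<psi> p \<in> E p)"
  then obtain x l where \<psi>: "smooth_cp1 \<phi>" "\<And>p. \<psi> p - (x + \<xi> p \<odot> l) \<in> E p" "\<And>p. \<phi> p - \<psi> p \<in> E p"
    unfolding H3_def by blast
  show "\<phi> \<in> H3"
  proof (rule H3I[OF \<psi>(1), of x l])
    show "\<phi> p - (x + \<xi> p \<odot> l) \<in> E p" for p
      using E_closed(1)[OF \<psi>(2) \<psi>(3), of p] by (simp add: algebra_simps)
  qed
next
  define b where "b = (\<lambda>k::nat. if k = 0 then (\<lambda>_. (1, 0)) else if k = 1 then (\<lambda>_. (0, 1)) else \<xi>)"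
  have sum: "(\<Sum>k<2 + 1. b k p \<odot> l k) = (l 0, l 1) + \<xi> p \<odot> l 2" for l p
    by (simp add: b_def eval_nat_numeral prod_eq_iff)
  have "\<xi> \<in> H3" using comb_H3[of 0 1] by simp
  then have "\<forall>k<2 + 1. b k \<in> H3"
    using const_H3 by (auto simp: b_def)
  moreover have "\<forall>k<2 + 1. l k = 0" if "\<forall>p. (\<Sum>k<2 + 1. b k p \<odot> l k) \<in> E p" for l
  proof -
    have "R c u (l 0, l 1) + \<tau> c u * l 2 = 0" for c u
      using that[rule_format, of "par c u"] unfolding sum mem_E_iff by (simp add: R_add R_rscale R_\<xi>)
    from not_identically_zero[OF this] show ?thesis
      by (auto simp: less_Suc_eq numeral_2_eq_2 zero_prod_def)
  qed
  moreover have "\<exists>l. \<forall>p. \<psi> p - (\<Sum>k<2 + 1. b k p \<odot> l k) \<in> E p" if "\<psi> \<in> H3" for \<psi>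
  proof -
    obtain x l where \<psi>: "\<And>p. \<psi> p - (x + \<xi> p \<odot> l) \<in> E p"
      using \<open>\<psi> \<in> H3\<close> unfolding H3_def by blast
    show ?thesis
      unfolding sum
      by (rule exI[of _ "\<lambda>k. if k = 0 then fst x else if k = 1 then snd x else l"]) (use \<psi> in simp)
  qed
  ultimately show "\<exists>b. (\<forall>k<(2::nat) + 1. b k \<in> H3) \<and>
       (\<forall>l. (\<forall>p. (\<Sum>k<(2::nat) + 1. b k p \<odot> l k) \<in> E p) \<longrightarrow> (\<forall>k<(2::nat) + 1. l k = 0)) \<and>
       (\<forall>\<psi>\<in>H3. \<exists>l. \<forall>p. \<psi> p - (\<Sum>k<(2::nat) + 1. b k p \<odot> l k) \<in> E p)"
    by blast
qed

text \<open>A basis adapted to the point consists of a constant outside \<open>E\<close>, a constant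
  in \<open>E\<close> and the element of \<open>third_section\<close>, of orders 0, 1 and
  \<open>order z (k0 c) + 2\<close>; only the last can exceed its index.\<close>

lemma ord_at_H3:
  assumes J: "acts_as_i J"
  shows "ord_at E J 2 H3 (par c z) = int (order z (k0 c))"
proof -
  obtain a e where ae: "R c z a \<noteq> 0" "e \<noteq> 0" "R c z e = 0" "\<And>x. \<exists>l m. x = a \<odot> l + e \<odot> m"
    using fibre_basis by blast
  obtain y m where ym: "leads (\<lambda>u. R c u y + \<tau> c u * m) z (order z (k0 c) + 2)"
    using third_section by blast
  \<comment> \<open>The third element is not constant, again because of its order; so it completes
    the constants to a basis.\<close>
  have "m \<noteq> 0"
  proof
    assume "m = 0"
    then have *: "leads (\<lambda>u. R c u y) z (order z (k0 c) + 2)" using ym by simp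
    then have "y \<noteq> 0" using not_leads_zero by auto
    from leads_unique[OF * leads_const[OF this]] show False by (simp split: if_splits)
  qed
  define b where "b = (\<lambda>k::nat. if k = 0 then (\<lambda>_. a) else if k = 1 then (\<lambda>_. e) else (\<lambda>p. y + \<xi> p \<odot> m))"
  define k where "k = (\<lambda>j::nat. if j \<le> 1 then j else order z (k0 c) + 2)"
  have "ord_at E J 2 H3 (par c z) = (\<Sum>j\<le>2. int (k j) - int j)"
  proof (rule ord_at_adapted[OF J, where b = b])
    show "k i < k j" if "i < j" "j \<le> 2" for i j using that by (auto simp: k_def)
    show "b j \<in> H3" for j by (auto simp: b_def const_H3 comb_H3)
    show "leads (\<lambda>u. R c u (b j (par c u))) z (k j)" if "j \<le> 2" for j
    proof -
      have "a \<noteq> 0" using ae(1) by auto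
      then have "leads (\<lambda>u. R c u a) z 0" "leads (\<lambda>u. R c u e) z 1"
        using leads_const[of a c z] leads_const[OF ae(2), of c z] ae(1,3) by auto
      then show ?thesis
        using ym that by (auto simp: b_def k_def R_add R_rscale R_\<xi> le_Suc_eq numeral_2_eq_2)
    qed
    show "\<exists>l. \<forall>p. \<psi> p - (\<Sum>j\<le>2. b j p \<odot> l j) \<in> E p" if "\<psi> \<in> H3" for \<psi>
    proof -
      obtain x l where \<psi>: "\<And>p. \<psi> p - (x + \<xi> p \<odot> l) \<in> E p"
        using \<open>\<psi> \<in> H3\<close> unfolding H3_def by blast
      obtain l0 l1 where x: "x - y \<odot> (inverse m * l) = a \<odot> l0 + e \<odot> l1" using ae(4) by blast
      define ls where "ls = (\<lambda>k::nat. if k = 0 then l0 else if k = 1 then l1 else inverse m * l)"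
      have "(\<Sum>j\<le>2. b j p \<odot> ls j) = a \<odot> l0 + e \<odot> l1 + (y + \<xi> p \<odot> m) \<odot> (inverse m * l)" for p
        by (simp add: b_def ls_def eval_nat_numeral)
      also have "\<dots> p = x + \<xi> p \<odot> l" for p
        unfolding x[symmetric] using \<open>m \<noteq> 0\<close>
        by (simp add: rscale_add rscale_rscale flip: mult.assoc)
      finally show ?thesis using \<psi> by metis
    qed
  qed
  then show ?thesis by (simp add: k_def eval_nat_numeral)
qed

lemma total_ord_H3:
  assumes J: "acts_as_i J"
  shows "total_ord E J 2 H3 = int N - 3"
proof -
  let ?Z = "{z. poly (k0 Zchart) z = 0}"
  have fin: "finite ?Z" using k0_nonzero poly_roots_finite by blast
  have F: "ord_at E J 2 H3 (Finite z) = int (order z (k0 Zchart))" for z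
    using ord_at_H3[OF J, of Zchart z] by simp
  have I: "ord_at E J 2 H3 Infinity = int (order 0 (k0 Wchart))"
    using ord_at_H3[OF J, of Wchart 0] by simp
  have "total_ord E J 2 H3 = (\<Sum>p\<in>insert Infinity (Finite ` ?Z). ord_at E J 2 H3 p)"
    unfolding total_ord_def
  proof (rule sum.mono_neutral_left)
    show "{p. ord_at E J 2 H3 p \<noteq> 0} \<subseteq> insert Infinity (Finite ` ?Z)"
    proof
      fix p assume "p \<in> {p. ord_at E J 2 H3 p \<noteq> 0}"
      then show "p \<in> insert Infinity (Finite ` ?Z)"
        using k0_nonzero by (cases p) (auto simp: F order_root)
    qed
  qed (use fin in auto)
  also have "\<dots> = ord_at E J 2 H3 Infinity + (\<Sum>z\<in>?Z. ord_at E J 2 H3 (Finite z))"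
    using fin by (subst sum.insert) (auto simp: sum.reindex inj_on_def)
  also have "\<dots> = int (order 0 (k0 Wchart)) + int (\<Sum>z\<in>?Z. order z (k0 Zchart))"
    by (simp add: F I)
  also have "(\<Sum>z\<in>?Z. order z (k0 Zchart)) = degree (k0 Zchart)"
    by (rule sum_order_eq_degree[OF k0_nonzero fin]) simp
  finally show ?thesis using total_order by simp
qed

text \<open>Both sides are 4 \<pi> N: the left one by the area of the curve, the right one because 3
  (2 - 1) + (N - 3) = N for degree 1.\<close>

theorem plucker_equality_H3:
  "plucker_equality E J_frame D_frame 2 H3"
proof -
  have "\<And>x. smooth_cp1 (\<lambda>p. J_frame p x)"
    using complex_structure_J_frame unfolding complex_structure_quot_def smooth_End_def by blast
  then show ?thesis
    unfolding plucker_equality_def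
    by (simp add: linear_system_H3[OF is_dbar_D_frame, simplified] willmore_energy_eq[OF is_dbar_D_frame acts_as_i_J_frame]
        energy bundle_degree_eq_1[OF acts_as_i_J_frame] total_ord_H3[OF acts_as_i_J_frame])
qed

text \<open>The left side of \<open>total_order\<close> is nonnegative, so that even N \<ge>
  3.\<close>

lemma N_pos: "N > 0"
  using total_order by linarith

text \<open>
  The canonical linear system has vanishing orders \<open>0, 1\<close> everywhere and \<open>V/E\<close> has degree \<open>1\<close>, so that
  equality in the Pluecker estimate would force the Willmore energy \<open>4 \<pi> N\<close> to be zero.
\<close>

lemma no_small_system:
  assumes "complex_structure_quot E J" "star_delta_quot E J" "hol_structure E J D"
    and const: "\<And>x. (\<lambda>_. x) \<in> hol_sections E D" "\<And>x. (\<lambda>_. x) \<in> H"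
    and eq: "plucker_equality E J D n H"
  shows "n \<ge> 2"
proof (rule ccontr)
  assume "\<not> n \<ge> 2"
  have J: "acts_as_i J" by (rule star_delta_acts_as_i[OF assms(1,2)])
  have D: "is_dbar D" by (rule hol_structure_is_dbar[OF assms(3) J const(1)])
  have Js: "\<And>x. smooth_cp1 (\<lambda>p. J p x)"
    using assms(1) unfolding complex_structure_quot_def smooth_End_def by blast
  have indep: "x = 0" if "\<And>p. x \<in> E p" for x
    using not_identically_zero[of x 0] that by (simp add: mem_E_iff[symmetric])
  have "\<exists>b. (\<forall>k<n + 1. b k \<in> H) \<and>
       (\<forall>l. (\<forall>p. (\<Sum>k<n + 1. b k p \<odot> l k) \<in> E p) \<longrightarrow> (\<forall>k<n + 1. l k = 0)) \<and>
       (\<forall>\<psi>\<in>H. \<exists>l. \<forall>p. \<psi> p - (\<Sum>k<n + 1. b k p \<odot> l k) \<in> E p)"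
    using eq unfolding plucker_equality_def linear_system_def by (elim conjE)
  then obtain b where "\<forall>\<psi>\<in>H. \<exists>l. \<forall>p. \<psi> p - (\<Sum>k<n + 1. b k p \<odot> l k) \<in> E p"
    by (elim exE conjE) (rule that)
  note span = bspec[OF this]
  have cancel: "x = 0" if "\<And>p. x - y p \<odot> 0 \<in> E p" for x and y :: "cp1 \<Rightarrow> H2"
    by (rule indep) (use that in simp)
  \<comment> \<open>One section cannot represent both constants (1, 0) and (0, 1): eliminating it
    would make them dependent modulo \<open>E\<close>.\<close>
  have "n \<noteq> 0"
  proof
    assume "n = 0"
    obtain l where l: "\<And>p. (1, 0) - b 0 p \<odot> l \<in> E p"
      using span[OF const(2), of "(1, 0)"] \<open>n = 0\<close> by auto
    obtain m where m: "\<And>p. (0, 1) - b 0 p \<odot> m \<in> E p"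
      using span[OF const(2), of "(0, 1)"] \<open>n = 0\<close> by auto
    have "l \<noteq> 0" using cancel[of "(1, 0)" "b 0"] l by (auto simp: zero_prod_def)
    have "(0, 1) - (1, 0) \<odot> (inverse l * m) \<in> E p" for p
    proof -
      have "l * (inverse l * m) = m" using \<open>l \<noteq> 0\<close> by (simp flip: mult.assoc)
      then have *: "((0, 1) - b 0 p \<odot> m) - ((1, 0) - b 0 p \<odot> l) \<odot> (inverse l * m) =
          (0, 1) - (1, 0) \<odot> (inverse l * m)"
        by (simp add: prod_eq_iff left_diff_distrib mult.assoc)
      show ?thesis
        using E_closed(2)[OF m E_closed(3)[OF l], of p "inverse l * m"] unfolding * .
    qed
    from indep[OF this] show False by (simp add: prod_eq_iff)
  qed
  with \<open>\<not> n \<ge> 2\<close> have n: "n = 1" by simp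
  have span2: "\<exists>l m. \<forall>p. \<psi> p - (b 0 p \<odot> l + b 1 p \<odot> m) \<in> E p" if "\<psi> \<in> H" for \<psi>
  proof -
    obtain l where "\<forall>p. \<psi> p - (\<Sum>k<n + 1. b k p \<odot> l k) \<in> E p" using span[OF \<open>\<psi> \<in> H\<close>] by blast
    then show ?thesis
      using n by (intro exI[of _ "l 0"] exI[of _ "l 1"]) (simp add: eval_nat_numeral)
  qed
  \<comment> \<open>Two independent constants span a system of dimension two. This is Gaussian
    elimination with quaternionic coefficients on the right: the two basis sections are eliminated
    one after the other.\<close>
  have is_const: "\<exists>x. \<forall>p. \<psi> p - x \<in> E p" if "\<psi> \<in> H" for \<psi>
  proof -
    have step: "\<exists>x. \<forall>p. \<psi> p - x \<in> E p"
      if l: "\<And>p. (1, 0) - (c p \<odot> l0 + d p \<odot> l1) \<in> E p" and m: "\<And>p. (0, 1) - (c p \<odot> m0 + d p \<odot> m1) \<in> E p"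
        and \<psi>: "\<And>p. \<psi> p - (c p \<odot> a0 + d p \<odot> a1) \<in> E p" and l0: "l0 \<noteq> 0" for c d l0 l1 m0 m1 a0 a1
    proof -
      define s where "s = m1 - l1 * (inverse l0 * m0)"
      define t where "t = a1 - l1 * (inverse l0 * a0)"
      let ?e = "(0, 1) - (1, 0) \<odot> (inverse l0 * m0)"
      let ?f = "\<lambda>p. \<psi> p - (1, 0) \<odot> (inverse l0 * a0)"
      have A: "?e - d p \<odot> s \<in> E p" for p
      proof -
        have *: "((0, 1) - (c p \<odot> m0 + d p \<odot> m1)) - ((1, 0) - (c p \<odot> l0 + d p \<odot> l1)) \<odot> (inverse l0 * m0) =
            ?e - d p \<odot> s"
        proof -
          have "l0 * (inverse l0 * m0) = m0" using l0 by (simp flip: mult.assoc)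
          then show ?thesis
            by (simp add: s_def prod_eq_iff algebra_simps)
        qed
        show ?thesis
          using E_closed(2)[OF m E_closed(3)[OF l], of p "inverse l0 * m0"] unfolding * .
      qed
      have B: "?f p - d p \<odot> t \<in> E p" for p
      proof -
        have *: "(\<psi> p - (c p \<odot> a0 + d p \<odot> a1)) - ((1, 0) - (c p \<odot> l0 + d p \<odot> l1)) \<odot> (inverse l0 * a0) =
            ?f p - d p \<odot> t"
        proof -
          have "l0 * (inverse l0 * a0) = a0" using l0 by (simp flip: mult.assoc)
          then show ?thesis
            by (simp add: t_def prod_eq_iff algebra_simps)
        qed
        show ?thesis
          using E_closed(2)[OF \<psi> E_closed(3)[OF l], of p "inverse l0 * a0"] unfolding * .
      qed
      have "s \<noteq> 0"
      proof
        assume "s = 0"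
        from cancel[of ?e d] A this have "?e = 0" by simp
        then show False by (simp add: prod_eq_iff)
      qed
      then have "?f p - ?e \<odot> (inverse s * t) \<in> E p" for p
      proof -
        have *: "(?f p - d p \<odot> t) - (?e - d p \<odot> s) \<odot> (inverse s * t) = ?f p - ?e \<odot> (inverse s * t)"
        proof -
          have "s * (inverse s * t) = t" using \<open>s \<noteq> 0\<close> by (simp flip: mult.assoc)
          then show ?thesis by (simp add: prod_eq_iff algebra_simps)
        qed
        show ?thesis
          using E_closed(2)[OF B E_closed(3)[OF A], of p "inverse s * t"] unfolding * .
      qed
      then show ?thesis
        by (intro exI[of _ "(1, 0) \<odot> (inverse l0 * a0) + ?e \<odot> (inverse s * t)"]) (simp add: diff_diff_eq)
    qed
    obtain l0 l1 where l: "\<And>p. (1, 0) - (b 0 p \<odot> l0 + b 1 p \<odot> l1) \<in> E p"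
      using span2[OF const(2)] by blast
    obtain m0 m1 where m: "\<And>p. (0, 1) - (b 0 p \<odot> m0 + b 1 p \<odot> m1) \<in> E p"
      using span2[OF const(2)] by blast
    obtain a0 a1 where a: "\<And>p. \<psi> p - (b 0 p \<odot> a0 + b 1 p \<odot> a1) \<in> E p"
      using span2[OF \<open>\<psi> \<in> H\<close>] by blast
    show ?thesis
    proof (cases "l0 = 0")
      case False
      then show ?thesis using step[OF l m a] by blast
    next
      \<comment> \<open>If the first coefficient of (1, 0) vanishes, the second one does not, and
        \<open>b 0\<close> and \<open>b 1\<close> exchange their roles.\<close>
      case True
      have "l1 \<noteq> 0"
        using cancel[of "(1, 0)" "b 1"] l True by (auto simp: zero_prod_def)
      then show ?thesis
        using step[of "b 1" l1 "b 0" l0 m1 m0 a1 a0] l m a by (simp add: add.commute)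
    qed
  qed
  have "ord_at E J 1 H p = 0" for p
  proof (cases rule: par_surj[of p])
    case (1 c z)
    obtain a e where ae: "R c z a \<noteq> 0" "e \<noteq> 0" "R c z e = 0" "\<And>x. \<exists>l m. x = a \<odot> l + e \<odot> m"
      using fibre_basis by blast
    define b' where "b' = (\<lambda>k::nat. if k = 0 then (\<lambda>_::cp1. a) else (\<lambda>_. e))"
    have "ord_at E J 1 H (par c z) = (\<Sum>j\<le>1. int (id j) - int j)"
    proof (rule ord_at_adapted[OF J, where b = b'])
      show "b' j \<in> H" for j by (simp add: b'_def const)
      show "leads (\<lambda>u. R c u (b' j (par c u))) z (id j)" if "j \<le> 1" for j
      proof -
        have "a \<noteq> 0" using ae(1) by auto
        then have "leads (\<lambda>u. R c u a) z 0" "leads (\<lambda>u. R c u e) z 1"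
          using leads_const[of a c z] leads_const[OF ae(2), of c z] ae(1,3) by auto
        then show ?thesis using that by (auto simp: b'_def le_Suc_eq)
      qed
      show "\<exists>l. \<forall>p. \<psi> p - (\<Sum>j\<le>1. b' j p \<odot> l j) \<in> E p" if "\<psi> \<in> H" for \<psi>
      proof -
        obtain x where x: "\<forall>p. \<psi> p - x \<in> E p" using is_const[OF \<open>\<psi> \<in> H\<close>] by blast
        obtain l m where "x = a \<odot> l + e \<odot> m" using ae(4) by blast
        then show ?thesis
          using x by (intro exI[of _ "\<lambda>k. if k = 0 then l else m"]) (simp add: b'_def)
      qed
    qed auto
    then show ?thesis by (simp add: 1)
  qed
  then have "total_ord E J 1 H = 0" by (simp add: total_ord_def)
  \<comment> \<open>For n = 1, degree 1 and total order 0 the bracket on the right side is 2 (1 - 1)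
    + 0.\<close>
  then have "4 * (pi * real N) = 0"
    using eq unfolding plucker_equality_def n
    by (simp add: willmore_energy_eq[OF D J Js] energy bundle_degree_eq_1[OF J])
  then show False using N_pos by simp
qed

end

section \<open>The area integral of a rational curve\<close>

text \<open>Transfers the integral to pairs of reals, where it can be iterated.\<close>

lemma lborel_complex: "(lborel :: complex measure) = distr lborel borel (\<lambda>(x, y). Complex x y)"
proof (rule lborel_eqI)
  have cont: "continuous_on UNIV (\<lambda>(x, y). Complex x y)"
    unfolding Complex_eq case_prod_beta by (intro continuous_intros)
  then have meas: "(\<lambda>(x, y). Complex x y) \<in> borel_measurable lborel"
    by (simp add: borel_measurable_continuous_onI)
  fix l u :: complex
  assume le: "\<And>b. b \<in> Basis \<Longrightarrow> l \<bullet> b \<le> u \<bullet> b"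
  have le': "Re l \<le> Re u" "Im l \<le> Im u"
    using le[of 1] le[of \<i>] by (auto simp: Basis_complex_def inner_complex_def)
  have "(\<lambda>(x, y). Complex x y) -` box l u \<inter> space lborel = box (Re l, Im l) (Re u, Im u)"
    by (auto simp: box_def Basis_complex_def inner_complex_def Basis_prod_def)
  then have "emeasure (distr lborel borel (\<lambda>(x, y). Complex x y)) (box l u) =
      emeasure lborel (box (Re l, Im l) (Re u, Im u))"
    using meas by (subst emeasure_distr) auto
  also have "\<dots> = ennreal ((Re u - Re l) * (Im u - Im l))"
    using le' by (subst emeasure_lborel_box) (auto simp: Basis_prod_def prod.union_disjoint)
  also have "\<dots> = ennreal (\<Prod>b\<in>Basis. (u - l) \<bullet> b)"
    by (simp add: Basis_complex_def inner_complex_def)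
  finally show "emeasure (distr lborel borel (\<lambda>(x, y). Complex x y)) (box l u) = ennreal (\<Prod>b\<in>Basis. (u - l) \<bullet> b)" .
qed simp

lemma lborel_integral_complex:
  fixes g :: "complex \<Rightarrow> real"
  assumes "g \<in> borel_measurable borel"
  shows "(\<integral>z. g z \<partial>lborel) = (\<integral>p. g (Complex (fst p) (snd p)) \<partial>lborel)"
proof -
  have "continuous_on UNIV (\<lambda>(x, y). Complex x y)"
    unfolding Complex_eq case_prod_beta by (intro continuous_intros)
  then have "(\<lambda>(x, y). Complex x y) \<in> borel_measurable lborel"
    by (simp add: borel_measurable_continuous_onI)
  then show ?thesis
    using assms by (subst lborel_complex, subst integral_distr) (auto simp: case_prod_beta)
qed

text \<open>For nonnegative \<open>g\<close>, monotone convergence over the growing squares yields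
  integrability together with the value, so that the value is not the default 0 of a non-integrable
  function.\<close>

lemma lborel_integral_squares:
  fixes g :: "complex \<Rightarrow> real"
  assumes cont: "continuous_on UNIV g" and nonneg: "\<And>z. g z \<ge> 0"
    and lim: "(\<lambda>n. integral {- real n..real n} (\<lambda>x. integral {- real n..real n} (\<lambda>y. g (Complex x y)))) \<longlonglongrightarrow> I"
  shows "(\<integral>z. g z \<partial>lborel) = I"
proof -
  define G where "G = (\<lambda>p. g (Complex (fst p) (snd p)))"
  define S :: "nat \<Rightarrow> (real \<times> real) set" where "S n = cbox (- real n, - real n) (real n, real n)" for n
  have G: "continuous_on X G" for X
    unfolding G_def Complex_eq by (intro continuous_on_compose2[OF cont] continuous_intros) auto
  have int: "integrable lborel (\<lambda>p. indicator (S n) p *\<^sub>R G p)" for n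
    unfolding S_def by (intro borel_integrable_compact compact_cbox G)
  have "(\<integral>p. indicator (S n) p *\<^sub>R G p \<partial>lborel) = integral (S n) G" for n
    using set_borel_integral_eq_integral(2)[of "S n" G] int[of n]
    by (simp add: set_integrable_def set_lebesgue_integral_def)
  also have "integral (S n) G =
      integral {- real n..real n} (\<lambda>x. integral {- real n..real n} (\<lambda>y. g (Complex x y)))" for n
    unfolding S_def by (subst integral_prod_continuous[OF G]) (simp add: G_def)
  finally have lim': "(\<lambda>n. \<integral>p. indicator (S n) p *\<^sub>R G p \<partial>lborel) \<longlonglongrightarrow> I"
    using lim by simp
  have "(\<integral>p. G p \<partial>lborel) = I"
  proof (rule integral_monotone_convergence_nonneg(2)[OF int _ _ _ lim'])
    have sub: "S m \<subseteq> S n" if "m \<le> n" for m n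
      using that by (auto simp: S_def cbox_Pair_eq)
    show "AE p in lborel. mono (\<lambda>n. indicator (S n) p *\<^sub>R G p)"
    proof (intro AE_I2 monoI)
      fix p :: "real \<times> real" and m n :: nat
      assume "m \<le> n"
      show "indicator (S m) p *\<^sub>R G p \<le> indicator (S n) p *\<^sub>R G p"
        using subsetD[OF sub[OF \<open>m \<le> n\<close>], of p] nonneg by (auto simp: indicator_def G_def)
    qed
    show "AE p in lborel. 0 \<le> indicator (S n) p *\<^sub>R G p" for n
      using nonneg by (simp add: G_def)
    show "AE p in lborel. (\<lambda>n. indicator (S n) p *\<^sub>R G p) \<longlonglongrightarrow> G p"
    proof (intro AE_I2)
      fix p :: "real \<times> real"
      obtain m where m: "\<bar>fst p\<bar> \<le> real m" "\<bar>snd p\<bar> \<le> real m"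
        using real_arch_simple[of "max \<bar>fst p\<bar> \<bar>snd p\<bar>"] by auto
      have "p \<in> S n" if "n \<ge> m" for n
        using m that by (cases p) (auto simp: S_def cbox_Pair_eq)
      then have "\<forall>\<^sub>F n in sequentially. indicator (S n) p *\<^sub>R G p = G p"
        by (intro eventually_sequentiallyI[of m]) simp
      then show "(\<lambda>n. indicator (S n) p *\<^sub>R G p) \<longlonglongrightarrow> G p"
        by (rule tendsto_eventually)
    qed
    show "G \<in> borel_measurable lborel"
      using borel_measurable_continuous_onI[OF G] by simp
  qed
  then show ?thesis
    using lborel_integral_complex[OF borel_measurable_continuous_onI[OF cont]] by (simp add: G_def)
qed

text \<open>The contour integral of f dz along the boundary of the square of half side r around 0,
  taken counterclockwise: bottom minus top, and \<i> times right minus left.\<close>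

definition square_boundary :: "(complex \<Rightarrow> complex) \<Rightarrow> real \<Rightarrow> complex"
  where "square_boundary f r = integral {-r..r} (\<lambda>x. f (Complex x (-r)) - f (Complex x r))
    + \<i> * integral {-r..r} (\<lambda>y. f (Complex r y) - f (Complex (-r) y))"

text \<open>Green's theorem in complex form: the boundary integral of f dz is 2 \<i> times the area
  integral of the derivative of \<open>f\<close> in the conjugate variable, which is
  \<open>g\<close> by \<open>eq\<close>. The fundamental theorem of calculus treats each pair of
  opposite sides, and Fubini brings the two double integrals to the same order.\<close>

lemma green_square:
  assumes f: "\<And>z. (f has_derivative f' z) (at z)"
    and cont: "continuous_on UNIV (\<lambda>z. f' z 1)" "continuous_on UNIV (\<lambda>z. f' z \<i>)" "continuous_on UNIV g"
    and eq: "\<And>z. f' z 1 + \<i> * f' z \<i> = 2 * of_real (g z)" and r: "r \<ge> 0"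
  shows "square_boundary f r = 2 * \<i> * of_real (integral {-r..r} (\<lambda>x. integral {-r..r} (\<lambda>y. g (Complex x y))))"
proof -
  have c: "continuous_on X (\<lambda>p. Complex (u p) (v p))" if "continuous_on X u" "continuous_on X v"
    for X :: "'b::topological_space set" and u v
    unfolding Complex_eq by (intro continuous_intros that)
  have cg: "continuous_on X (\<lambda>p. g (Complex (u p) (v p)))" if "continuous_on X u" "continuous_on X v"
    for X :: "'b::topological_space set" and u v
    by (rule continuous_on_compose2[OF cont(3) c[OF that]]) simp
  have of_real: "integral {-r..r} (\<lambda>y. complex_of_real (u y)) = of_real (integral {-r..r} u)"
    if "continuous_on {-r..r} u" for u
    using integral_linear[OF integrable_continuous_real[OF that] bounded_linear_of_real] by (simp add: o_def)
  define fx where "fx = (\<lambda>x y. f' (Complex x y) 1)"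
  define fy where "fy = (\<lambda>x y. f' (Complex x y) \<i>)"
  have cfx: "continuous_on X (\<lambda>p. fx (u p) (v p))" "continuous_on X (\<lambda>p. fy (u p) (v p))"
    if "continuous_on X u" "continuous_on X v" for X :: "'b::topological_space set" and u v
    unfolding fx_def fy_def
    by (rule continuous_on_compose2[OF cont(1) c[OF that]] continuous_on_compose2[OF cont(2) c[OF that]], simp)+
  have cx: "((\<lambda>x. f (Complex x y)) has_vector_derivative fx x y) (at x within X)" for x y X
  proof -
    have "((\<lambda>x. Complex x y) has_derivative (\<lambda>t. t *\<^sub>R 1)) (at x within X)"
      unfolding Complex_eq by (auto intro!: derivative_eq_intros simp: scaleR_conv_of_real)
    from has_derivative_compose[OF this f] have "((\<lambda>x. f (Complex x y)) has_derivative (\<lambda>t. f' (Complex x y) (t *\<^sub>R 1))) (at x within X)" .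
    then show ?thesis
      unfolding has_vector_derivative_def fx_def
      by (simp add: linear_scale[OF has_derivative_linear[OF f]])
  qed
  have cy: "((\<lambda>y. f (Complex x y)) has_vector_derivative fy x y) (at y within X)" for x y X
  proof -
    have "((\<lambda>y. Complex x y) has_derivative (\<lambda>t. t *\<^sub>R \<i>)) (at y within X)"
      unfolding Complex_eq by (auto intro!: derivative_eq_intros simp: scaleR_conv_of_real)
    from has_derivative_compose[OF this f] have "((\<lambda>y. f (Complex x y)) has_derivative (\<lambda>t. f' (Complex x y) (t *\<^sub>R \<i>))) (at y within X)" .
    then show ?thesis
      unfolding has_vector_derivative_def fy_def
      by (simp add: linear_scale[OF has_derivative_linear[OF f]])
  qed
  have Ix: "integral {-r..r} (\<lambda>x. fx x y) = f (Complex r y) - f (Complex (-r) y)" for y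
    using fundamental_theorem_of_calculus[OF _ cx] r by (intro integral_unique) auto
  have Iy: "integral {-r..r} (\<lambda>y. fy x y) = f (Complex x r) - f (Complex x (-r))" for x
    using fundamental_theorem_of_calculus[OF _ cy] r by (intro integral_unique) auto
  have int: "(\<lambda>y. fx x y) integrable_on {-r..r}" "(\<lambda>y. fy x y) integrable_on {-r..r}" for x
    by (intro integrable_continuous_real cfx continuous_intros)+
  have cint: "continuous_on {-r..r} (\<lambda>x. integral {-r..r} (\<lambda>y. fx x y))"
    "continuous_on {-r..r} (\<lambda>x. integral {-r..r} (\<lambda>y. fy x y))"
  proof -
    have "continuous_on ({-r..r} \<times> cbox (-r) r) (\<lambda>(x, y). fx x y)"
      "continuous_on ({-r..r} \<times> cbox (-r) r) (\<lambda>(x, y). fy x y)"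
      unfolding case_prod_beta by (intro cfx continuous_on_fst continuous_on_snd continuous_on_id)+
    from this[THEN integral_continuous_on_param]
    show "continuous_on {-r..r} (\<lambda>x. integral {-r..r} (\<lambda>y. fx x y))"
      "continuous_on {-r..r} (\<lambda>x. integral {-r..r} (\<lambda>y. fy x y))"
      by simp_all
  qed
  have "square_boundary f r = integral {-r..r} (\<lambda>x. - integral {-r..r} (\<lambda>y. fy x y))
      + \<i> * integral {-r..r} (\<lambda>y. integral {-r..r} (\<lambda>x. fx x y))"
    unfolding square_boundary_def Ix Iy by simp
  also have "integral {-r..r} (\<lambda>y. integral {-r..r} (\<lambda>x. fx x y)) = integral {-r..r} (\<lambda>x. integral {-r..r} (\<lambda>y. fx x y))"
    using integral_swap_continuous[of "-r" "-r" r r fx]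
      cfx(1)[of "cbox (-r, -r) (r, r)" fst snd] by (simp add: case_prod_beta continuous_on_fst continuous_on_snd)
  also have "integral {-r..r} (\<lambda>x. - integral {-r..r} (\<lambda>y. fy x y)) + \<i> * \<dots> =
      integral {-r..r} (\<lambda>x. - integral {-r..r} (\<lambda>y. fy x y) + \<i> * integral {-r..r} (\<lambda>y. fx x y))"
    using cint by (subst integral_add) (auto intro!: integrable_continuous_real continuous_intros)
  also have "\<dots> = integral {-r..r} (\<lambda>x. 2 * \<i> * of_real (integral {-r..r} (\<lambda>y. g (Complex x y))))"
  proof (rule integral_cong)
    fix x
    have "- integral {-r..r} (\<lambda>y. fy x y) + \<i> * integral {-r..r} (\<lambda>y. fx x y) =
        integral {-r..r} (\<lambda>y. - fy x y + \<i> * fx x y)"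
      using int[of x] by (subst integral_add) (auto intro!: integrable_neg)
    also have "\<dots> = integral {-r..r} (\<lambda>y. 2 * \<i> * of_real (g (Complex x y)))"
    proof (rule integral_cong)
      fix y
      have "- fy x y + \<i> * fx x y = \<i> * (fx x y + \<i> * fy x y)" by (simp add: algebra_simps)
      then show "- fy x y + \<i> * fx x y = 2 * \<i> * of_real (g (Complex x y))"
        using eq[of "Complex x y"] by (simp add: fx_def fy_def)
    qed
    also have "\<dots> = 2 * \<i> * of_real (integral {-r..r} (\<lambda>y. g (Complex x y)))"
      by (simp add: of_real cg)
    finally show "- integral {-r..r} (\<lambda>y. fy x y) + \<i> * integral {-r..r} (\<lambda>y. fx x y) =
        2 * \<i> * of_real (integral {-r..r} (\<lambda>y. g (Complex x y)))" .
  qed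
  also have "\<dots> = 2 * \<i> * of_real (integral {-r..r} (\<lambda>x. integral {-r..r} (\<lambda>y. g (Complex x y))))"
  proof -
    have "continuous_on ({-r..r} \<times> cbox (-r) r) (\<lambda>(x, y). g (Complex x y))"
      unfolding case_prod_beta by (intro cg continuous_on_fst continuous_on_snd continuous_on_id)
    from integral_continuous_on_param[OF this] show ?thesis
      by (simp add: of_real)
  qed
  finally show ?thesis .
qed

text \<open>An antiderivative is 2 arctan (x / r). Up to a factor \<i>, the value \<pi> is the share
  of two opposite sides of the square in the residue integral of 1/z.\<close>

lemma arctan_integral:
  assumes "r > (0::real)"
  shows "((\<lambda>x. 2 * r / (x\<^sup>2 + r\<^sup>2)) has_integral pi) {-r..r}"
proof -
  have "((\<lambda>x. 2 * r / (x\<^sup>2 + r\<^sup>2)) has_integral (2 * arctan (r / r) - 2 * arctan (- r / r))) {-r..r}"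
  proof (rule fundamental_theorem_of_calculus)
    fix x
    have "((\<lambda>x. 2 * arctan (x / r)) has_real_derivative 2 * r / (x\<^sup>2 + r\<^sup>2)) (at x)"
    proof -
      have "((\<lambda>x. arctan (x * inverse r)) has_real_derivative inverse (1 + (x * inverse r)\<^sup>2) * inverse r) (at x)"
        by (rule DERIV_chain2[OF DERIV_arctan]) (auto intro!: derivative_eq_intros)
      then have "((\<lambda>x. 2 * arctan (x / r)) has_real_derivative 2 * (inverse (1 + (x / r)\<^sup>2) * inverse r)) (at x)"
        by (intro DERIV_cmult) (simp add: divide_inverse)
      moreover have "2 * (inverse (1 + (x / r)\<^sup>2) * inverse r) = 2 * r / (x\<^sup>2 + r\<^sup>2)"
      proof -
        have "1 + (x / r)\<^sup>2 = (x\<^sup>2 + r\<^sup>2) / r\<^sup>2"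
          using assms by (simp add: power_divide add_divide_distrib)
        then show ?thesis
          using assms by (simp only: inverse_divide) (simp add: power2_eq_square inverse_eq_divide)
      qed
      ultimately show ?thesis by simp
    qed
    then show "((\<lambda>x. 2 * arctan (x / r)) has_vector_derivative 2 * r / (x\<^sup>2 + r\<^sup>2)) (at x within {-r..r})"
      using has_real_derivative_iff_has_vector_derivative has_vector_derivative_at_within by blast
  qed (use assms in simp)
  then show ?thesis
    using assms by (simp add: arctan_minus arctan_one)
qed

text \<open>The term d / z contributes its residue 2 \<pi> \<i> d exactly; the remainder is at most
  C / r^2 on a boundary of length 8 r.\<close>

lemma square_boundary_estimate:
  assumes cont: "continuous_on UNIV f" and r: "r > 0"
    and C: "\<And>z. norm z \<ge> r \<Longrightarrow> norm (f z - of_real d / z) \<le> C / r\<^sup>2"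
  shows "norm (square_boundary f r - 2 * \<i> * of_real (pi * d)) \<le> 8 * C / r"
proof -
  have edge: "norm (integral {-r..r} F - c * of_real (pi * d)) \<le> 4 * C / r"
    if F: "continuous_on {-r..r} F" and est: "\<And>x. norm (F x - c * of_real d * of_real (2 * r / (x\<^sup>2 + r\<^sup>2))) \<le> 2 * (C / r\<^sup>2)"
    for F and c :: complex
  proof -
    have A: "((\<lambda>x. c * of_real d * of_real (2 * r / (x\<^sup>2 + r\<^sup>2))) has_integral c * of_real d * of_real pi) {-r..r}"
      by (intro has_integral_mult_right has_integral_of_real arctan_integral r)
    have "((\<lambda>x. F x - c * of_real d * of_real (2 * r / (x\<^sup>2 + r\<^sup>2))) has_integral integral {-r..r} F - c * of_real d * of_real pi) {-r..r}"
      by (intro has_integral_diff A integrable_integral integrable_continuous_real F)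
    then have "norm (integral {-r..r} F - c * of_real d * of_real pi) \<le> 2 * (C / r\<^sup>2) * measure lborel {-r..r}"
      using r est order_trans[OF norm_ge_zero est] by (intro has_integral_bound_real) auto
    also have "\<dots> = 4 * C / r"
      using r by (simp add: power2_eq_square field_simps)
    finally show ?thesis by (simp add: mult_ac)
  qed
  have diff: "norm (f a - f b - (of_real d / a - of_real d / b)) \<le> 2 * (C / r\<^sup>2)" if "norm a \<ge> r" "norm b \<ge> r" for a b
  proof -
    have *: "f a - f b - (of_real d / a - of_real d / b) = (f a - of_real d / a) - (f b - of_real d / b)" by simp
    show ?thesis
      unfolding *
      using norm_triangle_ineq4[of "f a - of_real d / a" "f b - of_real d / b"] C[OF that(1)] C[OF that(2)] by simp
  qed
  have cc: "continuous_on X (\<lambda>p. f (Complex (u p) (v p)))" if "continuous_on X u" "continuous_on X v"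
    for X :: "real set" and u v
    unfolding Complex_eq by (intro continuous_on_compose2[OF cont] continuous_intros that) auto
  have n: "norm (Complex x r) \<ge> r" "norm (Complex x (-r)) \<ge> r" "norm (Complex r x) \<ge> r" "norm (Complex (-r) x) \<ge> r" for x
    using r by (auto simp: cmod_def intro!: real_le_rsqrt)
  have inv: "1 / Complex x (-r) - 1 / Complex x r = \<i> * of_real (2 * r / (x\<^sup>2 + r\<^sup>2))"
    "1 / Complex r x - 1 / Complex (-r) x = of_real (2 * r / (x\<^sup>2 + r\<^sup>2))" for x
  proof -
    have i: "1 / Complex a b = Complex a (- b) / of_real (a\<^sup>2 + b\<^sup>2)" for a b
      using complex_div_cnj[of 1 "Complex a b"] unfolding cmod_power2 by (simp add: complex_eq_iff)
    show "1 / Complex x (-r) - 1 / Complex x r = \<i> * of_real (2 * r / (x\<^sup>2 + r\<^sup>2))"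
      unfolding i by (simp add: complex_eq_iff Re_divide_of_real Im_divide_of_real)
    show "1 / Complex r x - 1 / Complex (-r) x = of_real (2 * r / (x\<^sup>2 + r\<^sup>2))"
      unfolding i by (simp add: complex_eq_iff add.commute)
  qed
  have A: "norm (integral {-r..r} (\<lambda>x. f (Complex x (-r)) - f (Complex x r)) - \<i> * of_real (pi * d)) \<le> 4 * C / r"
  proof (rule edge)
    fix x
    have "of_real d / Complex x (-r) - of_real d / Complex x r = \<i> * of_real d * of_real (2 * r / (x\<^sup>2 + r\<^sup>2))"
      using arg_cong[OF inv(1)[of x], of "\<lambda>z. of_real d * z"] by (simp add: algebra_simps)
    then show "norm (f (Complex x (-r)) - f (Complex x r) - \<i> * of_real d * of_real (2 * r / (x\<^sup>2 + r\<^sup>2))) \<le> 2 * (C / r\<^sup>2)"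
      using diff[OF n(2) n(1), of x x] by simp
  qed (intro continuous_intros cc)
  have B: "norm (integral {-r..r} (\<lambda>y. f (Complex r y) - f (Complex (-r) y)) - 1 * of_real (pi * d)) \<le> 4 * C / r"
  proof (rule edge)
    fix y
    have "of_real d / Complex r y - of_real d / Complex (-r) y = 1 * of_real d * of_real (2 * r / (y\<^sup>2 + r\<^sup>2))"
      using arg_cong[OF inv(2)[of y], of "\<lambda>z. of_real d * z"] by (simp add: algebra_simps)
    then show "norm (f (Complex r y) - f (Complex (-r) y) - 1 * of_real d * of_real (2 * r / (y\<^sup>2 + r\<^sup>2))) \<le> 2 * (C / r\<^sup>2)"
      using diff[OF n(3) n(4), of y y] by simp
  qed (intro continuous_intros cc)
  have eq: "square_boundary f r - 2 * \<i> * of_real (pi * d) =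
      (integral {-r..r} (\<lambda>x. f (Complex x (-r)) - f (Complex x r)) - \<i> * of_real (pi * d)) +
      \<i> * (integral {-r..r} (\<lambda>y. f (Complex r y) - f (Complex (-r) y)) - 1 * of_real (pi * d))"
    (is "?l = ?a + \<i> * ?b")
    by (simp add: square_boundary_def algebra_simps)
  have "norm (?a + \<i> * ?b) \<le> norm ?a + norm ?b"
    using norm_triangle_ineq[of ?a "\<i> * ?b"] by (simp add: norm_mult)
  also have "\<dots> \<le> 4 * C / r + 4 * C / r"
    by (intro add_mono A B)
  finally show ?thesis unfolding eq by simp
qed

text \<open>By \<open>green_square\<close> the area integral over a square is a boundary integral,
  and by the decay of \<open>f\<close> the latter tends to 2 \<pi> \<i> d.\<close>

lemma integral_dbar_plane:
  assumes f: "\<And>z. (f has_derivative f' z) (at z)"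
    and cont: "continuous_on UNIV (\<lambda>z. f' z 1)" "continuous_on UNIV (\<lambda>z. f' z \<i>)" "continuous_on UNIV g"
    and eq: "\<And>z. f' z 1 + \<i> * f' z \<i> = 2 * of_real (g z)" and g: "\<And>z. g z \<ge> 0"
    and decay: "\<And>z. norm z \<ge> r0 \<Longrightarrow> norm (f z - of_real d / z) \<le> C / (norm z)\<^sup>2"
    and C: "C \<ge> 0" "r0 > 0"
  shows "(\<integral>z. g z \<partial>lborel) = pi * d"
proof (rule lborel_integral_squares[OF cont(3) g])
  let ?I = "\<lambda>n. integral {- real n..real n} (\<lambda>x. integral {- real n..real n} (\<lambda>y. g (Complex x y)))"
  have fc: "continuous_on UNIV f"
    using f has_derivative_continuous continuous_at_imp_continuous_on by blast
  have "\<forall>\<^sub>F n in sequentially. norm (2 * \<i> * of_real (?I n) - 2 * \<i> * of_real (pi * d)) \<le> 8 * C / real n"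
  proof (rule eventually_sequentiallyI)
    fix n assume n: "n \<ge> nat \<lceil>r0\<rceil>"
    then have n': "real n \<ge> r0" "real n > 0" using C(2) by linarith+
    have "norm (square_boundary f (real n) - 2 * \<i> * of_real (pi * d)) \<le> 8 * C / real n"
    proof (rule square_boundary_estimate[OF fc n'(2)])
      fix z :: complex assume z: "norm z \<ge> real n"
      have "norm (f z - of_real d / z) \<le> C / (norm z)\<^sup>2" using z n' by (intro decay) simp
      also have "\<dots> \<le> C / (real n)\<^sup>2"
        using z n' C(1) by (intro divide_left_mono power_mono mult_pos_pos zero_less_power) auto
      finally show "norm (f z - of_real d / z) \<le> C / (real n)\<^sup>2" .
    qed
    then show "norm (2 * \<i> * of_real (?I n) - 2 * \<i> * of_real (pi * d)) \<le> 8 * C / real n"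
      using green_square[OF f cont eq, of "real n"] by simp
  qed
  moreover have "(\<lambda>n. 8 * C / real n) \<longlonglongrightarrow> 0"
    by (rule lim_const_over_n)
  ultimately have "(\<lambda>n. 2 * \<i> * of_real (?I n) - 2 * \<i> * of_real (pi * d)) \<longlonglongrightarrow> 0"
    by (rule Lim_null_comparison)
  then have "(\<lambda>n. norm (2 * \<i> * of_real (?I n) - 2 * \<i> * of_real (pi * d)) / 2) \<longlonglongrightarrow> 0"
    using tendsto_norm_zero tendsto_divide_zero by blast
  moreover have "norm (2 * \<i> * of_real (?I n) - 2 * \<i> * of_real (pi * d)) / 2 = \<bar>?I n - pi * d\<bar>" for n
  proof -
    have "2 * \<i> * of_real (?I n) - 2 * \<i> * of_real (pi * d) = 2 * \<i> * of_real (?I n - pi * d)"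
      by (simp add: algebra_simps)
    then show ?thesis by (simp only: norm_mult norm_of_real) simp
  qed
  ultimately have "(\<lambda>n. \<bar>?I n - pi * d\<bar>) \<longlonglongrightarrow> 0" by simp
  then show "?I \<longlonglongrightarrow> pi * d"
    using tendsto_rabs_zero_iff LIM_zero_cancel by blast
qed

section \<open>Polynomials in the coordinate at infinity and the area of a rational curve\<close>

definition hat_poly :: "nat \<Rightarrow> complex poly \<Rightarrow> complex poly"
  where "hat_poly n p = monom 1 (n - degree p) * reflect_poly p"

lemma poly_hat_poly:
  assumes "degree p \<le> n" "w \<noteq> 0"
  shows "poly (hat_poly n p) w = w ^ n * poly p (1 / w)"
proof -
  have "w ^ (n - degree p) * w ^ degree p = w ^ n"
    using assms(1) by (simp flip: power_add)
  then show ?thesis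
    using assms(2) by (simp add: hat_poly_def poly_monom poly_reflect_poly_nz inverse_eq_divide flip: mult.assoc)
qed

lemma poly_hat_poly_0:
  assumes "degree p \<le> n"
  shows "poly (hat_poly n p) 0 = coeff p n"
  using assms by (cases "degree p = n") (auto simp: hat_poly_def poly_monom coeff_eq_0)

text \<open>The integrand is the density of the area that the curve (P : Q) inherits from the
  Fubini-Study metric, normalized so that the projective line has area \<pi>. With N = |P|^2 + |Q|^2
  it is the conjugate derivative of a / N, where a is the z-derivative of N, and a / N equals d / z
  up to O(1 / |z|^2) at infinity.\<close>

lemma area_rational_curve:
  fixes P Q :: "complex poly"
  assumes no_zero: "\<And>z. poly P z \<noteq> 0 \<or> poly Q z \<noteq> 0"
  defines "d \<equiv> max (degree P) (degree Q)"
  shows "(\<integral>z. (norm (poly (P * pderiv Q - Q * pderiv P) z))\<^sup>2 /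
      ((norm (poly P z))\<^sup>2 + (norm (poly Q z))\<^sup>2)\<^sup>2 \<partial>lborel) = pi * real d"
proof -
  define P' Q' where "P' = pderiv P" and "Q' = pderiv Q"
  define P'' Q'' where "P'' = pderiv P'" and "Q'' = pderiv Q'"
  define N where "N z = poly P z * cnj (poly P z) + poly Q z * cnj (poly Q z)" for z
  define a where "a z = cnj (poly P z) * poly P' z + cnj (poly Q z) * poly Q' z" for z
  define a' where "a' z v = cnj (poly P z) * (poly P'' z * v) + cnj (poly P' z * v) * poly P' z
      + (cnj (poly Q z) * (poly Q'' z * v) + cnj (poly Q' z * v) * poly Q' z)" for z v
  define N' where "N' z v = poly P z * cnj (poly P' z * v) + (poly P' z * v) * cnj (poly P z)
      + (poly Q z * cnj (poly Q' z * v) + (poly Q' z * v) * cnj (poly Q z))" for z v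
  define n where "n z = (norm (poly P z))\<^sup>2 + (norm (poly Q z))\<^sup>2" for z
  have n_pos: "n z > 0" for z
    using no_zero[of z] by (auto simp: n_def add_pos_nonneg add_nonneg_pos)
  have Nn: "N z = of_real (n z)" for z
    by (simp only: N_def n_def complex_norm_square of_real_add)
  have N0: "N z \<noteq> 0" for z using n_pos[of z] by (simp add: Nn)
  have dp: "((\<lambda>z. poly p z) has_derivative (\<lambda>v. poly (pderiv p) z * v)) (at z)" for p :: "complex poly" and z
    using poly_DERIV[of p z] by (simp add: has_field_derivative_def)
  have dcp: "((\<lambda>z. cnj (poly p z)) has_derivative (\<lambda>v. cnj (poly (pderiv p) z * v))) (at z)"
    for p :: "complex poly" and z
    using bounded_linear.has_derivative[OF bounded_linear_cnj dp] .
  have da: "(a has_derivative a' z) (at z)" for z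
    unfolding a_def a'_def P''_def Q''_def P'_def Q'_def
    by (intro has_derivative_add has_derivative_mult dp dcp)
  have dN: "(N has_derivative N' z) (at z)" for z
    unfolding N_def N'_def P'_def Q'_def
    by (intro has_derivative_add has_derivative_mult dp dcp)
  define f' where "f' z v = (a' z v * N z - a z * N' z v) / (N z * N z)" for z v
  have f: "((\<lambda>z. a z / N z) has_derivative f' z) (at z)" for z
    unfolding f'_def using has_derivative_divide'[OF da dN N0] .
  define K where "K = P * Q' - Q * P'"
  have cont: "continuous_on UNIV (\<lambda>z. poly p z)" "continuous_on UNIV (\<lambda>z. cnj (poly p z))" for p
    by (intro continuous_intros)+
  have "(\<integral>z. (norm (poly K z))\<^sup>2 / (n z)\<^sup>2 \<partial>lborel) = pi * real d"
  proof -
    have cf: "continuous_on UNIV (\<lambda>z. f' z v)" for v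
      unfolding f'_def by (intro continuous_on_divide)
        (auto simp: a'_def a_def N_def N'_def N0[unfolded N_def] intro!: continuous_intros)
    have cg: "continuous_on UNIV (\<lambda>z. (norm (poly K z))\<^sup>2 / (n z)\<^sup>2)"
    proof (intro continuous_on_divide ballI)
      show "continuous_on UNIV (\<lambda>z. (n z)\<^sup>2)"
        unfolding n_def by (intro continuous_intros)
      show "(n z)\<^sup>2 \<noteq> 0" for z using n_pos[of z] by simp
    qed (intro continuous_intros)
    have eq: "f' z 1 + \<i> * f' z \<i> = 2 * of_real ((norm (poly K z))\<^sup>2 / (n z)\<^sup>2)" for z
    proof -
      have ii: "\<i> * (\<i> * x) = - x" for x :: complex
        by (simp flip: mult.assoc)
      have 1: "a' z 1 + \<i> * a' z \<i> = 2 * (cnj (poly P' z) * poly P' z + cnj (poly Q' z) * poly Q' z)"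
        by (simp add: a'_def algebra_simps ii)
      have 2: "N' z 1 + \<i> * N' z \<i> = 2 * (poly P z * cnj (poly P' z) + poly Q z * cnj (poly Q' z))"
        by (simp add: N'_def algebra_simps ii)
      have "f' z 1 + \<i> * f' z \<i> = ((a' z 1 + \<i> * a' z \<i>) * N z - a z * (N' z 1 + \<i> * N' z \<i>)) / (N z * N z)"
        by (simp add: f'_def add_divide_distrib diff_divide_distrib algebra_simps)
      also have "(a' z 1 + \<i> * a' z \<i>) * N z - a z * (N' z 1 + \<i> * N' z \<i>) =
          2 * (poly K z * cnj (poly K z))"
        unfolding 1 2 by (simp add: a_def N_def K_def algebra_simps)
      finally show ?thesis
        by (simp add: Nn power2_eq_square flip: complex_norm_square)
    qed
    define p q where "p = hat_poly d P" and "q = hat_poly d Q"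
    \<comment> \<open>Passing from r to z r' - d r kills the coefficient of z^d; this makes z a - d
      N smaller than N by one power of z.\<close>
    define p1 q1 where "p1 = [:0, 1:] * P' - smult (of_nat d) P" and "q1 = [:0, 1:] * Q' - smult (of_nat d) Q"
    have deg1: "degree ([:0, 1:] * pderiv r - smult (of_nat d) r) \<le> d" "coeff ([:0, 1:] * pderiv r - smult (of_nat d) r) d = 0"
      if "degree r \<le> d" for r :: "complex poly"
    proof -
      show "degree ([:0, 1:] * pderiv r - smult (of_nat d) r) \<le> d"
        using that by (intro degree_diff_le) (auto simp: degree_pderiv degree_pCons_eq_if pderiv_eq_0_iff)
      show "coeff ([:0, 1:] * pderiv r - smult (of_nat d) r) d = 0"
        by (cases d) (auto simp: coeff_pderiv)
    qed
    have deg: "degree P \<le> d" "degree Q \<le> d" by (auto simp: d_def)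
    have "poly (hat_poly d p1) 0 = 0" "poly (hat_poly d q1) 0 = 0"
      unfolding p1_def q1_def P'_def Q'_def using deg1 deg by (simp_all add: poly_hat_poly_0)
    then obtain p2 q2 where p2: "hat_poly d p1 = [:0, 1:] * p2" and q2: "hat_poly d q1 = [:0, 1:] * q2"
      unfolding poly_eq_0_iff_dvd by (auto elim!: dvdE)
    define m where "m w = (norm (poly p w))\<^sup>2 + (norm (poly q w))\<^sup>2" for w
    have "m 0 \<noteq> 0"
    proof -
      have "P \<noteq> 0 \<or> Q \<noteq> 0" using no_zero[of 0] by auto
      then have "coeff P d \<noteq> 0 \<or> coeff Q d \<noteq> 0"
        unfolding d_def max_def using le_degree[of P] le_degree[of Q]
        by (metis leading_coeff_0_iff degree_0 le_0_eq nat_le_linear)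
      then show ?thesis
        by (auto simp: m_def p_def q_def poly_hat_poly_0 deg add_nonneg_eq_0_iff)
    qed
    \<comment> \<open>In the coordinate w = 1/z the error a / N - d / z is w^2 \<phi> w, and \<phi>
      is continuous at w = 0, because \<open>m\<close> is nonzero there.\<close>
    define \<phi> where "\<phi> w = (cnj (poly p w) * poly p2 w + cnj (poly q w) * poly q2 w) / of_real (m w)" for w
    have "isCont m 0"
      unfolding m_def by (intro continuous_intros)
    then have "isCont \<phi> 0"
      unfolding \<phi>_def using \<open>m 0 \<noteq> 0\<close> by (intro continuous_intros) simp_all
    then obtain e where e: "e > 0" "\<And>w. dist w 0 < e \<Longrightarrow> dist (\<phi> w) (\<phi> 0) < 1"
      unfolding continuous_at_eps_delta using zero_less_one by blast
    have mw: "poly r z = z ^ d * poly (hat_poly d r) (1 / z)" if "z \<noteq> 0" "degree r \<le> d" for z r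
      using that poly_hat_poly[of r d "1 / z"] by (simp add: power_divide)
    have decay: "norm (a z / N z - of_real (real d) / z) \<le> (norm (\<phi> 0) + 1) / (norm z)\<^sup>2"
      if z: "norm z \<ge> 2 / e" for z
    proof -
      have z0: "z \<noteq> 0" using z e(1) by (metis divide_pos_pos norm_zero not_le zero_less_numeral)
      define w where "w = 1 / z"
      have w: "norm w < e" using z e(1) z0
        by (simp add: w_def norm_divide field_simps)
      have wz: "w * z = 1" using z0 by (simp add: w_def)
      have "z * a z - of_nat d * N z = cnj (poly P z) * poly p1 z + cnj (poly Q z) * poly q1 z"
        by (simp add: a_def N_def p1_def q1_def algebra_simps)
      also have "poly P z = z ^ d * poly p w"
        using mw[OF z0 deg(1)] by (simp add: p_def w_def)
      also have "poly Q z = z ^ d * poly q w"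
        using mw[OF z0 deg(2)] by (simp add: q_def w_def)
      also have "poly p1 z = z ^ d * (w * poly p2 w)"
        using mw[OF z0 deg1(1)[OF deg(1)]] p2 by (simp add: p1_def P'_def w_def)
      also have "poly q1 z = z ^ d * (w * poly q2 w)"
        using mw[OF z0 deg1(1)[OF deg(2)]] q2 by (simp add: q1_def Q'_def w_def)
      finally have A: "z * a z - of_nat d * N z =
          cnj (z ^ d) * z ^ d * w * (cnj (poly p w) * poly p2 w + cnj (poly q w) * poly q2 w)"
        by (simp add: algebra_simps)
      have B: "N z = cnj (z ^ d) * z ^ d * of_real (m w)"
        using mw[OF z0 deg(1)] mw[OF z0 deg(2)]
        unfolding N_def m_def of_real_add complex_norm_square p_def q_def w_def by (simp add: algebra_simps)
      have "m w \<noteq> 0" using B N0[of z] by auto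
      have "a z / N z - of_real (real d) / z = w * ((z * a z - of_nat d * N z) / N z)"
        using N0[of z] z0 by (simp add: w_def field_simps)
      also have "\<dots> = w * (w * \<phi> w)"
        unfolding A unfolding B \<phi>_def using z0 \<open>m w \<noteq> 0\<close> by simp
      finally have "norm (a z / N z - of_real (real d) / z) = (norm w)\<^sup>2 * norm (\<phi> w)"
        by (simp add: norm_mult power2_eq_square)
      also have "norm (\<phi> w) \<le> norm (\<phi> 0) + 1"
        using e(2)[of w] w norm_triangle_ineq2[of "\<phi> w" "\<phi> 0"] by (simp add: dist_norm)
      then have "(norm w)\<^sup>2 * norm (\<phi> w) \<le> (norm w)\<^sup>2 * (norm (\<phi> 0) + 1)"
        by (intro mult_left_mono) auto
      finally show ?thesis
        by (simp add: w_def norm_divide power_divide)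
    qed
    show ?thesis
    proof (rule integral_dbar_plane[OF f cf cf cg eq])
      show "norm (a z / N z - of_real (real d) / z) \<le> (norm (\<phi> 0) + 1) / (norm z)\<^sup>2"
        if "norm z \<ge> 2 / e" for z
        using that by (rule decay)
    qed (use e(1) in auto)
  qed
  then show ?thesis
    unfolding K_def P'_def Q'_def n_def .
qed

section \<open>Spinor data of one chart\<close>

text \<open>With s = p - k q, the derivative of s^-1 Y is a complex linear term minus s^-1 s' times
  s^-1 Y. Since s^-1 = (cnj p + k q) / (|p|^2 + |q|^2), the factor s^-1 s' splits into a complex
  linear part, which the (0,1)-part kills, and k h dz.\<close>

lemma hol_at_inverse_spinor:
  assumes p: "(p has_field_derivative p') (at z)" and q: "(q has_field_derivative q') (at z)"
    and nz: "p z \<noteq> 0 \<or> q z \<noteq> 0"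
    and Y: "(Y has_derivative (\<lambda>v. (qc (p z) - quat_k * qc (q z)) * qc v * \<gamma>)) (at z)"
  shows "hol_at ((q z * p' - p z * q') / of_real ((norm (p z))\<^sup>2 + (norm (q z))\<^sup>2))
    (\<lambda>u. inverse (qc (p u) - quat_k * qc (q u)) * Y u) z"
proof -
  define s where "s u = qc (p u) - quat_k * qc (q u)" for u
  define N where "N = (norm (p z))\<^sup>2 + (norm (q z))\<^sup>2"
  have N: "N \<noteq> 0" using nz by (auto simp: N_def add_nonneg_eq_0_iff)
  have sN: "(qc (cnj (p z)) + quat_k * qc (q z)) * s z = of_real N"
    unfolding s_def N_def cmod_power2 by (simp add: quat_eq_iff of_real_def power2_eq_square)
  then have s0: "s z \<noteq> 0" using N by auto
  have inv_s: "inverse (s z) = (1 / N) *\<^sub>R (qc (cnj (p z)) + quat_k * qc (q z))"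
  proof -
    have "((1 / N) *\<^sub>R (qc (cnj (p z)) + quat_k * qc (q z))) * s z = 1"
      using sN N by (simp add: of_real_def)
    then show ?thesis
      using s0 by (metis inverse_unique left_inverse mult.assoc mult.right_neutral mult_1)
  qed
  define s' where "s' v = qc (p' * v) - quat_k * qc (q' * v)" for v
  have ds: "(s has_derivative s') (at z)"
    unfolding s_def s'_def
    using p q unfolding has_field_derivative_def
    by (intro has_derivative_diff has_derivative_mult_right bounded_linear.has_derivative[OF bounded_linear_qc])
  define \<eta> where "\<eta> = inverse (s z) * Y z"
  have "((\<lambda>u. inverse (s u) * Y u) has_derivative
      (\<lambda>v. inverse (s z) * (s z * qc v * \<gamma>) + - (inverse (s z) * s' v * inverse (s z)) * Y z)) (at z)"
    by (intro has_derivative_mult Deriv.has_derivative_inverse s0 ds Y[folded s_def])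
  moreover have "inverse (s z) * (s z * qc v * \<gamma>) + - (inverse (s z) * s' v * inverse (s z)) * Y z =
      qc v * \<gamma> - inverse (s z) * s' v * \<eta>" for v
    using s0 by (simp add: \<eta>_def mult.assoc) (simp flip: mult.assoc)
  ultimately have d: "((\<lambda>u. inverse (s u) * Y u) has_derivative (\<lambda>v. qc v * \<gamma> - inverse (s z) * s' v * \<eta>)) (at z)"
    by simp
  define h where "h = (q z * p' - p z * q') / of_real N"
  have s'_eq: "inverse (s z) * s' v + qc \<i> * (inverse (s z) * s' (\<i> * v)) = 2 *\<^sub>R (quat_k * qc (h * v))" for v
  proof -
    have *: "inverse (s z) * s' v =
        qc ((cnj (p z) * p' + cnj (q z) * q') / of_real N * v) + quat_k * qc (h * v)" for v
    proof -
      have N: "(1 / N) *\<^sub>R qc w = qc (w / of_real N)" for w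
        by (simp add: quat_eq_iff Re_divide_of_real Im_divide_of_real)
      have "inverse (s z) * s' v = (1 / N) *\<^sub>R ((qc (cnj (p z)) + quat_k * qc (q z)) * s' v)"
        unfolding inv_s by (rule mult_scaleR_left)
      also have "(qc (cnj (p z)) + quat_k * qc (q z)) * s' v =
          qc ((cnj (p z) * p' + cnj (q z) * q') * v) + quat_k * qc ((q z * p' - p z * q') * v)"
        unfolding s'_def by (simp add: quat_eq_iff algebra_simps)
      finally show ?thesis
        unfolding scaleR_add_right mult_scaleR_right[symmetric] N by (simp add: h_def)
    qed
    have "qc (a * v) + quat_k * qc (h * v) + qc \<i> * (qc (a * (\<i> * v)) + quat_k * qc (h * (\<i> * v))) =
        2 *\<^sub>R (quat_k * qc (h * v))" for a
      by (simp add: quat_eq_iff algebra_simps)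
    then show ?thesis unfolding * .
  qed
  show ?thesis
    unfolding hol_at_def s_def[symmetric] N_def[symmetric] h_def[symmetric]
  proof (intro exI conjI allI)
    show "((\<lambda>u. inverse (s u) * Y u) has_derivative (\<lambda>v. qc v * \<gamma> - inverse (s z) * s' v * \<eta>)) (at z)"
      by (rule d)
    fix v
    have "qc v * \<gamma> + qc \<i> * (qc (\<i> * v) * \<gamma>) = 0"
      by (simp add: qc_mult mult.assoc qc_i_qc_i)
    then have "qc v * \<gamma> - inverse (s z) * s' v * \<eta> + qc \<i> * (qc (\<i> * v) * \<gamma> - inverse (s z) * s' (\<i> * v) * \<eta>) =
        - ((inverse (s z) * s' v + qc \<i> * (inverse (s z) * s' (\<i> * v))) * \<eta>)"
      by (simp add: algebra_simps)
    then show "qc v * \<gamma> - inverse (s z) * s' v * \<eta> + qc \<i> * (qc (\<i> * v) * \<gamma> - inverse (s z) * s' (\<i> * v) * \<eta>) =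
        - (2 *\<^sub>R (quat_k * qc (h * v) * (inverse (s z) * Y z)))"
      unfolding s'_eq \<eta>_def by simp
  qed
qed

lemma hol_at_cong:
  assumes "hol_at h f z" "open S" "z \<in> S" "\<And>u. u \<in> S \<Longrightarrow> f u = g u"
  shows "hol_at h g z"
proof -
  obtain f' where f': "(f has_derivative f') (at z)"
    "\<forall>v. f' v + qc \<i> * f' (\<i> * v) = - (2 *\<^sub>R (quat_k * qc (h * v) * f z))"
    using assms(1) unfolding hol_at_def by blast
  have "(g has_derivative f') (at z)"
    by (rule has_derivative_transform_within_open[OF f'(1) assms(2,3)]) (rule assms(4))
  then show ?thesis
    unfolding hol_at_def using f'(2) assms(4)[OF assms(3)] by auto
qed

lemma zero_by_continuity:
  fixes f :: "complex \<Rightarrow> 'a::real_normed_vector"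
  assumes "isCont f z" "\<forall>\<^sub>F u in at z. f u = 0"
  shows "f z = 0"
proof -
  have "(f \<longlongrightarrow> 0) (at z)"
    using assms(2) by (rule tendsto_eventually)
  then show ?thesis
    using assms(1) unfolding isCont_def by (rule tendsto_unique[OF trivial_limit_at, rotated])
qed

lemma eventually_at_poly_nonzero:
  fixes p :: "complex poly"
  assumes "p \<noteq> 0"
  shows "\<forall>\<^sub>F u in at z. poly p u \<noteq> 0"
proof -
  have "finite {u. poly p u = 0}" using assms poly_roots_finite by blast
  then have "\<not> z islimpt {u. poly p u = 0}" by (rule islimpt_finite)
  then show ?thesis by (simp add: islimpt_iff_eventually)
qed

text \<open>Both sides of the equation are continuous, and the zeros of \<open>D\<close> are
  isolated.\<close>

lemma hol_at_closure:
  assumes f: "smooth_on UNIV f" and h: "continuous_on UNIV h" and D: "D \<noteq> 0"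
    and hol: "\<And>z. poly D z \<noteq> 0 \<Longrightarrow> hol_at (h z) f z"
  shows "hol_at (h z) f z"
proof -
  have F: "(f has_derivative frechet_derivative f (at u)) (at u)" for u
    using smooth_on_has_derivative[OF open_UNIV f] by simp
  have "frechet_derivative f (at z) v + qc \<i> * frechet_derivative f (at z) (\<i> * v)
      + 2 *\<^sub>R (quat_k * qc (h z * v) * f z) = 0" for v
  proof (rule zero_by_continuity[where z = z])
    have "isCont (\<lambda>u. frechet_derivative f (at u) w) z" for w
      using smooth_on_continuous[OF smooth_on_frechet[OF open_UNIV f]]
        continuous_on_eq_continuous_at[OF open_UNIV] by blast
    moreover have "isCont (\<lambda>u. qc (h u * v)) z"
      using h continuous_on_eq_continuous_at[OF open_UNIV]
      by (intro bounded_linear.continuous[OF bounded_linear_qc] continuous_intros) blast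
    moreover have "isCont f z"
      using smooth_on_continuous[OF f] continuous_on_eq_continuous_at[OF open_UNIV] by blast
    ultimately show "isCont (\<lambda>z. frechet_derivative f (at z) v + qc \<i> * frechet_derivative f (at z) (\<i> * v)
        + 2 *\<^sub>R (quat_k * qc (h z * v) * f z)) z"
      by (intro continuous_intros)
    show "\<forall>\<^sub>F u in at z. frechet_derivative f (at u) v + qc \<i> * frechet_derivative f (at u) (\<i> * v)
        + 2 *\<^sub>R (quat_k * qc (h u * v) * f u) = 0"
      using eventually_at_poly_nonzero[OF D]
    proof eventually_elim
      case (elim u)
      from hol_atD[OF hol[OF elim] F] show ?case by simp
    qed
  qed
  then show ?thesis
    unfolding hol_at_def using F by (intro exI[of _ "frechet_derivative f (at z)"]) (simp add: eq_neg_iff_add_eq_0)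
qed

text \<open>A complex power on the right of a quaternion is not the action of a scalar through J. It
  passes to the left where \<open>f\<close> is complex, and this is needed only at the point z
  itself, the difference being of higher order.\<close>

lemma leads_conjugated_power:
  assumes f: "(f has_derivative f') (at z)" and fz: "f z = qc c" "c \<noteq> 0"
  shows "leads (\<lambda>u. qc ((u - z) ^ r) * f u * qc ((u - z) ^ n)) z (r + n)"
proof -
  have "bigO_at (\<lambda>u. qc ((u - z) ^ r) * (f u - f z) * qc ((u - z) ^ n)) z (r + 1 + n)"
    by (intro bigO_at_mult bigO_at_power bigO_at_differentiable[OF f])
  moreover have "qc ((u - z) ^ r) * (f u - f z) * qc ((u - z) ^ n) =
      qc ((u - z) ^ r) * f u * qc ((u - z) ^ n) - qc ((u - z) ^ (r + n)) * f z" for u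
    unfolding fz by (simp add: algebra_simps power_add flip: qc_mult)
  ultimately show ?thesis
    unfolding leads_def using fz by (intro exI[of _ "qc c"]) simp
qed

lemma leads_power_left:
  assumes f: "(f has_derivative f') (at z)" and fz: "f z \<noteq> 0"
  shows "leads (\<lambda>u. qc ((u - z) ^ r) * f u) z r"
proof -
  have "bigO_at (\<lambda>u. qc ((u - z) ^ r) * (f u - f z)) z (r + 1)"
    by (intro bigO_at_mult bigO_at_power bigO_at_differentiable[OF f])
  then show ?thesis
    unfolding leads_def using fz by (intro exI[of _ "f z"]) (simp add: algebra_simps)
qed

lemma poly_factor_root:
  fixes p :: "complex poly"
  assumes "poly p a = 0"
  obtains q where "p = [:- a, 1:] * q"
  using assms by (metis dvdE poly_eq_0_iff_dvd)

lemma order_factor: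
  fixes p :: "complex poly"
  assumes "p \<noteq> 0"
  obtains q where "p = [:- a, 1:] ^ order a p * q" "poly q a \<noteq> 0"
  using order_decomp[OF assms, of a] by (metis poly_eq_0_iff_dvd)

lemma order_of_factor:
  fixes q :: "complex poly"
  assumes "poly q a \<noteq> 0"
  shows "order a ([:- a, 1:] ^ n * q) = n"
proof -
  have "q \<noteq> 0" using assms by auto
  then show ?thesis
    using assms by (subst order_mult) (simp_all add: order_power_n_n order_0I)
qed

text \<open>Near \<open>a\<close> the Wronskian is e^2 times the derivative of g / e, so it loses
  one order and the leading coefficient acquires the factor n + 1.\<close>

lemma wronskian_factor:
  fixes e g :: "complex poly"
  assumes e: "poly e a \<noteq> 0" and g: "g = [:- a, 1:] ^ Suc n * q"
  obtains w where "e * pderiv g - g * pderiv e = [:- a, 1:] ^ n * w"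
    "poly w a = of_nat (Suc n) * poly e a * poly q a"
proof
  let ?t = "[:- a, 1:] :: complex poly"
  have t: "pderiv (?t ^ Suc n) = smult (of_nat (Suc n)) (?t ^ n)"
    unfolding pderiv_power_Suc by (simp add: pderiv_pCons)
  have "pderiv g = ?t ^ Suc n * pderiv q + q * smult (of_nat (Suc n)) (?t ^ n)"
    unfolding g pderiv_mult t ..
  then show "e * pderiv g - g * pderiv e =
      ?t ^ n * (smult (of_nat (Suc n)) (e * q) + ?t * (e * pderiv q - q * pderiv e))"
    unfolding g by (simp add: algebra_simps smult_add_right del: mult_pCons_left mult_pCons_right)
  show "poly (smult (of_nat (Suc n)) (e * q) + ?t * (e * pderiv q - q * pderiv e)) a =
      of_nat (Suc n) * poly e a * poly q a"
    by simp
qed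

lemma order_wronskian:
  fixes e g :: "complex poly"
  assumes e: "poly e a \<noteq> 0" and g: "g \<noteq> 0" "poly g a = 0"
  shows "e * pderiv g - g * pderiv e \<noteq> 0" "order a g = Suc (order a (e * pderiv g - g * pderiv e))"
proof -
  obtain q where q: "g = [:- a, 1:] ^ order a g * q" "poly q a \<noteq> 0"
    using order_factor[OF g(1)] by blast
  obtain n where n: "order a g = Suc n"
    using g order_root[of g a] by (cases "order a g") auto
  obtain w where w: "e * pderiv g - g * pderiv e = [:- a, 1:] ^ n * w"
    "poly w a = of_nat (Suc n) * poly e a * poly q a"
    using wronskian_factor[OF e] q(1)[unfolded n] by blast
  have "poly w a \<noteq> 0" using w(2) e q(2) by (simp del: of_nat_Suc)
  then show "e * pderiv g - g * pderiv e \<noteq> 0" "order a g = Suc (order a (e * pderiv g - g * pderiv e))"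
    unfolding w(1) n using order_of_factor[OF \<open>poly w a \<noteq> 0\<close>, of n] by auto
qed

text \<open>\<open>ep\<close> is the radical of \<open>dl\<close>, and \<open>nu / ep\<close> the logarithmic derivative of \<open>dl\<close>.\<close>

locale radical =
  fixes dl ep d1 nu :: "complex poly"
  assumes dl_nonzero: "dl \<noteq> 0"
    and dl_eq: "dl = ep * d1" and pderiv_dl: "pderiv dl = d1 * nu"
    and ep_root: "poly dl z = 0 \<Longrightarrow> poly ep z = 0"
    and ep_simple: "poly ep z = 0 \<Longrightarrow> poly (pderiv ep) z \<noteq> 0"
begin

lemma ep_nonzero: "ep \<noteq> 0" and d1_nonzero: "d1 \<noteq> 0"
  using dl_nonzero dl_eq by auto

text \<open>The logarithmic derivative nu / ep of \<open>dl\<close> has the residue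
  \<open>order a dl\<close> at a, and \<open>ep\<close> has a simple zero there.\<close>

lemma root_nu:
  assumes "poly dl a = 0"
  shows "poly nu a = of_nat (Suc (order a d1)) * poly (pderiv ep) a" "order a dl = Suc (order a d1)" "order a ep = 1"
proof -
  have ea: "poly ep a = 0" using ep_root[OF assms] .
  obtain e where e: "ep = [:- a, 1:] * e" using poly_factor_root[OF ea] .
  have e': "poly (pderiv ep) a = poly e a" unfolding e pderiv_mult by (simp add: pderiv_pCons)
  then have e0: "poly e a \<noteq> 0" using ep_simple[OF ea] by simp
  show oe: "order a ep = 1"
    using order_of_factor[OF e0, of 1] e by simp
  show "order a dl = Suc (order a d1)"
    using dl_nonzero unfolding dl_eq by (simp add: order_mult oe)
  define k where "k = order a d1"
  obtain f where f: "d1 = [:- a, 1:] ^ k * f" "poly f a \<noteq> 0"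
    using order_factor[OF d1_nonzero] unfolding k_def by blast
  define t :: "complex poly" where "t = [:- a, 1:]"
  have t: "pderiv t = 1" "poly t a = 0" "t \<noteq> 0" by (auto simp: t_def pderiv_pCons)
  have d1t: "d1 = t ^ k * f" and ept: "ep = t * e" using f(1) e by (simp_all add: t_def)
  have "pderiv d1 * t = t ^ k * (smult (of_nat k) f + t * pderiv f)"
  proof (cases k)
    case 0
    then show ?thesis using d1t by simp
  next
    case (Suc j)
    then show ?thesis
      unfolding d1t pderiv_mult Suc pderiv_power_Suc by (simp add: t(1) algebra_simps)
  qed
  then have "ep * pderiv d1 = t ^ k * (e * (smult (of_nat k) f + t * pderiv f))"
    unfolding ept by (simp add: mult_ac)
  moreover have "d1 * pderiv ep = t ^ k * (f * pderiv ep)"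
    unfolding d1t by (simp add: mult.assoc)
  moreover have "d1 * nu = ep * pderiv d1 + d1 * pderiv ep"
    using pderiv_dl dl_eq pderiv_mult[of ep d1] by simp
  moreover have "d1 * nu = t ^ k * (f * nu)"
    unfolding d1t by (simp add: mult.assoc)
  ultimately have "t ^ k * (f * nu) = t ^ k * (f * pderiv ep + e * (smult (of_nat k) f + t * pderiv f))"
    by (simp add: distrib_left)
  then have "f * nu = f * pderiv ep + e * (smult (of_nat k) f + t * pderiv f)"
    using t(3) by (metis mult_left_cancel power_not_zero)
  then have "poly (f * nu) a = poly (f * pderiv ep + e * (smult (of_nat k) f + t * pderiv f)) a"
    by simp
  then have "poly f a * poly nu a = poly f a * (of_nat (Suc k) * poly e a)"
    by (simp add: e' t(2) algebra_simps)
  then show "poly nu a = of_nat (Suc (order a d1)) * poly (pderiv ep) a"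
    using f(2) by (simp add: e' k_def del: of_nat_Suc)
qed

end

text \<open>
  \<open>F = A / dl\<close> in lowest terms, and \<open>dF F\<^sup>-\<^sup>1\<close> and \<open>F\<^sup>-\<^sup>1 dF\<close> are the squares of two spinors: they have
  rank one, and with the columns \<open>s = (x, y) / ep\<close> and \<open>t = (P, Q) / dl\<close> their entries are
  \<open>s\<^sub>1 s\<^sub>2, - s\<^sub>1\<^sup>2, s\<^sub>2\<^sup>2, - s\<^sub>1 s\<^sub>2\<close> and likewise for \<open>t\<close>. The smooth ends are encoded by \<open>ep\<close> having
  simple roots only.
\<close>

locale chart_data = radical dl ep d1 nu for dl ep d1 nu :: "complex poly" +
  fixes a11 a12 a21 a22 x y P Q :: "complex poly"
  assumes det_A: "a11 * a22 - a12 * a21 = dl * dl"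
    and A_nonzero: "poly a11 z \<noteq> 0 \<or> poly a12 z \<noteq> 0 \<or> poly a21 z \<noteq> 0 \<or> poly a22 z \<noteq> 0"
    and xy_nonzero: "poly x z \<noteq> 0 \<or> poly y z \<noteq> 0"
    and PQ_nonzero: "poly P z \<noteq> 0 \<or> poly Q z \<noteq> 0"
    and epQ: "y * a11 - x * a21 = ep * Q" and epP: "x * a22 - y * a12 = ep * P"
    and dA: "ep * pderiv a11 - nu * a11 = x * Q" "ep * pderiv a12 - nu * a12 = - (x * P)"
      "ep * pderiv a21 - nu * a21 = y * Q" "ep * pderiv a22 - nu * a22 = - (y * P)"
begin

text \<open>Cramer's rule applied to \<open>epQ\<close> and \<open>epP\<close>. In other words, the
  spinor of dF F^-1 is F times the spinor of F^-1 dF.\<close>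

lemma PQ_A: "P * a21 + Q * a22 = dl * d1 * y" "P * a11 + Q * a12 = dl * d1 * x"
proof -
  have "ep * (P * a21 + Q * a22) = (x * a22 - y * a12) * a21 + (y * a11 - x * a21) * a22"
    unfolding epP epQ by (simp add: algebra_simps)
  also have "\<dots> = y * (a11 * a22 - a12 * a21)" by (simp add: algebra_simps)
  also have "\<dots> = ep * (dl * d1 * y)" unfolding det_A by (subst dl_eq) (simp add: algebra_simps)
  finally show "P * a21 + Q * a22 = dl * d1 * y" using ep_nonzero by simp
  have "ep * (P * a11 + Q * a12) = (x * a22 - y * a12) * a11 + (y * a11 - x * a21) * a12"
    unfolding epP epQ by (simp add: algebra_simps)
  also have "\<dots> = x * (a11 * a22 - a12 * a21)" by (simp add: algebra_simps)
  also have "\<dots> = ep * (dl * d1 * x)" unfolding det_A by (subst dl_eq) (simp add: algebra_simps)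
  finally show "P * a11 + Q * a12 = dl * d1 * x" using ep_nonzero by simp
qed

definition W where "W = x * pderiv y - y * pderiv x"

definition K where "K = P * pderiv Q - Q * pderiv P"

lemma dA': "ep * pderiv a11 = nu * a11 + x * Q" "ep * pderiv a12 = nu * a12 - x * P"
    "ep * pderiv a21 = nu * a21 + y * Q" "ep * pderiv a22 = nu * a22 - y * P"
  using dA by (simp_all add: diff_eq_eq)

text \<open>The two spinors have the same Wronskian up to the factor \<open>d1\<^sup>2\<close>, the Hopf differential.\<close>

lemma pderiv_spinor: "pderiv y * a11 - pderiv x * a21 = (pderiv ep - nu) * Q + ep * pderiv Q"
    "pderiv x * a22 - pderiv y * a12 = (pderiv ep - nu) * P + ep * pderiv P"
proof -
  have "ep * (pderiv y * a11 - pderiv x * a21) + (y * (ep * pderiv a11) - x * (ep * pderiv a21)) =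
      ep * pderiv (y * a11 - x * a21)"
    by (simp add: pderiv_mult pderiv_diff algebra_simps)
  also have "\<dots> = ep * (pderiv ep * Q + ep * pderiv Q)"
    unfolding epQ by (simp add: pderiv_mult algebra_simps)
  finally have *: "ep * (pderiv y * a11 - pderiv x * a21) + (y * (ep * pderiv a11) - x * (ep * pderiv a21)) =
      ep * (pderiv ep * Q + ep * pderiv Q)" .
  have "y * (ep * pderiv a11) - x * (ep * pderiv a21) = nu * (y * a11 - x * a21)"
    unfolding dA' by (simp add: algebra_simps)
  with * have "ep * (pderiv y * a11 - pderiv x * a21) = ep * ((pderiv ep - nu) * Q + ep * pderiv Q)"
    unfolding epQ by (simp only: eq_diff_eq[symmetric]) (simp add: algebra_simps)
  then show "pderiv y * a11 - pderiv x * a21 = (pderiv ep - nu) * Q + ep * pderiv Q"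
    using ep_nonzero by simp
  have "ep * (pderiv x * a22 - pderiv y * a12) + (x * (ep * pderiv a22) - y * (ep * pderiv a12)) =
      ep * pderiv (x * a22 - y * a12)"
    by (simp add: pderiv_mult pderiv_diff algebra_simps)
  also have "\<dots> = ep * (pderiv ep * P + ep * pderiv P)"
    unfolding epP by (simp add: pderiv_mult algebra_simps)
  finally have *: "ep * (pderiv x * a22 - pderiv y * a12) + (x * (ep * pderiv a22) - y * (ep * pderiv a12)) =
      ep * (pderiv ep * P + ep * pderiv P)" .
  have "x * (ep * pderiv a22) - y * (ep * pderiv a12) = nu * (x * a22 - y * a12)"
    unfolding dA' by (simp add: algebra_simps)
  with * have "ep * (pderiv x * a22 - pderiv y * a12) = ep * ((pderiv ep - nu) * P + ep * pderiv P)"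
    unfolding epP by (simp only: eq_diff_eq[symmetric]) (simp add: algebra_simps)
  then show "pderiv x * a22 - pderiv y * a12 = (pderiv ep - nu) * P + ep * pderiv P"
    using ep_nonzero by simp
qed

lemma K_eq: "K = W * d1 * d1"
proof -
  have "ep * ep * K = (ep * P) * (ep * pderiv Q) - (ep * Q) * (ep * pderiv P)"
    by (simp add: K_def algebra_simps)
  also have "\<dots> = (x * a22 - y * a12) * (pderiv y * a11 - pderiv x * a21 - (pderiv ep - nu) * Q)
      - (y * a11 - x * a21) * (pderiv x * a22 - pderiv y * a12 - (pderiv ep - nu) * P)"
    using pderiv_spinor epP epQ by simp
  also have "\<dots> = (x * a22 - y * a12) * (pderiv y * a11 - pderiv x * a21)
      - (y * a11 - x * a21) * (pderiv x * a22 - pderiv y * a12)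
      - (pderiv ep - nu) * ((ep * P) * Q - (ep * Q) * P)"
    unfolding epP[symmetric] epQ[symmetric] by (simp add: algebra_simps)
  also have "\<dots> = W * (a11 * a22 - a12 * a21)"
    by (simp add: W_def algebra_simps)
  finally have "ep * ep * K = ep * ep * (W * d1 * d1)"
    unfolding det_A by (subst (asm) (1 2) dl_eq) (simp add: algebra_simps)
  then show ?thesis using ep_nonzero by simp
qed

end

lemma order_le_imp_dvd:
  fixes p q :: "complex poly"
  assumes "p \<noteq> 0" "q \<noteq> 0" "\<And>a. order a p \<le> order a q"
  shows "p dvd q"
  using assms
proof (induction "degree p" arbitrary: p q)
  case 0
  obtain c where c: "p = [:c:]" using "0.hyps" by (metis degree_eq_zeroE)
  then have "q = p * smult (inverse c) q" using "0.prems"(1) by simp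
  then show ?case by (rule dvdI)
next
  case (Suc n)
  obtain a where a: "poly p a = 0"
    using alg_closed_imp_poly_has_root[of p] Suc.hyps(2) by auto
  obtain p1 where p1: "p = [:- a, 1:] * p1" using poly_factor_root[OF a] .
  have "order a q \<noteq> 0" using Suc.prems(3)[of a] a Suc.prems(1) by (auto simp: order_root)
  then have "poly q a = 0" using Suc.prems(2) by (simp add: order_root)
  then obtain q1 where q1: "q = [:- a, 1:] * q1" by (rule poly_factor_root)
  have nz: "p1 \<noteq> 0" "q1 \<noteq> 0" using Suc.prems p1 q1 by auto
  have o: "order z p = order z [:- a, 1:] + order z p1" "order z q = order z [:- a, 1:] + order z q1" for z
    using Suc.prems(1,2) unfolding p1 q1 by (simp_all add: order_mult del: mult_pCons_left)
  have "p1 dvd q1"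
  proof (rule Suc.hyps(1))
    show "n = degree p1" using Suc.hyps(2) nz(1) p1 by (simp add: degree_mult_eq del: mult_pCons_left)
    show "order z p1 \<le> order z q1" for z using Suc.prems(3)[of z] o by simp
  qed (use nz in auto)
  then show ?case unfolding p1 q1 by (rule mult_dvd_mono[OF dvd_refl])
qed

lemma spinor_product:
  "(qc a + quat_k * qc b) * (qc c + quat_k * qc d) = qc (a * c - cnj b * d) + quat_k * qc (cnj a * d + b * c)"
  by (simp add: quat_eq_iff algebra_simps)

context chart_data
begin

text \<open>The indicial equation at an end: the pole order \<open>r\<close> of \<open>F\<close> satisfies \<open>r (r - 1) = W / ep'\<^sup>2\<close>.\<close>

lemma W_at_root:
  assumes "poly dl a = 0"
  shows "poly W a = of_nat (order a d1) * of_nat (Suc (order a d1)) * (poly (pderiv ep) a)\<^sup>2"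
proof -
  have ea: "poly ep a = 0" using ep_root[OF assms] .
  let ?n = "poly nu a" and ?e = "poly (pderiv ep) a"
  \<comment> \<open>At an end \<open>ep\<close> vanishes, and the differential equations
    \<open>dA\<close> and their consequences \<open>pderiv_spinor\<close> become linear relations
    between values at the point.\<close>
  have A: "- (?n * poly a11 a) = poly x a * poly Q a" "?n * poly a12 a = poly x a * poly P a"
    "- (?n * poly a21 a) = poly y a * poly Q a" "?n * poly a22 a = poly y a * poly P a"
    using dA[THEN arg_cong, of "\<lambda>p. poly p a"] ea by (simp_all add: minus_equation_iff)
  have B: "poly (pderiv y) a * poly a11 a - poly (pderiv x) a * poly a21 a = (?e - ?n) * poly Q a"
    "poly (pderiv x) a * poly a22 a - poly (pderiv y) a * poly a12 a = (?e - ?n) * poly P a"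
    using pderiv_spinor[THEN arg_cong, of "\<lambda>p. poly p a"] ea by simp_all
  have "poly W a * poly Q a = poly (pderiv y) a * (poly x a * poly Q a) - poly (pderiv x) a * (poly y a * poly Q a)"
    by (simp add: W_def algebra_simps)
  also have "\<dots> = - (?n * (poly (pderiv y) a * poly a11 a - poly (pderiv x) a * poly a21 a))"
    unfolding A[symmetric] by (simp add: algebra_simps)
  also have "\<dots> = ?n * (?n - ?e) * poly Q a" unfolding B by (simp add: algebra_simps)
  finally have 1: "poly W a * poly Q a = ?n * (?n - ?e) * poly Q a" .
  have "poly W a * poly P a = poly (pderiv y) a * (poly x a * poly P a) - poly (pderiv x) a * (poly y a * poly P a)"
    by (simp add: W_def algebra_simps)
  also have "\<dots> = - (?n * (poly (pderiv x) a * poly a22 a - poly (pderiv y) a * poly a12 a))"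
    unfolding A[symmetric] by (simp add: algebra_simps)
  also have "\<dots> = ?n * (?n - ?e) * poly P a" unfolding B by (simp add: algebra_simps)
  finally have 2: "poly W a * poly P a = ?n * (?n - ?e) * poly P a" .
  have "poly W a = ?n * (?n - ?e)"
    using 1 2 PQ_nonzero[of a] by auto
  then show ?thesis
    unfolding root_nu(1)[OF assms] by (simp add: algebra_simps power2_eq_square)
qed

text \<open>The zeros of \<open>ep\<close> are simple, so one zero of W d1 at each end suffices:
  \<open>d1\<close> vanishes where F has a pole of order at least two, and at a simple pole W
  vanishes by \<open>W_at_root\<close>.\<close>

lemma ep_dvd: "ep dvd W * d1"
proof (cases "W = 0")
  case False
  show ?thesis
  proof (rule order_le_imp_dvd[OF ep_nonzero])
    show "W * d1 \<noteq> 0" using False d1_nonzero by simp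
    fix a
    show "order a ep \<le> order a (W * d1)"
    proof (cases "poly ep a = 0")
      case True
      then have a: "poly dl a = 0" by (simp add: dl_eq)
      have "poly (W * d1) a = 0"
      proof (cases "order a d1 = 0")
        case True
        then show ?thesis using W_at_root[OF a] by simp
      next
        case False
        then show ?thesis using d1_nonzero by (simp add: order_root)
      qed
      then show ?thesis
        using root_nu(3)[OF a] \<open>W * d1 \<noteq> 0\<close> order_root[of "W * d1" a] by simp
    qed (simp add: order_0I)
  qed
qed simp

definition k0 :: "complex poly" where "k0 = (W * d1) div ep"

lemma ep_k0: "ep * k0 = W * d1"
  unfolding k0_def using ep_dvd by simp

lemma K_k0: "K = dl * k0"
proof -
  have "dl * k0 = (ep * k0) * d1" by (subst dl_eq) (simp add: algebra_simps)
  then show ?thesis unfolding ep_k0 K_eq by simp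
qed

lemma k0_nonzero: "K \<noteq> 0 \<Longrightarrow> k0 \<noteq> 0"
  by (auto simp: K_k0)

text \<open>
  At regular points \<open>(row1, row2) = (p - k q)\<^sup>-\<^sup>1 (1, - k) F\<^sup>-\<^sup>1\<close> and \<open>tau = (p - k q)\<^sup>-\<^sup>1\<close> with
  \<open>(p, q) = (P, Q) / dl\<close>. The row annihilates \<open>F (k, 1)\<close>, and the expressions below extend it over
  the poles.
\<close>

definition spin :: "complex \<Rightarrow> quat"
  where "spin u = qc (poly P u) - quat_k * qc (poly Q u)"

definition nrm :: "complex \<Rightarrow> real"
  where "nrm u = (norm (poly P u))\<^sup>2 + (norm (poly Q u))\<^sup>2"

definition tau :: "complex \<Rightarrow> quat"
  where "tau u = qc (poly dl u) * inverse (spin u)"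

definition row1 :: "complex \<Rightarrow> quat"
  where "row1 u = inverse (nrm u) *\<^sub>R (qc (cnj (poly P u) * poly a22 u - cnj (poly Q u) * poly a21 u)
    + quat_k * qc (cnj (poly dl u) * poly d1 u * poly y u))"

definition row2 :: "complex \<Rightarrow> quat"
  where "row2 u = inverse (nrm u) *\<^sub>R (qc (cnj (poly Q u) * poly a11 u - cnj (poly P u) * poly a12 u)
    - quat_k * qc (cnj (poly dl u) * poly d1 u * poly x u))"

definition hopf :: "complex \<Rightarrow> complex"
  where "hopf u = - (poly k0 u * cnj (poly dl u) / of_real (nrm u))"

lemma nrm_pos: "nrm u > 0"
  using PQ_nonzero[of u] by (auto simp: nrm_def add_pos_nonneg add_nonneg_pos)

lemma spin_times: "(qc (cnj (poly P u)) + quat_k * qc (poly Q u)) * spin u = of_real (nrm u)"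
  unfolding spin_def nrm_def cmod_power2 by (simp add: quat_eq_iff of_real_def power2_eq_square)

lemma spin_nonzero: "spin u \<noteq> 0"
  using spin_times[of u] nrm_pos[of u] by auto

lemma inverse_spin: "inverse (spin u) = inverse (nrm u) *\<^sub>R (qc (cnj (poly P u)) + quat_k * qc (poly Q u))"
proof -
  have "(inverse (nrm u) *\<^sub>R (qc (cnj (poly P u)) + quat_k * qc (poly Q u))) * spin u = 1"
    using spin_times[of u] nrm_pos[of u] by (simp add: of_real_def)
  then show ?thesis
    using spin_nonzero[of u] by (metis mult.assoc mult.right_neutral mult_1 right_inverse)
qed

lemma smooth_spin: "smooth_on UNIV spin"
  unfolding spin_def by (intro smooth_on_diff smooth_on_mult smooth_on_const smooth_on_qc smooth_on_poly open_UNIV)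

lemma smooth_tau: "smooth_on UNIV tau"
  unfolding tau_def
  by (intro smooth_on_mult smooth_on_qc smooth_on_poly smooth_on_quat_inverse smooth_spin open_UNIV spin_nonzero)

lemma smooth_inverse_nrm: "smooth_on UNIV (\<lambda>u. inverse (nrm u))"
proof (rule smooth_on_inverse)
  show "smooth_on UNIV nrm"
    unfolding nrm_def by (intro smooth_on_add smooth_on_norm_square smooth_on_poly open_UNIV)
  show "nrm z \<noteq> 0" for z using nrm_pos[of z] by simp
qed simp

lemma smooth_row: "smooth_on UNIV row1" "smooth_on UNIV row2"
  unfolding row1_def row2_def
  by (intro smooth_on_scaleR smooth_inverse_nrm smooth_on_add smooth_on_diff smooth_on_mult smooth_on_const
      smooth_on_qc smooth_on_cnj smooth_on_poly open_UNIV)+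

lemma continuous_hopf: "continuous_on UNIV hopf"
proof -
  have "continuous_on UNIV (\<lambda>u. complex_of_real (nrm u))"
    unfolding nrm_def by (intro continuous_intros)
  moreover have "complex_of_real (nrm u) \<noteq> 0" for u using nrm_pos[of u] by simp
  ultimately show ?thesis
    unfolding hopf_def by (intro continuous_intros) auto
qed

text \<open>Multiplication by the inverse of the spinor produces P a21 + Q a22 and P a11 + Q a12,
  which \<open>PQ_A\<close> shows to be divisible by \<open>dl * d1\<close>; this removes the
  denominators. A factor \<open>dl\<close> turns into its conjugate when it passes k.\<close>

lemma row_regular:
  assumes "poly dl u \<noteq> 0"
  shows "row1 u = tau u * (qc (poly a22 u / poly dl u) + quat_k * qc (poly a21 u / poly dl u))"
    and "row2 u = - (tau u * (qc (poly a12 u / poly dl u) + quat_k * qc (poly a11 u / poly dl u)))"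
proof -
  have t: "tau u * (qc b + quat_k * qc c) = inverse (nrm u) *\<^sub>R
      (qc (poly dl u * (cnj (poly P u) * b - cnj (poly Q u) * c)) +
        quat_k * qc (cnj (poly dl u) * (poly P u * c + poly Q u * b)))" for b c
  proof -
    have "tau u * (qc b + quat_k * qc c) = inverse (nrm u) *\<^sub>R
        (qc (poly dl u) * ((qc (cnj (poly P u)) + quat_k * qc (poly Q u)) * (qc b + quat_k * qc c)))"
      by (simp add: tau_def inverse_spin mult.assoc)
    also have "(qc (cnj (poly P u)) + quat_k * qc (poly Q u)) * (qc b + quat_k * qc c) =
        qc (cnj (poly P u) * b - cnj (poly Q u) * c) + quat_k * qc (poly P u * c + poly Q u * b)"
      by (simp add: spinor_product)
    also have "qc (poly dl u) * \<dots> = qc (poly dl u * (cnj (poly P u) * b - cnj (poly Q u) * c)) +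
        quat_k * qc (cnj (poly dl u) * (poly P u * c + poly Q u * b))"
      using spinor_product[of "poly dl u" 0 "cnj (poly P u) * b - cnj (poly Q u) * c" "poly P u * c + poly Q u * b"]
      by simp
    finally show ?thesis .
  qed
  have 1: "poly P u * (poly a21 u / poly dl u) + poly Q u * (poly a22 u / poly dl u) = poly d1 u * poly y u"
    using arg_cong[OF PQ_A(1), of "\<lambda>p. poly p u"] assms by (simp add: field_simps)
  have 2: "poly P u * (poly a11 u / poly dl u) + poly Q u * (poly a12 u / poly dl u) = poly d1 u * poly x u"
    using arg_cong[OF PQ_A(2), of "\<lambda>p. poly p u"] assms by (simp add: field_simps)
  have 3: "poly dl u * (cnj (poly P u) * (b / poly dl u) - cnj (poly Q u) * (c / poly dl u)) =
      cnj (poly P u) * b - cnj (poly Q u) * c" for b c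
    using assms by (simp add: field_simps)
  show "row1 u = tau u * (qc (poly a22 u / poly dl u) + quat_k * qc (poly a21 u / poly dl u))"
    unfolding t 1 3 by (simp add: row1_def mult.assoc)
  show "row2 u = - (tau u * (qc (poly a12 u / poly dl u) + quat_k * qc (poly a11 u / poly dl u)))"
    unfolding t 2 3 by (simp add: row2_def mult.assoc qc_diff flip: scaleR_minus_right)
qed

lemma quotient_derivative:
  assumes "poly dl z \<noteq> 0" "ep * pderiv a - nu * a = b"
  shows "((\<lambda>u. poly a u / poly dl u) has_field_derivative (poly b z / (poly ep z * poly dl z))) (at z)"
proof -
  have nz: "poly ep z \<noteq> 0" "poly d1 z \<noteq> 0" using assms(1) by (auto simp: dl_eq)
  have "((\<lambda>u. poly a u / poly dl u) has_field_derivative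
      ((poly (pderiv a) z * poly dl z - poly a z * poly (pderiv dl) z) / (poly dl z * poly dl z))) (at z)"
    by (intro DERIV_divide poly_DERIV assms(1))
  also have "(poly (pderiv a) z * poly dl z - poly a z * poly (pderiv dl) z) / (poly dl z * poly dl z) =
      poly b z / (poly ep z * poly dl z)"
    unfolding pderiv_dl assms(2)[symmetric] using nz by (simp add: dl_eq field_simps)
  finally show ?thesis .
qed

lemma tau_eq:
  assumes "poly dl u \<noteq> 0"
  shows "tau u = inverse (qc (poly P u / poly dl u) - quat_k * qc (poly Q u / poly dl u))"
proof -
  have "qc (poly P u / poly dl u) - quat_k * qc (poly Q u / poly dl u) = spin u * inverse (qc (poly dl u))"
    by (simp add: spin_def divide_inverse qc_mult qc_inverse left_diff_distrib mult.assoc)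
  then show ?thesis
    using assms spin_nonzero[of u] by (simp add: tau_def nonzero_inverse_mult_distrib)
qed

text \<open>\<open>hopf\<close> is the coefficient of \<open>hol_at_inverse_spinor\<close> for the
  pair (P, Q) / dl: its Wronskian is K / dl^2 = k0 / dl, and the denominator |P|^2 + |Q|^2 is
  divided by |dl|^2.\<close>

lemma hol_at_regular:
  assumes z: "poly dl z \<noteq> 0"
    and Y: "(Y has_derivative (\<lambda>v. (qc (poly P z / poly dl z) - quat_k * qc (poly Q z / poly dl z)) * qc v * \<gamma>)) (at z)"
  shows "hol_at (hopf z) (\<lambda>u. tau u * Y u) z"
proof -
  let ?p = "\<lambda>u. poly P u / poly dl u" and ?q = "\<lambda>u. poly Q u / poly dl u"
  let ?p' = "(poly (pderiv P) z * poly dl z - poly P z * poly (pderiv dl) z) / (poly dl z * poly dl z)"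
  let ?q' = "(poly (pderiv Q) z * poly dl z - poly Q z * poly (pderiv dl) z) / (poly dl z * poly dl z)"
  have p: "(?p has_field_derivative ?p') (at z)" and q: "(?q has_field_derivative ?q') (at z)"
    by (intro DERIV_divide poly_DERIV z)+
  have nz: "?p z \<noteq> 0 \<or> ?q z \<noteq> 0" using z PQ_nonzero[of z] by auto
  have "(?q z * ?p' - ?p z * ?q') / of_real ((norm (?p z))\<^sup>2 + (norm (?q z))\<^sup>2) = hopf z"
  proof -
    let ?d = "poly dl z"
    have "?q z * ?p' - ?p z * ?q' = - poly K z / (?d * ?d)"
    proof -
      have "?q z * ?p' - ?p z * ?q' =
          (poly Q z * (poly (pderiv P) z * ?d - poly P z * poly (pderiv dl) z)
           - poly P z * (poly (pderiv Q) z * ?d - poly Q z * poly (pderiv dl) z)) / (?d * (?d * ?d))"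
      proof -
        have "(q / d) * (X / (d * d)) - (p / d) * (Y / (d * d)) = (q * X - p * Y) / (d * (d * d))"
          for q p X Y d :: complex
          by (simp add: diff_divide_distrib)
        then show ?thesis .
      qed
      also have "\<dots> = (- poly K z * ?d) / (?d * (?d * ?d))"
        by (rule arg_cong[of _ _ "\<lambda>a. a / _"]) (simp add: K_def algebra_simps)
      finally show ?thesis using z by simp
    qed
    also have "\<dots> = - poly k0 z / ?d"
      using z by (simp add: K_k0)
    finally have 1: "?q z * ?p' - ?p z * ?q' = - poly k0 z / ?d" .
    have 2: "complex_of_real ((norm (?p z))\<^sup>2 + (norm (?q z))\<^sup>2) = of_real (nrm z) / (?d * cnj ?d)"
      unfolding nrm_def complex_norm_square[symmetric]
      by (simp add: norm_divide power_divide add_divide_distrib)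
    show ?thesis
      unfolding 1 2 hopf_def using z by simp
  qed
  then have *: "hol_at (hopf z) (\<lambda>u. inverse (qc (?p u) - quat_k * qc (?q u)) * Y u) z"
    using hol_at_inverse_spinor[OF p q nz Y] by simp
  show ?thesis
  proof (rule hol_at_cong[OF *])
    show "open {u. poly dl u \<noteq> 0}"
      by (intro open_Collect_neq continuous_intros)
    show "inverse (qc (?p u) - quat_k * qc (?q u)) * Y u = tau u * Y u" if "u \<in> {u. poly dl u \<noteq> 0}" for u
      using that by (simp add: tau_eq)
  qed (use z in simp)
qed

text \<open>By the null condition the derivatives of the entries of F are multiples of P and Q, so
  the quotients in \<open>row_regular\<close> fit \<open>hol_at_regular\<close> with \<gamma> = - y
  / ep and \<gamma> = - x / ep; \<open>tau\<close> fits it with the constant 1 and \<gamma> = 0. The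
  ends are reached by \<open>hol_at_closure\<close>.\<close>

lemma hol_at_row_tau: "hol_at (hopf z) row1 z" "hol_at (hopf z) row2 z" "hol_at (hopf z) tau z"
proof -
  have q: "((\<lambda>u. qc (poly a u / poly dl u) + quat_k * qc (poly b u / poly dl u)) has_derivative
      (\<lambda>v. (qc (poly P z / poly dl z) - quat_k * qc (poly Q z / poly dl z)) * qc v * qc (- (poly c z / poly ep z)))) (at z)"
    if z: "poly dl z \<noteq> 0" and a: "ep * pderiv a - nu * a = - (c * P)" and b: "ep * pderiv b - nu * b = c * Q" for a b c z
  proof -
    have "((\<lambda>u. qc (poly a u / poly dl u) + quat_k * qc (poly b u / poly dl u)) has_derivative
      (\<lambda>v. qc (poly (- (c * P)) z / (poly ep z * poly dl z) * v) + quat_k * qc (poly (c * Q) z / (poly ep z * poly dl z) * v))) (at z)"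
      using quotient_derivative[OF z a] quotient_derivative[OF z b] unfolding has_field_derivative_def
      by (intro has_derivative_add has_derivative_mult_right bounded_linear.has_derivative[OF bounded_linear_qc])
    moreover have "qc (poly (- (c * P)) z / (poly ep z * poly dl z) * v) + quat_k * qc (poly (c * Q) z / (poly ep z * poly dl z) * v) =
      (qc (poly P z / poly dl z) - quat_k * qc (poly Q z / poly dl z)) * qc v * qc (- (poly c z / poly ep z))" for v
    proof -
      have "(qc (poly P z / poly dl z) - quat_k * qc (poly Q z / poly dl z)) * qc v * qc (- (poly c z / poly ep z)) =
        qc (poly P z / poly dl z * v * - (poly c z / poly ep z)) - quat_k * qc (poly Q z / poly dl z * v * - (poly c z / poly ep z))"
        by (simp only: qc_mult left_diff_distrib mult.assoc)
      also have "\<dots> = qc (poly P z / poly dl z * v * - (poly c z / poly ep z)) + quat_k * qc (poly Q z / poly dl z * v * (poly c z / poly ep z))"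
        by (simp add: qc_minus)
      finally show ?thesis
        by (simp add: mult_ac)
    qed
    ultimately show ?thesis by simp
  qed
  have r1: "hol_at (hopf z) row1 z" if z: "poly dl z \<noteq> 0" for z
  proof (rule hol_at_cong[OF hol_at_regular[OF z q[OF z dA(4,3)]]])
    show "open {u. poly dl u \<noteq> 0}" by (intro open_Collect_neq continuous_intros)
  qed (use z row_regular in auto)
  have r2: "hol_at (hopf z) row2 z" if z: "poly dl z \<noteq> 0" for z
  proof (rule hol_at_cong[OF hol_at_mult_right[OF hol_at_regular[OF z q[OF z dA(2,1)]], of "-1"]])
    show "open {u. poly dl u \<noteq> 0}" by (intro open_Collect_neq continuous_intros)
  qed (use z row_regular in auto)
  have t: "hol_at (hopf z) tau z" if z: "poly dl z \<noteq> 0" for z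
    using hol_at_regular[OF z, of "\<lambda>_. 1" 0] by simp
  show "hol_at (hopf z) row1 z"
    by (rule hol_at_closure[OF smooth_row(1) continuous_hopf dl_nonzero r1])
  show "hol_at (hopf z) row2 z"
    by (rule hol_at_closure[OF smooth_row(2) continuous_hopf dl_nonzero r2])
  show "hol_at (hopf z) tau z"
    by (rule hol_at_closure[OF smooth_tau continuous_hopf dl_nonzero t])
qed

text \<open>If both rows vanish, their k-parts give dl d1 = 0, and then \<open>PQ_A\<close> supplies
  two further linear equations. The vectors (P, Q) and (- cnj Q, cnj P) are independent, so all
  entries of A vanish at u, against \<open>A_nonzero\<close>.\<close>

lemma row_nonzero: "row1 u \<noteq> 0 \<or> row2 u \<noteq> 0"
proof (rule ccontr)
  let ?P = "poly P u" and ?Q = "poly Q u"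
  assume "\<not> ?thesis"
  then have r: "row1 u = 0" "row2 u = 0" by auto
  have n: "inverse (nrm u) \<noteq> 0" using nrm_pos[of u] by simp
  have 1: "cnj ?P * poly a22 u - cnj ?Q * poly a21 u = 0" "cnj (poly dl u) * poly d1 u * poly y u = 0"
    using r(1) n by (auto simp: row1_def qc_quat_k_eq_0_iff simp del: mult_eq_0_iff)
  have "qc (cnj ?Q * poly a11 u - cnj ?P * poly a12 u) + quat_k * qc (- (cnj (poly dl u) * poly d1 u * poly x u)) = 0"
    using r(2) n by (simp add: row2_def qc_minus)
  then have 2: "cnj ?Q * poly a11 u - cnj ?P * poly a12 u = 0" "cnj (poly dl u) * poly d1 u * poly x u = 0"
    unfolding qc_quat_k_eq_0_iff by (auto simp del: mult_eq_0_iff)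
  have d: "poly dl u * poly d1 u = 0"
    using 1(2) 2(2) xy_nonzero[of u] by auto
  have 3: "?P * poly a21 u + ?Q * poly a22 u = 0" "?P * poly a11 u + ?Q * poly a12 u = 0"
    using PQ_A[THEN arg_cong, of "\<lambda>p. poly p u"] d by auto
  have n': "?P * cnj ?P + ?Q * cnj ?Q \<noteq> 0"
    using nrm_pos[of u] unfolding nrm_def complex_norm_square[symmetric] of_real_add[symmetric] of_real_eq_0_iff by linarith
  have "(?P * cnj ?P + ?Q * cnj ?Q) * poly a22 u =
      ?P * (cnj ?P * poly a22 u - cnj ?Q * poly a21 u) + cnj ?Q * (?P * poly a21 u + ?Q * poly a22 u)"
    by (simp add: algebra_simps)
  moreover have "(?P * cnj ?P + ?Q * cnj ?Q) * poly a21 u =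
      cnj ?P * (?P * poly a21 u + ?Q * poly a22 u) - ?Q * (cnj ?P * poly a22 u - cnj ?Q * poly a21 u)"
    by (simp add: algebra_simps)
  moreover have "(?P * cnj ?P + ?Q * cnj ?Q) * poly a12 u =
      cnj ?Q * (?P * poly a11 u + ?Q * poly a12 u) - ?P * (cnj ?Q * poly a11 u - cnj ?P * poly a12 u)"
    by (simp add: algebra_simps)
  moreover have "(?P * cnj ?P + ?Q * cnj ?Q) * poly a11 u =
      cnj ?P * (?P * poly a11 u + ?Q * poly a12 u) + ?Q * (cnj ?Q * poly a11 u - cnj ?P * poly a12 u)"
    by (simp add: algebra_simps)
  ultimately have "poly a22 u = 0" "poly a21 u = 0" "poly a12 u = 0" "poly a11 u = 0"
    unfolding 1 2 3 using n' by auto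
  then show False using A_nonzero[of u] by blast
qed

lemma det_quotient:
  assumes "poly dl z \<noteq> 0"
  shows "poly a11 z / poly dl z * (poly a22 z / poly dl z) - poly a12 z / poly dl z * (poly a21 z / poly dl z) = 1"
proof -
  have "poly a11 z * poly a22 z - poly a12 z * poly a21 z = poly dl z * poly dl z"
    using arg_cong[OF det_A, of "\<lambda>p. poly p z"] by simp
  then show ?thesis using assms by (simp flip: diff_divide_distrib)
qed

text \<open>The row is a left multiple of (1, - k) F^-1, and (1, - k) annihilates the column (k,
  1).\<close>

lemma row_kernel:
  assumes "poly dl u \<noteq> 0"
  defines "f a \<equiv> qc (poly a u / poly dl u)"
  shows "row1 u * (f a11 * quat_k + f a12) + row2 u * (f a21 * quat_k + f a22) = 0"
    and "(f a11 * quat_k + f a12, f a21 * quat_k + f a22) \<noteq> 0"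
proof -
  note det = det_quotient[OF assms(1)]
  have *: "(qc d + quat_k * qc c) * (qc a * quat_k + qc b) - (qc b + quat_k * qc a) * (qc c * quat_k + qc d) = 0"
    if "a * d - b * c = 1" for a b c d
  proof -
    have "(qc d + quat_k * qc c) * (qc a * quat_k + qc b) - (qc b + quat_k * qc a) * (qc c * quat_k + qc d) =
        qc (a * d - b * c) * quat_k - quat_k * qc (a * d - b * c)"
      by (simp add: quat_eq_iff algebra_simps)
    then show ?thesis unfolding that by simp
  qed
  have "row1 u * (f a11 * quat_k + f a12) + row2 u * (f a21 * quat_k + f a22) =
      tau u * ((f a22 + quat_k * f a21) * (f a11 * quat_k + f a12) - (f a12 + quat_k * f a11) * (f a21 * quat_k + f a22))"
    unfolding row_regular[OF assms(1)] f_def by (simp add: right_diff_distrib mult.assoc)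
  then show "row1 u * (f a11 * quat_k + f a12) + row2 u * (f a21 * quat_k + f a22) = 0"
    unfolding f_def *[OF det] by simp
  show "(f a11 * quat_k + f a12, f a21 * quat_k + f a22) \<noteq> 0"
  proof
    assume "(f a11 * quat_k + f a12, f a21 * quat_k + f a22) = 0"
    then have "qc (poly a12 u / poly dl u) + qc (poly a11 u / poly dl u) * quat_k = 0"
      by (simp add: zero_prod_def f_def add.commute)
    then have "poly a11 u / poly dl u = 0" "poly a12 u / poly dl u = 0"
      by (auto simp: quat_eq_iff complex_eq_iff)
    then show False using det assms(1) by auto
  qed
qed

end

text \<open>The converse of \<open>wronskian_factor\<close>: M / e vanishes at \<open>a\<close> and
  is a primitive of (z - a)^j B / e^2, so it gains one order, and the leading coefficient is divided
  by j + 1.\<close>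

lemma wronskian_primitive:
  fixes e M B :: "complex poly"
  assumes e: "poly e a \<noteq> 0" and M: "poly M a = 0" and eq: "e * pderiv M - M * pderiv e = [:- a, 1:] ^ j * B"
  obtains V where "M = [:- a, 1:] ^ Suc j * V" "of_nat (Suc j) * poly e a * poly V a = poly B a"
proof (cases "M = 0")
  case True
  then have "[:- a, 1:] ^ j * B = 0" using eq by simp
  then have "B = 0" by simp
  then show ?thesis using True by (intro that[of 0]) simp_all
next
  case False
  note o = order_wronskian[OF e False M]
  have "B \<noteq> 0" using o(1) eq by auto
  have "order a ([:- a, 1:] ^ j * B) = j + order a B"
    using \<open>B \<noteq> 0\<close> by (subst order_mult) (simp_all add: order_power_n_n)
  then have "Suc j \<le> order a M" using o(2) unfolding eq by simp
  then have "[:- a, 1:] ^ Suc j dvd M" unfolding order_divides by simp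
  then obtain V where V: "M = [:- a, 1:] ^ Suc j * V" by (elim dvdE)
  obtain w where w: "e * pderiv M - M * pderiv e = [:- a, 1:] ^ j * w"
    "poly w a = of_nat (Suc j) * poly e a * poly V a"
    using wronskian_factor[OF e V] .
  have "w = B" using w(1) eq by simp
  then show ?thesis using that[OF V] w(2) by simp
qed

section \<open>Vanishing orders of the third section\<close>

context chart_data
begin

text \<open>At a pole of F of order at least two, W is nonzero by \<open>W_at_root\<close>, so ep k0
  = W d1 gives \<open>order a k0 + 2 = order a dl\<close>; and \<open>tau\<close> has the order of
  \<open>dl\<close>, since the spinor has no zeros.\<close>

lemma leads_tau_root:
  assumes W: "W \<noteq> 0" and a: "poly d1 a = 0"
  shows "leads tau a (order a k0 + 2)"
proof -
  have dla: "poly dl a = 0" using a by (simp add: dl_eq)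
  have k: "order a d1 \<noteq> 0" using a d1_nonzero by (simp add: order_root)
  have "poly W a \<noteq> 0"
    using W_at_root[OF dla] k ep_simple[OF ep_root[OF dla]] by (simp del: of_nat_Suc)
  then have "order a W = 0" by (rule order_0I)
  have "ep * k0 \<noteq> 0" unfolding ep_k0 using W d1_nonzero by simp
  then have "order a ep + order a k0 = order a W + order a d1"
    using order_mult[of ep k0 a] order_mult[of W d1 a] unfolding ep_k0 by simp
  then have ord: "order a k0 + 2 = order a dl"
    using root_nu(2,3)[OF dla] k \<open>order a W = 0\<close> by simp
  obtain g where g: "dl = [:- a, 1:] ^ order a dl * g" "poly g a \<noteq> 0"
    using order_factor[OF dl_nonzero] by blast
  define f where "f u = qc (poly g u) * inverse (spin u)" for u
  have "smooth_on UNIV f"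
    unfolding f_def
    by (intro smooth_on_mult smooth_on_qc smooth_on_poly smooth_on_quat_inverse smooth_spin open_UNIV spin_nonzero)
  then have "(f has_derivative frechet_derivative f (at a)) (at a)"
    by (rule smooth_on_has_derivative[OF open_UNIV _ UNIV_I])
  moreover have "f a \<noteq> 0" using g(2) spin_nonzero[of a] by (simp add: f_def)
  ultimately have "leads (\<lambda>u. qc ((u - a) ^ order a dl) * f u) a (order a dl)"
    by (rule leads_power_left)
  moreover have "qc ((u - a) ^ order a dl) * f u = tau u" for u
  proof -
    have "poly dl u = (u - a) ^ order a dl * poly g u"
      by (subst g(1)) simp
    then show ?thesis
      by (simp add: tau_def f_def qc_mult mult.assoc)
  qed
  ultimately have "leads tau a (order a dl)" by simp
  then show ?thesis unfolding ord .
qed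

text \<open>The constant vector is the value at \<open>a\<close> of the spinor (x, y). Its
  coordinate is \<open>tau\<close> times N1 / dl - k N2 / dl, where the derivatives of the two
  quotients are - G / ep times P / dl and Q / dl, and G = x(a) y - y(a) x vanishes at
  \<open>a\<close> to order \<open>order a W + 1\<close>. Removing the values of the quotients at
  \<open>a\<close> by a multiple of \<open>tau\<close> leaves the high order.\<close>

lemma leads_comb:
  assumes W: "W \<noteq> 0" and a: "poly d1 a \<noteq> 0"
  shows "\<exists>c1 c2 l. leads (\<lambda>u. row1 u * qc c1 + row2 u * qc c2 + tau u * l) a (order a k0 + 2)"
proof -
  define t :: "complex poly" where "t = [:- a, 1:]"
  have t: "pderiv t = 1" "poly t a = 0" "t \<noteq> 0" "\<And>u. poly t u = u - a" by (auto simp: t_def pderiv_pCons)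
  define c1 c2 where "c1 = poly x a" and "c2 = poly y a"
  define G where "G = smult c1 y - smult c2 x"
  have Ga: "poly G a = 0" by (simp add: G_def c1_def c2_def)
  have ordG: "G \<noteq> 0" "order a G = Suc (order a W)"
  proof -
    have 1: "x * pderiv G - G * pderiv x = smult c1 W" "y * pderiv G - G * pderiv y = smult c2 W"
      by (simp_all add: G_def W_def pderiv_diff pderiv_smult algebra_simps smult_diff_right)
    have c: "c1 \<noteq> 0 \<or> c2 \<noteq> 0" using xy_nonzero[of a] by (simp add: c1_def c2_def)
    show G0: "G \<noteq> 0" using 1 c W by auto
    show "order a G = Suc (order a W)"
    proof (cases "c1 = 0")
      case False
      then show ?thesis
        using order_wronskian(2)[of x a G] G0 Ga unfolding 1 by (simp add: c1_def order_smult)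
    next
      case True
      then have "c2 \<noteq> 0" using c by simp
      then show ?thesis
        using order_wronskian(2)[of y a G] G0 Ga unfolding 1 by (simp add: c2_def order_smult)
    qed
  qed
  obtain g where g: "G = t ^ order a G * g" "poly g a \<noteq> 0"
    using order_factor[OF ordG(1)] unfolding t_def by blast
  define N1 N2 where "N1 = smult c1 a22 - smult c2 a12" and "N2 = smult c2 a11 - smult c1 a21"
  have N: "dl * pderiv N1 - N1 * pderiv dl = - (P * d1 * G)" "dl * pderiv N2 - N2 * pderiv dl = - (Q * d1 * G)"
  proof -
    have "ep * pderiv N1 - nu * N1 = smult c1 (ep * pderiv a22 - nu * a22) - smult c2 (ep * pderiv a12 - nu * a12)"
      "ep * pderiv N2 - nu * N2 = smult c2 (ep * pderiv a11 - nu * a11) - smult c1 (ep * pderiv a21 - nu * a21)"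
      by (simp_all add: N1_def N2_def pderiv_diff pderiv_smult algebra_simps smult_diff_right)
    then have *: "ep * pderiv N1 - nu * N1 = - (P * G)" "ep * pderiv N2 - nu * N2 = - (Q * G)"
      unfolding dA by (simp_all add: G_def algebra_simps smult_diff_right)
    have "dl * pderiv N1 - N1 * pderiv dl = d1 * (ep * pderiv N1 - nu * N1)"
      "dl * pderiv N2 - N2 * pderiv dl = d1 * (ep * pderiv N2 - nu * N2)"
      unfolding pderiv_dl by (simp_all add: dl_eq algebra_simps)
    then show "dl * pderiv N1 - N1 * pderiv dl = - (P * d1 * G)" "dl * pderiv N2 - N2 * pderiv dl = - (Q * d1 * G)"
      unfolding * by (simp_all add: algebra_simps)
  qed
  \<comment> \<open>As \<open>d1\<close> does not vanish at \<open>a\<close>, F is regular there or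
    has a simple pole; in the latter case \<open>W_at_root\<close> with
    \<open>order a d1 = 0\<close> shows that W vanishes at \<open>a\<close>.\<close>
  define r where "r = order a dl"
  have r: "r = 0 \<or> r = 1" and ord_ep: "order a ep = r" and rW: "r \<le> order a W"
  proof -
    have d10: "order a d1 = 0" using a by (rule order_0I)
    show "r = 0 \<or> r = 1" "order a ep = r" "r \<le> order a W"
    proof (atomize(full), cases "poly dl a = 0")
      case True
      have "poly W a = 0" using W_at_root[OF True] d10 by simp
      then have "order a W \<noteq> 0" using W by (simp add: order_root)
      then show "(r = 0 \<or> r = 1) \<and> order a ep = r \<and> r \<le> order a W"
        using root_nu(2,3)[OF True] d10 by (simp add: r_def)
    next
      case False
      then have "poly ep a \<noteq> 0" by (simp add: dl_eq)
      then show "(r = 0 \<or> r = 1) \<and> order a ep = r \<and> r \<le> order a W"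
        using False by (simp add: r_def order_0I)
    qed
  qed
  obtain e where e: "dl = t ^ r * e" "poly e a \<noteq> 0"
    using order_factor[OF dl_nonzero] unfolding t_def r_def by blast
  have factor: "\<exists>n. M = t ^ r * n" if M: "dl * pderiv M - M * pderiv dl = - (S * d1 * G)" for M S
  proof (cases "r = 0")
    case False
    then have r1: "r = 1" using r by simp
    then have dla: "poly dl a = 0" using e(1) t(2) by simp
    have "poly (dl * pderiv M - M * pderiv dl) a = 0" unfolding M using Ga by simp
    then have "poly M a * poly (pderiv dl) a = 0" using dla by simp
    moreover have "poly (pderiv dl) a = poly e a"
      unfolding e(1) r1 using t by (simp add: pderiv_mult)
    ultimately have "poly M a = 0" using e(2) by simp
    then show ?thesis unfolding r1 t_def using poly_factor_root[of M a] by auto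
  qed simp
  obtain n1 where n1: "N1 = t ^ r * n1" using factor[OF N(1)] by blast
  obtain n2 where n2: "N2 = t ^ r * n2" using factor[OF N(2)] by blast
  \<comment> \<open>The derivative of N1 / dl is - P G / (ep dl), and \<open>ep\<close> and
    \<open>dl\<close> both vanish to order r; j is the order that remains.\<close>
  define j where "j = order a G - 2 * r"
  have jr: "order a G = 2 * r + j" using rW r unfolding j_def ordG(2) by auto
  have wr: "e * pderiv n - n * pderiv e = t ^ j * (- (S * d1 * g))"
    if M: "dl * pderiv (t ^ r * n) - (t ^ r * n) * pderiv dl = - (S * d1 * G)" for n S
  proof -
    have "dl * pderiv (t ^ r * n) - (t ^ r * n) * pderiv dl = t ^ (2 * r) * (e * pderiv n - n * pderiv e)"
      unfolding e(1) pderiv_mult by (simp add: algebra_simps mult_2_right power_add)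
    moreover have "- (S * d1 * G) = t ^ (2 * r) * (t ^ j * (- (S * d1 * g)))"
      by (subst g(1)) (simp add: jr power_add algebra_simps)
    ultimately have "t ^ (2 * r) * (e * pderiv n - n * pderiv e) = t ^ (2 * r) * (t ^ j * (- (S * d1 * g)))"
      using M by simp
    then show ?thesis using t(3) by (simp only: mult_cancel_left power_eq_0_iff) simp
  qed
  have prim: "\<exists>w V. n = smult w e + t ^ Suc j * V \<and> of_nat (Suc j) * poly e a * poly V a = - (poly S a * poly d1 a * poly g a)"
    if n: "e * pderiv n - n * pderiv e = t ^ j * (- (S * d1 * g))" for n S
  proof -
    define w where "w = poly n a / poly e a"
    have "poly (n - smult w e) a = 0" using e(2) by (simp add: w_def)
    moreover have "e * pderiv (n - smult w e) - (n - smult w e) * pderiv e = [:- a, 1:] ^ j * (- (S * d1 * g))"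
      using n unfolding t_def[symmetric] by (simp add: pderiv_diff pderiv_smult algebra_simps)
    ultimately obtain V where "n - smult w e = [:- a, 1:] ^ Suc j * V"
      "of_nat (Suc j) * poly e a * poly V a = poly (- (S * d1 * g)) a"
      using wronskian_primitive[OF e(2)] by metis
    then show ?thesis
      unfolding t_def by (intro exI[of _ w] exI[of _ V]) (simp add: diff_eq_eq add.commute)
  qed
  obtain w1 V1 where V1: "n1 = smult w1 e + t ^ Suc j * V1"
    "of_nat (Suc j) * poly e a * poly V1 a = - (poly P a * poly d1 a * poly g a)"
    using prim[OF wr[OF N(1)[unfolded n1]]] by blast
  obtain w2 V2 where V2: "n2 = smult w2 e + t ^ Suc j * V2"
    "of_nat (Suc j) * poly e a * poly V2 a = - (poly Q a * poly d1 a * poly g a)"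
    using prim[OF wr[OF N(2)[unfolded n2]]] by blast
  \<comment> \<open>w1 and w2 are the values at \<open>a\<close> to which N1 / dl and N2 / dl
    extend; this multiple of \<open>tau\<close> cancels them.\<close>
  define l where "l = - (qc w1 - quat_k * qc w2)"
  define \<Phi> where "\<Phi> u = qc (poly e u) * inverse (spin u) * (qc (poly V1 u / poly e u) - quat_k * qc (poly V2 u / poly e u))" for u
  define \<kappa> where "\<kappa> = - (poly d1 a * poly g a / (of_nat (Suc j) * poly e a))"
  have \<kappa>: "\<kappa> \<noteq> 0" using a g(2) e(2) by (simp add: \<kappa>_def del: of_nat_Suc)
  \<comment> \<open>At \<open>a\<close> the coefficients V1 and V2 are P and Q times the common
    factor \<kappa>, so the spinor cancels and \<Phi> takes a complex value there, as
    \<open>leads_conjugated_power\<close> requires.\<close>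
  have \<Phi>a: "\<Phi> a = qc \<kappa>"
  proof -
    have nz: "of_nat (Suc j) * poly e a \<noteq> 0" using e(2) by (simp del: of_nat_Suc)
    have "v = b * \<kappa>" if "of_nat (Suc j) * poly e a * v = - (b * poly d1 a * poly g a)" for v b
      using arg_cong[OF that, of "\<lambda>w. w / (of_nat (Suc j) * poly e a)"] e(2)
      unfolding nonzero_mult_div_cancel_left[OF nz] \<kappa>_def by (simp add: mult.assoc)
    then have V: "poly V1 a = poly P a * \<kappa>" "poly V2 a = poly Q a * \<kappa>"
      using V1(2) V2(2) by blast+
    have "qc (poly V1 a / poly e a) - quat_k * qc (poly V2 a / poly e a) = spin a * qc (\<kappa> / poly e a)"
      unfolding V spin_def by (simp add: left_diff_distrib mult.assoc flip: qc_mult)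
    then have "\<Phi> a = qc (poly e a) * (inverse (spin a) * spin a) * qc (\<kappa> / poly e a)"
      by (simp add: \<Phi>_def mult.assoc)
    also have "\<dots> = qc \<kappa>"
      using spin_nonzero[of a] e(2) by (simp flip: qc_mult)
    finally show ?thesis .
  qed
  have "\<exists>\<Phi>'. (\<Phi> has_derivative \<Phi>') (at a)"
  proof -
    have q: "((\<lambda>u. qc (poly V u / poly e u)) has_derivative
        (\<lambda>v. qc ((poly (pderiv V) a * poly e a - poly V a * poly (pderiv e) a) / (poly e a * poly e a) * v))) (at a)" for V
      using DERIV_divide[OF poly_DERIV poly_DERIV e(2), of V] unfolding has_field_derivative_def
      by (rule bounded_linear.has_derivative[OF bounded_linear_qc])
    have "smooth_on UNIV (\<lambda>u. qc (poly e u) * inverse (spin u))"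
      by (intro smooth_on_mult smooth_on_qc smooth_on_poly smooth_on_quat_inverse smooth_spin open_UNIV spin_nonzero)
    note s = smooth_on_has_derivative[OF open_UNIV this UNIV_I]
    show ?thesis
      unfolding \<Phi>_def
      by (rule exI, rule has_derivative_mult[OF s has_derivative_diff[OF q has_derivative_mult_right[OF q]]])
  qed
  then obtain \<Phi>' where \<Phi>': "(\<Phi> has_derivative \<Phi>') (at a)" by blast
  define \<eta> where "\<eta> u = row1 u * qc c1 + row2 u * qc c2 + tau u * l" for u
  define \<xi> where "\<xi> u = qc ((u - a) ^ r) * \<Phi> u * qc ((u - a) ^ Suc j)" for u
  have "leads \<xi> a (r + Suc j)"
    unfolding \<xi>_def by (rule leads_conjugated_power[OF \<Phi>' \<Phi>a \<kappa>])
  moreover have "\<forall>\<^sub>F u in nhds a. \<eta> u = \<xi> u"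
    unfolding eventually_nhds_conv_at
  proof
    show ev: "\<forall>\<^sub>F u in at a. \<eta> u = \<xi> u"
      using eventually_at_poly_nonzero[OF dl_nonzero]
    proof eventually_elim
      case (elim u)
      have dlu: "poly dl u = (u - a) ^ r * poly e u" unfolding e(1) by (simp add: t(4))
      then have eu: "poly e u \<noteq> 0" and tu: "(u - a) ^ r \<noteq> 0" using elim by auto
      have n: "poly N1 u / poly dl u = w1 + (u - a) ^ Suc j * (poly V1 u / poly e u)"
        "poly N2 u / poly dl u = w2 + (u - a) ^ Suc j * (poly V2 u / poly e u)"
      proof -
        have "b * (w * c + d * v) / (b * c) = w + d * (v / c)" if "b \<noteq> 0" "c \<noteq> 0" for b c d v w :: complex
          using that by (simp add: add_divide_distrib)
        from this[OF tu eu] show "poly N1 u / poly dl u = w1 + (u - a) ^ Suc j * (poly V1 u / poly e u)"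
          "poly N2 u / poly dl u = w2 + (u - a) ^ Suc j * (poly V2 u / poly e u)"
          unfolding dlu n1 n2 V1(1) V2(1) by (simp_all only: poly_mult poly_power poly_add poly_smult t(4))
      qed
      have "row1 u * qc c1 + row2 u * qc c2 = tau u * (qc (poly a22 u / poly dl u * c1) + quat_k * qc (poly a21 u / poly dl u * c1)
          - (qc (poly a12 u / poly dl u * c2) + quat_k * qc (poly a11 u / poly dl u * c2)))"
        unfolding row_regular[OF elim] qc_mult
        by (simp only: mult_minus_left mult_minus_right distrib_left distrib_right right_diff_distrib mult.assoc diff_conv_add_uminus minus_add_distrib)
      also have "qc (poly a22 u / poly dl u * c1) + quat_k * qc (poly a21 u / poly dl u * c1)
          - (qc (poly a12 u / poly dl u * c2) + quat_k * qc (poly a11 u / poly dl u * c2)) =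
          qc (poly N1 u / poly dl u) - quat_k * qc (poly N2 u / poly dl u)"
        by (simp add: N1_def N2_def qc_diff diff_divide_distrib right_diff_distrib mult.commute)
      finally have "\<eta> u = tau u * (qc ((u - a) ^ Suc j * (poly V1 u / poly e u)) - quat_k * qc ((u - a) ^ Suc j * (poly V2 u / poly e u)))"
      proof -
        assume A: "row1 u * qc c1 + row2 u * qc c2 = tau u * (qc (poly N1 u / poly dl u) - quat_k * qc (poly N2 u / poly dl u))"
        have "qc (w1 + b1) - quat_k * qc (w2 + b2) + l = qc b1 - quat_k * qc b2" for b1 b2
          unfolding l_def qc_add by (simp add: distrib_left)
        then show ?thesis
          unfolding \<eta>_def A n distrib_left[symmetric] by simp
      qed
      also have "\<dots> = tau u * ((qc (poly V1 u / poly e u) - quat_k * qc (poly V2 u / poly e u)) * qc ((u - a) ^ Suc j))"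
        by (simp only: left_diff_distrib mult.assoc qc_mult[symmetric] mult.commute[of "_ ^ Suc j"])
      also have "\<dots> = \<xi> u"
        unfolding tau_def dlu \<xi>_def \<Phi>_def by (simp only: qc_mult mult.assoc)
      finally show ?case .
    qed
    have "\<eta> a - \<xi> a = 0"
    proof (rule zero_by_continuity[where z = a])
      have "smooth_on UNIV \<eta>"
        unfolding \<eta>_def by (intro smooth_on_add smooth_on_mult smooth_row smooth_tau smooth_on_const open_UNIV)
      then have "isCont \<eta> a"
        using smooth_on_continuous continuous_on_eq_continuous_at[OF open_UNIV] by blast
      moreover have "isCont \<xi> a"
        unfolding \<xi>_def
        by (intro continuous_intros bounded_linear.isCont[OF bounded_linear_qc] has_derivative_continuous[OF \<Phi>'])
      ultimately show "isCont (\<lambda>u. \<eta> u - \<xi> u) a" by (intro continuous_intros)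
      show "\<forall>\<^sub>F u in at a. \<eta> u - \<xi> u = 0" using ev by eventually_elim simp
    qed
    then show "\<eta> a = \<xi> a" by simp
  qed
  ultimately have "leads \<eta> a (r + Suc j)" by (rule leads_cong)
  \<comment> \<open>By ep k0 = W d1 the order of \<open>k0\<close> is that of W minus r, and 2 r + j
    is the order of G, one more than that of W.\<close>
  moreover have "r + Suc j = order a k0 + 2"
  proof -
    have "ep * k0 \<noteq> 0" unfolding ep_k0 using W d1_nonzero by simp
    then have "order a ep + order a k0 = order a W + order a d1"
      using order_mult[of ep k0 a] order_mult[of W d1 a] unfolding ep_k0 by simp
    then have "r + order a k0 = order a W"
      using ord_ep a by (simp add: order_0I)
    then show ?thesis using jr ordG(2) by linarith
  qed
  ultimately have "leads \<eta> a (order a k0 + 2)" by simp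
  then show ?thesis unfolding \<eta>_def by blast
qed

end

section \<open>Polynomial data of a rational null immersion\<close>

text \<open>A common zero of the denominator and all numerators is divided out; the degree of the
  denominator falls each time.\<close>

lemma reduce_fractions:
  fixes p0 :: "'i \<Rightarrow> complex poly"
  assumes "q0 \<noteq> 0"
  shows "\<exists>p q. q \<noteq> 0 \<and> (\<forall>i. p i * q0 = p0 i * q) \<and> (\<forall>z. poly q z \<noteq> 0 \<or> (\<exists>i. poly (p i) z \<noteq> 0))"
  using assms
proof (induction "degree q0" arbitrary: p0 q0 rule: less_induct)
  case less
  show ?case
  proof (cases "\<exists>z. poly q0 z = 0 \<and> (\<forall>i. poly (p0 i) z = 0)")
    case False
    then show ?thesis using less.prems by (intro exI[of _ p0] exI[of _ q0]) auto
  next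
    case True
    then obtain a where a: "poly q0 a = 0" "\<And>i. poly (p0 i) a = 0" by blast
    obtain q1 where q1: "q0 = [:- a, 1:] * q1" using poly_factor_root[OF a(1)] .
    have "\<forall>i. \<exists>p1. p0 i = [:- a, 1:] * p1" using poly_factor_root[OF a(2)] by metis
    then obtain p1 where p1: "\<And>i. p0 i = [:- a, 1:] * p1 i" by metis
    have "q1 \<noteq> 0" using less.prems q1 by auto
    moreover have "degree q1 < degree q0"
      unfolding q1 using \<open>q1 \<noteq> 0\<close> by (simp add: degree_mult_eq del: mult_pCons_left)
    ultimately obtain p q where pq: "q \<noteq> 0" "\<And>i. p i * q1 = p1 i * q"
      "\<And>z. poly q z \<noteq> 0 \<or> (\<exists>i. poly (p i) z \<noteq> 0)"
      using less.hyps[of q1 p1] by blast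
    have "p i * q0 = p0 i * q" for i
      using arg_cong[OF pq(2)[of i], of "\<lambda>r. [:- a, 1:] * r"] unfolding q1 p1
      by (simp only: mult.assoc mult.left_commute mult.commute)
    then show ?thesis using pq(1,3) by blast
  qed
qed

definition reduced_fraction :: "(complex \<Rightarrow> complex) \<Rightarrow> complex poly \<Rightarrow> complex poly \<Rightarrow> bool"
  where "reduced_fraction f p q \<longleftrightarrow> q \<noteq> 0 \<and> (\<forall>z. poly q z \<noteq> 0 \<or> poly p z \<noteq> 0) \<and>
    (\<forall>z. poly q z \<noteq> 0 \<longrightarrow> f z = poly p z / poly q z)"

text \<open>Values are described only where the reduced denominator is nonzero. There
  \<open>remove_sings\<close> returns the limit, and its junk value at the poles does not enter. In
  the w-chart numerator and denominator are reversed to a common degree.\<close>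

lemma rational_fun_chart:
  assumes "rational_fun f"
  shows "\<exists>p q. reduced_fraction (\<lambda>z. f (par c z)) p q"
proof -
  obtain p0 q0 where q0: "q0 \<noteq> 0"
    and fin: "\<And>z. f (Finite z) = remove_sings (\<lambda>u. poly p0 u / poly q0 u) z"
    and inf: "f Infinity = remove_sings (\<lambda>w. poly p0 (1 / w) / poly q0 (1 / w)) 0"
    using assms unfolding rational_fun_def by blast
  obtain p' q where "q \<noteq> 0" "\<forall>i::unit. p' i * q0 = p0 * q" "\<forall>z. poly q z \<noteq> 0 \<or> (\<exists>i::unit. poly (p' i) z \<noteq> 0)"
    using reduce_fractions[OF q0, of "\<lambda>_::unit. p0"] by blast
  then obtain p where q: "q \<noteq> 0" and eq: "p * q0 = p0 * q" and red: "\<And>z. poly q z \<noteq> 0 \<or> poly p z \<noteq> 0"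
    by (metis (full_types) old.unit.exhaust)
  have same: "poly p0 u / poly q0 u = poly p u / poly q u" if "poly q0 u \<noteq> 0" "poly q u \<noteq> 0" for u
    using arg_cong[OF eq, of "\<lambda>r. poly r u"] that by (simp add: frac_eq_eq)
  have Z: "f (Finite z) = poly p z / poly q z" if z: "poly q z \<noteq> 0" for z
  proof -
    have "((\<lambda>u. poly p u / poly q u) \<longlongrightarrow> poly p z / poly q z) (at z)"
      using z by (intro tendsto_intros)
    moreover have "\<forall>\<^sub>F u in at z. poly p u / poly q u = poly p0 u / poly q0 u"
      using eventually_at_poly_nonzero[OF q0] eventually_at_poly_nonzero[OF q]
      by eventually_elim (simp add: same)
    ultimately have "((\<lambda>u. poly p0 u / poly q0 u) \<longlongrightarrow> poly p z / poly q z) (at z)"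
      by (rule Lim_transform_eventually)
    then show ?thesis unfolding fin by (rule remove_sings_eqI)
  qed
  show ?thesis
  proof (cases c)
    case Zchart
    then show ?thesis using q red Z by (intro exI[of _ p] exI[of _ q]) (simp add: reduced_fraction_def)
  next
    case Wchart
    define n where "n = max (degree p) (degree q)"
    have deg: "degree p \<le> n" "degree q \<le> n" by (auto simp: n_def)
    have qh: "hat_poly n q \<noteq> 0"
    proof -
      obtain w where w: "w \<noteq> 0" "poly q (1 / w) \<noteq> 0"
      proof -
        obtain z where "poly q z \<noteq> 0 \<and> z \<noteq> 0"
          using eventually_happens[OF eventually_conj[OF eventually_at_poly_nonzero[OF q, of 0]
            eventually_neq_at_within[of 0 0 UNIV]]] by auto
        then show ?thesis using that[of "1 / z"] by simp
      qed
      then show ?thesis using poly_hat_poly[OF deg(2) w(1)] by auto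
    qed
    have quot: "poly p (1 / w) / poly q (1 / w) = poly (hat_poly n p) w / poly (hat_poly n q) w" if "w \<noteq> 0" for w
      using that by (simp add: poly_hat_poly deg)
    have lead0: "coeff p n \<noteq> 0 \<or> coeff q n \<noteq> 0"
    proof (cases "degree p \<le> degree q")
      case True
      then show ?thesis using q by (simp add: n_def max_def)
    next
      case False
      then have "p \<noteq> 0" "n = degree p" by (auto simp: n_def)
      then show ?thesis by simp
    qed
    have "reduced_fraction (\<lambda>w. f (par Wchart w)) (hat_poly n p) (hat_poly n q)"
      unfolding reduced_fraction_def
    proof (intro conjI allI impI qh)
      fix w
      show "poly (hat_poly n q) w \<noteq> 0 \<or> poly (hat_poly n p) w \<noteq> 0"
      proof (cases "w = 0")
        case True
        then show ?thesis using lead0 by (auto simp: poly_hat_poly_0 deg)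
      next
        case False
        then show ?thesis using red[of "1 / w"] by (simp add: poly_hat_poly deg)
      qed
    next
      fix w assume w: "poly (hat_poly n q) w \<noteq> 0"
      show "f (par Wchart w) = poly (hat_poly n p) w / poly (hat_poly n q) w"
      proof (cases "w = 0")
        case False
        then have "poly q (1 / w) \<noteq> 0" using w by (auto simp: poly_hat_poly deg)
        then show ?thesis using False by (simp add: Z quot)
      next
        case True
        have "((\<lambda>w. poly (hat_poly n p) w / poly (hat_poly n q) w) \<longlongrightarrow>
            poly (hat_poly n p) 0 / poly (hat_poly n q) 0) (at 0)"
          using w True by (intro tendsto_intros) simp
        moreover have "\<forall>\<^sub>F w in at 0. poly (hat_poly n p) w / poly (hat_poly n q) w =
            poly p0 (1 / w) / poly q0 (1 / w)"
        proof -
          have "hat_poly (degree q0) q0 \<noteq> 0"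
            using q0 by (simp add: hat_poly_def)
          from eventually_at_poly_nonzero[OF this, of 0] eventually_at_poly_nonzero[OF qh, of 0]
            eventually_neq_at_within[of 0 0 UNIV]
          show ?thesis
          proof eventually_elim
            case (elim w)
            then have "poly q0 (1 / w) \<noteq> 0" "poly q (1 / w) \<noteq> 0"
              by (auto simp: poly_hat_poly deg)
            then show ?case using same quot elim by simp
          qed
        qed
        ultimately have "((\<lambda>w. poly p0 (1 / w) / poly q0 (1 / w)) \<longlongrightarrow>
            poly (hat_poly n p) 0 / poly (hat_poly n q) 0) (at 0)"
          by (rule Lim_transform_eventually)
        then show ?thesis using True inf by (simp add: remove_sings_eqI)
      qed
    qed
    then show ?thesis using Wchart by blast
  qed
qed

lemma common_denominator:
  fixes M :: "complex \<Rightarrow> complex^2^2"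
  assumes "\<And>i j. \<exists>p q. reduced_fraction (\<lambda>z. M z $ i $ j) p q"
  shows "\<exists>A dl. dl \<noteq> 0 \<and> (\<forall>z. poly dl z \<noteq> 0 \<or> (\<exists>i j. poly (A i j) z \<noteq> 0)) \<and>
    (\<forall>z i j. poly dl z \<noteq> 0 \<longrightarrow> M z $ i $ j = poly (A i j) z / poly dl z)"
proof -
  obtain p q where pq: "\<And>i j. reduced_fraction (\<lambda>z. M z $ i $ j) (p i j) (q i j)"
    using assms by metis
  have q0: "q i j \<noteq> 0" for i j using pq[of i j] by (simp add: reduced_fraction_def)
  define q' where "q' k = q (fst k) (snd k)" for k
  define D where "D = (\<Prod>k\<in>UNIV. q' k)"
  have D0: "D \<noteq> 0" using q0 by (simp add: D_def q'_def)
  define B where "B k = p (fst k) (snd k) * (\<Prod>k'\<in>UNIV - {k}. q' k')" for k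
  have B: "B k * q' k = p (fst k) (snd k) * D" for k
    unfolding B_def D_def using prod.remove[of UNIV k q'] by (simp add: mult_ac)
  obtain A dl where A: "dl \<noteq> 0" "\<And>k. A k * D = B k * dl" "\<And>z. poly dl z \<noteq> 0 \<or> (\<exists>k. poly (A k) z \<noteq> 0)"
    using reduce_fractions[OF D0, of B] by blast
  have eq: "A (i, j) * q i j = p i j * dl" for i j
  proof -
    have "D * (A (i, j) * q i j) = (A (i, j) * D) * q' (i, j)" by (simp add: q'_def mult_ac)
    also have "\<dots> = (B (i, j) * q' (i, j)) * dl" unfolding A(2) by (simp add: mult_ac)
    also have "\<dots> = D * (p i j * dl)" unfolding B by (simp add: mult_ac)
    finally show ?thesis using D0 by simp
  qed
  have "M z $ i $ j = poly (A (i, j)) z / poly dl z" if z: "poly dl z \<noteq> 0" for z i j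
  proof -
    have e: "poly (A (i, j)) z * poly (q i j) z = poly (p i j) z * poly dl z"
      using arg_cong[OF eq[of i j], of "\<lambda>r. poly r z"] by simp
    then have "poly (q i j) z \<noteq> 0" using pq[of i j] z by (auto simp: reduced_fraction_def)
    moreover from this have "M z $ i $ j = poly (p i j) z / poly (q i j) z"
      using pq[of i j] by (simp add: reduced_fraction_def)
    ultimately show ?thesis using e z by (simp add: frac_eq_eq)
  qed
  moreover have "poly dl z \<noteq> 0 \<or> (\<exists>i j. poly (A (i, j)) z \<noteq> 0)" for z
    using A(3)[of z] by auto
  ultimately show ?thesis
    using A(1) by (intro exI[of _ "\<lambda>i j. A (i, j)"] exI[of _ dl]) blast
qed

text \<open>Linear factors are restored one at a time: a factor that is already present enlarges
  \<open>d1\<close>, a new one enlarges \<open>ep\<close>. In both cases nu / ep gains the fraction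
  1 / (z - a).\<close>

lemma radical_exists:
  fixes dl :: "complex poly"
  assumes "dl \<noteq> 0"
  shows "\<exists>ep d1 nu. radical dl ep d1 nu"
  using assms
proof (induction "degree dl" arbitrary: dl)
  case 0
  then obtain c where c: "dl = [:c:]" by (metis degree_eq_zeroE)
  have "radical dl dl 1 0"
    by standard (use c 0 in \<open>auto simp: pderiv_pCons\<close>)
  then show ?case by blast
next
  case (Suc n)
  obtain a where a: "poly dl a = 0"
    using alg_closed_imp_poly_has_root[of dl] Suc.hyps(2) by auto
  obtain dl' where dl': "dl = [:- a, 1:] * dl'" using poly_factor_root[OF a] .
  have nz: "dl' \<noteq> 0" using Suc.prems dl' by auto
  have "n = degree dl'" using Suc.hyps(2) nz dl' by (simp add: degree_mult_eq del: mult_pCons_left)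
  from Suc.hyps(1)[OF this nz] obtain ep d1 nu where "radical dl' ep d1 nu" by blast
  then interpret radical dl' ep d1 nu .
  define t :: "complex poly" where "t = [:- a, 1:]"
  have t: "pderiv t = 1" "t \<noteq> 0" "\<And>u. poly t u = u - a" by (auto simp: t_def pderiv_pCons)
  have dlt: "dl = t * dl'" using dl' by (simp add: t_def)
  have D: "pderiv dl = dl' + t * (d1 * nu)"
    unfolding dlt pderiv_mult by (simp add: t(1) pderiv_dl)
  show ?case
  proof (cases "poly dl' a = 0")
    case True
    obtain e where e: "ep = t * e" using poly_factor_root[OF ep_root[OF True]] unfolding t_def .
    have "radical dl ep (t * d1) (e + nu)"
    proof
      show "dl = ep * (t * d1)" unfolding dlt by (subst dl_eq) (simp add: mult_ac)
      show "pderiv dl = t * d1 * (e + nu)"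
        unfolding D by (subst dl_eq) (simp add: e algebra_simps)
      show "poly ep z = 0" if "poly dl z = 0" for z
        using that ep_root[of z] True ep_root[of a] by (auto simp: dlt t(3))
    qed (use Suc.prems ep_simple in auto)
    then show ?thesis by blast
  next
    case False
    have "radical dl (t * ep) d1 (ep + t * nu)"
    proof
      show "dl = t * ep * d1" unfolding dlt by (subst dl_eq) (simp add: mult_ac)
      show "pderiv dl = d1 * (ep + t * nu)"
        unfolding D by (subst dl_eq) (simp add: algebra_simps)
      show "poly (t * ep) z = 0" if "poly dl z = 0" for z
        using that ep_root[of z] by (auto simp: dlt)
      show "poly (pderiv (t * ep)) z \<noteq> 0" if z: "poly (t * ep) z = 0" for z
      proof (cases "z = a")
        case True
        then show ?thesis using False by (auto simp: pderiv_mult t dl_eq)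
      next
        case neq: False
        then have "poly ep z = 0" using z by (simp add: t(3))
        then show ?thesis using ep_simple[of z] neq by (simp add: pderiv_mult t)
      qed
    qed (use Suc.prems in auto)
    then show ?thesis by blast
  qed
qed

lemma even_orders_square:
  fixes p :: "complex poly"
  assumes "p = 0 \<or> (\<forall>a. even (order a p))"
  shows "\<exists>s. p = s * s"
  using assms
proof (induction "degree p" arbitrary: p rule: less_induct)
  case less
  consider "p = 0" | "p \<noteq> 0" "degree p = 0" | "p \<noteq> 0" "degree p > 0" by blast
  then show ?case
  proof cases
    case 1
    then show ?thesis by (intro exI[of _ 0]) simp
  next
    case 2
    then obtain c where "p = [:c:]" by (metis degree_eq_zeroE)
    then show ?thesis
      using power2_csqrt[of c] by (intro exI[of _ "[:csqrt c:]"]) (simp add: power2_eq_square)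
  next
    case 3
    obtain a where a: "poly p a = 0" using alg_closed_imp_poly_has_root[of p] 3 by auto
    have "order a p \<noteq> 0" using a 3 by (simp add: order_root)
    moreover have ev: "even (order z p)" for z using less.prems 3 by blast
    ultimately have "2 \<le> order a p" by (metis One_nat_def even_Suc le_less_Suc_eq less_2_cases_iff not_less numeral_2_eq_2 odd_one)
    then have "[:- a, 1:] ^ 2 dvd p" unfolding order_divides by simp
    then obtain q where q: "p = [:- a, 1:] ^ 2 * q" by (elim dvdE)
    have q0: "q \<noteq> 0" using q 3 by auto
    have "degree p = 2 + degree q"
      unfolding q using q0 by (simp add: degree_mult_eq degree_power_eq del: mult_pCons_left)
    moreover have "even (order z q)" for z
    proof -
      have "order z p = order z ([:- a, 1:] ^ 2) + order z q"
        using 3 unfolding q by (simp add: order_mult del: mult_pCons_left)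
      moreover have "order z (t ^ 2) = 2 * order z t" if "t \<noteq> 0" for t :: "complex poly"
        using that unfolding power2_eq_square by (simp add: order_mult)
      then have "order z ([:- a, 1:] ^ 2) = 2 * order z [:- a, 1:]"
        by (metis one_neq_zero pCons_eq_0_iff)
      ultimately show ?thesis using ev[of z] by simp
    qed
    ultimately obtain s where "q = s * s" using less.hyps[of q] by auto
    then show ?thesis
      unfolding q by (intro exI[of _ "[:- a, 1:] * s"]) (simp only: power2_eq_square mult_ac)
  qed
qed

text \<open>Where one factor vanishes the other does not, so the zeros of each have even order and
  each is a square; the sign of \<open>a\<close> is absorbed into \<open>x\<close>.\<close>

lemma coprime_squares:
  fixes b c a :: "complex poly"
  assumes "b * c = a * a" "\<And>z. poly b z \<noteq> 0 \<or> poly c z \<noteq> 0"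
  shows "\<exists>x y. b = x * x \<and> c = y * y \<and> a = x * y"
proof -
  have even: "b = 0 \<or> (\<forall>z. even (order z b))"
    if bc: "b * c = a * a" "\<And>z. poly b z \<noteq> 0 \<or> poly c z \<noteq> 0" for b c
  proof (cases "b = 0 \<or> c = 0")
    case True
    then show ?thesis
    proof
      assume "c = 0"
      then have "poly b z \<noteq> 0" for z using bc(2)[of z] by simp
      then show ?thesis by (simp add: order_0I)
    qed simp
  next
    case False
    then have "a \<noteq> 0" using bc(1) by auto
    have "even (order z b)" for z
    proof (cases "poly b z = 0")
      case True
      then have "order z c = 0" using bc(2)[of z] by (simp add: order_0I)
      moreover have "order z b + order z c = 2 * order z a"
        using order_mult[of b c z] order_mult[of a a z] bc(1) False \<open>a \<noteq> 0\<close> by simp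
      ultimately show ?thesis by simp
    qed (simp add: order_0I)
    then show ?thesis by blast
  qed
  obtain x where x: "b = x * x" using even_orders_square[OF even[OF assms]] by blast
  have "c * b = a * a" "\<And>z. poly c z \<noteq> 0 \<or> poly b z \<noteq> 0"
    using assms by (auto simp: mult.commute)
  from even_orders_square[OF even[OF this]] obtain y where y: "c = y * y" by blast
  have "(x * y - a) * (x * y + a) = 0"
    using assms(1) unfolding x y by (simp add: algebra_simps)
  then consider "a = x * y" | "a = - x * y" by (auto simp: eq_neg_iff_add_eq_0 add.commute)
  then show ?thesis
  proof cases
    case 1 then show ?thesis using x y by blast
  next
    case 2 then show ?thesis using x y by (intro exI[of _ "- x"] exI[of _ y]) simp
  qed
qed

section \<open>From the matrix function to the polynomial data of a chart\<close>

lemma poly_eq_off_roots: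
  fixes p q D :: "complex poly"
  assumes "D \<noteq> 0" "\<And>z. poly D z \<noteq> 0 \<Longrightarrow> poly p z = poly q z"
  shows "p = q"
proof -
  have "poly (D * (p - q)) z = 0" for z using assms(2)[of z] by auto
  then have "D * (p - q) = 0" using poly_all_0_iff_0 by blast
  then show ?thesis using assms(1) by simp
qed

lemma matrix_inv_2:
  fixes A :: "complex^2^2"
  assumes "det A = 1"
  shows "matrix_inv A = (\<chi> i j. if i = 1 then (if j = 1 then A $ 2 $ 2 else - A $ 1 $ 2)
      else (if j = 1 then - A $ 2 $ 1 else A $ 1 $ 1))"
    (is "_ = ?B")
proof -
  have AB: "A ** ?B = mat 1" "?B ** A = mat 1"
    using assms by (simp_all add: vec_eq_iff forall_2 matrix_matrix_mult_def sum_2 mat_def det_2 algebra_simps)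
  have "A ** matrix_inv A = mat 1"
    unfolding matrix_inv_def by (rule someI2[of _ ?B]) (use AB in auto)
  then have "?B ** (A ** matrix_inv A) = ?B" by simp
  then show ?thesis by (simp only: matrix_mul_assoc AB(2) matrix_mul_lid)
qed

lemma tendsto_matrix:
  fixes X :: "complex \<Rightarrow> 2 \<Rightarrow> 2 \<Rightarrow> complex"
  assumes "\<And>i j. ((\<lambda>u. X u i j) \<longlongrightarrow> B $ i $ j) F"
  shows "((\<lambda>u. \<chi> i j. X u i j) \<longlongrightarrow> B) F"
  by (intro vec_tendstoI) (simp add: assms)

text \<open>After the common power has been cancelled, the limit is the matrix of the values of Y
  over the remaining denominator, and its \<open>i0\<close>, \<open>j0\<close> entry is
  nonzero.\<close>

lemma pole_of_order_quotient:
  fixes X :: "2 \<Rightarrow> 2 \<Rightarrow> complex poly"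
  assumes D: "D \<noteq> 0" and M: "\<forall>\<^sub>F u in at z. \<forall>i j. M u $ i $ j = poly (X i j) u / poly D u"
    and X: "\<And>i j. X i j = [:- z, 1:] ^ o' * Y i j" and Y: "poly (Y i0 j0) z \<noteq> 0" and o': "o' < order z D"
  shows "pole_of_order M z (order z D - o')"
proof -
  obtain E where E: "D = [:- z, 1:] ^ order z D * E" "poly E z \<noteq> 0"
    using order_factor[OF D] by blast
  define B :: "complex^2^2" where "B = (\<chi> i j. poly (Y i j) z / poly E z)"
  have "B $ i0 $ j0 \<noteq> 0" using Y E(2) by (simp add: B_def)
  then have "B \<noteq> 0" by (metis zero_index)
  moreover have "((\<lambda>u. \<chi> i j. (u - z) ^ (order z D - o') * M u $ i $ j) \<longlongrightarrow> B) (at z)"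
  proof (rule tendsto_matrix)
    fix i j
    have "((\<lambda>u. poly (Y i j) u / poly E u) \<longlongrightarrow> B $ i $ j) (at z)"
      unfolding B_def using E(2) by (auto intro!: tendsto_intros)
    moreover have "\<forall>\<^sub>F u in at z. poly (Y i j) u / poly E u = (u - z) ^ (order z D - o') * M u $ i $ j"
      using M eventually_at_poly_nonzero[OF D] eventually_neq_at_within[of z z UNIV]
    proof eventually_elim
      case (elim u)
      have *: "b / e = c * (d * b / (c * d * e))" if "c \<noteq> 0" "d \<noteq> 0" for b c d e :: complex
        using that by simp
      have "poly D u = (u - z) ^ order z D * poly E u" by (subst E(1)) simp
      also have "(u - z) ^ order z D = (u - z) ^ (order z D - o') * (u - z) ^ o'"
        using o' by (simp flip: power_add)
      finally have eq: "M u $ i $ j = (u - z) ^ o' * poly (Y i j) u / ((u - z) ^ (order z D - o') * (u - z) ^ o' * poly E u)"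
        using elim(1) X[of i j] by simp
      have "(u - z) ^ (order z D - o') \<noteq> 0" "(u - z) ^ o' \<noteq> 0"
        using elim(3) by simp_all
      then show ?case unfolding eq by (rule *)
    qed
    ultimately show "((\<lambda>u. (u - z) ^ (order z D - o') * M u $ i $ j) \<longlongrightarrow> B $ i $ j) (at z)"
      by (rule Lim_transform_eventually)
  qed
  ultimately show ?thesis
    unfolding pole_of_order_def using o' by auto
qed

lemma no_pole_quotient:
  fixes X :: "2 \<Rightarrow> 2 \<Rightarrow> complex poly"
  assumes D: "poly D z \<noteq> 0" and M: "\<And>u i j. poly D u \<noteq> 0 \<Longrightarrow> M u $ i $ j = poly (X i j) u / poly D u"
  shows "\<not> pole_of_order M z m"
proof
  assume "pole_of_order M z m"
  then obtain B where m: "m > 0" and B: "B \<noteq> 0" "((\<lambda>u. \<chi> i j. (u - z) ^ m * M u $ i $ j) \<longlongrightarrow> B) (at z)"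
    unfolding pole_of_order_def by blast
  have "B $ i $ j = 0" for i j
  proof -
    have "((\<lambda>u. (u - z) ^ m * M u $ i $ j) \<longlongrightarrow> B $ i $ j) (at z)"
      using tendsto_vec_nth[OF tendsto_vec_nth[OF B(2), of i], of j] by simp
    moreover have "((\<lambda>u. (u - z) ^ m * M u $ i $ j) \<longlongrightarrow> 0) (at z)"
    proof (rule Lim_transform_eventually)
      show "((\<lambda>u. (u - z) ^ m * (poly (X i j) u / poly D u)) \<longlongrightarrow> 0) (at z)"
        using m D by (auto intro!: tendsto_eq_intros)
      have "D \<noteq> 0" using D by auto
      from eventually_at_poly_nonzero[OF this]
      show "\<forall>\<^sub>F u in at z. (u - z) ^ m * (poly (X i j) u / poly D u) = (u - z) ^ m * M u $ i $ j"
        by eventually_elim (simp add: M)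
    qed
    ultimately show ?thesis using tendsto_unique[OF trivial_limit_at] by blast
  qed
  then show False using B(1) by (simp add: vec_eq_iff)
qed

lemma lowest_order:
  fixes X :: "2 \<Rightarrow> 2 \<Rightarrow> complex poly"
  assumes "\<exists>i j. X i j \<noteq> 0"
  obtains o' Y i0 j0 where "\<And>i j. X i j = [:- z, 1:] ^ o' * Y i j" "poly (Y i0 j0) z \<noteq> 0"
proof -
  define P where "P n \<longleftrightarrow> (\<exists>i j. X i j \<noteq> 0 \<and> order z (X i j) = n)" for n
  have ex: "\<exists>n. P n" using assms by (auto simp: P_def)
  define n where "n = (LEAST n. P n)"
  have "P n" unfolding n_def using ex by (rule LeastI_ex)
  then obtain i0 j0 where ij: "X i0 j0 \<noteq> 0" "order z (X i0 j0) = n" by (auto simp: P_def)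
  have "[:- z, 1:] ^ n dvd X i j" for i j
  proof (cases "X i j = 0")
    case False
    then have "n \<le> order z (X i j)" unfolding n_def by (intro Least_le) (auto simp: P_def)
    then show ?thesis unfolding order_divides by simp
  qed simp
  then have "\<forall>i j. \<exists>y. X i j = [:- z, 1:] ^ n * y" by (meson dvdE)
  then obtain Y where Y: "\<And>i j. X i j = [:- z, 1:] ^ n * Y i j" by metis
  have "poly (Y i0 j0) z \<noteq> 0"
  proof
    assume "poly (Y i0 j0) z = 0"
    then obtain y where "Y i0 j0 = [:- z, 1:] * y" by (rule poly_factor_root)
    then have "[:- z, 1:] ^ Suc n dvd X i0 j0"
      unfolding Y by (simp add: power_Suc2 mult.assoc del: mult_pCons_left mult_pCons_right power_Suc)
    then show False using ij unfolding order_divides by simp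
  qed
  with Y show ?thesis by (rule that)
qed

lemma squarefree_dvd:
  fixes ep p :: "complex poly"
  assumes "ep \<noteq> 0" "\<And>z. poly ep z = 0 \<Longrightarrow> poly (pderiv ep) z \<noteq> 0" "\<And>z. poly ep z = 0 \<Longrightarrow> poly p z = 0"
  shows "ep dvd p"
proof (cases "p = 0")
  case False
  show ?thesis
  proof (rule order_le_imp_dvd[OF assms(1) False])
    fix a
    show "order a ep \<le> order a p"
    proof (cases "poly ep a = 0")
      case True
      then obtain e where e: "ep = [:- a, 1:] * e" by (rule poly_factor_root)
      have "poly (pderiv ep) a = poly e a" unfolding e pderiv_mult by (simp add: pderiv_pCons)
      then have "poly e a \<noteq> 0" using assms(2)[OF True] by simp
      then have "order a ep = 1" using order_of_factor[of e a 1] e by simp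
      moreover have "order a p \<noteq> 0" using assms(3)[OF True] False by (simp add: order_root)
      ultimately show ?thesis by simp
    qed (simp add: order_0I)
  qed
qed simp

text \<open>With F = A / dl, the numerators C of dF and X of dF F^-1 have the denominators dl^2 and
  dl^3. The condition on the ends lowers the denominator of dF F^-1 to ep^2, with a numerator
  \<Omega>0 that has no zeros. The trace of \<Omega>0 vanishes because det F is constant, its
  determinant by the null condition, so its entries are products of two polynomials x and y without
  common zeros. Dividing y A1 - x A2 by \<open>ep\<close>, where A1 and A2 are the rows of A, yields
  the other spinor.\<close>

lemma chart_data_exists:
  fixes M :: "complex \<Rightarrow> complex^2^2"
  assumes rat: "\<And>i j. \<exists>p q. reduced_fraction (\<lambda>z. M z $ i $ j) p q"
    and null: "\<And>z. (\<nexists>m. pole_of_order M z m) \<Longrightarrow>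
      det (M z) = 1 \<and> det (matrix_deriv M z) = 0 \<and> matrix_deriv M z \<noteq> 0"
    and smooth_end: "\<And>z m. pole_of_order (\<lambda>u. matrix_deriv M u ** matrix_inv (M u)) z m \<Longrightarrow> m = 2"
  shows "\<exists>dl ep d1 nu a11 a12 a21 a22 x y P Q. chart_data dl ep d1 nu a11 a12 a21 a22 x y P Q \<and>
    (\<forall>z. poly dl z \<noteq> 0 \<longrightarrow> (\<nexists>m. pole_of_order M z m) \<and>
      M z $ 1 $ 1 = poly a11 z / poly dl z \<and> M z $ 1 $ 2 = poly a12 z / poly dl z \<and>
      M z $ 2 $ 1 = poly a21 z / poly dl z \<and> M z $ 2 $ 2 = poly a22 z / poly dl z)"
proof -
  obtain A dl where dl: "dl \<noteq> 0" and A0: "\<And>z. poly dl z \<noteq> 0 \<or> (\<exists>i j. poly (A i j) z \<noteq> 0)"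
    and M: "\<And>z i j. poly dl z \<noteq> 0 \<Longrightarrow> M z $ i $ j = poly (A i j) z / poly dl z"
    using common_denominator[of M, OF rat] by blast
  obtain ep d1 nu where "radical dl ep d1 nu" using radical_exists[OF dl] by blast
  then interpret radical dl ep d1 nu .
  define C where "C i j = pderiv (A i j) * dl - A i j * pderiv dl" for i j
  have C_eq: "C i j = d1 * (ep * pderiv (A i j) - nu * A i j)" for i j
    unfolding C_def pderiv_dl by (subst dl_eq) (simp add: algebra_simps)
  have regular: "\<nexists>m. pole_of_order M z m" if "poly dl z \<noteq> 0" for z
    using no_pole_quotient[OF that M] by blast
  note null' = null[OF regular]
  have dM: "matrix_deriv M z $ i $ j = poly (C i j) z / (poly dl z * poly dl z)" if z: "poly dl z \<noteq> 0" for z i j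
  proof -
    have "((\<lambda>u. poly (A i j) u / poly dl u) has_field_derivative
      ((poly (pderiv (A i j)) z * poly dl z - poly (A i j) z * poly (pderiv dl) z) / (poly dl z * poly dl z))) (at z)"
      by (intro DERIV_divide poly_DERIV z)
    then have "((\<lambda>u. poly (A i j) u / poly dl u) has_field_derivative poly (C i j) z / (poly dl z * poly dl z)) (at z)"
      by (simp add: C_def)
    then have "((\<lambda>u. M u $ i $ j) has_field_derivative poly (C i j) z / (poly dl z * poly dl z)) (at z)"
    proof (rule has_field_derivative_transform_within_open)
      show "open {u. poly dl u \<noteq> 0}" by (intro open_Collect_neq continuous_intros)
    qed (use z M in auto)
    then show ?thesis by (simp add: matrix_deriv_def DERIV_imp_deriv)
  qed
  have det_A: "A 1 1 * A 2 2 - A 1 2 * A 2 1 = dl * dl"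
  proof (rule poly_eq_off_roots[OF dl])
    fix z assume z: "poly dl z \<noteq> 0"
    have "poly (A 1 1) z / poly dl z * (poly (A 2 2) z / poly dl z) - poly (A 1 2) z / poly dl z * (poly (A 2 1) z / poly dl z) = 1"
      using null'[OF z] by (simp add: det_2 M[OF z])
    then have "(poly (A 1 1) z * poly (A 2 2) z - poly (A 1 2) z * poly (A 2 1) z) / (poly dl z * poly dl z) = 1"
      by (simp add: diff_divide_distrib)
    then show "poly (A 1 1 * A 2 2 - A 1 2 * A 2 1) z = poly (dl * dl) z"
      using z by simp
  qed
  have det_C: "C 1 1 * C 2 2 - C 1 2 * C 2 1 = 0"
  proof (rule poly_eq_off_roots[OF dl])
    fix z assume z: "poly dl z \<noteq> 0"
    let ?d = "poly dl z * poly dl z"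
    have "poly (C 1 1) z / ?d * (poly (C 2 2) z / ?d) - poly (C 1 2) z / ?d * (poly (C 2 1) z / ?d) = 0"
      using null'[OF z] by (simp only: det_2 dM[OF z])
    then have "(poly (C 1 1) z * poly (C 2 2) z - poly (C 1 2) z * poly (C 2 1) z) / (?d * ?d) = 0"
      by (simp add: diff_divide_distrib)
    then show "poly (C 1 1 * C 2 2 - C 1 2 * C 2 1) z = poly 0 z"
      using z by simp
  qed
  have C_nonzero: "\<exists>i j. poly (C i j) z \<noteq> 0" if z: "poly dl z \<noteq> 0" for z
  proof (rule ccontr)
    assume "\<not> ?thesis"
    then have "matrix_deriv M z = 0" by (simp add: vec_eq_iff dM[OF z])
    then show False using null'[OF z] by simp
  qed
  \<comment> \<open>The adjugate of A; it is dl F^-1 because det F = 1.\<close>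
  define B :: "2 \<Rightarrow> 2 \<Rightarrow> complex poly" where "B i j = (if i = 1 then (if j = 1 then A 2 2 else - A 1 2)
      else (if j = 1 then - A 2 1 else A 1 1))" for i j
  define X where "X i j = C i 1 * B 1 j + C i 2 * B 2 j" for i j
  have B_simps: "B 1 1 = A 2 2" "B 1 2 = - A 1 2" "B 2 1 = - A 2 1" "B 2 2 = A 1 1"
    by (simp_all add: B_def)
  have XA: "X i 1 * A 1 j + X i 2 * A 2 j = C i j * (dl * dl)" for i j
  proof -
    have j: "j = 1 \<or> j = 2" by (rule exhaust_2)
    then show ?thesis
      unfolding det_A[symmetric] by (auto simp: X_def B_simps algebra_simps)
  qed
  define \<Omega> where "\<Omega> u = matrix_deriv M u ** matrix_inv (M u)" for u
  have \<Omega>: "\<Omega> z $ i $ j = poly (X i j) z / poly (dl * dl * dl) z" if z: "poly dl z \<noteq> 0" for z i j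
  proof -
    have "det (M z) = 1" using null'[OF z] by simp
    then have "matrix_inv (M z) $ k $ j = poly (B k j) z / poly dl z" for k
      by (auto simp: matrix_inv_2 M[OF z] B_def)
    then show ?thesis
      by (simp add: \<Omega>_def matrix_matrix_mult_def sum_2 dM[OF z] X_def add_divide_distrib mult.assoc)
  qed
  have ev\<Omega>: "\<forall>\<^sub>F u in at z. \<forall>i j. \<Omega> u $ i $ j = poly (X i j) u / poly (dl * dl * dl) u" for z
    using eventually_at_poly_nonzero[OF dl] by eventually_elim (simp add: \<Omega>)
  have X_nonzero: "\<exists>i j. poly (X i j) z \<noteq> 0" if z: "poly dl z \<noteq> 0" for z
  proof (rule ccontr)
    assume "\<not> ?thesis"
    then have "poly (C i j) z = 0" for i j
      using arg_cong[OF XA[of i j], of "\<lambda>p. poly p z"] z by simp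
    then show False using C_nonzero[OF z] by blast
  qed
  have X0: "\<exists>i j. X i j \<noteq> 0"
  proof -
    obtain z where "poly dl z \<noteq> 0"
      using eventually_happens[OF eventually_at_poly_nonzero[OF dl, of 0]] by auto
    then obtain i j where "poly (X i j) z \<noteq> 0" using X_nonzero by blast
    then have "X i j \<noteq> 0" by auto
    then show ?thesis by blast
  qed
  have D3: "dl * dl * dl \<noteq> 0" using dl by simp
  have ord3: "order z (dl * dl * dl) = 3 * order z dl" for z
    using dl by (simp add: order_mult)
  \<comment> \<open>Either dF F^-1 has no pole at z or its pole has order exactly two. The exactness
    is what keeps \<Omega>0 from vanishing at the ends.\<close>
  have low: "(\<forall>i j. [:- z, 1:] ^ (3 * order z dl) dvd X i j) \<or>
      (\<forall>i j. [:- z, 1:] ^ (3 * order z dl - 2) dvd X i j) \<and> 3 * order z dl \<ge> 2 \<and>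
      (\<exists>i j. \<not> [:- z, 1:] ^ (3 * order z dl - 1) dvd X i j)" for z
  proof -
    obtain o' Y i0 j0 where Y: "\<And>i j. X i j = [:- z, 1:] ^ o' * Y i j" "poly (Y i0 j0) z \<noteq> 0"
      using lowest_order[OF X0] by blast
    show ?thesis
    proof (cases "o' < 3 * order z dl")
      case True
      then have "pole_of_order \<Omega> z (3 * order z dl - o')"
        using pole_of_order_quotient[OF D3 ev\<Omega> Y(1) Y(2)] by (simp add: ord3)
      then have "3 * order z dl - o' = 2" using smooth_end unfolding \<Omega>_def by blast
      then have o'': "o' = 3 * order z dl - 2" "3 * order z dl \<ge> 2" "3 * order z dl - 1 = Suc o'" by linarith+
      have "\<not> [:- z, 1:] ^ Suc o' dvd X i0 j0"
      proof -
        have "order z (X i0 j0) = o'" unfolding Y(1) by (rule order_of_factor[OF Y(2)])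
        moreover have "X i0 j0 \<noteq> 0" using Y by auto
        ultimately show ?thesis unfolding order_divides by simp
      qed
      moreover have "[:- z, 1:] ^ o' dvd X i j" for i j unfolding Y(1) by simp
      ultimately show ?thesis using o'' by metis
    next
      case False
      then have "[:- z, 1:] ^ (3 * order z dl) dvd X i j" for i j
        unfolding Y(1) by (intro dvd_mult2 le_imp_power_dvd) simp
      then show ?thesis by blast
    qed
  qed
  have "dl * dl * dl dvd ep * ep * X i j" for i j
  proof (cases "X i j = 0")
    case False
    then have nz: "ep * ep * X i j \<noteq> 0" using ep_nonzero by simp
    show ?thesis
    proof (rule order_le_imp_dvd[OF D3 nz])
      fix z
      have o: "order z (ep * ep * X i j) = 2 * order z ep + order z (X i j)"
        using nz by (simp add: order_mult)
      show "order z (dl * dl * dl) \<le> order z (ep * ep * X i j)"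
      proof (cases "poly dl z = 0")
        case True
        have "3 * order z dl - 2 \<le> order z (X i j)"
        proof -
          have "[:- z, 1:] ^ (3 * order z dl - 2) dvd X i j"
            using low[of z] power_le_dvd[of "[:- z, 1:]" "3 * order z dl" "X i j" "3 * order z dl - 2"] by auto
          then show ?thesis using False unfolding order_divides by simp
        qed
        then show ?thesis unfolding ord3 o root_nu(3)[OF True] by linarith
      qed (simp add: ord3 order_0I)
    qed
  qed simp
  then have "\<forall>i j. \<exists>w. ep * ep * X i j = dl * dl * dl * w" by (meson dvdE)
  then obtain \<Omega>0 where \<Omega>0: "\<And>i j. ep * ep * X i j = dl * dl * dl * \<Omega>0 i j" by metis
  \<comment> \<open>The equation dF = (dF F^-1) F in polynomial form.\<close>
  have key: "ep * (ep * pderiv (A i j) - nu * A i j) = \<Omega>0 i 1 * A 1 j + \<Omega>0 i 2 * A 2 j" for i j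
  proof -
    have "dl * dl * dl * (\<Omega>0 i 1 * A 1 j + \<Omega>0 i 2 * A 2 j) = ep * ep * (X i 1 * A 1 j + X i 2 * A 2 j)"
      using \<Omega>0[of i 1] \<Omega>0[of i 2] by (simp add: distrib_left flip: mult.assoc)
    also have "\<dots> = dl * dl * (ep * (ep * d1) * (ep * pderiv (A i j) - nu * A i j))"
      unfolding XA C_eq by (simp add: mult_ac)
    also have "\<dots> = dl * dl * dl * (ep * (ep * pderiv (A i j) - nu * A i j))"
      unfolding dl_eq[symmetric] by (simp add: mult_ac)
    finally show ?thesis using D3 by (metis mult_left_cancel)
  qed
  have A_nonzero: "\<exists>i j. poly (A i j) z \<noteq> 0" for z
  proof (cases "poly dl z = 0")
    case False
    have "poly (A 1 1) z * poly (A 2 2) z - poly (A 1 2) z * poly (A 2 1) z = poly dl z * poly dl z"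
      using arg_cong[OF det_A, of "\<lambda>p. poly p z"] by simp
    then have "poly (A 1 1) z \<noteq> 0 \<or> poly (A 1 2) z \<noteq> 0"
      using False by auto
    then show ?thesis by blast
  qed (use A0 in blast)
  have nu_nonzero: "poly nu z \<noteq> 0" if "poly dl z = 0" for z
    using root_nu(1)[OF that] ep_simple[OF ep_root[OF that]] by (simp del: of_nat_Suc)
  have \<Omega>0_nonzero: "\<exists>i j. poly (\<Omega>0 i j) z \<noteq> 0" for z
  proof (rule ccontr)
    assume "\<not> ?thesis"
    then have z: "\<And>i j. poly (\<Omega>0 i j) z = 0" by blast
    show False
    proof (cases "poly dl z = 0")
      case False
      then have "poly ep z \<noteq> 0" by (simp add: dl_eq)
      then have "poly (X i j) z = 0" for i j
        using arg_cong[OF \<Omega>0[of i j], of "\<lambda>p. poly p z"] z by simp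
      then show False using X_nonzero[OF False] by blast
    next
      \<comment> \<open>If \<Omega>0 vanished at an end, a pole of dF F^-1 there would have order
        less than two, hence there is none by \<open>low\<close>. Then the quotient \<Omega>1
        vanishes at z as well, and dF = (dF F^-1) F forces nu A = 0 at z, although nu is nonzero
        there and A / dl is in lowest terms.\<close>
      case True
      define t :: "complex poly" where "t = [:- z, 1:]"
      have t: "t \<noteq> 0" by (simp add: t_def)
      obtain e where e: "ep = t * e" using poly_factor_root[OF ep_root[OF True]] unfolding t_def .
      have e0: "poly e z \<noteq> 0"
        using ep_simple[OF ep_root[OF True]] unfolding e pderiv_mult by (auto simp: t_def pderiv_pCons)
      obtain g where g: "dl = t ^ order z dl * g" "poly g z \<noteq> 0"
        using order_factor[OF dl_nonzero] unfolding t_def by blast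
      have "\<forall>i j. \<exists>w. \<Omega>0 i j = t * w" using poly_factor_root[OF z] unfolding t_def by metis
      then obtain \<Omega>1 where \<Omega>1: "\<And>i j. \<Omega>0 i j = t * \<Omega>1 i j" by metis
      have r: "order z dl \<ge> 1" using True dl by (metis One_nat_def Suc_leI order_root neq0_conv)
      have eq: "t ^ 2 * (e * e * X i j) = t ^ 2 * (t ^ (3 * order z dl - 1) * (g * g * g * \<Omega>1 i j))" for i j
      proof -
        have "t ^ 2 * (e * e * X i j) = ep * ep * X i j" unfolding e by (simp add: power2_eq_square mult_ac)
        also have "\<dots> = (t ^ order z dl * g) * (t ^ order z dl * g) * (t ^ order z dl * g) * (t * \<Omega>1 i j)"
          unfolding \<Omega>0 \<Omega>1 using g(1) by simp
        also have "\<dots> = t ^ (order z dl + order z dl + order z dl + 1) * (g * g * g * \<Omega>1 i j)"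
          by (simp add: power_add mult_ac)
        also have "order z dl + order z dl + order z dl + 1 = 2 + (3 * order z dl - 1)" using r by linarith
        finally show ?thesis by (simp only: power_add mult.assoc)
      qed
      then have eq': "e * e * X i j = t ^ (3 * order z dl - 1) * (g * g * g * \<Omega>1 i j)" for i j
        using t by (metis mult_left_cancel power_not_zero)
      have dvd1: "t ^ (3 * order z dl - 1) dvd X i j" for i j
      proof (cases "X i j = 0")
        case False
        have nz: "e * e * X i j \<noteq> 0" using False e0 by auto
        have "t ^ (3 * order z dl - 1) dvd e * e * X i j" unfolding eq' by simp
        then have "3 * order z dl - 1 \<le> order z (e * e * X i j)" using nz unfolding t_def order_divides by simp
        also have "\<dots> = order z (X i j)" using nz e0 by (simp add: order_mult order_0I)
        finally show ?thesis unfolding t_def order_divides by simp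
      qed simp
      then have dvd0: "t ^ (3 * order z dl) dvd X i j" for i j
        using low[of z] unfolding t_def by blast
      have "poly (\<Omega>1 i j) z = 0" for i j
      proof -
        obtain w where "X i j = t ^ (3 * order z dl) * w" using dvd0[of i j] by (rule dvdE)
        moreover have "3 * order z dl = Suc (3 * order z dl - 1)" using r by linarith
        ultimately have "X i j = t ^ (3 * order z dl - 1) * (t * w)"
          by (metis power_Suc2 mult.assoc)
        then have "t ^ (3 * order z dl - 1) * (e * e * (t * w)) = t ^ (3 * order z dl - 1) * (g * g * g * \<Omega>1 i j)"
          using eq'[of i j] by (simp add: mult_ac)
        then have "e * e * (t * w) = g * g * g * \<Omega>1 i j"
          using t by (metis mult_left_cancel power_not_zero)
        then have "poly (e * e * (t * w)) z = poly (g * g * g * \<Omega>1 i j) z" by simp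
        then show ?thesis using g(2) by (simp add: t_def)
      qed
      moreover have "e * (ep * pderiv (A i j) - nu * A i j) = \<Omega>1 i 1 * A 1 j + \<Omega>1 i 2 * A 2 j" for i j
      proof -
        have "t * (e * (ep * pderiv (A i j) - nu * A i j)) = t * (\<Omega>1 i 1 * A 1 j + \<Omega>1 i 2 * A 2 j)"
          using key[of i j] unfolding \<Omega>1 by (simp add: e algebra_simps)
        then show ?thesis using t by simp
      qed
      then have "poly (e * (ep * pderiv (A i j) - nu * A i j)) z = poly (\<Omega>1 i 1 * A 1 j + \<Omega>1 i 2 * A 2 j) z" for i j
        by simp
      ultimately have "poly e z * (poly nu z * poly (A i j) z) = 0" for i j
        using ep_root[OF True] by simp
      then have "poly (A i j) z = 0" for i j using e0 nu_nonzero[OF True] by simp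
      then show False using A_nonzero[of z] by blast
    qed
  qed
  \<comment> \<open>The trace of dF F^-1 is the logarithmic derivative of det F = 1.\<close>
  have trace: "\<Omega>0 1 1 + \<Omega>0 2 2 = 0"
  proof -
    have "X 1 1 + X 2 2 = dl * pderiv (A 1 1 * A 2 2 - A 1 2 * A 2 1) - 2 * pderiv dl * (A 1 1 * A 2 2 - A 1 2 * A 2 1)"
      by (simp add: X_def B_simps C_def pderiv_mult pderiv_diff algebra_simps)
    also have "\<dots> = 0" unfolding det_A by (simp add: pderiv_mult algebra_simps)
    finally have "X 1 1 + X 2 2 = 0" .
    moreover have "dl * dl * dl * (\<Omega>0 1 1 + \<Omega>0 2 2) = ep * ep * (X 1 1 + X 2 2)"
      unfolding distrib_left \<Omega>0 ..
    ultimately have "dl * dl * dl * (\<Omega>0 1 1 + \<Omega>0 2 2) = 0" by simp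
    then show ?thesis using D3 by simp
  qed
  have detX: "X 1 1 * X 2 2 - X 1 2 * X 2 1 = 0"
  proof -
    have "X 1 1 * X 2 2 - X 1 2 * X 2 1 = (C 1 1 * C 2 2 - C 1 2 * C 2 1) * (A 1 1 * A 2 2 - A 1 2 * A 2 1)"
      by (simp add: X_def B_simps algebra_simps)
    then show ?thesis unfolding det_C by simp
  qed
  have \<Omega>22: "\<Omega>0 2 2 = - \<Omega>0 1 1"
    using trace by (simp add: add_eq_0_iff)
  have "\<Omega>0 1 1 * \<Omega>0 2 2 - \<Omega>0 1 2 * \<Omega>0 2 1 = 0"
  proof -
    have "(dl * dl * dl) * (dl * dl * dl) * (\<Omega>0 1 1 * \<Omega>0 2 2 - \<Omega>0 1 2 * \<Omega>0 2 1) =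
        (dl * dl * dl * \<Omega>0 1 1) * (dl * dl * dl * \<Omega>0 2 2) - (dl * dl * dl * \<Omega>0 1 2) * (dl * dl * dl * \<Omega>0 2 1)"
      by (simp add: right_diff_distrib mult_ac)
    also have "\<dots> = (ep * ep) * (ep * ep) * (X 1 1 * X 2 2 - X 1 2 * X 2 1)"
      unfolding \<Omega>0[symmetric] by (simp add: right_diff_distrib mult_ac)
    finally show ?thesis unfolding detX using D3 by simp
  qed
  then have prod: "(- \<Omega>0 1 2) * \<Omega>0 2 1 = \<Omega>0 1 1 * \<Omega>0 1 1"
    unfolding \<Omega>22 by (simp add: minus_equation_iff)
  have nz: "poly (- \<Omega>0 1 2) z \<noteq> 0 \<or> poly (\<Omega>0 2 1) z \<noteq> 0" for z
  proof (rule ccontr)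
    assume *: "\<not> ?thesis"
    then have "poly (\<Omega>0 1 1 * \<Omega>0 1 1) z = 0" unfolding prod[symmetric] by simp
    then have "poly (\<Omega>0 i j) z = 0" for i j
      using * \<Omega>22 exhaust_2[of i] exhaust_2[of j] by auto
    then show False using \<Omega>0_nonzero[of z] by blast
  qed
  from coprime_squares[OF prod nz]
  obtain x y where xy: "- \<Omega>0 1 2 = x * x" "\<Omega>0 2 1 = y * y" "\<Omega>0 1 1 = x * y"
    by blast
  have \<Omega>xy: "\<Omega>0 1 1 = x * y" "\<Omega>0 1 2 = - (x * x)" "\<Omega>0 2 1 = y * y" "\<Omega>0 2 2 = - (x * y)"
    unfolding xy(1)[symmetric] \<Omega>22 by (simp_all add: xy(2,3))
  have xy_nonzero: "poly x z \<noteq> 0 \<or> poly y z \<noteq> 0" for z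
  proof (rule ccontr)
    assume "\<not> ?thesis"
    then have "poly (\<Omega>0 i j) z = 0" for i j
      using exhaust_2[of i] exhaust_2[of j] \<Omega>xy by auto
    then show False using \<Omega>0_nonzero[of z] by blast
  qed
  have key1: "ep * (ep * pderiv (A 1 j) - nu * A 1 j) = x * (y * A 1 j - x * A 2 j)"
    and key2: "ep * (ep * pderiv (A 2 j) - nu * A 2 j) = y * (y * A 1 j - x * A 2 j)" for j
    unfolding key \<Omega>xy by (simp_all add: algebra_simps)
  \<comment> \<open>The zeros of \<open>ep\<close> are simple, so it suffices to vanish there. By
    \<open>key1\<close> and \<open>key2\<close> both x and y times the expression vanish, and x and
    y have no common zero.\<close>
  have "ep dvd y * A 1 j - x * A 2 j" for j
  proof (rule squarefree_dvd[OF ep_nonzero ep_simple])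
    fix z assume "poly ep z = 0"
    then have "poly (x * (y * A 1 j - x * A 2 j)) z = 0" "poly (y * (y * A 1 j - x * A 2 j)) z = 0"
      unfolding key1[symmetric] key2[symmetric] by simp_all
    then show "poly (y * A 1 j - x * A 2 j) z = 0" using xy_nonzero[of z] by auto
  qed
  then have "\<forall>j. \<exists>w. y * A 1 j - x * A 2 j = ep * w" unfolding dvd_def by blast
  then obtain S where S: "\<And>j. y * A 1 j - x * A 2 j = ep * S j" by (rule choice[THEN exE]) blast
  have dA: "ep * pderiv (A 1 j) - nu * A 1 j = x * S j" "ep * pderiv (A 2 j) - nu * A 2 j = y * S j" for j
  proof -
    have "ep * (ep * pderiv (A 1 j) - nu * A 1 j) = ep * (x * S j)"
      "ep * (ep * pderiv (A 2 j) - nu * A 2 j) = ep * (y * S j)"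
      unfolding key1 key2 S by (simp_all add: mult_ac)
    then show "ep * pderiv (A 1 j) - nu * A 1 j = x * S j" "ep * pderiv (A 2 j) - nu * A 2 j = y * S j"
      unfolding mult_left_cancel[OF ep_nonzero] .
  qed
  have S_nonzero: "poly (S 1) z \<noteq> 0 \<or> poly (S 2) z \<noteq> 0" for z
  proof (rule ccontr)
    assume *: "\<not> ?thesis"
    then have S0: "poly (S j) z = 0" for j using exhaust_2[of j] by auto
    have z: "poly (ep * pderiv (A i j) - nu * A i j) z = 0" for i j
      using exhaust_2[of i] dA[of j, THEN arg_cong, of "\<lambda>p. poly p z"] S0[of j] by auto
    show False
    proof (cases "poly dl z = 0")
      case True
      then have "poly (A i j) z = 0" for i j
        using z[of i j] ep_root[OF True] nu_nonzero[OF True] by simp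
      then show False using A_nonzero[of z] by blast
    next
      case False
      have "poly (C i j) z = 0" for i j using z[of i j] unfolding C_eq by simp
      then show False using C_nonzero[OF False] by blast
    qed
  qed
  have "chart_data dl ep d1 nu (A 1 1) (A 1 2) (A 2 1) (A 2 2) x y (- S 2) (S 1)"
  proof (unfold_locales)
    show "A 1 1 * A 2 2 - A 1 2 * A 2 1 = dl * dl" by (rule det_A)
    show "poly (A 1 1) z \<noteq> 0 \<or> poly (A 1 2) z \<noteq> 0 \<or> poly (A 2 1) z \<noteq> 0 \<or> poly (A 2 2) z \<noteq> 0" for z
    proof -
      obtain i j where "poly (A i j) z \<noteq> 0" using A_nonzero[of z] by blast
      then show ?thesis using exhaust_2[of i] exhaust_2[of j] by auto
    qed
    show "poly x z \<noteq> 0 \<or> poly y z \<noteq> 0" for z by (rule xy_nonzero)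
    show "poly (- S 2) z \<noteq> 0 \<or> poly (S 1) z \<noteq> 0" for z using S_nonzero[of z] by auto
    show "y * A 1 1 - x * A 2 1 = ep * S 1" by (rule S)
    show "x * A 2 2 - y * A 1 2 = ep * (- S 2)" using S[of 2] by (simp add: algebra_simps)
    show "ep * pderiv (A 1 1) - nu * A 1 1 = x * S 1" "ep * pderiv (A 2 1) - nu * A 2 1 = y * S 1"
      by (rule dA)+
    show "ep * pderiv (A 1 2) - nu * A 1 2 = - (x * - S 2)" "ep * pderiv (A 2 2) - nu * A 2 2 = - (y * - S 2)"
      unfolding dA by simp_all
  qed
  then show ?thesis using M regular by blast
qed

section \<open>Both charts\<close>

lemma common_sign:
  fixes a b \<alpha> \<beta> :: "'a::idom"
  assumes "a * a = \<alpha> * \<alpha>" "b * b = \<beta> * \<beta>" "a * b = \<alpha> * \<beta>"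
  shows "a = \<alpha> \<and> b = \<beta> \<or> a = - \<alpha> \<and> b = - \<beta>"
proof -
  have *: "s = t \<or> s = - t" if "s * s = t * t" for s t :: 'a
    using square_eq_iff[of s t] that by simp
  show ?thesis
  proof (cases "\<alpha> = 0")
    case True
    then have "a = 0" using assms(1) by simp
    then show ?thesis using True *[OF assms(2)] by auto
  next
    case False
    from *[OF assms(1)] show ?thesis
    proof
      assume a: "a = \<alpha>"
      then have "b = \<beta>" using assms(3) False by simp
      then show ?thesis using a by simp
    next
      assume a: "a = - \<alpha>"
      then have "\<alpha> * (- b) = \<alpha> * \<beta>" using assms(3) by simp
      then have "- b = \<beta>" using False mult_left_cancel by blast
      then show ?thesis using a by auto
    qed
  qed
qed

lemma poly_eq_off_zero:
  fixes p q :: "complex poly"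
  assumes "D \<noteq> 0" "\<And>w. w \<noteq> 0 \<Longrightarrow> poly D w \<noteq> 0 \<Longrightarrow> poly p w = poly q w"
  shows "p = q"
  by (rule poly_eq_off_roots[of "[:0, 1:] * D"]) (use assms in auto)

lemma hat_poly_nonzero:
  assumes "p \<noteq> 0" "degree p \<le> n"
  shows "hat_poly n p \<noteq> 0"
proof
  assume h: "hat_poly n p = 0"
  have "p = 0"
  proof (rule poly_eq_off_zero[of 1])
    fix w :: complex assume w: "w \<noteq> 0"
    have "(1 / w) ^ n * poly p w = 0"
      using poly_hat_poly[OF assms(2), of "1 / w"] w by (simp add: h)
    then show "poly p w = poly 0 w" using w by simp
  qed simp
  then show False using assms(1) by simp
qed

context chart_data
begin

lemma spinor_ratio:
  assumes "poly dl z \<noteq> 0"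
  defines "f a \<equiv> poly a z / poly dl z" and "\<xi> \<equiv> poly x z / poly ep z" and "\<eta> \<equiv> poly y z / poly ep z"
  shows "f Q = \<eta> * f a11 - \<xi> * f a21" "f P = \<xi> * f a22 - \<eta> * f a12"
    and "f P * f a11 + f Q * f a12 = \<xi>" "f P * f a21 + f Q * f a22 = \<eta>"
proof -
  have nz: "poly ep z \<noteq> 0" "poly d1 z \<noteq> 0" using assms(1) by (auto simp: dl_eq)
  have "f Q = poly (ep * Q) z / (poly ep z * poly dl z)" "f P = poly (ep * P) z / (poly ep z * poly dl z)"
    using nz by (simp_all add: f_def)
  then show "f Q = \<eta> * f a11 - \<xi> * f a21" "f P = \<xi> * f a22 - \<eta> * f a12"
    by (simp_all add: f_def \<xi>_def \<eta>_def epQ[symmetric] epP[symmetric] diff_divide_distrib)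
  have "f P * f a11 + f Q * f a12 = poly (P * a11 + Q * a12) z / (poly dl z * poly dl z)"
    "f P * f a21 + f Q * f a22 = poly (P * a21 + Q * a22) z / (poly dl z * poly dl z)"
    by (simp_all add: f_def add_divide_distrib)
  then show "f P * f a11 + f Q * f a12 = \<xi>" "f P * f a21 + f Q * f a22 = \<eta>"
    unfolding PQ_A \<xi>_def \<eta>_def using nz assms(1) by (simp_all add: dl_eq field_simps)
qed

lemma entry_derivative:
  assumes "poly dl z \<noteq> 0"
  defines "f a \<equiv> poly a z / poly dl z" and "\<xi> \<equiv> poly x z / poly ep z" and "\<eta> \<equiv> poly y z / poly ep z"
  shows "((\<lambda>u. poly a11 u / poly dl u) has_field_derivative \<xi> * f Q) (at z)"
    "((\<lambda>u. poly a12 u / poly dl u) has_field_derivative - (\<xi> * f P)) (at z)"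
    "((\<lambda>u. poly a21 u / poly dl u) has_field_derivative \<eta> * f Q) (at z)"
    "((\<lambda>u. poly a22 u / poly dl u) has_field_derivative - (\<eta> * f P)) (at z)"
  using dA[THEN quotient_derivative[OF assms(1)]] by (simp_all add: f_def \<xi>_def \<eta>_def)

lemma chart_data_minus: "chart_data dl ep d1 nu a11 a12 a21 a22 (- x) (- y) (- P) (- Q)"
  by unfold_locales
    (use det_A A_nonzero xy_nonzero PQ_nonzero epQ epP dA in \<open>auto simp: algebra_simps\<close>)

end

text \<open>Spinors are half-forms: for z = 1 / w the factor \<i> / w is a square root of dz / dw =
  - 1 / w^2.\<close>

locale chart_pair = Z: chart_data dl ep d1 nu a11 a12 a21 a22 x y P Q +
    I: chart_data dl' ep' d1' nu' b11 b12 b21 b22 x' y' P' Q'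
  for dl ep d1 nu a11 a12 a21 a22 x y P Q dl' ep' d1' nu' b11 b12 b21 b22 x' y' P' Q' :: "complex poly" +
  assumes entries: "w \<noteq> 0 \<Longrightarrow> poly dl' w \<noteq> 0 \<Longrightarrow> poly dl (1 / w) \<noteq> 0 \<Longrightarrow>
      poly b11 w / poly dl' w = poly a11 (1 / w) / poly dl (1 / w) \<and>
      poly b12 w / poly dl' w = poly a12 (1 / w) / poly dl (1 / w) \<and>
      poly b21 w / poly dl' w = poly a21 (1 / w) / poly dl (1 / w) \<and>
      poly b22 w / poly dl' w = poly a22 (1 / w) / poly dl (1 / w)"
    and spinors: "w \<noteq> 0 \<Longrightarrow> poly dl' w \<noteq> 0 \<Longrightarrow> poly dl (1 / w) \<noteq> 0 \<Longrightarrow>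
      poly x' w / poly ep' w = \<i> / w * (poly x (1 / w) / poly ep (1 / w)) \<and>
      poly y' w / poly ep' w = \<i> / w * (poly y (1 / w) / poly ep (1 / w))"

text \<open>
  The products of the components of the spinor \<open>(x, y) / ep\<close> are the entries of \<open>dF F\<^sup>-\<^sup>1\<close>, so that the
  spinors of the two charts agree up to a global sign.
\<close>

lemma chart_pair_exists:
  assumes Z: "chart_data dl ep d1 nu a11 a12 a21 a22 x y P Q"
    and I: "chart_data dl' ep' d1' nu' b11 b12 b21 b22 x' y' P' Q'"
    and entries: "\<And>w. w \<noteq> 0 \<Longrightarrow> poly dl' w \<noteq> 0 \<Longrightarrow> poly dl (1 / w) \<noteq> 0 \<Longrightarrow>
      poly b11 w / poly dl' w = poly a11 (1 / w) / poly dl (1 / w) \<and>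
      poly b12 w / poly dl' w = poly a12 (1 / w) / poly dl (1 / w) \<and>
      poly b21 w / poly dl' w = poly a21 (1 / w) / poly dl (1 / w) \<and>
      poly b22 w / poly dl' w = poly a22 (1 / w) / poly dl (1 / w)"
  shows "\<exists>x' y' P' Q'. chart_pair dl ep d1 nu a11 a12 a21 a22 x y P Q dl' ep' d1' nu' b11 b12 b21 b22 x' y' P' Q'"
proof -
  interpret Z: chart_data dl ep d1 nu a11 a12 a21 a22 x y P Q by fact
  interpret I: chart_data dl' ep' d1' nu' b11 b12 b21 b22 x' y' P' Q' by fact
  define n where "n = max (max (degree x) (degree y)) (max (degree ep) (degree dl))"
  have deg: "degree x \<le> n" "degree y \<le> n" "degree ep \<le> n" "degree dl \<le> n" by (auto simp: n_def)
  let ?D = "dl' * hat_poly n dl"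
  have D: "?D \<noteq> 0" using I.dl_nonzero hat_poly_nonzero[OF Z.dl_nonzero deg(4)] by simp
  have reg: "poly dl' w \<noteq> 0 \<and> poly dl (1 / w) \<noteq> 0" if "w \<noteq> 0" "poly ?D w \<noteq> 0" for w
    using that poly_hat_poly[OF deg(4) that(1)] by auto
  have ep: "poly ep' w \<noteq> 0 \<and> poly ep (1 / w) \<noteq> 0" if "poly dl' w \<noteq> 0" "poly dl (1 / w) \<noteq> 0" for w
    using that by (auto simp: Z.dl_eq I.dl_eq)
  \<comment> \<open>X, Y and X2, Y2 are the two sides of the relation between the spinors with the
    denominators cleared; n is a common bound for the degrees.\<close>
  define X where "X = [:0, 1:] * hat_poly n ep * x'"
  define Y where "Y = [:0, 1:] * hat_poly n ep * y'"
  define X2 where "X2 = smult \<i> (ep' * hat_poly n x)"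
  define Y2 where "Y2 = smult \<i> (ep' * hat_poly n y)"
  have scale: "poly X w = w ^ n * poly ep' w * poly ep (1 / w) * w * (poly x' w / poly ep' w)"
    "poly Y w = w ^ n * poly ep' w * poly ep (1 / w) * w * (poly y' w / poly ep' w)"
    "poly X2 w = w ^ n * poly ep' w * poly ep (1 / w) * w * (\<i> / w * (poly x (1 / w) / poly ep (1 / w)))"
    "poly Y2 w = w ^ n * poly ep' w * poly ep (1 / w) * w * (\<i> / w * (poly y (1 / w) / poly ep (1 / w)))"
    if w: "w \<noteq> 0" "poly dl' w \<noteq> 0" "poly dl (1 / w) \<noteq> 0" for w
    using ep[OF w(2,3)] w(1)
    by (simp_all add: X_def Y_def X2_def Y2_def poly_hat_poly[OF deg(1) w(1)] poly_hat_poly[OF deg(2) w(1)]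
        poly_hat_poly[OF deg(3) w(1)])
  \<comment> \<open>The products of spinor components are entries of dF F^-1 up to sign. The chain
    rule for F gives the factor - 1 / w^2, the square of \<i> / w.\<close>
  have sq: "(poly x' w / poly ep' w) * (poly x' w / poly ep' w) = \<i> / w * (poly x (1 / w) / poly ep (1 / w)) * (\<i> / w * (poly x (1 / w) / poly ep (1 / w)))"
     "(poly y' w / poly ep' w) * (poly y' w / poly ep' w) = \<i> / w * (poly y (1 / w) / poly ep (1 / w)) * (\<i> / w * (poly y (1 / w) / poly ep (1 / w)))"
     "(poly x' w / poly ep' w) * (poly y' w / poly ep' w) = \<i> / w * (poly x (1 / w) / poly ep (1 / w)) * (\<i> / w * (poly y (1 / w) / poly ep (1 / w)))"
    if w: "w \<noteq> 0" "poly dl' w \<noteq> 0" "poly dl (1 / w) \<noteq> 0" for w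
  proof -
    let ?z = "1 / w"
    define S where "S = {u. u \<noteq> 0 \<and> poly dl' u \<noteq> 0 \<and> poly dl (1 / u) \<noteq> 0}"
    have "open ((- {0}) \<inter> (\<lambda>u. poly dl (1 / u)) -` (- {0}))"
      by (intro continuous_open_preimage continuous_intros) auto
    moreover have "open {u. poly dl' u \<noteq> 0}" by (intro open_Collect_neq continuous_intros)
    ultimately have "open (((- {0}) \<inter> (\<lambda>u. poly dl (1 / u)) -` (- {0})) \<inter> {u. poly dl' u \<noteq> 0})"
      by (rule open_Int)
    also have "((- {0}) \<inter> (\<lambda>u. poly dl (1 / u)) -` (- {0})) \<inter> {u. poly dl' u \<noteq> 0} = S"
      unfolding S_def by auto
    finally have S: "open S" .
    have d: "(poly b' u / poly dl' u) = (poly a' (1 / u) / poly dl (1 / u))"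
      if "u \<in> S" "(b', a') \<in> {(b11, a11), (b12, a12), (b21, a21), (b22, a22)}" for u b' a'
      using entries[of u] that unfolding S_def by blast
    have wS: "w \<in> S" using w by (simp add: S_def)
    have transfer: "D' = - (1 / w\<^sup>2) * d'"
      if "((\<lambda>u. poly b' u / poly dl' u) has_field_derivative D') (at w)"
        and "((\<lambda>u. poly a' u / poly dl u) has_field_derivative d') (at ?z)"
        and ab: "(b', a') \<in> {(b11, a11), (b12, a12), (b21, a21), (b22, a22)}" for b' a' D' d'
    proof -
      have inv: "((\<lambda>u. 1 / u) has_field_derivative - (1 / w\<^sup>2)) (at w)"
        using w(1) by (auto intro!: derivative_eq_intros simp: power2_eq_square)
      have "((\<lambda>u. poly a' (1 / u) / poly dl (1 / u)) has_field_derivative d' * - (1 / w\<^sup>2)) (at w)"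
        using DERIV_chain2[OF that(2) inv] .
      then have "((\<lambda>u. poly b' u / poly dl' u) has_field_derivative d' * - (1 / w\<^sup>2)) (at w)"
        by (rule has_field_derivative_transform_within_open[OF _ S wS]) (use d[OF _ ab] in simp)
      then show ?thesis using DERIV_unique[OF that(1)] by (simp add: mult.commute)
    qed
    note dI = I.entry_derivative[OF w(2)] and dZ = Z.entry_derivative[OF w(3)]
    note t = transfer[OF dI(1) dZ(1)] transfer[OF dI(2) dZ(2)] transfer[OF dI(3) dZ(3)] transfer[OF dI(4) dZ(4)]
    define \<xi> where "\<xi> = poly x ?z / poly ep ?z"
    define \<eta> where "\<eta> = poly y ?z / poly ep ?z"
    define \<xi>' where "\<xi>' = poly x' w / poly ep' w"
    define \<eta>' where "\<eta>' = poly y' w / poly ep' w"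
    define f where "f a = poly a ?z / poly dl ?z" for a
    define f' where "f' a = poly a w / poly dl' w" for a
    have e: "f' b11 = f a11" "f' b12 = f a12" "f' b21 = f a21" "f' b22 = f a22"
      using entries[OF w] by (simp_all add: f_def f'_def)
    have u: "f P * f a11 + f Q * f a12 = \<xi>" "f P * f a21 + f Q * f a22 = \<eta>"
      using Z.spinor_ratio(3,4)[OF w(3)] by (simp_all add: f_def \<xi>_def \<eta>_def)
    have u': "f' P' * f a11 + f' Q' * f a12 = \<xi>'" "f' P' * f a21 + f' Q' * f a22 = \<eta>'"
      using I.spinor_ratio(3,4)[OF w(2)] unfolding e[symmetric] by (simp_all add: f'_def \<xi>'_def \<eta>'_def)
    have v: "\<xi>' * f' Q' = - (1 / w\<^sup>2) * (\<xi> * f Q)" "\<xi>' * f' P' = - (1 / w\<^sup>2) * (\<xi> * f P)"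
       "\<eta>' * f' Q' = - (1 / w\<^sup>2) * (\<eta> * f Q)" "\<eta>' * f' P' = - (1 / w\<^sup>2) * (\<eta> * f P)"
      using t[unfolded mult_minus_right neg_equal_iff_equal]
      unfolding f_def f'_def \<xi>_def \<eta>_def \<xi>'_def \<eta>'_def by blast+
    have c: "\<i> / w * a * (\<i> / w * b) = - (1 / w\<^sup>2) * (a * b)" for a b
    proof -
      have "\<i> / w * a * (\<i> / w * b) = (\<i> * \<i>) * (a * b) / (w * w)" by (simp add: mult_ac del: complex_i_mult_minus i_squared)
      then show ?thesis by (simp add: power2_eq_square)
    qed
    have "\<xi>' * \<xi>' = (\<xi>' * f' P') * f a11 + (\<xi>' * f' Q') * f a12"
      unfolding u'(1)[symmetric] by (simp add: algebra_simps)
    also have "\<dots> = - (1 / w\<^sup>2) * (\<xi> * (f P * f a11 + f Q * f a12))" unfolding v by (simp add: algebra_simps)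
    finally have 1: "\<xi>' * \<xi>' = - (1 / w\<^sup>2) * (\<xi> * \<xi>)" unfolding u .
    have "\<eta>' * \<eta>' = (\<eta>' * f' P') * f a21 + (\<eta>' * f' Q') * f a22"
      unfolding u'(2)[symmetric] by (simp add: algebra_simps)
    also have "\<dots> = - (1 / w\<^sup>2) * (\<eta> * (f P * f a21 + f Q * f a22))" unfolding v by (simp add: algebra_simps)
    finally have 2: "\<eta>' * \<eta>' = - (1 / w\<^sup>2) * (\<eta> * \<eta>)" unfolding u .
    have "\<xi>' * \<eta>' = (\<xi>' * f' P') * f a21 + (\<xi>' * f' Q') * f a22"
      unfolding u'(2)[symmetric] by (simp add: algebra_simps)
    also have "\<dots> = - (1 / w\<^sup>2) * (\<xi> * (f P * f a21 + f Q * f a22))" unfolding v by (simp add: algebra_simps)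
    finally have 3: "\<xi>' * \<eta>' = - (1 / w\<^sup>2) * (\<xi> * \<eta>)" unfolding u .
    show "(poly x' w / poly ep' w) * (poly x' w / poly ep' w) = \<i> / w * (poly x (1 / w) / poly ep (1 / w)) * (\<i> / w * (poly x (1 / w) / poly ep (1 / w)))"
     "(poly y' w / poly ep' w) * (poly y' w / poly ep' w) = \<i> / w * (poly y (1 / w) / poly ep (1 / w)) * (\<i> / w * (poly y (1 / w) / poly ep (1 / w)))"
     "(poly x' w / poly ep' w) * (poly y' w / poly ep' w) = \<i> / w * (poly x (1 / w) / poly ep (1 / w)) * (\<i> / w * (poly y (1 / w) / poly ep (1 / w)))"
      unfolding c using 1 2 3 unfolding \<xi>_def \<xi>'_def \<eta>_def \<eta>'_def by blast+
  qed
  have mm: "(c * a) * (c * b) = (c * a2) * (c * b2)" if "a * b = a2 * b2" for a b c a2 b2 :: complex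
  proof -
    have "(c * a) * (c * b) = c * c * (a * b)" by (simp only: mult_ac)
    also have "\<dots> = (c * a2) * (c * b2)" unfolding that by (simp only: mult_ac)
    finally show ?thesis .
  qed
  have "X * X = X2 * X2"
  proof (rule poly_eq_off_zero[OF D])
    fix w assume "w \<noteq> 0" "poly ?D w \<noteq> 0"
    then have w: "w \<noteq> 0" "poly dl' w \<noteq> 0" "poly dl (1 / w) \<noteq> 0" using reg by auto
    show "poly (X * X) w = poly (X2 * X2) w" unfolding poly_mult scale[OF w] by (rule mm[OF sq(1)[OF w]])
  qed
  moreover have "Y * Y = Y2 * Y2"
  proof (rule poly_eq_off_zero[OF D])
    fix w assume "w \<noteq> 0" "poly ?D w \<noteq> 0"
    then have w: "w \<noteq> 0" "poly dl' w \<noteq> 0" "poly dl (1 / w) \<noteq> 0" using reg by auto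
    show "poly (Y * Y) w = poly (Y2 * Y2) w" unfolding poly_mult scale[OF w] by (rule mm[OF sq(2)[OF w]])
  qed
  moreover have "X * Y = X2 * Y2"
  proof (rule poly_eq_off_zero[OF D])
    fix w assume "w \<noteq> 0" "poly ?D w \<noteq> 0"
    then have w: "w \<noteq> 0" "poly dl' w \<noteq> 0" "poly dl (1 / w) \<noteq> 0" using reg by auto
    show "poly (X * Y) w = poly (X2 * Y2) w" unfolding poly_mult scale[OF w] by (rule mm[OF sq(3)[OF w]])
  qed
  ultimately consider "X = X2" "Y = Y2" | "X = - X2" "Y = - Y2" using common_sign by blast
  then show ?thesis
  proof cases
    case 1
    have "chart_pair dl ep d1 nu a11 a12 a21 a22 x y P Q dl' ep' d1' nu' b11 b12 b21 b22 x' y' P' Q'"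
    proof (unfold_locales)
      fix w :: complex assume w: "w \<noteq> 0" "poly dl' w \<noteq> 0" "poly dl (1 / w) \<noteq> 0"
      have nz: "w ^ n * poly ep' w * poly ep (1 / w) * w \<noteq> 0" using w(1) ep[OF w(2,3)] by simp
      show "poly x' w / poly ep' w = \<i> / w * (poly x (1 / w) / poly ep (1 / w)) \<and>
        poly y' w / poly ep' w = \<i> / w * (poly y (1 / w) / poly ep (1 / w))"
        using arg_cong[OF 1(1), of "\<lambda>p. poly p w"] arg_cong[OF 1(2), of "\<lambda>p. poly p w"]
        unfolding scale[OF w] mult_left_cancel[OF nz] by blast
    qed (rule entries)
    then show ?thesis by blast
  next
    case 2
    \<comment> \<open>For the opposite sign the spinors of the second chart are replaced by their
      negatives, which satisfy the same equations.\<close>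
    interpret J: chart_data dl' ep' d1' nu' b11 b12 b21 b22 "- x'" "- y'" "- P'" "- Q'"
      by (rule I.chart_data_minus)
    have "chart_pair dl ep d1 nu a11 a12 a21 a22 x y P Q dl' ep' d1' nu' b11 b12 b21 b22 (- x') (- y') (- P') (- Q')"
    proof (unfold_locales)
      fix w :: complex assume w: "w \<noteq> 0" "poly dl' w \<noteq> 0" "poly dl (1 / w) \<noteq> 0"
      have nz: "w ^ n * poly ep' w * poly ep (1 / w) * w \<noteq> 0" using w(1) ep[OF w(2,3)] by simp
      have m: "(c * a = - (c * b)) = (- a = b)" if "c \<noteq> 0" for a b c :: complex
        using that by (metis minus_minus mult_left_cancel mult_minus_right)
      show "poly (- x') w / poly ep' w = \<i> / w * (poly x (1 / w) / poly ep (1 / w)) \<and>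
        poly (- y') w / poly ep' w = \<i> / w * (poly y (1 / w) / poly ep (1 / w))"
        using arg_cong[OF 2(1), of "\<lambda>p. poly p w"] arg_cong[OF 2(2), of "\<lambda>p. poly p w"]
        unfolding poly_minus scale[OF w] m[OF nz] minus_divide_left by blast
    qed (rule entries)
    then show ?thesis by blast
  qed
qed

section \<open>Transition between the charts and the count of zeros\<close>

context chart_pair
begin

lemma PQ_transition:
  assumes "w \<noteq> 0" "poly dl' w \<noteq> 0" "poly dl (1 / w) \<noteq> 0"
  shows "poly P' w / poly dl' w = \<i> / w * (poly P (1 / w) / poly dl (1 / w))"
    and "poly Q' w / poly dl' w = \<i> / w * (poly Q (1 / w) / poly dl (1 / w))"
proof -
  note e = entries[OF assms, THEN conjunct1] entries[OF assms, THEN conjunct2, THEN conjunct1]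
    entries[OF assms, THEN conjunct2, THEN conjunct2, THEN conjunct1]
    entries[OF assms, THEN conjunct2, THEN conjunct2, THEN conjunct2]
  note s = spinors[OF assms, THEN conjunct1] spinors[OF assms, THEN conjunct2]
  show "poly P' w / poly dl' w = \<i> / w * (poly P (1 / w) / poly dl (1 / w))"
    unfolding I.spinor_ratio(2)[OF assms(2)] Z.spinor_ratio(2)[OF assms(3)] e s
    by (simp only: right_diff_distrib mult.assoc)
  show "poly Q' w / poly dl' w = \<i> / w * (poly Q (1 / w) / poly dl (1 / w))"
    unfolding I.spinor_ratio(1)[OF assms(2)] Z.spinor_ratio(1)[OF assms(3)] e s
    by (simp only: right_diff_distrib mult.assoc)
qed

lemma regular_transition:
  assumes "z \<noteq> 0" "poly dl z \<noteq> 0" "poly dl' (1 / z) \<noteq> 0"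
  shows "I.tau (1 / z) = qc (1 / (\<i> * z)) * Z.tau z" "I.row1 (1 / z) = qc (1 / (\<i> * z)) * Z.row1 z"
    "I.row2 (1 / z) = qc (1 / (\<i> * z)) * Z.row2 z"
proof -
  have w: "1 / z \<noteq> 0" "poly dl' (1 / z) \<noteq> 0" "poly dl (1 / (1 / z)) \<noteq> 0" using assms by auto
  have z: "1 / (1 / z) = z" by simp
  have "I.tau (1 / z) = inverse (qc (\<i> / (1 / z) * (poly P z / poly dl z)) - quat_k * qc (\<i> / (1 / z) * (poly Q z / poly dl z)))"
    unfolding I.tau_eq[OF assms(3)] PQ_transition[OF w] z ..
  also have "qc (\<i> / (1 / z) * (poly P z / poly dl z)) - quat_k * qc (\<i> / (1 / z) * (poly Q z / poly dl z)) =
    (qc (poly P z / poly dl z) - quat_k * qc (poly Q z / poly dl z)) * qc (\<i> * z)"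
    by (simp add: left_diff_distrib mult.assoc flip: qc_mult) (simp add: mult_ac)
  also have "inverse \<dots> = inverse (qc (\<i> * z)) * Z.tau z"
    unfolding Z.tau_eq[OF assms(2)] using assms(1)
    by (cases "qc (poly P z / poly dl z) - quat_k * qc (poly Q z / poly dl z) = 0") (simp_all add: nonzero_inverse_mult_distrib)
  finally show tau: "I.tau (1 / z) = qc (1 / (\<i> * z)) * Z.tau z"
    by (simp only: qc_inverse divide_inverse mult_1)
  note e = entries[OF w, unfolded z]
  show "I.row1 (1 / z) = qc (1 / (\<i> * z)) * Z.row1 z" "I.row2 (1 / z) = qc (1 / (\<i> * z)) * Z.row2 z"
    unfolding I.row_regular[OF assms(3)] Z.row_regular[OF assms(2)] tau using e by (simp_all add: mult.assoc)
qed

lemma eventually_regular: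
  assumes "z \<noteq> 0"
  shows "\<forall>\<^sub>F u in at z. u \<noteq> 0 \<and> poly dl u \<noteq> 0 \<and> poly dl' (1 / u) \<noteq> 0"
proof -
  have "hat_poly (degree dl') dl' \<noteq> 0"
    by (rule hat_poly_nonzero[OF I.dl_nonzero]) simp
  then have "\<forall>\<^sub>F u in at z. poly (hat_poly (degree dl') dl') u \<noteq> 0"
    by (rule eventually_at_poly_nonzero)
  moreover have "\<forall>\<^sub>F u in at z. poly dl u \<noteq> 0"
    by (rule eventually_at_poly_nonzero[OF Z.dl_nonzero])
  moreover have "\<forall>\<^sub>F u in at z. poly [:0, 1:] u \<noteq> 0"
    by (rule eventually_at_poly_nonzero) simp
  ultimately show ?thesis
  proof eventually_elim
    case (elim u)
    then have "u \<noteq> 0" by simp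
    then show ?case using elim poly_hat_poly[of dl' "degree dl'" u] by simp
  qed
qed

lemma transition_closure:
  fixes f g :: "complex \<Rightarrow> quat"
  assumes f: "smooth_on UNIV f" and g: "smooth_on UNIV g" and z: "z \<noteq> 0"
    and eq: "\<And>u. u \<noteq> 0 \<Longrightarrow> poly dl u \<noteq> 0 \<Longrightarrow> poly dl' (1 / u) \<noteq> 0 \<Longrightarrow> g (1 / u) = qc (1 / (\<i> * u)) * f u"
  shows "g (1 / z) = qc (1 / (\<i> * z)) * f z"
proof -
  have cf: "isCont f u" and cg: "isCont g u" for u
    using smooth_on_continuous[OF f] smooth_on_continuous[OF g]
    by (simp_all add: continuous_on_eq_continuous_at)
  have "isCont (\<lambda>u. 1 / u) z" using z by (intro continuous_intros)
  then have 1: "isCont (\<lambda>u. g (1 / u)) z" by (rule isCont_o2) (rule cg)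
  have "isCont (\<lambda>u. 1 / (\<i> * u)) z" using z by (intro continuous_intros) auto
  then have "isCont (\<lambda>u. qc (1 / (\<i> * u))) z"
    by (rule bounded_linear.isCont[OF bounded_linear_qc])
  then have "isCont (\<lambda>u. g (1 / u) - qc (1 / (\<i> * u)) * f u) z"
    by (intro continuous_intros 1 cf)
  moreover have "\<forall>\<^sub>F u in at z. g (1 / u) - qc (1 / (\<i> * u)) * f u = 0"
    using eventually_regular[OF z] by eventually_elim (simp add: eq)
  ultimately have "g (1 / z) - qc (1 / (\<i> * z)) * f z = 0" by (rule zero_by_continuity)
  then show ?thesis by simp
qed

lemma tau_transition: "z \<noteq> 0 \<Longrightarrow> I.tau (1 / z) = qc (1 / (\<i> * z)) * Z.tau z"
  by (rule transition_closure[OF Z.smooth_tau I.smooth_tau _ regular_transition(1)])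

lemma row1_transition: "z \<noteq> 0 \<Longrightarrow> I.row1 (1 / z) = qc (1 / (\<i> * z)) * Z.row1 z"
  by (rule transition_closure[OF Z.smooth_row(1) I.smooth_row(1) _ regular_transition(2)])

lemma row2_transition: "z \<noteq> 0 \<Longrightarrow> I.row2 (1 / z) = qc (1 / (\<i> * z)) * Z.row2 z"
  by (rule transition_closure[OF Z.smooth_row(2) I.smooth_row(2) _ regular_transition(3)])

text \<open>As P and Q have no common zero, this is the degree of the rational curve (P :
  Q).\<close>

definition N :: nat where "N = max (degree P) (degree Q)"

lemma energy: "(\<integral>z. (norm (Z.hopf z))\<^sup>2 \<partial>lborel) = pi * real N"
proof -
  have "(norm (Z.hopf z))\<^sup>2 = (norm (poly (P * pderiv Q - Q * pderiv P) z))\<^sup>2 / ((norm (poly P z))\<^sup>2 + (norm (poly Q z))\<^sup>2)\<^sup>2" for z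
  proof -
    have "P * pderiv Q - Q * pderiv P = dl * Z.k0" using Z.K_k0 unfolding Z.K_def .
    then have "norm (poly (P * pderiv Q - Q * pderiv P) z) = norm (poly Z.k0 z * cnj (poly dl z))"
      by (simp add: norm_mult)
    then show ?thesis
      unfolding Z.hopf_def norm_minus_cancel norm_divide power_divide norm_of_real Z.nrm_def by simp
  qed
  then show ?thesis
    using area_rational_curve[of P Q, OF Z.PQ_nonzero] unfolding N_def by simp
qed

lemma poly_relation:
  "[:0, 1:] ^ Suc N * hat_poly (degree dl) dl * P' = smult \<i> ([:0, 1:] ^ degree dl * dl') * hat_poly N P"
  "[:0, 1:] ^ Suc N * hat_poly (degree dl) dl * Q' = smult \<i> ([:0, 1:] ^ degree dl * dl') * hat_poly N Q"
proof -
  have D: "dl' * hat_poly (degree dl) dl \<noteq> 0"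
    using I.dl_nonzero hat_poly_nonzero[OF Z.dl_nonzero order_refl] by simp
  have *: "[:0, 1:] ^ Suc N * hat_poly (degree dl) dl * p' = smult \<i> ([:0, 1:] ^ degree dl * dl') * hat_poly N p"
    if p: "\<And>w. w \<noteq> 0 \<Longrightarrow> poly dl' w \<noteq> 0 \<Longrightarrow> poly dl (1 / w) \<noteq> 0 \<Longrightarrow>
        poly p' w / poly dl' w = \<i> / w * (poly p (1 / w) / poly dl (1 / w))"
      and deg: "degree p \<le> N" for p p'
  proof (rule poly_eq_off_zero[OF D])
    fix w assume w: "w \<noteq> 0" "poly (dl' * hat_poly (degree dl) dl) w \<noteq> 0"
    then have nz: "poly dl' w \<noteq> 0" "poly dl (1 / w) \<noteq> 0" using poly_hat_poly[of dl "degree dl" w] by auto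
    have "poly p' w = poly dl' w * (\<i> / w * (poly p (1 / w) / poly dl (1 / w)))"
      using p[OF w(1) nz] nz by (simp add: field_simps)
    then show "poly ([:0, 1:] ^ Suc N * hat_poly (degree dl) dl * p') w =
        poly (smult \<i> ([:0, 1:] ^ degree dl * dl') * hat_poly N p) w"
      using w(1) nz by (simp add: poly_hat_poly[OF deg w(1)] poly_hat_poly[of dl "degree dl" w] poly_power field_simps)
  qed
  show "[:0, 1:] ^ Suc N * hat_poly (degree dl) dl * P' = smult \<i> ([:0, 1:] ^ degree dl * dl') * hat_poly N P"
    by (rule *[OF PQ_transition(1)]) (auto simp: N_def)
  show "[:0, 1:] ^ Suc N * hat_poly (degree dl) dl * Q' = smult \<i> ([:0, 1:] ^ degree dl * dl') * hat_poly N Q"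
    by (rule *[OF PQ_transition(2)]) (auto simp: N_def)
qed

lemma order_0_power_X: "order 0 ([:0, 1:] ^ n * p) = n + order 0 p" if "p \<noteq> 0" for p :: "complex poly"
proof -
  have "order 0 ([:0, 1:] ^ n :: complex poly) = n"
    using order_power_n_n[of "0 :: complex" n] by simp
  moreover have "[:0, 1:] ^ n * p \<noteq> 0" using that by simp
  ultimately show ?thesis by (simp add: order_mult)
qed

lemma order_hat_dl: "order 0 (hat_poly (degree dl) dl) = 0"
  using Z.dl_nonzero by (intro order_0I) (simp add: poly_hat_poly_0)

text \<open>A general linear combination of P / dl and Q / dl is a section, with N zeros, of a
  square root of the canonical bundle, which has degree -1; its poles are the zeros of
  \<open>dl\<close> in both charts. The two inequalities come from a component that is nonzero at
  infinity in the w-chart and from one of full degree N.\<close>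

lemma degree_dl: "degree dl + order 0 dl' = Suc N"
proof -
  have hd: "hat_poly (degree dl) dl \<noteq> 0" by (rule hat_poly_nonzero[OF Z.dl_nonzero order_refl])
  have *: "Suc N + order 0 p' = degree dl + order 0 dl' + order 0 (hat_poly N p)"
    if eq: "[:0, 1:] ^ Suc N * hat_poly (degree dl) dl * p' = smult \<i> ([:0, 1:] ^ degree dl * dl') * hat_poly N p"
      and nz: "p' \<noteq> 0 \<or> hat_poly N p \<noteq> 0" for p p'
  proof -
    have n1: "p' \<noteq> 0" and n2: "hat_poly N p \<noteq> 0"
      using nz arg_cong[OF eq, of "\<lambda>p. p = 0"] hd I.dl_nonzero by auto
    have "order 0 ([:0, 1:] ^ Suc N * (hat_poly (degree dl) dl * p')) = order 0 (smult \<i> ([:0, 1:] ^ degree dl * (dl' * hat_poly N p)))"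
      using eq by (simp only: mult_smult_left mult.assoc)
    moreover have "order 0 (hat_poly (degree dl) dl * p') = order 0 p'"
      using hd n1 by (simp add: order_mult order_hat_dl)
    moreover have "order 0 (dl' * hat_poly N p) = order 0 dl' + order 0 (hat_poly N p)"
      using I.dl_nonzero n2 by (simp add: order_mult)
    ultimately show ?thesis
      using hd n1 n2 I.dl_nonzero by (simp add: order_0_power_X order_smult del: power_Suc)
  qed
  have 1: "Suc N = degree dl + order 0 dl' + order 0 (hat_poly N p)"
    if "poly p' 0 \<noteq> 0"
      "[:0, 1:] ^ Suc N * hat_poly (degree dl) dl * p' = smult \<i> ([:0, 1:] ^ degree dl * dl') * hat_poly N p" for p p'
  proof -
    have "p' \<noteq> 0" "order 0 p' = 0" using that(1) by (auto simp: order_0I)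
    then show ?thesis using *[OF that(2)] by simp
  qed
  have 2: "Suc N + order 0 p' = degree dl + order 0 dl'"
    if "coeff p N \<noteq> 0" "degree p \<le> N"
      "[:0, 1:] ^ Suc N * hat_poly (degree dl) dl * p' = smult \<i> ([:0, 1:] ^ degree dl * dl') * hat_poly N p" for p p'
  proof -
    have "poly (hat_poly N p) 0 \<noteq> 0" using that(1,2) by (simp add: poly_hat_poly_0)
    then have "hat_poly N p \<noteq> 0" "order 0 (hat_poly N p) = 0" by (auto simp: order_0I)
    then show ?thesis using *[OF that(3)] by simp
  qed
  have "degree dl + order 0 dl' \<le> Suc N"
    using I.PQ_nonzero[of 0] 1[OF _ poly_relation(1)] 1[OF _ poly_relation(2)] by linarith
  moreover have "degree dl + order 0 dl' \<ge> Suc N"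
  proof -
    have "coeff P N \<noteq> 0 \<or> coeff Q N \<noteq> 0"
    proof (rule ccontr)
      assume "\<not> ?thesis"
      moreover have "N = degree P \<or> N = degree Q" by (simp add: N_def max_def)
      ultimately have "P = 0 \<and> N = degree P \<or> Q = 0 \<and> N = degree Q" by auto
      moreover have "P \<noteq> 0 \<or> Q \<noteq> 0" using Z.PQ_nonzero[of 0] by auto
      ultimately have "degree P = 0 \<and> degree Q = 0" "N = 0" by (auto simp: N_def)
      then obtain p q where pq: "P = [:p:]" "Q = [:q:]" by (metis degree_eq_zeroE)
      then show False using \<open>\<not> (coeff P N \<noteq> 0 \<or> coeff Q N \<noteq> 0)\<close> \<open>N = 0\<close> Z.PQ_nonzero[of 0] by auto
    qed
    moreover have "degree P \<le> N" "degree Q \<le> N" by (auto simp: N_def)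
    ultimately show ?thesis
      using 2[OF _ _ poly_relation(1)] 2[OF _ _ poly_relation(2)] by linarith
  qed
  ultimately show ?thesis by simp
qed

lemma wronskian_mult: "(a * p) * pderiv (a * q) - (a * q) * pderiv (a * p) = a * a * (p * pderiv q - q * pderiv p)"
  for a p q :: "complex poly"
  by (simp add: pderiv_mult algebra_simps)

text \<open>The Wronskian of P and Q reversed to degree N; by \<open>K_relation\<close> it agrees
  with \<open>I.K\<close> up to the squares of the factors that relate the two pairs.\<close>

definition hat_K :: "complex poly"
  where "hat_K = hat_poly N P * pderiv (hat_poly N Q) - hat_poly N Q * pderiv (hat_poly N P)"

lemma K_relation:
  "([:0, 1:] ^ Suc N * hat_poly (degree dl) dl) * ([:0, 1:] ^ Suc N * hat_poly (degree dl) dl) * I.K =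
    (smult \<i> ([:0, 1:] ^ degree dl * dl')) * (smult \<i> ([:0, 1:] ^ degree dl * dl')) * hat_K"
  unfolding I.K_def hat_K_def wronskian_mult[symmetric] poly_relation ..

text \<open>Under w = 1/z the Wronskian of two polynomials of formal degree N is reversed to the
  formal degree 2 N - 2, up to sign; the terms N P Q from differentiating w^N cancel.\<close>

lemma hat_K_eq: "[:0, 1:] ^ (degree Z.K + 2) * hat_K = - ([:0, 1:] ^ (2 * N) * hat_poly (degree Z.K) Z.K)"
proof (rule poly_eq_off_zero[of 1])
  fix w :: complex assume w: "w \<noteq> 0"
  have d: "degree P \<le> N" "degree Q \<le> N" by (auto simp: N_def)
  have hd: "w\<^sup>2 * poly (pderiv (hat_poly N p)) w = of_nat N * w * w ^ N * poly p (1 / w) - w ^ N * poly (pderiv p) (1 / w)"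
    if p: "degree p \<le> N" for p
  proof -
    have "((\<lambda>u. u ^ N * poly p (1 / u)) has_field_derivative
       (of_nat N * w ^ (N - 1) * poly p (1 / w) + w ^ N * (poly (pderiv p) (1 / w) * - (1 / w\<^sup>2)))) (at w)"
    proof -
      have "((\<lambda>u. 1 / u) has_field_derivative - (1 / w\<^sup>2)) (at w)"
        using w by (auto intro!: derivative_eq_intros simp: power2_eq_square)
      from DERIV_chain2[OF poly_DERIV this, of p]
      have "((\<lambda>u. poly p (1 / u)) has_field_derivative poly (pderiv p) (1 / w) * - (1 / w\<^sup>2)) (at w)" .
      moreover have "((\<lambda>u. u ^ N) has_field_derivative of_nat N * w ^ (N - 1)) (at w)"
        by (auto intro!: derivative_eq_intros)
      ultimately have "((\<lambda>u. u ^ N * poly p (1 / u)) has_field_derivative of_nat N * w ^ (N - 1) * poly p (1 / w) +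
          (poly (pderiv p) (1 / w) * - (1 / w\<^sup>2)) * w ^ N) (at w)"
        by (rule DERIV_mult[rotated])
      then show ?thesis by (rule DERIV_cong) (simp add: mult_ac)
    qed
    then have "(poly (hat_poly N p) has_field_derivative
       (of_nat N * w ^ (N - 1) * poly p (1 / w) + w ^ N * (poly (pderiv p) (1 / w) * - (1 / w\<^sup>2)))) (at w)"
      by (rule has_field_derivative_transform_within_open[of _ _ _ "- {0}"]) (use w poly_hat_poly[OF p] in auto)
    then have "poly (pderiv (hat_poly N p)) w =
        of_nat N * w ^ (N - 1) * poly p (1 / w) + w ^ N * (poly (pderiv p) (1 / w) * - (1 / w\<^sup>2))"
      using DERIV_unique poly_DERIV by blast
    then have "w\<^sup>2 * poly (pderiv (hat_poly N p)) w =
        of_nat N * (w\<^sup>2 * w ^ (N - 1)) * poly p (1 / w) - w ^ N * poly (pderiv p) (1 / w)"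
      using w by (simp add: right_diff_distrib mult_ac)
    also have "of_nat N * (w\<^sup>2 * w ^ (N - 1)) = of_nat N * w * w ^ N"
      by (cases N) (simp_all add: power2_eq_square)
    finally show ?thesis .
  qed
  have "w\<^sup>2 * poly hat_K w = poly (hat_poly N P) w * (w\<^sup>2 * poly (pderiv (hat_poly N Q)) w)
      - poly (hat_poly N Q) w * (w\<^sup>2 * poly (pderiv (hat_poly N P)) w)"
    by (simp add: hat_K_def algebra_simps)
  also have "\<dots> = - (w ^ N * w ^ N * poly Z.K (1 / w))"
    unfolding hd[OF d(1)] hd[OF d(2)] poly_hat_poly[OF d(1) w] poly_hat_poly[OF d(2) w]
    by (simp add: Z.K_def algebra_simps)
  finally have *: "w\<^sup>2 * poly hat_K w = - (w ^ N * w ^ N * poly Z.K (1 / w))" .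
  have "poly ([:0, 1:] ^ (degree Z.K + 2) * hat_K) w = w ^ degree Z.K * (w\<^sup>2 * poly hat_K w)"
    by (simp add: poly_power power_add power2_eq_square mult_ac)
  also have "\<dots> = - (w ^ (2 * N) * (w ^ degree Z.K * poly Z.K (1 / w)))"
    unfolding * by (simp add: mult_2 power_add mult_ac)
  also have "\<dots> = poly (- ([:0, 1:] ^ (2 * N) * hat_poly (degree Z.K) Z.K)) w"
    by (simp add: poly_power poly_hat_poly[OF order_refl w])
  finally show "poly ([:0, 1:] ^ (degree Z.K + 2) * hat_K) w = poly (- ([:0, 1:] ^ (2 * N) * hat_poly (degree Z.K) Z.K)) w" .
qed simp

text \<open>The Wronskian has 2 N - 2 zeros on the sphere and \<open>dl\<close> has N + 1 by
  \<open>degree_dl\<close>, so k0 = K / dl has N - 3.\<close>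

lemma total_order:
  assumes K: "Z.K \<noteq> 0"
  shows "I.K \<noteq> 0" "int (degree Z.k0) + int (order 0 I.k0) = int N - 3"
proof -
  have hK: "hat_poly (degree Z.K) Z.K \<noteq> 0" "order 0 (hat_poly (degree Z.K) Z.K) = 0"
    using hat_poly_nonzero[OF K order_refl] K by (auto intro!: order_0I simp: poly_hat_poly_0)
  have hat_K: "hat_K \<noteq> 0"
    using arg_cong[OF hat_K_eq, of "\<lambda>p. p = 0"] hK by auto
  have hd: "hat_poly (degree dl) dl \<noteq> 0" by (rule hat_poly_nonzero[OF Z.dl_nonzero order_refl])
  have d': "dl' \<noteq> 0" by (rule I.dl_nonzero)
  show IK: "I.K \<noteq> 0"
    using arg_cong[OF K_relation, of "\<lambda>p. p = 0"] hat_K d' by auto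
  have "order 0 ([:0, 1:] ^ (degree Z.K + 2) * hat_K) = order 0 ([:0, 1:] ^ (2 * N) * hat_poly (degree Z.K) Z.K)"
    unfolding hat_K_eq by (rule order_uminus)
  then have 1: "degree Z.K + 2 + order 0 hat_K = 2 * N"
    unfolding order_0_power_X[OF hat_K] order_0_power_X[OF hK(1)] hK(2) by simp
  have "order 0 ([:0, 1:] ^ (2 * Suc N) * (hat_poly (degree dl) dl * hat_poly (degree dl) dl * I.K)) =
      order 0 (smult (\<i> * \<i>) ([:0, 1:] ^ (2 * degree dl) * (dl' * dl' * hat_K)))"
    using arg_cong[OF K_relation, of "order 0"] by (simp only: mult_2 mult_2_right power_add mult_smult_left mult_smult_right smult_smult mult_ac)
  moreover have "order 0 (hat_poly (degree dl) dl * hat_poly (degree dl) dl * I.K) = order 0 I.K"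
    using hd IK by (simp add: order_mult order_hat_dl)
  moreover have "order 0 (dl' * dl' * hat_K) = 2 * order 0 dl' + order 0 hat_K"
    using d' hat_K by (simp add: order_mult)
  moreover have "hat_poly (degree dl) dl * hat_poly (degree dl) dl * I.K \<noteq> 0" "dl' * dl' * hat_K \<noteq> 0"
    using hd IK d' hat_K by auto
  ultimately have 2: "2 * Suc N + order 0 I.K = 2 * degree dl + (2 * order 0 dl' + order 0 hat_K)"
    by (simp add: order_0_power_X order_smult del: power_Suc mult_Suc_right)
  have "degree Z.K = degree dl + degree Z.k0"
    using K Z.dl_nonzero Z.k0_nonzero[OF K] unfolding Z.K_k0 by (simp add: degree_mult_eq)
  moreover have "order 0 I.K = order 0 dl' + order 0 I.k0"
    using IK unfolding I.K_k0 by (simp add: order_mult)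
  moreover have "k + k' + 3 = n"
    if "m = d + k" "m' = r + k'" "m + 2 + l = 2 * n" "2 * Suc n + m' = 2 * d + (2 * r + l)" "d + r = Suc n"
    for k k' n m d m' r l :: nat
    using that by simp
  ultimately have "degree Z.k0 + order 0 I.k0 + 3 = N"
    using 1 2 degree_dl by blast
  then show "int (degree Z.k0) + int (order 0 I.k0) = int N - 3" by simp
qed

end

section \<open>The frame of a Bryant sphere\<close>

lemma self_in_hline: "v \<in> hline v"
  unfolding hline_def by (rule image_eqI[of _ _ 1]) simp_all

lemma hline_rscale: "l \<noteq> 0 \<Longrightarrow> hline (v \<odot> l) = hline v"
proof -
  assume l: "l \<noteq> 0"
  have "v \<odot> m = v \<odot> l \<odot> (inverse l * m)" for m
    using l by (simp add: rscale_rscale) (simp add: mult.assoc[symmetric])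
  then show ?thesis
    unfolding hline_def by (metis (no_types, opaque_lifting) rscale_rscale subset_antisym image_subsetI rangeI)
qed

lemma kernel_hline:
  assumes r: "r1 \<noteq> 0 \<or> r2 \<noteq> 0" and v: "v \<noteq> 0" "r1 * fst v + r2 * snd v = 0"
  shows "y \<in> hline v \<longleftrightarrow> r1 * fst y + r2 * snd y = 0"
proof
  assume "y \<in> hline v"
  then obtain l where "y = v \<odot> l" by (auto simp: hline_def)
  then have "r1 * fst y + r2 * snd y = (r1 * fst v + r2 * snd v) * l" by (simp add: distrib_right mult.assoc)
  then show "r1 * fst y + r2 * snd y = 0" using v(2) by simp
next
  assume y: "r1 * fst y + r2 * snd y = 0"
  have 1: "a = - (inverse r * (s * b))" if "r * a + s * b = 0" "r \<noteq> 0" for a b r s :: quat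
  proof -
    have "r * a = - (s * b)" using that(1) by (simp add: eq_neg_iff_add_eq_0)
    then have "inverse r * (r * a) = inverse r * - (s * b)" by simp
    then show ?thesis using that(2) by (simp add: mult.assoc[symmetric])
  qed
  show "y \<in> hline v"
  proof (cases "r1 = 0")
    case True
    then have "r2 \<noteq> 0" using r by simp
    then have "snd v = 0" "snd y = 0" using v(2) y True by auto
    moreover have "fst v \<noteq> 0" using v(1) \<open>snd v = 0\<close> by (auto simp: prod_eq_iff)
    ultimately have "y = v \<odot> (inverse (fst v) * fst y)" by (simp add: prod_eq_iff mult.assoc[symmetric])
    then show ?thesis unfolding hline_def by (rule image_eqI) simp
  next
    case False
    have f: "fst v = - (inverse r1 * (r2 * snd v))" "fst y = - (inverse r1 * (r2 * snd y))"
      using 1[OF v(2) False] 1[OF y False] .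
    then have "snd v \<noteq> 0" using v(1) by (auto simp: prod_eq_iff)
    then have "y = v \<odot> (inverse (snd v) * snd y)"
      by (simp add: prod_eq_iff f mult.assoc) (simp add: mult.assoc[symmetric])
    then show ?thesis unfolding hline_def by (rule image_eqI) simp
  qed
qed

lemma projective_facts:
  assumes "projective_transformation T"
  shows "rlinear T" "bij T" "T x = 0 \<longleftrightarrow> x = 0" "T (inv T x) = x" "inv T (T x) = x"
proof -
  show r: "rlinear T" and b: "bij T" using assms by (auto simp: projective_transformation_def)
  show "T (inv T x) = x" "inv T (T x) = x" using b by (simp_all add: bij_is_surj surj_f_inv_f bij_is_inj)
  show "T x = 0 \<longleftrightarrow> x = 0" using rlinear_0[OF r] b by (metis bij_pointE)
qed

lemma projective_image_hline:
  assumes "projective_transformation T"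
  shows "T ` hline v = hline (T v)"
proof -
  have "T (v \<odot> l) = T v \<odot> l" for l using projective_facts(1)[OF assms] unfolding rlinear_def by blast
  then show ?thesis unfolding hline_def image_image by simp
qed

lemma projective_inv:
  assumes "projective_transformation T"
  shows "projective_transformation (inv T)"
proof -
  note T = projective_facts[OF assms]
  have "inv T (x + y) = inv T x + inv T y" for x y
  proof -
    have "T (inv T x + inv T y) = T (inv T (x + y))"
      unfolding rlinear_add[OF T(1)] T(4) ..
    then show ?thesis using bij_is_inj[OF T(2)] by (metis injD)
  qed
  moreover have "inv T (x \<odot> l) = inv T x \<odot> l" for x l
  proof -
    have "T (inv T x \<odot> l) = T (inv T x) \<odot> l" using T(1) unfolding rlinear_def by blast
    then have "T (inv T x \<odot> l) = T (inv T (x \<odot> l))" unfolding T(4) .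
    then show ?thesis using bij_is_inj[OF T(2)] by (metis injD)
  qed
  ultimately show ?thesis
    unfolding projective_transformation_def rlinear_def using bij_imp_bij_inv[OF T(2)] by blast
qed

lemma immersion_section:
  assumes "immersion L"
  obtains s s' where "\<forall>\<^sub>F u in nhds z. L (par c u) = hline (s u)" "(s has_derivative s') (at z)"
    "s' 1 \<notin> hline (s z)"
proof -
  obtain f f' where f: "affine_rep L c z f" "(f has_derivative f') (at z)" "inj f'"
    using assms unfolding immersion_def by blast
  have f'1: "f' 1 \<noteq> 0"
    using f(3) linear_0[OF has_derivative_linear[OF f(2)]] by (metis injD zero_neq_one)
  from f(1) show ?thesis
    unfolding affine_rep_def
  proof
    assume *: "\<forall>\<^sub>F u in nhds z. L (par c u) = hline (f u, 1)"
    have "((\<lambda>u. (f u, 1 :: quat)) has_derivative (\<lambda>v. (f' v, 0))) (at z)"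
      by (intro has_derivative_Pair f(2) has_derivative_const)
    moreover have "(f' 1, 0) \<notin> hline (f z, 1)" using f'1 by (auto simp: hline_def rscale_def)
    ultimately show ?thesis using that[OF *] by simp
  next
    assume *: "\<forall>\<^sub>F u in nhds z. L (par c u) = hline (1, f u)"
    have "((\<lambda>u. (1 :: quat, f u)) has_derivative (\<lambda>v. (0, f' v))) (at z)"
      by (intro has_derivative_Pair f(2) has_derivative_const)
    moreover have "(0, f' 1) \<notin> hline (1, f z)" using f'1 by (auto simp: hline_def rscale_def)
    ultimately show ?thesis using that[OF *] by simp
  qed
qed

text \<open>Along a local section s of \<open>L\<close> the product R s vanishes, so R (s') = - (dR)
  s. If the derivative of the row killed the fibre, the derivative of s would stay in
  \<open>L\<close>, against the immersion.\<close>

lemma immersion_row_derivative: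
  fixes R :: "complex \<Rightarrow> H2 \<Rightarrow> quat"
  assumes imm: "immersion L"
    and add: "\<And>u x y. R u (x + y) = R u x + R u y" and scale: "\<And>u x l. R u (x \<odot> l) = R u x * l"
    and diff: "\<And>x. (\<lambda>u. R u x) differentiable at z"
    and mem: "\<And>u x. x \<in> L (par c u) \<longleftrightarrow> R u x = 0"
    and x: "x \<noteq> 0" "R z x = 0"
  shows "frechet_derivative (\<lambda>u. R u x) (at z) 1 \<noteq> 0"
proof
  define D where "D y v = frechet_derivative (\<lambda>u. R u y) (at z) v" for y v
  have D: "((\<lambda>u. R u y) has_derivative D y) (at z)" for y
    unfolding D_def[abs_def] using diff frechet_derivative_works by blast
  have Dscale: "D (y \<odot> l) v = D y v * l" for y l v
  proof -
    have "((\<lambda>u. R u y * l) has_derivative (\<lambda>v. D y v * l)) (at z)" by (intro has_derivative_mult_left D)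
    then have "((\<lambda>u. R u (y \<odot> l)) has_derivative (\<lambda>v. D y v * l)) (at z)" unfolding scale .
    then show ?thesis using has_derivative_unique[OF D] by metis
  qed
  have basis: "R u y = R u (1, 0) * fst y + R u (0, 1) * snd y" for u y
    using arg_cong[OF H2_basis[of y], of "R u"] by (simp only: add scale)
  assume "frechet_derivative (\<lambda>u. R u x) (at z) 1 = 0"
  then have Dx: "D x 1 = 0" by (simp add: D_def)
  obtain s s' where s: "\<forall>\<^sub>F u in nhds z. L (par c u) = hline (s u)" "(s has_derivative s') (at z)"
    "s' 1 \<notin> hline (s z)"
    using immersion_section[OF imm] by blast
  have Lz: "L (par c z) = hline (s z)" using eventually_nhds_x_imp_x[OF s(1)] .
  have s0: "R u (s u) = 0" if "L (par c u) = hline (s u)" for u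
    unfolding mem[symmetric] that by (rule self_in_hline)
  obtain l where l: "x = s z \<odot> l" using x(2) unfolding mem[symmetric] Lz hline_def by blast
  then have "l \<noteq> 0" using x(1) by auto
  then have Ds: "D (s z) 1 = 0" using Dx unfolding l Dscale by simp
  have "((\<lambda>u. R u (1, 0) * fst (s u) + R u (0, 1) * snd (s u)) has_derivative
      (\<lambda>v. (R z (1, 0) * fst (s' v) + D (1, 0) v * fst (s z)) + (R z (0, 1) * snd (s' v) + D (0, 1) v * snd (s z)))) (at z)"
    by (intro has_derivative_add has_derivative_mult D has_derivative_fst has_derivative_snd s(2))
  moreover have "((\<lambda>u. R u (1, 0) * fst (s u) + R u (0, 1) * snd (s u)) has_derivative (\<lambda>v. 0)) (at z)"
  proof (rule has_derivative_transform_eventually[OF has_derivative_const[of 0]])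
    show "\<forall>\<^sub>F u in at z. 0 = R u (1, 0) * fst (s u) + R u (0, 1) * snd (s u)"
      using s(1) unfolding eventually_at_filter basis[symmetric] by (auto elim!: eventually_mono simp: s0)
    show "0 = R z (1, 0) * fst (s z) + R z (0, 1) * snd (s z)" unfolding basis[symmetric] using s0[OF Lz] by simp
  qed simp
  ultimately have "(\<lambda>v. (R z (1, 0) * fst (s' v) + D (1, 0) v * fst (s z)) + (R z (0, 1) * snd (s' v) + D (0, 1) v * snd (s z))) = (\<lambda>v. 0)"
    by (rule has_derivative_unique)
  then have "(R z (1, 0) * fst (s' 1) + D (1, 0) 1 * fst (s z)) + (R z (0, 1) * snd (s' 1) + D (0, 1) 1 * snd (s z)) = 0"
    by meson
  moreover have "D (s z) 1 = D (1, 0) 1 * fst (s z) + D (0, 1) 1 * snd (s z)"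
  proof -
    have "((\<lambda>u. R u (1, 0) * fst (s z) + R u (0, 1) * snd (s z)) has_derivative
        (\<lambda>v. D (1, 0) v * fst (s z) + D (0, 1) v * snd (s z))) (at z)"
      by (intro has_derivative_add has_derivative_mult_left D)
    then show ?thesis unfolding basis[symmetric] using has_derivative_unique[OF D] by metis
  qed
  ultimately have "R z (s' 1) + D (s z) 1 = 0" unfolding basis[of z "s' 1"] by (simp add: algebra_simps)
  then have "R z (s' 1) = 0" using Ds by simp
  then show False using s(3) unfolding mem[symmetric] Lz by blast
qed

section \<open>The line of a Bryant sphere as the kernel of the row\<close>

context chart_data
begin

definition row :: "(H2 \<Rightarrow> H2) \<Rightarrow> complex \<Rightarrow> H2 \<Rightarrow> quat"
  where "row T u v = row1 u * fst (T v) + row2 u * snd (T v)"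

definition bryant_line :: "complex \<Rightarrow> H2"
  where "bryant_line u = (qc (poly a11 u / poly dl u) * quat_k + qc (poly a12 u / poly dl u),
    qc (poly a21 u / poly dl u) * quat_k + qc (poly a22 u / poly dl u))"

lemma smooth_row_T: "smooth_on UNIV (\<lambda>u. row T u v)"
  unfolding row_def by (intro smooth_on_add smooth_on_mult smooth_on_const smooth_row open_UNIV)

lemma row_linear:
  assumes "projective_transformation T"
  shows "row T u (v + v') = row T u v + row T u v'" "row T u (v \<odot> l) = row T u v * l"
proof -
  have "T (v + v') = T v + T v'" "T (v \<odot> l) = T v \<odot> l"
    using projective_facts(1)[OF assms] unfolding rlinear_def by blast+
  then show "row T u (v + v') = row T u v + row T u v'" "row T u (v \<odot> l) = row T u v * l"
    unfolding row_def by (simp_all add: algebra_simps)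
qed

lemma hol_at_row: "hol_at (hopf z) (\<lambda>u. row T u v) z"
  unfolding row_def by (intro hol_at_add hol_at_mult_right hol_at_row_tau)

text \<open>At a regular point the kernel is the line of F (k, 1) by \<open>row_kernel\<close>. At
  an end a local section of the bundle is annihilated by continuity, and since the row is nonzero
  there, its kernel is not larger than the line.\<close>

lemma mem_line_iff:
  assumes T: "projective_transformation T"
    and regular: "\<And>u. poly dl u \<noteq> 0 \<Longrightarrow> T ` E u = hline (bryant_line u)"
    and "open U" "z \<in> U" "smooth_on U \<psi>" and \<psi>: "\<And>u. u \<in> U \<Longrightarrow> \<psi> u \<noteq> 0 \<and> E u = hline (\<psi> u)"
  shows "v \<in> E z \<longleftrightarrow> row T z v = 0"
proof -
  note Tf = projective_facts[OF T]
  have 1: "v \<in> E u \<longleftrightarrow> row T u v = 0" if u: "poly dl u \<noteq> 0" for u v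
  proof -
    have "v \<in> E u \<longleftrightarrow> T v \<in> T ` E u" using bij_is_inj[OF Tf(2)] by (simp add: inj_image_mem_iff)
    also have "\<dots> \<longleftrightarrow> row T u v = 0"
      unfolding regular[OF u] row_def
      using kernel_hline[OF row_nonzero, of "bryant_line u" u "T v"] row_kernel[OF u]
      by (simp add: bryant_line_def)
    finally show ?thesis .
  qed
  have "isCont \<psi> z" using smooth_on_continuous[OF assms(5)] assms(3,4) by (simp add: continuous_on_eq_continuous_at)
  moreover have rT: "T v = T (1, 0) \<odot> fst v + T (0, 1) \<odot> snd v" for v
  proof -
    have "T v = T ((1, 0) \<odot> fst v + (0, 1) \<odot> snd v)" by (rule arg_cong[OF H2_basis])
    then show ?thesis using Tf(1) unfolding rlinear_def by simp
  qed
  have "isCont row1 z" "isCont row2 z"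
    using smooth_row[THEN smooth_on_continuous] by (simp_all add: continuous_on_eq_continuous_at)
  ultimately have "isCont (\<lambda>u. row T u (\<psi> u)) z"
    unfolding row_def rT[of "\<psi> _"] fst_add snd_add rscale_simps
    by (intro isCont_add isCont_mult isCont_fst isCont_snd continuous_const)
  moreover have "\<forall>\<^sub>F u in at z. row T u (\<psi> u) = 0"
  proof -
    have "\<forall>\<^sub>F u in at z. u \<in> U" using assms(3,4) by (rule eventually_at_in_open')
    moreover have "\<forall>\<^sub>F u in at z. poly dl u \<noteq> 0" by (rule eventually_at_poly_nonzero[OF dl_nonzero])
    ultimately show ?thesis
      by eventually_elim (use 1 \<psi> self_in_hline in blast)
  qed
  ultimately have 2: "row T z (\<psi> z) = 0" by (rule zero_by_continuity)
  have "v \<in> E z \<longleftrightarrow> T v \<in> T ` E z" using bij_is_inj[OF Tf(2)] by (simp add: inj_image_mem_iff)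
  also have "T ` E z = hline (T (\<psi> z))" using \<psi>[OF assms(4)] projective_image_hline[OF T] by simp
  also have "T v \<in> hline (T (\<psi> z)) \<longleftrightarrow> row T z v = 0"
    unfolding row_def using kernel_hline[OF row_nonzero, of "T (\<psi> z)" z "T v"] 2 \<psi>[OF assms(4)] Tf(3)
    by (simp add: row_def)
  finally show ?thesis .
qed

text \<open>At poles of order at least two \<open>tau\<close> alone has the required order,
  elsewhere the combination of \<open>leads_comb\<close> has it; T only changes the constant
  vector.\<close>

lemma third_section_exists:
  assumes T: "projective_transformation T" and W: "W \<noteq> 0"
  shows "\<exists>v l. leads (\<lambda>u. row T u v + tau u * l) z (order z k0 + 2)"
proof (cases "poly d1 z = 0")
  case True
  have "T 0 = 0" using projective_facts(3)[OF T] by blast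
  then have "leads (\<lambda>u. row T u 0 + tau u * 1) z (order z k0 + 2)"
    using leads_tau_root[OF W True] by (simp add: row_def)
  then show ?thesis by blast
next
  case False
  then obtain c1 c2 l where l: "leads (\<lambda>u. row1 u * qc c1 + row2 u * qc c2 + tau u * l) z (order z k0 + 2)"
    using leads_comb[OF W] by blast
  have eq: "row T u (inv T (qc c1, qc c2)) = row1 u * qc c1 + row2 u * qc c2" for u
    by (simp add: row_def projective_facts(4)[OF T])
  show ?thesis by (rule exI[of _ "inv T (qc c1, qc c2)"], rule exI[of _ l], unfold eq, rule l)
qed

end

locale bryant_frame = chart_pair +
  fixes L :: "cp1 \<Rightarrow> H2 set" and T :: "H2 \<Rightarrow> H2"
  assumes immersion: "immersion L" and projective: "projective_transformation T"
    and Z_line: "poly dl z \<noteq> 0 \<Longrightarrow> T ` L (par Zchart z) = hline (Z.bryant_line z)"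
    and I_line: "poly dl' z \<noteq> 0 \<Longrightarrow> T ` L (par Wchart z) = hline (I.bryant_line z)"
begin

definition R :: "chart \<Rightarrow> complex \<Rightarrow> H2 \<Rightarrow> quat"
  where "R c = (case c of Zchart \<Rightarrow> Z.row T | Wchart \<Rightarrow> I.row T)"

definition h :: "chart \<Rightarrow> complex \<Rightarrow> complex"
  where "h c = (case c of Zchart \<Rightarrow> Z.hopf | Wchart \<Rightarrow> I.hopf)"

definition \<tau> :: "chart \<Rightarrow> complex \<Rightarrow> quat"
  where "\<tau> c = (case c of Zchart \<Rightarrow> Z.tau | Wchart \<Rightarrow> I.tau)"

definition k0 :: "chart \<Rightarrow> complex poly"
  where "k0 c = (case c of Zchart \<Rightarrow> Z.k0 | Wchart \<Rightarrow> I.k0)"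

lemma R_linear: "R c z (v + v') = R c z v + R c z v'" "R c z (v \<odot> l) = R c z v * l"
  by (cases c; simp add: R_def Z.row_linear[OF projective] I.row_linear[OF projective])+

lemma smooth_R: "smooth_on UNIV (\<lambda>z. R c z v)"
  by (cases c) (simp_all add: R_def Z.smooth_row_T I.smooth_row_T)

lemma mem_L_iff: "v \<in> L (par c z) \<longleftrightarrow> R c z v = 0"
proof -
  obtain U \<psi> where U: "z \<in> U" "open U" "smooth_on U \<psi>"
    and \<psi>: "\<And>u. u \<in> U \<Longrightarrow> \<psi> u \<noteq> 0 \<and> L (par c u) = hline (\<psi> u)"
    using immersion[unfolded immersion_def line_subbundle_def, THEN conjunct1, rule_format, of z c] by (elim exE conjE) blast
  show ?thesis
  proof (cases c)
    case Zchart
    have "v \<in> L (par Zchart z) \<longleftrightarrow> Z.row T z v = 0"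
    proof (rule Z.mem_line_iff[where E = "\<lambda>u. L (par Zchart u)" and v = v, OF projective _ U(2,1,3)])
      show "T ` L (par Zchart u) = hline (Z.bryant_line u)" if "poly dl u \<noteq> 0" for u by (rule Z_line[OF that])
      show "\<psi> u \<noteq> 0 \<and> L (par Zchart u) = hline (\<psi> u)" if "u \<in> U" for u
        using \<psi>[OF that] unfolding Zchart .
    qed
    then show ?thesis by (simp add: Zchart R_def del: par.simps)
  next
    case Wchart
    have "v \<in> L (par Wchart z) \<longleftrightarrow> I.row T z v = 0"
    proof (rule I.mem_line_iff[where E = "\<lambda>u. L (par Wchart u)" and v = v, OF projective _ U(2,1,3)])
      show "T ` L (par Wchart u) = hline (I.bryant_line u)" if "poly dl' u \<noteq> 0" for u by (rule I_line[OF that])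
      show "\<psi> u \<noteq> 0 \<and> L (par Wchart u) = hline (\<psi> u)" if "u \<in> U" for u
        using \<psi>[OF that] unfolding Wchart .
    qed
    then show ?thesis by (simp add: Wchart R_def del: par.simps)
  qed
qed

sublocale spinor_frame L R h
proof
  fix c z and x y :: H2 and l
  show "R c z (x + y) = R c z x + R c z y" "R c z (x \<odot> l) = R c z x * l" by (rule R_linear)+
  show "smooth_on UNIV (\<lambda>z. R c z x)" by (rule smooth_R)
  show "x \<in> L (par c z) \<longleftrightarrow> R c z x = 0" by (rule mem_L_iff)
  show "\<exists>x. R c z x \<noteq> 0"
  proof -
    have *: "\<exists>x. a * fst (T x) + b * snd (T x) \<noteq> 0" if "a \<noteq> 0 \<or> b \<noteq> 0" for a b :: quat
    proof -
      have "a * fst (T (inv T (1, 0))) + b * snd (T (inv T (1, 0))) = a"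
        "a * fst (T (inv T (0, 1))) + b * snd (T (inv T (0, 1))) = b"
        by (simp_all add: projective_facts(4)[OF projective])
      then show ?thesis using that by metis
    qed
    show ?thesis
      using *[OF Z.row_nonzero] *[OF I.row_nonzero] by (cases c) (simp_all add: R_def Z.row_def I.row_def)
  qed
  show "R Wchart (1 / z) x = qc (1 / (\<i> * z)) * R Zchart z x" if "z \<noteq> 0"
    using row1_transition[OF that] row2_transition[OF that]
    by (simp add: R_def Z.row_def I.row_def distrib_left mult.assoc)
  show "hol_at (h c z) (\<lambda>u. R c u x) z"
    by (cases c) (simp_all add: h_def R_def Z.hol_at_row I.hol_at_row)
  show "frechet_derivative (\<lambda>u. R c u x) (at z) 1 \<noteq> 0" if "x \<noteq> 0" "R c z x = 0"
  proof (rule immersion_row_derivative[where R = "R c" and c = c, OF immersion R_linear _ mem_L_iff that])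
    show "(\<lambda>u. R c u x) differentiable at z" for x
      using smooth_on_has_derivative[OF open_UNIV smooth_R] unfolding differentiable_def by blast
  qed
qed

lemma soliton_frame:
  assumes K: "Z.K \<noteq> 0"
  shows "soliton_frame L R h \<tau> k0 N"
proof -
  have IK: "I.K \<noteq> 0" by (rule total_order(1)[OF K])
  have W: "Z.W \<noteq> 0" "I.W \<noteq> 0" using K IK by (auto simp: Z.K_eq I.K_eq)
  show ?thesis
  proof
    fix c z
    show "smooth_on UNIV (\<tau> c)" by (cases c) (simp_all add: \<tau>_def Z.smooth_tau I.smooth_tau)
    show "\<tau> Wchart (1 / z) = qc (1 / (\<i> * z)) * \<tau> Zchart z" if "z \<noteq> 0"
      using tau_transition[OF that] by (simp add: \<tau>_def)
    show "hol_at (h c z) (\<tau> c) z"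
      by (cases c) (simp_all add: h_def \<tau>_def Z.hol_at_row_tau I.hol_at_row_tau)
    show "\<exists>x l. leads (\<lambda>u. R c u x + \<tau> c u * l) z (order z (k0 c) + 2)"
      using Z.third_section_exists[OF projective W(1)] I.third_section_exists[OF projective W(2)]
      by (cases c) (simp_all add: R_def \<tau>_def k0_def)
    show "k0 c \<noteq> 0" using Z.k0_nonzero[OF K] I.k0_nonzero[OF IK] by (cases c) (simp_all add: k0_def)
    show "int (degree (k0 Zchart)) + int (order 0 (k0 Wchart)) = int N - 3"
      using total_order(2)[OF K] by (simp add: k0_def)
    show "(\<integral>z. (norm (h Zchart z))\<^sup>2 \<partial>lborel) = pi * real N"
      using energy by (simp add: h_def)
  qed
qed

end

lemma bryant_frame_exists:
  assumes "bryant_sphere_smooth_ends L"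
  shows "\<exists>dl ep d1 nu a11 a12 a21 a22 x y P Q dl' ep' d1' nu' b11 b12 b21 b22 x' y' P' Q' T.
    bryant_frame dl ep d1 nu a11 a12 a21 a22 x y P Q dl' ep' d1' nu' b11 b12 b21 b22 x' y' P' Q' L T"
proof -
  obtain T F where imm: "immersion L" and T: "projective_transformation T" and F: "rational_null_immersion F"
    and ends: "\<And>c z m. pole_of_order (\<lambda>u. matrix_deriv (F \<circ> par c) u ** matrix_inv (F (par c u))) z m \<Longrightarrow> m = 2"
    and line: "\<And>c z. (\<nexists>m. pole_of_order (F \<circ> par c) z m) \<Longrightarrow> T ` L (par c z) = hline (bryant_vector (F (par c z)))"
    using assms unfolding bryant_sphere_smooth_ends_def by blast
  have data: "\<exists>dl ep d1 nu a11 a12 a21 a22 x y P Q. chart_data dl ep d1 nu a11 a12 a21 a22 x y P Q \<and>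
    (\<forall>z. poly dl z \<noteq> 0 \<longrightarrow> (\<nexists>m. pole_of_order (F \<circ> par c) z m) \<and>
      (F \<circ> par c) z $ 1 $ 1 = poly a11 z / poly dl z \<and> (F \<circ> par c) z $ 1 $ 2 = poly a12 z / poly dl z \<and>
      (F \<circ> par c) z $ 2 $ 1 = poly a21 z / poly dl z \<and> (F \<circ> par c) z $ 2 $ 2 = poly a22 z / poly dl z)" for c
  proof (rule chart_data_exists)
    show "\<exists>p q. reduced_fraction (\<lambda>z. (F \<circ> par c) z $ i $ j) p q" for i j
    proof -
      have "rational_fun (\<lambda>p. F p $ i $ j)" using F unfolding rational_null_immersion_def by blast
      from rational_fun_chart[OF this, of c] show ?thesis by simp
    qed
    show "det ((F \<circ> par c) z) = 1 \<and> det (matrix_deriv (F \<circ> par c) z) = 0 \<and> matrix_deriv (F \<circ> par c) z \<noteq> 0"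
      if "\<nexists>m. pole_of_order (F \<circ> par c) z m" for z
      using F that unfolding rational_null_immersion_def o_apply by blast
    show "m = 2" if "pole_of_order (\<lambda>u. matrix_deriv (F \<circ> par c) u ** matrix_inv ((F \<circ> par c) u)) z m" for z m
      using ends[of c z m] that unfolding o_apply .
  qed
  obtain dl ep d1 nu a11 a12 a21 a22 x y P Q where Z: "chart_data dl ep d1 nu a11 a12 a21 a22 x y P Q"
    and Zf: "\<And>z. poly dl z \<noteq> 0 \<Longrightarrow> (\<nexists>m. pole_of_order (F \<circ> par Zchart) z m) \<and>
      (F \<circ> par Zchart) z $ 1 $ 1 = poly a11 z / poly dl z \<and> (F \<circ> par Zchart) z $ 1 $ 2 = poly a12 z / poly dl z \<and>
      (F \<circ> par Zchart) z $ 2 $ 1 = poly a21 z / poly dl z \<and> (F \<circ> par Zchart) z $ 2 $ 2 = poly a22 z / poly dl z"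
    using data[of Zchart] by (elim exE conjE) blast
  obtain dl' ep' d1' nu' b11 b12 b21 b22 x0 y0 P0 Q0 where I: "chart_data dl' ep' d1' nu' b11 b12 b21 b22 x0 y0 P0 Q0"
    and If: "\<And>z. poly dl' z \<noteq> 0 \<Longrightarrow> (\<nexists>m. pole_of_order (F \<circ> par Wchart) z m) \<and>
      (F \<circ> par Wchart) z $ 1 $ 1 = poly b11 z / poly dl' z \<and> (F \<circ> par Wchart) z $ 1 $ 2 = poly b12 z / poly dl' z \<and>
      (F \<circ> par Wchart) z $ 2 $ 1 = poly b21 z / poly dl' z \<and> (F \<circ> par Wchart) z $ 2 $ 2 = poly b22 z / poly dl' z"
    using data[of Wchart] by (elim exE conjE) blast
  have "\<exists>x' y' P' Q'. chart_pair dl ep d1 nu a11 a12 a21 a22 x y P Q dl' ep' d1' nu' b11 b12 b21 b22 x' y' P' Q'"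
  proof (rule chart_pair_exists[OF Z I])
    fix w :: complex assume w: "w \<noteq> 0" "poly dl' w \<noteq> 0" "poly dl (1 / w) \<noteq> 0"
    have "(F \<circ> par Wchart) w = (F \<circ> par Zchart) (1 / w)" using w(1) by simp
    then show "poly b11 w / poly dl' w = poly a11 (1 / w) / poly dl (1 / w) \<and>
      poly b12 w / poly dl' w = poly a12 (1 / w) / poly dl (1 / w) \<and>
      poly b21 w / poly dl' w = poly a21 (1 / w) / poly dl (1 / w) \<and>
      poly b22 w / poly dl' w = poly a22 (1 / w) / poly dl (1 / w)"
      using If[OF w(2)] Zf[OF w(3)] by metis
  qed
  then obtain x' y' P' Q' where pair: "chart_pair dl ep d1 nu a11 a12 a21 a22 x y P Q dl' ep' d1' nu' b11 b12 b21 b22 x' y' P' Q'"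
    by blast
  then interpret chart_pair dl ep d1 nu a11 a12 a21 a22 x y P Q dl' ep' d1' nu' b11 b12 b21 b22 x' y' P' Q' .
  have "bryant_frame dl ep d1 nu a11 a12 a21 a22 x y P Q dl' ep' d1' nu' b11 b12 b21 b22 x' y' P' Q' L T"
  proof (unfold_locales)
    show "T ` L (par Zchart z) = hline (Z.bryant_line z)" if "poly dl z \<noteq> 0" for z
      using line[of Zchart z] Zf[OF that] unfolding Z.bryant_line_def bryant_vector_def o_apply by metis
    show "T ` L (par Wchart z) = hline (I.bryant_line z)" if "poly dl' z \<noteq> 0" for z
      using line[of Wchart z] If[OF that] unfolding I.bryant_line_def bryant_vector_def o_apply by metis
  qed (rule imm T)+
  then show ?thesis by (intro exI)
qed

text \<open>The frame is carried along by composition with the inverse of A, which changes neither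
  the equation nor \<tau> nor the orders. Applied to the map from \<open>L\<close> to its
  annihilator, this treats the dual bundle.\<close>

lemma soliton_frame_image:
  assumes "soliton_frame L R h \<tau> k0 N" and A: "projective_transformation A"
  shows "soliton_frame (\<lambda>p. A ` L p) (\<lambda>c z x. R c z (inv A x)) h \<tau> k0 N"
proof -
  interpret soliton_frame L R h \<tau> k0 N by fact
  note Af = projective_facts[OF A]
  note iA = projective_facts(1)[OF projective_inv[OF A]]
  show ?thesis
  proof
    fix c z x y l
    show "R c z (inv A (x + y)) = R c z (inv A x) + R c z (inv A y)"
      unfolding rlinear_add[OF iA] by (rule R_add)
    have "inv A (x \<odot> l) = inv A x \<odot> l" using iA unfolding rlinear_def by blast
    then show "R c z (inv A (x \<odot> l)) = R c z (inv A x) * l" by (simp add: R_rscale)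
    show "smooth_on UNIV (\<lambda>z. R c z (inv A x))" by (rule R_smooth)
    have "x \<in> A ` L (par c z) \<longleftrightarrow> inv A x \<in> L (par c z)"
      using Af(4,5) by (metis image_iff)
    then show "x \<in> A ` L (par c z) \<longleftrightarrow> R c z (inv A x) = 0" by (simp only: mem_E_iff)
    obtain v where "R c z v \<noteq> 0" using R_nonzero by blast
    then have "R c z (inv A (A v)) \<noteq> 0" by (simp only: Af(5) simp_thms)
    then show "\<exists>x. R c z (inv A x) \<noteq> 0" by (rule exI)
    show "R Wchart (1 / z) (inv A x) = qc (1 / (\<i> * z)) * R Zchart z (inv A x)" if "z \<noteq> 0"
      by (rule R_transition[OF that])
    show "hol_at (h c z) (\<lambda>u. R c u (inv A x)) z" by (rule R_hol)
    show "frechet_derivative (\<lambda>u. R c u (inv A x)) (at z) 1 \<noteq> 0" if "x \<noteq> 0" "R c z (inv A x) = 0"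
    proof (rule R_immersed[OF _ that(2)])
      show "inv A x \<noteq> 0" using that(1) projective_facts(3)[OF projective_inv[OF A]] by blast
    qed
    obtain v m where "leads (\<lambda>u. R c u v + \<tau> c u * m) z (order z (k0 c) + 2)"
      using third_section by blast
    then have "leads (\<lambda>u. R c u (inv A (A v)) + \<tau> c u * m) z (order z (k0 c) + 2)"
      unfolding Af(5) .
    then show "\<exists>x l. leads (\<lambda>u. R c u (inv A x) + \<tau> c u * l) z (order z (k0 c) + 2)" by (intro exI)
  qed (rule \<tau>_smooth \<tau>_transition \<tau>_hol k0_nonzero total_order energy; assumption?)+
qed

section \<open>The dual bundle\<close>

lemma pairing_add_left: "pairing (a + b) x = pairing a x + pairing b x"
  by (simp add: pairing_def qcnj_add distrib_right)

lemma pairing_add_right: "pairing a (x + y) = pairing a x + pairing a y"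
  by (simp add: pairing_def distrib_left)

lemma bounded_bilinear_pairing: "bounded_bilinear pairing"
proof
  fix a b x y :: H2 and r :: real
  show "pairing (a + b) x = pairing a x + pairing b x" by (rule pairing_add_left)
  show "pairing a (x + y) = pairing a x + pairing a y" by (rule pairing_add_right)
  show "pairing (r *\<^sub>R a) x = r *\<^sub>R pairing a x" "pairing a (r *\<^sub>R x) = r *\<^sub>R pairing a x"
    by (simp_all add: pairing_def qcnj_def quat_eq_iff algebra_simps)
  show "\<exists>K. \<forall>a x. norm (pairing a x) \<le> norm a * norm x * K"
  proof (intro exI[of _ 2] allI)
    fix a x :: H2
    have "norm (pairing a x) \<le> norm (fst a) * norm (fst x) + norm (snd a) * norm (snd x)"
      unfolding pairing_def by (rule order_trans[OF norm_triangle_ineq]) (simp add: norm_mult)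
    also have "\<dots> \<le> norm a * norm x + norm a * norm x"
    proof -
      have "norm (fst y) \<le> norm y" "norm (snd y) \<le> norm y" for y :: H2
        using norm_fst_le[of "fst y" "snd y"] norm_snd_le[of "snd y" "fst y"] by simp_all
      then show ?thesis by (intro add_mono mult_mono norm_ge_zero)
    qed
    finally show "norm (pairing a x) \<le> norm a * norm x * 2" by simp
  qed
qed

definition adjoint :: "(H2 \<Rightarrow> H2) \<Rightarrow> H2 \<Rightarrow> H2"
  where "adjoint A a = (qcnj (pairing a (A (1, 0))), qcnj (pairing a (A (0, 1))))"

lemma pairing_adjoint:
  assumes "rlinear A"
  shows "pairing (adjoint A a) x = pairing a (A x)"
proof -
  have "A x = A (1, 0) \<odot> fst x + A (0, 1) \<odot> snd x"
  proof -
    have "A x = A ((1, 0) \<odot> fst x + (0, 1) \<odot> snd x)" by (rule arg_cong[OF H2_basis])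
    then show ?thesis using assms unfolding rlinear_def by simp
  qed
  then have "pairing a (A x) = pairing a (A (1, 0)) * fst x + pairing a (A (0, 1)) * snd x"
    by (simp add: pairing_add_right pairing_rscale_right)
  then show ?thesis by (subst pairing_def) (simp add: adjoint_def)
qed

lemma pairing_self: "pairing a a = 0 \<Longrightarrow> a = 0"
proof -
  assume "pairing a a = 0"
  then have "qre (pairing a a) = 0" by simp
  then have "inner a a = 0"
    unfolding inner_prod_def inner_quat_def by (simp add: pairing_def)
  then show "a = 0" by simp
qed

lemma projectiveI:
  assumes "rlinear A" "\<And>x. A x = 0 \<Longrightarrow> x = 0"
  shows "projective_transformation A"
proof -
  have lin: "linear A"
    using assms(1) by (intro linearI) (auto simp: rlinear_add rlinear_scaleR)
  have "inj A" using assms(2) linear_injective_0[OF lin] by blast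
  then have "bij A" using linear_injective_imp_surjective[OF lin] by (simp add: bij_def)
  then show ?thesis using assms(1) by (simp add: projective_transformation_def)
qed

lemma projective_adjoint:
  assumes "projective_transformation A"
  shows "projective_transformation (adjoint A)"
proof (rule projectiveI)
  note Af = projective_facts[OF assms]
  show "rlinear (adjoint A)"
    unfolding rlinear_def
  proof (intro conjI allI)
    fix a b :: H2 and l
    show "adjoint A (a + b) = adjoint A a + adjoint A b"
      by (simp add: adjoint_def pairing_add_left qcnj_add)
    show "adjoint A (a \<odot> l) = adjoint A a \<odot> l"
      by (simp add: adjoint_def pairing_rscale_left qcnj_mult prod_eq_iff)
  qed
  show "a = 0" if "adjoint A a = 0" for a
  proof (rule pairing_self)
    have "pairing (adjoint A a) (inv A a) = 0" unfolding that by (simp add: pairing_def zero_prod_def qcnj_def quat_eq_iff)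
    then show "pairing a a = 0" unfolding pairing_adjoint[OF Af(1)] Af(4) .
  qed
qed

lemma projective_comp:
  assumes "projective_transformation A" "projective_transformation B"
  shows "projective_transformation (\<lambda>x. A (B x))"
  using assms bij_comp[of B A] unfolding projective_transformation_def rlinear_def o_def by (simp del: split_paired_All)

text \<open>
  The null lines of the indefinite Hermitian form \<open>pairing (hermitian x) y\<close> are the points of the
  conformal 3-sphere that contains the surface. The form identifies \<open>L\<close> with its annihilator, so
  that the two Moebius invariant bundles of a Bryant sphere are isomorphic.
\<close>

definition hermitian :: "H2 \<Rightarrow> H2"
  where "hermitian x = (- (Quat 0 0 1 0 * snd x), Quat 0 0 1 0 * fst x)"

lemma projective_hermitian: "projective_transformation hermitian"
proof (rule projectiveI)
  show "rlinear hermitian"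
    unfolding rlinear_def hermitian_def rscale_def plus_prod_def
    by (auto simp: algebra_simps simp del: split_paired_All)
  have "Quat 0 0 1 0 \<noteq> 0" by (simp add: quat_eq_iff)
  then show "x = 0" if "hermitian x = 0" for x
    using that by (simp add: hermitian_def prod_eq_iff)
qed

text \<open>For arbitrary a, b, c, d the value is 2 Im (a d - b c), which vanishes for determinant
  one.\<close>

lemma hermitian_isotropic:
  assumes "a * d - b * c = 1"
  defines "v \<equiv> (qc a * quat_k + qc b, qc c * quat_k + qc d)"
  shows "pairing (hermitian v) v = 0"
proof -
  have re: "Re a * Re d - Im a * Im d - Re b * Re c + Im b * Im c = 1"
    and im: "Re a * Im d + Im a * Re d - Re b * Im c - Im b * Re c = 0"
    using arg_cong[OF assms(1), of Re] arg_cong[OF assms(1), of Im] by (simp_all add: algebra_simps)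
  show ?thesis
    unfolding v_def pairing_def hermitian_def using re im
    by (simp add: quat_eq_iff) (simp add: algebra_simps)
qed

lemma annihilator_hline:
  assumes "v \<noteq> 0" "b \<noteq> 0" "pairing b v = 0"
  shows "{a. \<forall>x\<in>hline v. pairing a x = 0} = hline b"
proof -
  have "a \<in> hline b \<longleftrightarrow> qcnj (fst v) * fst a + qcnj (snd v) * snd a = 0" for a
  proof (rule kernel_hline[OF _ assms(2)])
    show "qcnj (fst v) \<noteq> 0 \<or> qcnj (snd v) \<noteq> 0" using assms(1) by (auto simp: prod_eq_iff)
    show "qcnj (fst v) * fst b + qcnj (snd v) * snd b = 0"
      using arg_cong[OF assms(3), of qcnj] by (simp add: pairing_def qcnj_add qcnj_mult)
  qed
  moreover have "qcnj (fst v) * fst a + qcnj (snd v) * snd a = qcnj (pairing a v)" for a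
    by (simp add: pairing_def qcnj_add qcnj_mult)
  ultimately have "a \<in> hline b \<longleftrightarrow> pairing a v = 0" for a by simp
  moreover have "(\<forall>x\<in>hline v. pairing a x = 0) \<longleftrightarrow> pairing a v = 0" for a
  proof
    assume *: "\<forall>x\<in>hline v. pairing a x = 0"
    then show "pairing a v = 0" using self_in_hline by blast
  qed (auto simp: hline_def pairing_rscale_right)
  ultimately show ?thesis by blast
qed

text \<open>
  Differentiating \<open>pairing \<alpha> \<psi> = 0\<close> shows that the derivative of the annihilator is minus the
  dual of the derivative of \<open>L\<close>.
\<close>

lemma star_delta_annihilator:
  assumes L: "line_subbundle L" and J: "complex_structure_sub L J" "star_delta_sub L J"
    and dual: "\<And>p a x. x \<in> L p \<Longrightarrow> pairing (J' p a) x = pairing a (J p x)"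
  shows "star_delta_quot (annihilator L) J'"
  unfolding star_delta_quot_def
proof (intro allI impI ballI)
  fix c U \<alpha> z v
  assume \<alpha>: "local_section (annihilator L) c U \<alpha>" and z: "z \<in> U"
  obtain V \<psi> where V: "z \<in> V" "open V" "smooth_on V \<psi>"
    and \<psi>: "\<And>u. u \<in> V \<Longrightarrow> \<psi> u \<noteq> 0 \<and> L (par c u) = hline (\<psi> u)"
    using L[unfolded line_subbundle_def, rule_format, of z c] by (elim exE conjE) blast
  have oU: "open U" and sU: "smooth_on U \<alpha>" and aU: "\<And>u. u \<in> U \<Longrightarrow> \<alpha> u \<in> annihilator L (par c u)"
    using \<alpha> unfolding local_section_def by blast+
  define S where "S = U \<inter> V"
  have S: "open S" "z \<in> S" "S \<subseteq> U" "S \<subseteq> V" using oU V z by (auto simp: S_def)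
  have s\<psi>: "smooth_on S \<psi>" by (rule smooth_on_subset[OF V(3,2) S(1,4)])
  \<comment> \<open>J \<psi> is a second section of \<open>L\<close>. Differentiating its pairing
    with \<alpha> supplies the term in which J acts on the dual side.\<close>
  define \<phi> where "\<phi> u = J (par c u) (\<psi> u)" for u
  have Jlin: "rlinear (J p)" and Jsm: "\<And>x. smooth_cp1 (\<lambda>p. J p x)"
    and JL: "\<And>x. x \<in> L p \<Longrightarrow> J p x \<in> L p" for p
    using J(1) unfolding complex_structure_sub_def smooth_End_def by blast+
  have \<phi>_eq: "\<phi> u = J (par c u) (1, 0) \<odot> fst (\<psi> u) + J (par c u) (0, 1) \<odot> snd (\<psi> u)" for u
  proof -
    have "\<phi> u = J (par c u) ((1, 0) \<odot> fst (\<psi> u) + (0, 1) \<odot> snd (\<psi> u))"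
      unfolding \<phi>_def by (rule arg_cong[OF H2_basis])
    then show ?thesis using Jlin[of "par c u"] unfolding rlinear_def by simp
  qed
  have sJ: "smooth_on S (\<lambda>u. J (par c u) x)" for x
    using Jsm[of x] smooth_on_subset[OF _ open_UNIV S(1)] unfolding smooth_cp1_def o_def by blast
  have s\<phi>: "smooth_on S \<phi>"
    unfolding \<phi>_eq[abs_def]
    by (intro smooth_on_add smooth_on_rscale smooth_on_fst smooth_on_snd sJ s\<psi> S(1))
  have \<psi>L: "\<psi> u \<in> L (par c u)" if "u \<in> S" for u
    using \<psi>[of u] self_in_hline[of "\<psi> u"] that S(4) by blast
  have \<phi>L: "\<phi> u \<in> L (par c u)" if "u \<in> S" for u
    unfolding \<phi>_def by (rule JL[OF \<psi>L[OF that]])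
  have d\<alpha>: "(\<alpha> has_derivative frechet_derivative \<alpha> (at z)) (at z)"
    by (rule smooth_on_has_derivative[OF oU sU z])
  have d: "pairing (frechet_derivative \<alpha> (at z) w) (f z) = - pairing (\<alpha> z) (frechet_derivative f (at z) w)"
    if f: "smooth_on S f" "\<And>u. u \<in> S \<Longrightarrow> f u \<in> L (par c u)" for f w
  proof -
    have "((\<lambda>u. pairing (\<alpha> u) (f u)) has_derivative
        (\<lambda>w. pairing (\<alpha> z) (frechet_derivative f (at z) w) + pairing (frechet_derivative \<alpha> (at z) w) (f z))) (at z)"
      by (rule bounded_bilinear.FDERIV[OF bounded_bilinear_pairing d\<alpha> smooth_on_has_derivative[OF S(1) f(1) S(2)]])
    moreover have "((\<lambda>u. pairing (\<alpha> u) (f u)) has_derivative (\<lambda>w. 0)) (at z)"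
    proof (rule has_derivative_transform_within_open[OF has_derivative_const[of 0] S(1,2)])
      fix u assume u: "u \<in> S"
      have "\<alpha> u \<in> annihilator L (par c u)" using aU u S(3) by blast
      then show "0 = pairing (\<alpha> u) (f u)" using f(2)[OF u] by (simp add: annihilator_def)
    qed
    ultimately have "(\<lambda>w. pairing (\<alpha> z) (frechet_derivative f (at z) w) + pairing (frechet_derivative \<alpha> (at z) w) (f z)) = (\<lambda>w. 0)"
      by (rule has_derivative_unique)
    then have "pairing (\<alpha> z) (frechet_derivative f (at z) w) + pairing (frechet_derivative \<alpha> (at z) w) (f z) = 0" by meson
    then show ?thesis by (simp add: eq_neg_iff_add_eq_0 add.commute)
  qed
  have "local_section L c S \<psi>" using S(1) s\<psi> \<psi>L unfolding local_section_def by blast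
  then have "frechet_derivative \<psi> (at z) (\<i> * v) - frechet_derivative \<phi> (at z) v \<in> L (par c z)"
    using J(2) S(2) unfolding star_delta_sub_def \<phi>_def by blast
  then have "pairing (\<alpha> z) (frechet_derivative \<psi> (at z) (\<i> * v) - frechet_derivative \<phi> (at z) v) = 0"
    using aU[OF z] by (simp add: annihilator_def)
  then have e: "pairing (\<alpha> z) (frechet_derivative \<psi> (at z) (\<i> * v)) = pairing (\<alpha> z) (frechet_derivative \<phi> (at z) v)"
    by (simp add: bounded_bilinear.diff_right[OF bounded_bilinear_pairing])
  let ?x = "frechet_derivative \<alpha> (at z) (\<i> * v) - J' (par c z) (frechet_derivative \<alpha> (at z) v)"
  have "pairing ?x (\<psi> z) = pairing (frechet_derivative \<alpha> (at z) (\<i> * v)) (\<psi> z) - pairing (frechet_derivative \<alpha> (at z) v) (\<phi> z)"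
    unfolding bounded_bilinear.diff_left[OF bounded_bilinear_pairing] dual[OF \<psi>L[OF S(2)]] \<phi>_def ..
  also have "\<dots> = 0" using d[OF s\<psi> \<psi>L, of "\<i> * v"] d[OF s\<phi> \<phi>L, of v] e by simp
  finally have "pairing ?x (\<psi> z) = 0" .
  then have "pairing ?x (\<psi> z \<odot> l) = 0" for l by (simp add: pairing_rscale_right)
  then show "?x \<in> annihilator L (par c z)"
    unfolding annihilator_def using \<psi>[OF V(1)] by (auto simp: hline_def simp del: split_paired_All)
qed

context bryant_frame
begin

text \<open>The Hermitian form pulled back by T, as a right linear map into the dual; its null lines
  form the 3-sphere that contains \<open>L\<close> itself.\<close>

definition dual_map :: "H2 \<Rightarrow> H2"
  where "dual_map v = adjoint T (hermitian (T v))"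

lemma projective_dual_map: "projective_transformation dual_map"
  unfolding dual_map_def[abs_def]
  by (intro projective_comp[OF projective_adjoint[OF projective]] projective_comp[OF projective_hermitian] projective)

lemma pairing_dual_map: "pairing (dual_map v) v' = pairing (hermitian (T v)) (T v')"
  unfolding dual_map_def by (rule pairing_adjoint[OF projective_facts(1)[OF projective]])

end

lemma (in chart_data) bryant_line_isotropic:
  assumes "poly dl u \<noteq> 0"
  shows "pairing (hermitian (bryant_line u)) (bryant_line u) = 0"
  unfolding bryant_line_def by (rule hermitian_isotropic[OF det_quotient[OF assms]])

context bryant_frame
begin

lemma eventually_isotropic: "\<forall>\<^sub>F u in at z. \<forall>v\<in>L (par c u). pairing (dual_map v) v = 0"
proof -
  have *: "pairing (hermitian (v \<odot> l)) (v \<odot> l) = 0" if "pairing (hermitian v) v = 0" for v l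
  proof -
    have "hermitian (v \<odot> l) = hermitian v \<odot> l"
      using projective_facts(1)[OF projective_hermitian] unfolding rlinear_def by blast
    then show ?thesis using that by (simp add: pairing_rscale_left pairing_rscale_right mult.assoc[symmetric])
  qed
  show ?thesis
  proof (cases c)
    case Zchart
    have "\<forall>\<^sub>F u in at z. poly dl u \<noteq> 0" by (rule eventually_at_poly_nonzero[OF Z.dl_nonzero])
    then show ?thesis
    proof eventually_elim
      case (elim u)
      show ?case
      proof
        fix v assume "v \<in> L (par c u)"
        then have "T v \<in> hline (Z.bryant_line u)" unfolding Z_line[OF elim, symmetric] Zchart by (rule imageI)
        then show "pairing (dual_map v) v = 0"
          unfolding pairing_dual_map hline_def using *[OF Z.bryant_line_isotropic[OF elim]] by (elim rangeE) simp
      qed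
    qed
  next
    case Wchart
    have "\<forall>\<^sub>F u in at z. poly dl' u \<noteq> 0" by (rule eventually_at_poly_nonzero[OF I.dl_nonzero])
    then show ?thesis
    proof eventually_elim
      case (elim u)
      show ?case
      proof
        fix v assume "v \<in> L (par c u)"
        then have "T v \<in> hline (I.bryant_line u)" unfolding I_line[OF elim, symmetric] Wchart by (rule imageI)
        then show "pairing (dual_map v) v = 0"
          unfolding pairing_dual_map hline_def using *[OF I.bryant_line_isotropic[OF elim]] by (elim rangeE) simp
      qed
    qed
  qed
qed

text \<open>\<open>L\<close> is isotropic at regular points because det F = 1, and at the ends by
  continuity. An isotropic line is annihilated by its own image under \<open>dual_map\<close>, and
  the annihilator of a line is a line.\<close>

lemma annihilator_eq: "annihilator L p = dual_map ` L p"
proof -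
  obtain c z where p: "p = par c z" by (rule par_surj)
  obtain U \<psi> where U: "z \<in> U" "open U" "smooth_on U \<psi>"
    and \<psi>: "\<And>u. u \<in> U \<Longrightarrow> \<psi> u \<noteq> 0 \<and> L (par c u) = hline (\<psi> u)"
    using immersion[unfolded immersion_def line_subbundle_def, THEN conjunct1, rule_format, of z c] by (elim exE conjE) blast
  note M = projective_facts[OF projective_dual_map]
  have lin: "bounded_linear dual_map"
    using M(1) by (intro linear_conv_bounded_linear[THEN iffD1] linearI) (auto simp: rlinear_add rlinear_scaleR)
  have c: "isCont \<psi> z" using smooth_on_continuous[OF U(3)] U(1,2) by (simp add: continuous_on_eq_continuous_at)
  have "isCont (\<lambda>u. pairing (dual_map (\<psi> u)) (\<psi> u)) z"
    by (intro bounded_bilinear.isCont[OF bounded_bilinear_pairing] bounded_linear.isCont[OF lin] c)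
  moreover have "\<forall>\<^sub>F u in at z. pairing (dual_map (\<psi> u)) (\<psi> u) = 0"
  proof -
    have "\<forall>\<^sub>F u in at z. u \<in> U" using U(2,1) by (rule eventually_at_in_open')
    with eventually_isotropic[of c z] show ?thesis
    proof eventually_elim
      case (elim u)
      then show ?case using \<psi> self_in_hline by blast
    qed
  qed
  ultimately have 0: "pairing (dual_map (\<psi> z)) (\<psi> z) = 0" by (rule zero_by_continuity)
  have nz: "\<psi> z \<noteq> 0" "dual_map (\<psi> z) \<noteq> 0" and Lp: "L p = hline (\<psi> z)"
    using \<psi>[OF U(1)] M(3) p by auto
  show ?thesis
    unfolding annihilator_def Lp annihilator_hline[OF nz 0] projective_image_hline[OF projective_dual_map] ..
qed

lemma soliton_frame_annihilator:
  assumes "Z.K \<noteq> 0"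
  shows "soliton_frame (annihilator L) (\<lambda>c z v. R c z (inv dual_map v)) h \<tau> k0 N"
  using soliton_frame_image[OF soliton_frame[OF assms] projective_dual_map]
  unfolding annihilator_eq[symmetric] .

end

section \<open>Constant curves\<close>

lemma basis_change:
  assumes "a \<noteq> 0" "b \<notin> hline a"
  obtains S where "projective_transformation S" "S a = (1, 0)" "S b = (0, 1)"
proof -
  define B where "B x = a \<odot> fst x + b \<odot> snd x" for x :: H2
  have "projective_transformation B"
  proof (rule projectiveI)
    show "rlinear B"
      unfolding rlinear_def B_def by (simp add: prod_eq_iff algebra_simps del: split_paired_All)
    show "x = 0" if "B x = 0" for x
    proof -
      have "snd x = 0"
      proof (rule ccontr)
        assume s: "snd x \<noteq> 0"
        have "b \<odot> snd x = a \<odot> (- fst x)"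
          using that by (simp add: B_def prod_eq_iff eq_neg_iff_add_eq_0 add.commute)
        then have "b \<odot> snd x \<odot> inverse (snd x) = a \<odot> (- fst x) \<odot> inverse (snd x)" by simp
        then have "b = a \<odot> (- fst x * inverse (snd x))"
          using s by (simp add: prod_eq_iff mult.assoc)
        then show False using assms(2) unfolding hline_def by blast
      qed
      then have "a \<odot> fst x = 0" using that by (simp add: B_def)
      then show "x = 0" using assms(1) \<open>snd x = 0\<close> by (auto simp: rscale_eq_0_iff prod_eq_iff)
    qed
  qed
  note B = projective_facts[OF this] projective_inv[OF this]
  have "B (1, 0) = a" "B (0, 1) = b" by (simp_all add: B_def)
  then have "inv B a = (1, 0)" "inv B b = (0, 1)" using B(5) by metis+
  then show ?thesis using that B(6) by blast
qed

text \<open>\<Psi> is a primitive of 1 / dl^2, and the left side of \<open>eq\<close> is the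
  numerator of the derivative of A / dl. Instead of integrating, the proof finds A to be affine: as
  \<open>dl\<close> is affine, A'' dl is the derivative of the constant \<kappa>.\<close>

lemma affine_quotient:
  fixes A dl :: "complex poly" and \<alpha>0 \<beta>0 \<kappa> :: complex
  assumes dl: "dl = [:\<alpha>0, \<beta>0:]" "dl \<noteq> 0" and eq: "pderiv A * dl - A * pderiv dl = [:\<kappa>:]"
  defines "\<Psi> z \<equiv> (if \<beta>0 = 0 then z / \<alpha>0\<^sup>2 else - (1 / (\<beta>0 * poly dl z)))"
  shows "\<exists>e. \<forall>z. poly dl z \<noteq> 0 \<longrightarrow> poly A z / poly dl z = e + \<kappa> * \<Psi> z"
proof -
  have "pderiv (pderiv dl) = 0" by (simp add: dl(1) pderiv_pCons)
  then have "pderiv (pderiv A) * dl = pderiv (pderiv A * dl - A * pderiv dl)"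
    by (simp add: pderiv_mult pderiv_diff algebra_simps)
  also have "\<dots> = 0" unfolding eq by (simp add: pderiv_pCons)
  finally have "pderiv (pderiv A) = 0" using dl(2) by simp
  then obtain \<beta> where \<beta>: "pderiv A = [:\<beta>:]" by (metis pderiv_iszero)
  have "pderiv (A - [:0, \<beta>:]) = 0" unfolding pderiv_diff \<beta> by (simp add: pderiv_pCons)
  then obtain \<alpha> where "A - [:0, \<beta>:] = [:\<alpha>:]" using pderiv_iszero by blast
  then have A: "A = [:\<alpha>, \<beta>:]" by (simp add: diff_eq_eq)
  have k: "\<kappa> = \<beta> * \<alpha>0 - \<alpha> * \<beta>0"
    using arg_cong[OF eq[symmetric], of "\<lambda>p. poly p 0"] by (simp add: A dl(1) pderiv_pCons mult.commute)
  show ?thesis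
  proof (cases "\<beta>0 = 0")
    case True
    then have "\<alpha>0 \<noteq> 0" using dl by auto
    then show ?thesis
      using True by (intro exI[of _ "\<alpha> / \<alpha>0"]) (simp add: A dl(1) k \<Psi>_def field_simps power2_eq_square)
  next
    case False
    have "poly A z / poly dl z = \<beta> / \<beta>0 + \<kappa> * \<Psi> z" if z: "poly dl z \<noteq> 0" for z
    proof -
      have "\<beta> / \<beta>0 + \<kappa> * \<Psi> z = (\<beta> * poly dl z - \<kappa>) / (\<beta>0 * poly dl z)"
        using False z by (simp add: \<Psi>_def field_simps)
      also have "\<beta> * poly dl z - \<kappa> = \<beta>0 * poly A z" by (simp add: k A dl(1) algebra_simps)
      finally show ?thesis using False by simp
    qed
    then show ?thesis by blast
  qed
qed

context chart_data
begin

text \<open>For constant (P, Q) the derivative of F (P, Q) vanishes, because the rows of dF are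
  multiples of (Q, - P); and F (P, Q) = (d1 x, d1 y) by \<open>PQ_A\<close>.\<close>

lemma constant_spinor:
  assumes "P = [:p:]" "Q = [:q:]"
  obtains X Y where "d1 * x = [:X:]" "d1 * y = [:Y:]"
proof -
  have *: "pderiv (d1 * c) = 0"
    if a: "ep * pderiv a = nu * a + c * Q" and b: "ep * pderiv b = nu * b - c * P" and ab: "P * a + Q * b = dl * d1 * c" for a b c
  proof -
    have "ep * pderiv (P * a + Q * b) = P * (ep * pderiv a) + Q * (ep * pderiv b)"
    proof -
      have "pderiv P = 0" "pderiv Q = 0" by (simp_all add: assms pderiv_pCons)
      then show ?thesis by (simp add: pderiv_mult pderiv_add algebra_simps)
    qed
    also have "\<dots> = nu * (P * a + Q * b)" unfolding a b by (simp add: algebra_simps)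
    finally have 1: "ep * pderiv (dl * (d1 * c)) = nu * (dl * (d1 * c))" unfolding ab by (simp only: mult.assoc)
    have "ep * pderiv (dl * (d1 * c)) = ep * d1 * nu * (d1 * c) + ep * dl * pderiv (d1 * c)"
      unfolding pderiv_mult[of dl] pderiv_dl by (simp add: algebra_simps)
    also have "ep * d1 * nu * (d1 * c) = nu * (dl * (d1 * c))" unfolding dl_eq[symmetric] by (simp add: mult_ac)
    finally have "ep * dl * pderiv (d1 * c) = 0" unfolding 1 by simp
    then show ?thesis using ep_nonzero dl_nonzero by simp
  qed
  have "pderiv (d1 * x) = 0" by (rule *[OF dA'(1,2) PQ_A(2)])
  moreover have "pderiv (d1 * y) = 0" by (rule *[OF dA'(3,4) PQ_A(1)])
  ultimately show ?thesis using that pderiv_iszero by metis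
qed

text \<open>If the rational curve \<open>(P : Q)\<close> is constant, \<open>F\<close> is affine in a coordinate \<open>\<Psi>\<close> of degree one.\<close>

lemma constant_curve_line:
  assumes PQ: "P = [:p:]" "Q = [:q:]" and dl: "dl = [:\<alpha>0, \<beta>0:]"
  defines "\<Psi> z \<equiv> (if \<beta>0 = 0 then z / \<alpha>0\<^sup>2 else - (1 / (\<beta>0 * poly dl z)))"
  obtains d e where "d \<noteq> 0" "e \<notin> hline d"
    "\<And>z. poly dl z \<noteq> 0 \<Longrightarrow> hline (bryant_line z) = hline (d \<odot> qc (\<Psi> z) + e)"
proof -
  obtain X Y where XY: "d1 * x = [:X:]" "d1 * y = [:Y:]" by (rule constant_spinor[OF PQ])
  have q: "\<exists>e. \<forall>z. poly dl z \<noteq> 0 \<longrightarrow> poly a z / poly dl z = e + \<kappa> * \<Psi> z"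
    if "ep * pderiv a - nu * a = b" "d1 * b = [:\<kappa>:]" for a b \<kappa>
    unfolding \<Psi>_def
  proof (rule affine_quotient[OF dl dl_nonzero])
    have "pderiv a * dl - a * pderiv dl = d1 * (ep * pderiv a - nu * a)"
      unfolding pderiv_dl by (subst dl_eq) (simp add: algebra_simps)
    then show "pderiv a * dl - a * pderiv dl = [:\<kappa>:]" unfolding that .
  qed
  have c: "d1 * (x * Q) = [:X * q:]" "d1 * (- (x * P)) = [:- (X * p):]" "d1 * (y * Q) = [:Y * q:]" "d1 * (- (y * P)) = [:- (Y * p):]"
    unfolding PQ using XY by (simp_all add: mult.assoc[symmetric])
  obtain e11 where e11: "\<And>z. poly dl z \<noteq> 0 \<Longrightarrow> poly a11 z / poly dl z = e11 + X * q * \<Psi> z" using q[OF dA(1) c(1)] by blast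
  obtain e12 where e12: "\<And>z. poly dl z \<noteq> 0 \<Longrightarrow> poly a12 z / poly dl z = e12 + - (X * p) * \<Psi> z" using q[OF dA(2) c(2)] by blast
  obtain e21 where e21: "\<And>z. poly dl z \<noteq> 0 \<Longrightarrow> poly a21 z / poly dl z = e21 + Y * q * \<Psi> z" using q[OF dA(3) c(3)] by blast
  obtain e22 where e22: "\<And>z. poly dl z \<noteq> 0 \<Longrightarrow> poly a22 z / poly dl z = e22 + - (Y * p) * \<Psi> z" using q[OF dA(4) c(4)] by blast
  \<comment> \<open>The part of F (k, 1) that depends on \<Psi> is (X, Y) \<Psi> times the constant
    q k - p on the right; dividing by this constant leaves d times a complex coordinate.\<close>
  define \<mu> where "\<mu> = qc q * quat_k - qc p"
  have pq: "p \<noteq> 0 \<or> q \<noteq> 0" using PQ_nonzero[of 0] PQ by simp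
  have \<mu>: "\<mu> \<noteq> 0" using pq by (auto simp: \<mu>_def quat_eq_iff complex_eq_iff)
  define d where "d = (qc X, qc Y)"
  define e where "e = (qc e11 * quat_k + qc e12, qc e21 * quat_k + qc e22) \<odot> inverse \<mu>"
  have comp: "qc (a + X * q * t) * quat_k + qc (b + - (X * p) * t) = (qc a * quat_k + qc b) + qc X * qc t * \<mu>"
    for a b t X
  proof -
    have 1: "qc X * qc t * \<mu> = qc (X * t * q) * quat_k - qc (X * t * p)"
      by (simp only: \<mu>_def right_diff_distrib mult.assoc[symmetric] qc_mult)
    have 2: "a + X * q * t = a + X * t * q" "b + - (X * p) * t = b - X * t * p" by (simp_all only: mult_ac, simp)
    show ?thesis unfolding 1 2 qc_add qc_diff distrib_right by simp
  qed
  have line: "bryant_line z = (d \<odot> qc (\<Psi> z) + e) \<odot> \<mu>" if z: "poly dl z \<noteq> 0" for z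
    unfolding bryant_line_def e11[OF z] e12[OF z] e21[OF z] e22[OF z] comp
    using \<mu> by (simp add: d_def e_def prod_eq_iff distrib_right mult.assoc)
  then have hl: "hline (bryant_line z) = hline (d \<odot> qc (\<Psi> z) + e)" if "poly dl z \<noteq> 0" for z
    using hline_rscale[OF \<mu>] that by simp
  obtain z where z: "poly dl z \<noteq> 0" using dl_nonzero poly_all_0_iff_0 by blast
  \<comment> \<open>Since F^-1 (X, Y) = (p, q), the row takes on d the value \<open>tau\<close>
    times p - k q, which is nonzero.\<close>
  have dz: "d \<notin> hline (bryant_line z)"
  proof
    assume "d \<in> hline (bryant_line z)"
    then have r: "row1 z * qc X + row2 z * qc Y = 0"
      using kernel_hline[OF row_nonzero, of "bryant_line z" z d] row_kernel[OF z]
      by (simp add: bryant_line_def d_def)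
    let ?f = "\<lambda>a. poly a z / poly dl z"
    note det = det_quotient[OF z]
    have X: "X = p * ?f a11 + q * ?f a12" "Y = p * ?f a21 + q * ?f a22"
      using PQ_A[THEN arg_cong, of "\<lambda>p. poly p z"] XY[THEN arg_cong, of "\<lambda>p. poly p z"] z unfolding PQ
      by (simp_all add: field_simps)
    have g: "(qc a + quat_k * qc b) * qc c - (qc a' + quat_k * qc b') * qc c' = qc (a * c - a' * c') + quat_k * qc (b * c - b' * c')"
      for a b c a' b' c'
      by (simp add: qc_diff qc_mult algebra_simps)
    have "row1 z * qc X + row2 z * qc Y = tau z * ((qc (?f a22) + quat_k * qc (?f a21)) * qc X - (qc (?f a12) + quat_k * qc (?f a11)) * qc Y)"
      unfolding row_regular[OF z] by (simp add: right_diff_distrib mult.assoc)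
    also have "\<dots> = tau z * (qc (?f a22 * X - ?f a12 * Y) + quat_k * qc (?f a21 * X - ?f a11 * Y))"
      unfolding g ..
    also have "?f a22 * X - ?f a12 * Y = p * (?f a11 * ?f a22 - ?f a12 * ?f a21)" unfolding X by (simp add: algebra_simps del: times_divide_eq_left times_divide_eq_right)
    also have "?f a21 * X - ?f a11 * Y = - q * (?f a11 * ?f a22 - ?f a12 * ?f a21)" unfolding X by (simp add: algebra_simps del: times_divide_eq_left times_divide_eq_right)
    finally have "tau z * (qc p + quat_k * qc (- q)) = 0" using r unfolding det by simp
    moreover have "tau z \<noteq> 0" using z spin_nonzero by (simp add: tau_def)
    ultimately show False using pq by (auto simp: qc_quat_k_eq_0_iff)
  qed
  have "d \<noteq> 0" using dz self_in_hline[of "bryant_line z"] by (metis hline_def rangeI rscale_zero(1))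
  moreover have "e \<notin> hline d"
  proof
    assume "e \<in> hline d"
    then obtain l where e: "e = d \<odot> l" by (auto simp: hline_def)
    then have b: "bryant_line z = d \<odot> ((qc (\<Psi> z) + l) * \<mu>)"
      unfolding line[OF z] by (simp add: prod_eq_iff algebra_simps)
    have "bryant_line z \<noteq> 0" using row_kernel(2)[OF z] by (simp add: bryant_line_def)
    then have "(qc (\<Psi> z) + l) * \<mu> \<noteq> 0" using b by (metis rscale_zero(1))
    then have "hline (bryant_line z) = hline d" unfolding b by (rule hline_rscale)
    then show False using dz self_in_hline by blast
  qed
  ultimately show ?thesis using that hl by blast
qed

end

context bryant_frame
begin

text \<open>The line is known near z but not at z, which may be an end. The row extends it: applied
  to a continuous homogeneous representative it vanishes at z by continuity, and its kernel there is
  the fibre of \<open>L\<close>.\<close>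

lemma line_limit:
  assumes T': "projective_transformation T'" and "isCont s z" "isCont t z" "s z \<noteq> 0 \<or> t z \<noteq> 0"
    and ev: "\<forall>\<^sub>F u in at z. T' ` L (par c u) = hline (qc (s u), qc (t u))"
  shows "T' ` L (par c z) = hline (qc (s z), qc (t z))"
proof -
  note Tf = projective_facts[OF T'] and Ti = projective_facts(1,3)[OF projective_inv[OF T']]
  define \<phi> where "\<phi> u = inv T' (qc (s u), qc (t u))" for u
  have \<phi>: "\<phi> u = inv T' (1, 0) \<odot> qc (s u) + inv T' (0, 1) \<odot> qc (t u)" for u
  proof -
    have "\<phi> u = inv T' ((1, 0) \<odot> fst (qc (s u), qc (t u)) + (0, 1) \<odot> snd (qc (s u), qc (t u)))"
      unfolding \<phi>_def by (rule arg_cong[OF H2_basis])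
    then show ?thesis using Ti(1) unfolding rlinear_def by simp
  qed
  have RL: "R c u (\<phi> u) = R c u (inv T' (1, 0)) * qc (s u) + R c u (inv T' (0, 1)) * qc (t u)" for u
    unfolding \<phi> by (simp add: R_add R_rscale)
  have "isCont (\<lambda>u. R c u x) z" for x
    using smooth_on_continuous[OF R_smooth] by (simp add: continuous_on_eq_continuous_at)
  then have "isCont (\<lambda>u. R c u (\<phi> u)) z"
    unfolding RL by (intro isCont_add isCont_mult bounded_linear.isCont[OF bounded_linear_qc] assms)
  moreover have "\<forall>\<^sub>F u in at z. R c u (\<phi> u) = 0"
    using ev
  proof eventually_elim
    case (elim u)
    have "(qc (s u), qc (t u)) \<in> T' ` L (par c u)" unfolding elim by (rule self_in_hline)
    then have "\<phi> u \<in> L (par c u)" unfolding \<phi>_def using Tf(5) by (metis imageE)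
    then show ?case by (simp only: mem_E_iff)
  qed
  ultimately have "R c z (\<phi> z) = 0" by (rule zero_by_continuity)
  then have "\<phi> z \<in> L (par c z)" by (simp only: mem_E_iff)
  moreover have "\<exists>v. L (par c z) = hline v"
    using immersion[unfolded immersion_def line_subbundle_def, THEN conjunct1, rule_format, of z c]
    by (elim exE conjE) (drule (1) bspec, rule exI, erule conjunct2)
  then obtain v where v: "L (par c z) = hline v" ..
  ultimately obtain l where l: "\<phi> z = v \<odot> l" by (auto simp: hline_def)
  have "\<phi> z \<noteq> 0" using Ti(2)[of "(qc (s z), qc (t z))"] assms(4) by (auto simp: \<phi>_def zero_prod_def)
  then have "l \<noteq> 0" using l by auto
  then have "L (par c z) = hline (\<phi> z)" unfolding l v by (simp add: hline_rscale)
  then show ?thesis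
    using projective_image_hline[OF T', of "\<phi> z"] by (simp add: \<phi>_def Tf(4))
qed

text \<open>If the Wronskian vanishes, so does the Hopf field, and the area formula
  \<open>energy\<close> gives degree 0.\<close>

lemma constant_curve:
  assumes K: "Z.K = 0"
  shows "N = 0"
proof -
  have "Z.k0 = 0" using K Z.K_k0 Z.dl_nonzero by simp
  then have "Z.hopf z = 0" for z by (simp add: Z.hopf_def)
  then show ?thesis using energy by simp
qed

text \<open>The count \<open>degree_dl\<close> leaves one zero of \<open>dl\<close> on the sphere,
  so \<Psi> is a coordinate of degree one, and in a suitable basis \<open>L\<close> is the line of
  (\<Psi>, 1). What remains are the points where the chart or the coordinate is infinite.\<close>

lemma round_sphere:
  assumes K: "Z.K = 0"
  shows "round_sphere L"
proof -
  have N: "N = 0" by (rule constant_curve[OF K])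
  then have "degree P = 0" "degree Q = 0" by (auto simp: N_def)
  then obtain p q where PQ: "P = [:p:]" "Q = [:q:]" by (metis degree_eq_zeroE)
  have "degree dl \<le> 1" using degree_dl N by simp
  then obtain \<alpha>0 \<beta>0 where dl: "dl = [:\<alpha>0, \<beta>0:]"
  proof (cases dl)
    case (pCons a r)
    then have "degree r = 0" using \<open>degree dl \<le> 1\<close> by (cases "r = 0") auto
    then obtain b where "r = [:b:]" by (metis degree_eq_zeroE)
    then show ?thesis using that pCons by simp
  qed
  define \<Psi> where "\<Psi> z = (if \<beta>0 = 0 then z / \<alpha>0\<^sup>2 else - (1 / (\<beta>0 * poly dl z)))" for z
  obtain d e where d: "d \<noteq> 0" "e \<notin> hline d"
    and line: "\<And>z. poly dl z \<noteq> 0 \<Longrightarrow> hline (Z.bryant_line z) = hline (d \<odot> qc (\<Psi> z) + e)"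
    using Z.constant_curve_line[OF PQ dl] unfolding \<Psi>_def by blast
  obtain S where S: "projective_transformation S" "S d = (1, 0)" "S e = (0, 1)"
    using basis_change[OF d] .
  define T' where "T' v = S (T v)" for v
  have T': "projective_transformation T'" unfolding T'_def[abs_def] by (rule projective_comp[OF S(1) projective])
  have regular: "T' ` L (Finite z) = hline (qc (\<Psi> z), 1)" if z: "poly dl z \<noteq> 0" for z
  proof -
    have "T' ` L (Finite z) = S ` T ` L (par Zchart z)" by (simp add: T'_def image_image)
    also have "\<dots> = hline (S (d \<odot> qc (\<Psi> z) + e))"
      unfolding Z_line[OF z] line[OF z] projective_image_hline[OF S(1)] ..
    also have "S (d \<odot> qc (\<Psi> z) + e) = (qc (\<Psi> z), 1)"
    proof -
      have "S (d \<odot> qc (\<Psi> z) + e) = S d \<odot> qc (\<Psi> z) + S e"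
        using projective_facts(1)[OF S(1)] unfolding rlinear_def by metis
      then show ?thesis unfolding S(2,3) by (simp add: prod_eq_iff)
    qed
    finally show ?thesis .
  qed
  have scale: "hline (qc a, 1) = hline (1, qc (inverse a))" if "a \<noteq> 0" for a
  proof -
    have "(1, qc (inverse a)) = (qc a, 1) \<odot> qc (inverse a)"
      using that by (simp add: prod_eq_iff qc_mult[symmetric])
    then show ?thesis using hline_rscale[of "qc (inverse a)" "(qc a, 1)"] that by simp
  qed
  have eqI: ?thesis if "range (\<lambda>p. T' ` L p) = insert (hline (1, 0)) (range (\<lambda>z. hline (qc z, 1)))"
    unfolding round_sphere_def using conformal_immersionI[OF immersion] T' that by blast
  show ?thesis
  \<comment> \<open>The pole of \<Psi> is at infinity if \<beta>0 = 0, and at the zero of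
    \<open>dl\<close> otherwise.\<close>
  proof (cases "\<beta>0 = 0")
    case True
    then have \<alpha>: "\<alpha>0 \<noteq> 0" using dl Z.dl_nonzero by auto
    have fin: "T' ` L (Finite z) = hline (qc (z / \<alpha>0\<^sup>2), 1)" for z
      using regular[of z] \<alpha> True by (simp add: \<Psi>_def dl)
    have inf: "T' ` L Infinity = hline (1, 0)"
    proof -
      have "T' ` L (par Wchart 0) = hline (qc 1, qc (\<alpha>0\<^sup>2 * 0))"
      proof (rule line_limit[OF T', where s = "\<lambda>_. 1" and t = "\<lambda>u. \<alpha>0\<^sup>2 * u"])
        have "\<forall>\<^sub>F u in at 0. u \<noteq> (0::complex)" by (simp add: eventually_at_filter)
        then show "\<forall>\<^sub>F u in at 0. T' ` L (par Wchart u) = hline (qc 1, qc (\<alpha>0\<^sup>2 * u))"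
        proof eventually_elim
          case (elim u)
          have "T' ` L (par Wchart u) = hline (qc (1 / u / \<alpha>0\<^sup>2), 1)" using elim fin by simp
          also have "\<dots> = hline (1, qc (inverse (1 / u / \<alpha>0\<^sup>2)))" by (rule scale) (use elim \<alpha> in simp)
          also have "inverse (1 / u / \<alpha>0\<^sup>2) = \<alpha>0\<^sup>2 * u" by (simp add: field_simps)
          finally show ?case by simp
        qed
      qed (auto intro!: continuous_intros)
      then show ?thesis by simp
    qed
    show ?thesis
    proof (rule eqI, intro subset_antisym subsetI)
      fix l assume "l \<in> range (\<lambda>p. T' ` L p)"
      then obtain p where "l = T' ` L p" by blast
      then show "l \<in> insert (hline (1, 0)) (range (\<lambda>z. hline (qc z, 1)))"
        using fin inf by (cases p) auto
    next
      fix l assume "l \<in> insert (hline (1, 0)) (range (\<lambda>z. hline (qc z, 1)))"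
      then consider "l = hline (1, 0)" | z where "l = hline (qc z, 1)" by blast
      then show "l \<in> range (\<lambda>p. T' ` L p)"
      proof cases
        case 1
        then show ?thesis using inf by blast
      next
        case (2 z)
        have "T' ` L (Finite (\<alpha>0\<^sup>2 * z)) = l" using 2 \<alpha> by (simp add: fin)
        then show ?thesis by blast
      qed
    qed
  next
    case False
    define a where "a = - \<alpha>0 / \<beta>0"
    have root: "poly dl u = 0 \<longleftrightarrow> u = a" for u
      using False by (auto simp: dl a_def field_simps add_eq_0_iff)
    have fin: "T' ` L (Finite a) = hline (1, 0)"
    proof -
      have "T' ` L (par Zchart a) = hline (qc 1, qc (- (\<beta>0 * poly dl a)))"
      proof (rule line_limit[OF T', where s = "\<lambda>_. 1" and t = "\<lambda>u. - (\<beta>0 * poly dl u)"])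
        have "\<forall>\<^sub>F u in at a. poly dl u \<noteq> 0" by (rule eventually_at_poly_nonzero[OF Z.dl_nonzero])
        then show "\<forall>\<^sub>F u in at a. T' ` L (par Zchart u) = hline (qc 1, qc (- (\<beta>0 * poly dl u)))"
        proof eventually_elim
          case (elim u)
          have "T' ` L (par Zchart u) = hline (qc (- (1 / (\<beta>0 * poly dl u))), 1)"
            using regular[OF elim] False by (simp add: \<Psi>_def)
          also have "\<dots> = hline (1, qc (inverse (- (1 / (\<beta>0 * poly dl u)))))" by (rule scale) (use elim False in simp)
          also have "inverse (- (1 / (\<beta>0 * poly dl u))) = - (\<beta>0 * poly dl u)" by (simp add: field_simps)
          finally show ?case by simp
        qed
      qed (auto intro!: continuous_intros)
      moreover have "poly dl a = 0" using root by simp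
      ultimately show ?thesis by simp
    qed
    have inf: "T' ` L Infinity = hline (0, 1)"
    proof -
      have "T' ` L (par Wchart 0) = hline (qc (- (0 / (\<beta>0 * (\<alpha>0 * 0 + \<beta>0)))), qc 1)"
      proof (rule line_limit[OF T', where t = "\<lambda>_. 1" and s = "\<lambda>u. - (u / (\<beta>0 * (\<alpha>0 * u + \<beta>0)))"])
        have "\<forall>\<^sub>F u in at 0. u \<noteq> (0::complex)" by (simp add: eventually_at_filter)
        moreover have "\<forall>\<^sub>F u in at 0. poly [:\<beta>0, \<alpha>0:] u \<noteq> 0" by (rule eventually_at_poly_nonzero) (use False in simp)
        ultimately show "\<forall>\<^sub>F u in at 0. T' ` L (par Wchart u) = hline (qc (- (u / (\<beta>0 * (\<alpha>0 * u + \<beta>0)))), qc 1)"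
        proof eventually_elim
          case (elim u)
          have "u * poly dl (1 / u) = \<alpha>0 * u + \<beta>0" using elim(1) by (simp add: dl field_simps)
          moreover have "\<alpha>0 * u + \<beta>0 \<noteq> 0" using elim(2) by (simp add: algebra_simps)
          ultimately have nz: "poly dl (1 / u) \<noteq> 0" and e: "\<alpha>0 * u + \<beta>0 = u * poly dl (1 / u)" by auto
          show ?case
            unfolding e using regular[OF nz] elim(1) False by (simp add: \<Psi>_def)
        qed
        show "isCont (\<lambda>u. - (u / (\<beta>0 * (\<alpha>0 * u + \<beta>0)))) 0"
          using False by (intro continuous_intros) auto
      qed auto
      then show ?thesis by simp
    qed
    show ?thesis
    proof (rule eqI, intro subset_antisym subsetI)
      fix l assume "l \<in> range (\<lambda>p. T' ` L p)"
      then obtain p where l: "l = T' ` L p" by blast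
      show "l \<in> insert (hline (1, 0)) (range (\<lambda>z. hline (qc z, 1)))"
      proof (cases p)
        case (Finite z)
        then show ?thesis using l fin regular[of z] root[of z] by (cases "z = a") auto
      next
        case Infinity
        have "hline (0, 1) = hline (qc 0, 1)" by simp
        then show ?thesis using l inf Infinity by blast
      qed
    next
      fix l assume "l \<in> insert (hline (1, 0)) (range (\<lambda>z. hline (qc z, 1)))"
      then consider "l = hline (1, 0)" | z where "l = hline (qc z, 1)" by blast
      then show "l \<in> range (\<lambda>p. T' ` L p)"
      proof cases
        case 1
        then show ?thesis using fin by blast
      next
        case (2 z)
        show ?thesis
        proof (cases "z = 0")
          case True
          then show ?thesis using 2 inf by auto
        next
          case z: False
          \<comment> \<open>The solution of \<Psi> u = z, where \<open>poly dl u\<close> has to be -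
            1 / (\<beta>0 z).\<close>
          define u where "u = a - 1 / (\<beta>0 * \<beta>0 * z)"
          have u: "poly dl u = - (1 / (\<beta>0 * z))" using False z by (simp add: dl u_def a_def field_simps)
          then have "poly dl u \<noteq> 0" "\<Psi> u = z" using False z by (simp_all add: \<Psi>_def)
          then have "T' ` L (Finite u) = l" using 2 regular[of u] by simp
          then show ?thesis by blast
        qed
      qed
    qed
  qed
qed

end

theorem theorem6p10:
  fixes L :: "cp1 \<Rightarrow> H2 set"
  assumes "bryant_sphere_smooth_ends L"
    and "\<not> round_sphere L"
  shows "n_soliton_sphere 2 L"
proof -
  obtain dl ep d1 nu a11 a12 a21 a22 x y P Q dl' ep' d1' nu' b11 b12 b21 b22 x' y' P' Q' T where
    "bryant_frame dl ep d1 nu a11 a12 a21 a22 x y P Q dl' ep' d1' nu' b11 b12 b21 b22 x' y' P' Q' L T"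
    using bryant_frame_exists[OF assms(1)] by (elim exE)
  then interpret bryant_frame dl ep d1 nu a11 a12 a21 a22 x y P Q dl' ep' d1' nu' b11 b12 b21 b22 x' y' P' Q' L T .
  have K: "Z.K \<noteq> 0" using round_sphere assms(2) by blast
  interpret S: soliton_frame L R h \<tau> k0 N by (rule soliton_frame[OF K])
  interpret A: soliton_frame "annihilator L" "\<lambda>c z v. R c z (inv dual_map v)" h \<tau> k0 N
    by (rule soliton_frame_annihilator[OF K])
  have "mobius_invariant_bundle L L J_frame"
    using complex_structure_J_frame acts_as_i_star_delta[OF acts_as_i_J_frame]
    unfolding mobius_invariant_bundle_def by blast
  then have 2: "has_soliton_system L 2"
    unfolding has_soliton_system_def
    using hol_structure_D_frame const_hol_sections[OF is_dbar_D_frame] S.plucker_equality_H3 S.const_H3 by blast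
  \<comment> \<open>A competing system may belong to either bundle and have any J, D and H. Both
    bundles carry a soliton frame, so \<open>no_small_system\<close> excludes dimensions below three
    for each.\<close>
  have least: "2 \<le> n" if n: "has_soliton_system L n" for n
  proof -
    obtain E J D H where mob: "mobius_invariant_bundle L E J" and D: "hol_structure E J D"
      and cst: "\<And>x. (\<lambda>_. x) \<in> hol_sections E D" "\<And>x. (\<lambda>_. x) \<in> H" and eq: "plucker_equality E J D n H"
      using n unfolding has_soliton_system_def by (elim exE conjE) blast
    have J: "complex_structure_quot E J" using mob unfolding mobius_invariant_bundle_def by (rule conjunct1)
    from mob consider "E = L" "star_delta_quot L J"
      | J\<^sub>L where "E = annihilator L" "complex_structure_sub L J\<^sub>L" "star_delta_sub L J\<^sub>L"
        "\<And>p a x. x \<in> L p \<Longrightarrow> pairing (J p a) x = pairing a (J\<^sub>L p x)"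
      unfolding mobius_invariant_bundle_def by blast
    then show ?thesis
    proof cases
      case 1
      show ?thesis using S.no_small_system J 1 D cst eq by blast
    next
      case 2
      have "line_subbundle L" using immersion by (simp add: immersion_def)
      then have "star_delta_quot E J"
        unfolding 2(1) by (rule star_delta_annihilator[OF _ 2(2-4)])
      then show ?thesis using A.no_small_system J D cst eq unfolding 2(1) by blast
    qed
  qed
  have "soliton_sphere L"
    unfolding soliton_sphere_def using conformal_immersionI[OF immersion] 2 by blast
  moreover have "soliton_number L = 2"
    unfolding soliton_number_def using assms(2) Least_equality[of "has_soliton_system L", OF 2 least] by simp
  ultimately show ?thesis by (simp add: n_soliton_sphere_def)
qed

end
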